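(* Let $1<p<\infty$, $\omega\in\mathcal{D}$ and $f\in\mathcal{H}(\mathbb{D})$. Then the little Hankel operator $h^\omega_{\overline{f}}:A^p_\omega\to\overline{A^p_\omega}$ is bounded if and only if $f\in\mathcal{B}$. Moreover, $$\|f\|_{\mathcal{B}}\asymp\|h^\omega_{\overline{f}}\|_{A^p_\omega\to\overline{A^p_\omega}},$$ where the constants of comparison do not depend on $f$.
   Context: $\mathbb{D}$ is the open unit disc, $dA(z)=\frac{dx\,dy}{\pi}$, $\mathcal{H}(\mathbb{D})$ is the space of analytic functions in $\mathbb{D}$, and $H^\infty$ is the space of bounded analytic functions in $\mathbb{D}$. A radial weight is a non-negative function $\omega\in L^1([0,1))$ extended to $\mathbb{D}$ by $\omega(z)=\omega(|z|)$; it is always assumed that $\widehat{\omega}(z)=\int_{|z|}^1\omega(s)\,ds>0$ for all $z\in\mathbb{D}$. Moments: $\omega_x=\int_0^1r^x\omega(r)\,dr$. Classes: $\omega\in\widehat{\mathcal{D}}$ if there is $C>1$ with $\widehat{\omega}(r)\le C\widehat{\omega}\left(\frac{1+r}{2}\right)$ for all $0\le r<1$; $\omega\in\mathcal{M}$ if there are $C>1$, $K>1$ with $\omega_x\ge C\omega_{Kx}$ for all $x\ge1$; $\omega\in\check{\mathcal{D}}$ if there are $K>1$, $C>1$ with $\widehat{\omega}(r)\ge C\widehat{\omega}\left(1-\frac{1-r}{K}\right)$ for all $0\le r<1$. Then $\mathcal{D}=\widehat{\mathcal{D}}\cap\mathcal{M}=\widehat{\mathcal{D}}\cap\check{\mathcal{D}}$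 (the equality is known). $L^p_\omega$ is the Lebesgue space on $\mathbb{D}$ with respect to $\omega\,dA$, $A^p_\omega=L^p_\omega\cap\mathcal{H}(\mathbb{D})$, and $\overline{A^p_\omega}=\{\overline{g}:g\in A^p_\omega\}$ with the $L^p_\omega$-norm. $B^\omega_z(\zeta)=\sum_{n=0}^\infty\frac{(\overline{z}\zeta)^n}{2\omega_{2n+1}}$ are the reproducing kernels of $A^2_\omega$. The little Hankel operator with symbol $\overline f$ is $h^\omega_{\overline f}(g)(z)=\int_{\mathbb{D}}\overline{f(\zeta)}g(\zeta)B^\omega_z(\zeta)\omega(\zeta)\,dA(\zeta)$, $z\in\mathbb{D}$. The statement that $h^\omega_{\overline f}:A^p_\omega\to\overline{A^p_\omega}$ is bounded means that $f\in L^1_\omega$ (so that the integral converges for every $g\in H^\infty$) and that $\|h^\omega_{\overline f}(g)\|_{L^p_\omega}\le C\|g\|_{A^p_\omega}$ for all $g$ in the dense subspace $H^\infty$ of $A^p_\omega$; the operator norm is the best such $C$. The Bloch space $\mathcal{B}$ consists of $f\in\mathcal{H}(\mathbb{D})$ with $\|f\|_{\mathcal{B}}=|f(0)|+\sup_{z\in\mathbb{D}}|f'(z)|(1-|z|^2)<\infty$. $a\asymp b$ means that each of $a,b$ is at most a constant multiple of the other. *)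

theory Defs
  imports "HOL-Analysis.Analysis"
begin

abbreviation disc :: "complex set" where
  "disc \<equiv> ball 0 1"

subsection \<open>Radial weights\<close>

text \<open>
  A radial weight is given by its profile on \<open>{0..<1}\<close>; the corresponding function on the disc is
  \<open>\<lambda>z. \<omega> (norm z)\<close>. Values of the profile outside \<open>{0..<1}\<close> are never used.
\<close>

definition weight_tail :: "(real \<Rightarrow> real) \<Rightarrow> real \<Rightarrow> real" where
  "weight_tail \<omega> r = (LINT s:{r..<1}|lebesgue. \<omega> s)"

definition weight_moment :: "(real \<Rightarrow> real) \<Rightarrow> real \<Rightarrow> real" where
  "weight_moment \<omega> x = (LINT r:{0..<1}|lebesgue. r powr x * \<omega> r)"

definition radial_weight :: "(real \<Rightarrow> real) \<Rightarrow> bool" where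
  "radial_weight \<omega> \<longleftrightarrow>
     (\<forall>r\<in>{0..<1}. 0 \<le> \<omega> r) \<and>
     set_integrable lebesgue {0..<1} \<omega> \<and>
     (\<forall>r\<in>{0..<1}. 0 < weight_tail \<omega> r)"

definition D_hat :: "(real \<Rightarrow> real) set" where
  "D_hat = {\<omega>. radial_weight \<omega> \<and>
     (\<exists>C>1. \<forall>r\<in>{0..<1}. weight_tail \<omega> r \<le> C * weight_tail \<omega> ((1 + r) / 2))}"

definition M_class :: "(real \<Rightarrow> real) set" where
  "M_class = {\<omega>. radial_weight \<omega> \<and>
     (\<exists>C>1. \<exists>K>1. \<forall>x\<ge>1. weight_moment \<omega> x \<ge> C * weight_moment \<omega> (K * x))}"

definition D_class :: "(real \<Rightarrow> real) set" where
  "D_class = D_hat \<inter> M_class"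

subsection \<open>Function spaces on the disc\<close>

definition disc_area :: "complex measure" where
  "disc_area = density (lebesgue_on disc) (\<lambda>_. ennreal (1 / pi))"

definition weighted_area :: "(real \<Rightarrow> real) \<Rightarrow> complex measure" where
  "weighted_area \<omega> = density disc_area (\<lambda>z. ennreal (\<omega> (norm z)))"

text \<open>
  The spaces consist of functions on \<open>complex\<close>, but membership and norms only depend on the
  restriction to the disc, which is the underlying space of \<open>weighted_area \<omega>\<close>.
\<close>

definition Lp_space :: "real \<Rightarrow> (real \<Rightarrow> real) \<Rightarrow> (complex \<Rightarrow> complex) set" where
  "Lp_space p \<omega> = {g. g \<in> borel_measurable (weighted_area \<omega>) \<and>
     integrable (weighted_area \<omega>) (\<lambda>z. norm (g z) powr p)}"

definition Lp_norm :: "real \<Rightarrow> (real \<Rightarrow> real) \<Rightarrow> (complex \<Rightarrow> complex) \<Rightarrow> real" where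
  "Lp_norm p \<omega> g = (\<integral>z. norm (g z) powr p \<partial>weighted_area \<omega>) powr (1 / p)"

definition bergman_space :: "real \<Rightarrow> (real \<Rightarrow> real) \<Rightarrow> (complex \<Rightarrow> complex) set" where
  "bergman_space p \<omega> = {g \<in> Lp_space p \<omega>. g holomorphic_on disc}"

definition conj_bergman_space :: "real \<Rightarrow> (real \<Rightarrow> real) \<Rightarrow> (complex \<Rightarrow> complex) set" where
  "conj_bergman_space p \<omega> = (\<lambda>g z. cnj (g z)) ` bergman_space p \<omega>"

definition H_infinity :: "(complex \<Rightarrow> complex) set" where
  "H_infinity = {g. g holomorphic_on disc \<and> bounded (g ` disc)}"

definition bloch_space :: "(complex \<Rightarrow> complex) set" where
  "bloch_space = {f. f holomorphic_on disc \<and>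
     bdd_above ((\<lambda>z. norm (deriv f z) * (1 - (norm z)\<^sup>2)) ` disc)}"

definition bloch_norm :: "(complex \<Rightarrow> complex) \<Rightarrow> real" where
  "bloch_norm f = norm (f 0) + (SUP z\<in>disc. norm (deriv f z) * (1 - (norm z)\<^sup>2))"

subsection \<open>The little Hankel operator\<close>

definition bergman_kernel :: "(real \<Rightarrow> real) \<Rightarrow> complex \<Rightarrow> complex \<Rightarrow> complex" where
  "bergman_kernel \<omega> z \<zeta> =
     (\<Sum>n. (cnj z * \<zeta>) ^ n / of_real (2 * weight_moment \<omega> (real (2 * n + 1))))"

text \<open>The argument \<open>f\<close> is the analytic function whose conjugate is the symbol.\<close>

definition little_hankel ::
    "(real \<Rightarrow> real) \<Rightarrow> (complex \<Rightarrow> complex) \<Rightarrow> (complex \<Rightarrow> complex) \<Rightarrow> complex \<Rightarrow> complex" where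
  "little_hankel \<omega> f g z =
     (\<integral>\<zeta>. cnj (f \<zeta>) * g \<zeta> * bergman_kernel \<omega> z \<zeta> \<partial>weighted_area \<omega>)"

text \<open>
  Since \<open>Lp_norm\<close> is real-valued, finiteness of the norm of the image is a separate requirement;
  it is part of the membership in the codomain.
\<close>

definition little_hankel_bound ::
    "real \<Rightarrow> (real \<Rightarrow> real) \<Rightarrow> (complex \<Rightarrow> complex) \<Rightarrow> real \<Rightarrow> bool" where
  "little_hankel_bound p \<omega> f C \<longleftrightarrow> 0 \<le> C \<and>
     (\<forall>g\<in>H_infinity. little_hankel \<omega> f g \<in> conj_bergman_space p \<omega> \<and>
        Lp_norm p \<omega> (little_hankel \<omega> f g) \<le> C * Lp_norm p \<omega> g)"

definition little_hankel_bounded ::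
    "real \<Rightarrow> (real \<Rightarrow> real) \<Rightarrow> (complex \<Rightarrow> complex) \<Rightarrow> bool" where
  "little_hankel_bounded p \<omega> f \<longleftrightarrow> f \<in> Lp_space 1 \<omega> \<and> (\<exists>C. little_hankel_bound p \<omega> f C)"

definition little_hankel_norm ::
    "real \<Rightarrow> (real \<Rightarrow> real) \<Rightarrow> (complex \<Rightarrow> complex) \<Rightarrow> real" where
  "little_hankel_norm p \<omega> f = Inf {C. little_hankel_bound p \<omega> f C}"

end

theory Submission
  imports Defs "HOL-Complex_Analysis.Complex_Analysis" "HOL-Real_Asymp.Real_Asymp"
begin

text \<open>
  Write \<open>W\<close> for the tail of \<open>\<omega>\<close>, \<open>lam n\<close> for the reciprocal of \<open>2 \<omega>\<^sub>2\<^sub>n\<^sub>+\<^sub>1\<close>, and \<open>kern m \<eta>\<close> for the series with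
  coefficients \<open>(n + 1) ^ m * lam n\<close>, so that the Bergman kernel is \<open>kern 0 (cnj z * \<zeta>)\<close>. Membership in the class
  \<open>\<D>\<close> gives two-sided power growth of the moments, hence symbol-type bounds for all finite differences of
  \<open>lam\<close>; repeated summation by parts then yields
  \<open>norm (kern m \<eta>) \<le> C * norm (1 - \<eta>) powr (- (1 + m + a)) * (1 - norm \<eta>) powr a / W (norm \<eta>)\<close> for some \<open>a > 0\<close>.

  Sufficiency: a radial integration by parts turns \<open>\<integral> f * cnj h\<close> over the weighted disc into an integral of
  \<open>(f + 2 z f') * cnj h\<close> against \<open>W\<close>, so for a Bloch function \<open>f\<close> the Hankel operator is dominated by
  \<open>\<integral> \<bar>g\<bar> \<bar>B_z\<bar> d\<nu>\<close> with \<open>d\<nu> = W r / (1 - r) dr dt\<close>. The Schur test with powers of \<open>1 - \<bar>z\<bar>\<close> bounds this operator on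
  \<open>L\<^sup>p(\<nu>)\<close>. Since circle means of \<open>\<bar>g\<bar>\<^sup>p\<close> are increasing and the tails of \<open>\<omega>\<close> and \<open>W r / (1 - r)\<close>
  are comparable, \<open>\<nu>\<close> and \<open>\<omega>\<close> define equivalent norms on analytic functions.

  Necessity: factor \<open>kern m (cnj w * \<zeta>) = g \<zeta> * u \<zeta>\<close> with \<open>g \<zeta> = (1 - cnj w * \<zeta>)^(-m)\<close>. Pairing \<open>f\<close> with \<open>g * u\<close> gives
  \<open>\<Sum>n. (n + 1) ^ m * a\<^sub>n * w ^ n\<close>, a derivative of \<open>f\<close> of order \<open>m\<close>; pairing \<open>u\<close> with the image of \<open>g\<close> bounds it
  by the operator norm times \<open>(1 - \<bar>w\<bar>)^(-m)\<close>. Integrating \<open>m - 1\<close> times along radii gives the Bloch bound.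
\<close>

section \<open>The Schur test\<close>

text \<open>A weight of the class may vanish on whole intervals, so its values cannot be estimated
  pointwise; only \<open>weight_tail\<close> and \<open>weight_moment\<close> behave regularly.
  Hence the kernel estimates are integrated against \<open>\<nu>\<close>, whose density is
  controlled at every radius, and \<open>\<omega>\<close> enters through tails, moments and monotone
  circle means. The kernel has no closed form: only the regularity of its coefficients is available,
  and the extra exponent \<open>a\<close>, taken from the decay of the moments, is what pushes the
  singularity above 1 and makes circle integrals of the kernel free of logarithms. In the necessity
  part \<open>m\<close> has to satisfy \<open>m * p > b + 1\<close>, where \<open>b\<close> is the
  growth exponent of the moments; then the norm of the test function is governed by radii beyond
  \<open>norm w\<close>. In p-th powers the test function contributes \<open>W (norm w)\<close> and
  the dual factor \<open>u\<close> contributes its reciprocal, so the weight cancels and exactly the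
  power \<open>(1 - norm w) powr (- m)\<close> remains.\<close>

lemma powr_Young:
  fixes y t p :: real
  assumes "1 < p" "0 \<le> y" "0 < t"
  shows "y \<le> y powr p * t powr (1 - p) / p + t * (p - 1) / p"
proof -
  let ?q = "p / (p - 1)"
  \<comment> \<open>The two powers of \<open>t\<close> multiply to 1. The free parameter is fixed in
    the next lemma.\<close>
  have "y * t powr ((1 - p) / p) * t powr ((p - 1) / p)
      \<le> (y * t powr ((1 - p) / p)) powr p / p + (t powr ((p - 1) / p)) powr ?q / ?q"
    by (rule Youngs_inequality) (use assms in \<open>auto simp: field_simps\<close>)
  moreover have "t powr ((1 - p) / p) * t powr ((p - 1) / p) = 1"
    using assms by (simp flip: powr_add add: field_simps)
  ultimately show ?thesis
    using assms by (simp add: powr_mult powr_powr mult.assoc)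
qed

lemma powr_Jensen_nn_integral:
  fixes w y :: "'a \<Rightarrow> real" and S D p :: real
  assumes p: "1 < p" and [measurable]: "w \<in> borel_measurable M" "y \<in> borel_measurable M"
    and nonneg: "\<And>x. 0 \<le> w x" "\<And>x. 0 \<le> y x" and S: "0 \<le> S" and D: "0 \<le> D"
    and mass: "(\<integral>\<^sup>+x. ennreal (w x) \<partial>M) \<le> ennreal D"
    and le: "ennreal S \<le> (\<integral>\<^sup>+x. ennreal (w x * y x) \<partial>M)"
  shows "ennreal (S powr p) \<le> ennreal (D powr (p - 1)) * (\<integral>\<^sup>+x. ennreal (w x * y x powr p) \<partial>M)"
proof (cases "S = 0 \<or> D = 0")
  case True
  have "S = 0" if "D = 0"
  proof -
    have "AE x in M. ennreal (w x) = 0"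
      using mass that by (subst nn_integral_0_iff_AE[symmetric]) auto
    then have "(\<integral>\<^sup>+x. ennreal (w x * y x) \<partial>M) = (\<integral>\<^sup>+x. 0 \<partial>M)"
    proof (intro nn_integral_cong_AE, eventually_elim)
      fix x assume "ennreal (w x) = 0"
      then have "w x = 0" using nonneg(1)[of x] by (simp add: ennreal_eq_0_iff)
      then show "ennreal (w x * y x) = 0" by simp
    qed
    with le S show ?thesis by simp
  qed
  with True have "S = 0" by auto
  then show ?thesis by simp
next
  case False
  with S D have S: "0 < S" and D: "0 < D" by auto
  define Y where "Y = (\<integral>\<^sup>+x. ennreal (w x * y x powr p) \<partial>M)"
  show ?thesis
  proof (cases "Y = \<infinity>")
    case True
    then show ?thesis
      using D by (simp add: Y_def ennreal_mult_top)
  next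
    case False
    then obtain Yr where Yr: "Y = ennreal Yr" "0 \<le> Yr"
      by (cases Y) auto
    \<comment> \<open>With this choice the second term of the Young bound contributes
      \<open>S - S / p\<close>. Subtracting it from \<open>S\<close> leaves \<open>S / p\<close>,
      which is the claim up to powers of \<open>S\<close> and \<open>D\<close>.\<close>
    define t where "t = S / D"
    have t: "0 < t" using S D by (simp add: t_def)
    have "ennreal S \<le> (\<integral>\<^sup>+x. ennreal (w x * y x) \<partial>M)" by (rule le)
    also have "\<dots> \<le> (\<integral>\<^sup>+x. ennreal (t powr (1 - p) / p) * ennreal (w x * y x powr p)
         + ennreal (t * (p - 1) / p) * ennreal (w x) \<partial>M)"
    proof (rule nn_integral_mono)
      fix x
      have "w x * y x \<le> w x * (y x powr p * t powr (1 - p) / p + t * (p - 1) / p)"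
        using nonneg p t by (intro mult_left_mono powr_Young) auto
      also have "\<dots> = t powr (1 - p) / p * (w x * y x powr p) + t * (p - 1) / p * w x"
        by (simp add: algebra_simps)
      finally have "ennreal (w x * y x)
          \<le> ennreal (t powr (1 - p) / p * (w x * y x powr p) + t * (p - 1) / p * w x)"
        by (rule ennreal_leI)
      also have "\<dots> = ennreal (t powr (1 - p) / p) * ennreal (w x * y x powr p)
         + ennreal (t * (p - 1) / p) * ennreal (w x)"
        using p t nonneg by (simp only: ennreal_mult[symmetric] ennreal_plus[symmetric] mult_nonneg_nonneg powr_ge_zero
            divide_nonneg_pos zero_less_one less_trans[OF zero_less_one p] less_imp_le diff_ge_0_iff_ge)
      finally show "ennreal (w x * y x) \<le> ennreal (t powr (1 - p) / p) * ennreal (w x * y x powr p)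
         + ennreal (t * (p - 1) / p) * ennreal (w x)" .
    qed
    also have "\<dots> = ennreal (t powr (1 - p) / p) * Y + ennreal (t * (p - 1) / p) * (\<integral>\<^sup>+x. ennreal (w x) \<partial>M)"
      by (simp add: nn_integral_add nn_integral_cmult Y_def)
    also have "\<dots> \<le> ennreal (t powr (1 - p) / p) * Y + ennreal (t * (p - 1) / p) * ennreal D"
      by (intro add_left_mono mult_left_mono mass) auto
    also have "\<dots> = ennreal (t powr (1 - p) / p * Yr + t * (p - 1) / p * D)"
      using p t D Yr by (simp flip: ennreal_mult ennreal_plus)
    finally have "S \<le> t powr (1 - p) / p * Yr + t * (p - 1) / p * D"
      using p t D Yr by (subst (asm) ennreal_le_iff) auto
    moreover have "t * (p - 1) / p * D = S - S / p"
      using D p by (simp add: t_def field_simps)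
    ultimately have "S / p \<le> t powr (1 - p) * Yr / p" by simp
    then have "S \<le> t powr (1 - p) * Yr"
      using p by (simp add: divide_le_cancel)
    then have "S * S powr (p - 1) \<le> t powr (1 - p) * Yr * S powr (p - 1)"
      by (rule mult_right_mono) simp
    also have "S * S powr (p - 1) = S powr p"
      using S powr_add[of S 1 "p - 1"] by simp
    also have "t powr (1 - p) * Yr * S powr (p - 1) = D powr (p - 1) * Yr"
    proof -
      have "t powr (1 - p) = S powr (1 - p) / D powr (1 - p)"
        using S D by (simp add: t_def powr_divide)
      moreover have "S powr (1 - p) * S powr (p - 1) = 1" "1 / D powr (1 - p) = D powr (p - 1)"
        using S D by (auto simp flip: powr_add simp: powr_minus_divide[symmetric])
      ultimately show ?thesis
        by (metis (no_types, opaque_lifting) divide_inverse inverse_eq_divide mult.assoc mult.commute mult.left_neutral)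
    qed
    finally show ?thesis
      using Yr D by (simp add: Y_def[symmetric] ennreal_mult[symmetric] ennreal_leI)
  qed
qed

text \<open>Jensen with weight \<open>k * hN powr q\<close> and values
  \<open>g * hN powr (-q)\<close> uses the first Schur condition, and Tonelli followed by the second
  condition finishes. The function \<open>S\<close> need not be an integral operator applied to
  \<open>g\<close>: it is enough that it is dominated by one, which is how a Hankel operator
  enters.\<close>

lemma schur_test:
  fixes k :: "'a \<times> 'b \<Rightarrow> real" and hM :: "'a \<Rightarrow> real" and hN :: "'b \<Rightarrow> real"
    and g :: "'b \<Rightarrow> real" and S :: "'a \<Rightarrow> real" and A B p q :: real
  assumes "sigma_finite_measure M" "sigma_finite_measure N"
    and [measurable]: "k \<in> borel_measurable (M \<Otimes>\<^sub>M N)" "hM \<in> borel_measurable M"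
      "hN \<in> borel_measurable N" "g \<in> borel_measurable N"
    and k: "\<And>z. 0 \<le> k z" and hN: "\<And>y. 0 < hN y" and hM: "\<And>x. 0 \<le> hM x" and g: "\<And>y. 0 \<le> g y"
    and S: "\<And>x. x \<in> space M \<Longrightarrow> 0 \<le> S x" and p: "1 < p" and q: "q = p / (p - 1)"
    and A: "0 \<le> A" and B: "0 \<le> B"
    and le: "\<And>x. x \<in> space M \<Longrightarrow> ennreal (S x) \<le> (\<integral>\<^sup>+y. ennreal (k (x, y) * g y) \<partial>N)"
    and le_A: "\<And>x. x \<in> space M \<Longrightarrow>
      (\<integral>\<^sup>+y. ennreal (k (x, y) * hN y powr q) \<partial>N) \<le> ennreal (A * hM x powr q)"
    and le_B: "\<And>y. y \<in> space N \<Longrightarrow>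
      (\<integral>\<^sup>+x. ennreal (k (x, y) * hM x powr p) \<partial>M) \<le> ennreal (B * hN y powr p)"
  shows "(\<integral>\<^sup>+x. ennreal (S x powr p) \<partial>M)
    \<le> ennreal (A powr (p - 1) * B) * (\<integral>\<^sup>+y. ennreal (g y powr p) \<partial>N)"
proof -
  interpret N: sigma_finite_measure N by fact
  interpret P: pair_sigma_finite M N using assms(1,2) by (simp add: pair_sigma_finite_def)
  \<comment> \<open>These identities make the test functions disappear: the power of
    \<open>hM\<close> produced by Jensen becomes \<open>hM powr p\<close>, and the powers of
    \<open>hN\<close> combine to \<open>hN powr (-p)\<close>, cancelled by the second Schur
    condition.\<close>
  have exps: "q + (- q) = 0" "q * (p - 1) = p" "q + - q * p = - p"
  proof -
    show *: "q * (p - 1) = p" unfolding q using p by auto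
    show "q + - q * p = - p" using * by (subst *[symmetric]) (simp add: algebra_simps)
  qed simp
  have pt: "ennreal (S x powr p)
      \<le> (\<integral>\<^sup>+y. ennreal (A powr (p - 1)) * ennreal (g y powr p * hN y powr (-p)) * ennreal (k (x, y) * hM x powr p) \<partial>N)"
    if x: "x \<in> space M" for x
  proof -
    note [measurable] = x
    have "ennreal (S x powr p) \<le> ennreal ((A * hM x powr q) powr (p - 1)) *
        (\<integral>\<^sup>+y. ennreal ((k (x, y) * hN y powr q) * (g y * hN y powr (-q)) powr p) \<partial>N)"
    proof (rule powr_Jensen_nn_integral)
      have eq: "k (x, y) * g y = (k (x, y) * hN y powr q) * (g y * hN y powr (-q))" for y
      proof -
        have 1: "hN y powr q * hN y powr (-q) = 1"
          using hN[of y] by (simp flip: powr_add)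
        have "(a * c) * (b * d) = a * b * (c * d)" for a b c d :: real
          by simp
        from this[of "k (x, y)" "hN y powr q" "g y" "hN y powr (-q)"]
        show ?thesis by (simp only: 1 mult_1_right)
      qed
      then show "ennreal (S x) \<le> (\<integral>\<^sup>+y. ennreal ((k (x, y) * hN y powr q) * (g y * hN y powr (-q))) \<partial>N)"
        using le[OF x] by (simp only: eq)
      show "(\<integral>\<^sup>+y. ennreal (k (x, y) * hN y powr q) \<partial>N) \<le> ennreal (A * hM x powr q)"
        by (rule le_A[OF x])
    qed (simp_all add: p k g A S[OF x])
    also have "(A * hM x powr q) powr (p - 1) = A powr (p - 1) * hM x powr p"
      using A hM by (simp add: powr_mult powr_powr exps)
    also have "(\<integral>\<^sup>+y. ennreal ((k (x, y) * hN y powr q) * (g y * hN y powr (-q)) powr p) \<partial>N)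
        = (\<integral>\<^sup>+y. ennreal (k (x, y) * (g y powr p * hN y powr (-p))) \<partial>N)"
    proof (rule nn_integral_cong)
      fix y
      have 1: "hN y powr q * (hN y powr (-q)) powr p = hN y powr (-p)"
        by (simp only: powr_powr powr_add[symmetric] exps)
      show "ennreal ((k (x, y) * hN y powr q) * (g y * hN y powr (-q)) powr p)
        = ennreal (k (x, y) * (g y powr p * hN y powr (-p)))"
        using g[of y] by (simp only: powr_mult powr_ge_zero 1[symmetric] mult_ac)
    qed
    also have "ennreal (A powr (p - 1) * hM x powr p) * (\<integral>\<^sup>+y. ennreal (k (x, y) * (g y powr p * hN y powr (-p))) \<partial>N)
      = (\<integral>\<^sup>+y. ennreal (A powr (p - 1) * hM x powr p) * ennreal (k (x, y) * (g y powr p * hN y powr (-p))) \<partial>N)"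
      by (rule nn_integral_cmult[symmetric]) measurable
    also have "\<dots> = (\<integral>\<^sup>+y. ennreal (A powr (p - 1)) * ennreal (g y powr p * hN y powr (-p)) * ennreal (k (x, y) * hM x powr p) \<partial>N)"
      using k by (intro nn_integral_cong) (simp only: ennreal_mult[symmetric] mult_nonneg_nonneg powr_ge_zero, simp only: mult_ac)
    finally show ?thesis .
  qed
  have "(\<integral>\<^sup>+x. ennreal (S x powr p) \<partial>M)
    \<le> (\<integral>\<^sup>+x. \<integral>\<^sup>+y. ennreal (A powr (p - 1)) * ennreal (g y powr p * hN y powr (-p)) * ennreal (k (x, y) * hM x powr p) \<partial>N \<partial>M)"
    by (intro nn_integral_mono pt)
  also have "\<dots> = (\<integral>\<^sup>+y. \<integral>\<^sup>+x. ennreal (A powr (p - 1)) * ennreal (g y powr p * hN y powr (-p)) * ennreal (k (x, y) * hM x powr p) \<partial>M \<partial>N)"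
    by (rule P.Fubini'[symmetric]) measurable
  also have "\<dots> = (\<integral>\<^sup>+y. ennreal (A powr (p - 1)) * ennreal (g y powr p * hN y powr (-p)) * (\<integral>\<^sup>+x. ennreal (k (x, y) * hM x powr p) \<partial>M) \<partial>N)"
    by (intro nn_integral_cong nn_integral_cmult) measurable
  also have "\<dots> \<le> (\<integral>\<^sup>+y. ennreal (A powr (p - 1)) * ennreal (g y powr p * hN y powr (-p)) * ennreal (B * hN y powr p) \<partial>N)"
    by (intro nn_integral_mono mult_left_mono le_B) auto
  also have "\<dots> = (\<integral>\<^sup>+y. ennreal (A powr (p - 1) * B) * ennreal (g y powr p) \<partial>N)"
  proof (intro nn_integral_cong)
    fix y
    have "hN y powr (-p) * hN y powr p = 1"
      using hN[of y] by (simp flip: powr_add)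
    then have "A powr (p - 1) * (g y powr p * hN y powr (-p)) * (B * hN y powr p)
        = A powr (p - 1) * B * g y powr p"
      by (simp add: mult.assoc)
    then show "ennreal (A powr (p - 1)) * ennreal (g y powr p * hN y powr (-p)) * ennreal (B * hN y powr p)
      = ennreal (A powr (p - 1) * B) * ennreal (g y powr p)"
      using A B by (simp only: ennreal_mult[symmetric] mult_nonneg_nonneg powr_ge_zero)
  qed
  also have "\<dots> = ennreal (A powr (p - 1) * B) * (\<integral>\<^sup>+y. ennreal (g y powr p) \<partial>N)"
    by (rule nn_integral_cmult) measurable
  finally show ?thesis .
qed

section \<open>Polar coordinates and radial measures\<close>

lemma measurable_Complex_pair [measurable]:
  "(\<lambda>(x, y). Complex x y) \<in> borel_measurable (borel \<Otimes>\<^sub>M borel)"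
  unfolding Complex_eq by measurable

text \<open>Both measures give a box the product of its side lengths. This opens the plane to
  iterated integration in real and imaginary part.\<close>

lemma lborel_complex_eq: "(lborel :: complex measure) = distr (lborel \<Otimes>\<^sub>M lborel) borel (\<lambda>(x, y). Complex x y)"
proof (rule lborel_eqI)
  fix l u :: complex
  assume le: "\<And>b. b \<in> Basis \<Longrightarrow> l \<bullet> b \<le> u \<bullet> b"
  have "(\<lambda>(x, y). Complex x y) -` box l u = {Re l<..<Re u} \<times> {Im l<..<Im u}"
    by (auto simp: in_box_complex_iff)
  then show "emeasure (distr (lborel \<Otimes>\<^sub>M lborel) borel (\<lambda>(x, y). Complex x y)) (box l u) = ennreal (\<Prod>b\<in>Basis. (u - l) \<bullet> b)"
    using le[of 1] le[of \<i>]
    by (simp add: emeasure_distr space_pair_measure lborel.emeasure_pair_measure_Times Basis_complex_def ennreal_mult)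
qed simp

lemma nn_integral_complex_cart:
  assumes [measurable]: "u \<in> borel_measurable borel"
  shows "(\<integral>\<^sup>+z. u z \<partial>lborel) = (\<integral>\<^sup>+y. \<integral>\<^sup>+x. u (Complex x y) \<partial>lborel \<partial>lborel)"
proof -
  have [measurable]: "(\<lambda>(x, y). u (Complex x y)) \<in> borel_measurable (borel \<Otimes>\<^sub>M borel)"
    using measurable_compose[OF measurable_Complex_pair assms] by (simp add: split_beta')
  have "(\<integral>\<^sup>+z. u z \<partial>lborel) = (\<integral>\<^sup>+p. u (case p of (x, y) \<Rightarrow> Complex x y) \<partial>(lborel \<Otimes>\<^sub>M lborel))"
    by (subst lborel_complex_eq) (simp add: nn_integral_distr)
  also have "\<dots> = (\<integral>\<^sup>+y. \<integral>\<^sup>+x. u (Complex x y) \<partial>lborel \<partial>lborel)"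
    by (subst lborel_pair.nn_integral_snd[symmetric]) (simp_all add: split_beta')
  finally show ?thesis .
qed

text \<open>A rotation is split into two affine substitutions in one variable, first in the real
  part for fixed imaginary part, then in the imaginary part. The first divides by
  \<open>cos t\<close>, whence the hypothesis; the excluded angles form a null set.\<close>

lemma nn_integral_rotate:
  assumes [measurable]: "u \<in> borel_measurable borel" and c: "cos t \<noteq> 0"
  shows "(\<integral>\<^sup>+z. u (z * cis t) \<partial>lborel) = (\<integral>\<^sup>+z. u z \<partial>lborel)"
proof -
  define c s where "c = cos t" and "s = sin t"
  have cs: "c \<noteq> 0" "s * s + c * c = 1"
    using c sin_cos_squared_add3[of t] by (auto simp: c_def s_def algebra_simps)
  have [measurable]: "(\<lambda>p. u (Complex (f p) (g p))) \<in> borel_measurable M"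
    if [measurable]: "f \<in> borel_measurable M" "g \<in> borel_measurable M" for f g and M :: "'x measure"
    unfolding Complex_eq by measurable
  have "(\<integral>\<^sup>+z. u (z * cis t) \<partial>lborel) = (\<integral>\<^sup>+y. \<integral>\<^sup>+x. u (Complex (x * c - y * s) (x * s + y * c)) \<partial>lborel \<partial>lborel)"
    by (subst nn_integral_complex_cart) (simp_all add: complex_mult c_def s_def cis.code)
  also have "\<dots> = (\<integral>\<^sup>+y. ennreal \<bar>1 / c\<bar> * (\<integral>\<^sup>+x. u (Complex x (x * s / c + (1 / c) * y)) \<partial>lborel) \<partial>lborel)"
  proof (rule nn_integral_cong)
    fix y
    have "(\<integral>\<^sup>+x. u (Complex (x * c - y * s) (x * s + y * c)) \<partial>lborel)
      = ennreal \<bar>1 / c\<bar> * (\<integral>\<^sup>+x. u (Complex ((y * s / c + 1 / c * x) * c - y * s) ((y * s / c + 1 / c * x) * s + y * c)) \<partial>lborel)"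
      using cs by (intro nn_integral_real_affine) auto
    also have "\<dots> = ennreal \<bar>1 / c\<bar> * (\<integral>\<^sup>+x. u (Complex x (x * s / c + (1 / c) * y)) \<partial>lborel)"
    proof (intro arg_cong2[where f = "(*)"] nn_integral_cong arg_cong[where f = u] refl)
      fix x
      have "(y * s / c + 1 / c * x) * s + y * c = x * s / c + y * (s * s + c * c) / c"
        using cs(1) by (simp add: field_simps)
      then have "(y * s / c + 1 / c * x) * s + y * c = x * s / c + (1 / c) * y"
        by (simp only: cs(2)) simp
      then show "Complex ((y * s / c + 1 / c * x) * c - y * s) ((y * s / c + 1 / c * x) * s + y * c)
        = Complex x (x * s / c + (1 / c) * y)"
        using cs by (simp add: field_simps)
    qed
    finally show "(\<integral>\<^sup>+x. u (Complex (x * c - y * s) (x * s + y * c)) \<partial>lborel)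
      = ennreal \<bar>1 / c\<bar> * (\<integral>\<^sup>+x. u (Complex x (x * s / c + (1 / c) * y)) \<partial>lborel)" .
  qed
  also have "\<dots> = ennreal \<bar>1 / c\<bar> * (\<integral>\<^sup>+y. \<integral>\<^sup>+x. u (Complex x (x * s / c + (1 / c) * y)) \<partial>lborel \<partial>lborel)"
    by (rule nn_integral_cmult) measurable
  also have "\<dots> = ennreal \<bar>1 / c\<bar> * (\<integral>\<^sup>+x. \<integral>\<^sup>+y. u (Complex x (x * s / c + (1 / c) * y)) \<partial>lborel \<partial>lborel)"
    by (subst lborel_pair.Fubini') (simp_all add: split_beta')
  also have "\<dots> = (\<integral>\<^sup>+x. ennreal \<bar>1 / c\<bar> * (\<integral>\<^sup>+y. u (Complex x (x * s / c + (1 / c) * y)) \<partial>lborel) \<partial>lborel)"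
    by (rule nn_integral_cmult[symmetric]) measurable
  also have "\<dots> = (\<integral>\<^sup>+x. \<integral>\<^sup>+y. u (Complex x y) \<partial>lborel \<partial>lborel)"
    using cs by (intro nn_integral_cong nn_integral_real_affine[symmetric]) auto
  also have "\<dots> = (\<integral>\<^sup>+y. \<integral>\<^sup>+x. u (Complex x y) \<partial>lborel \<partial>lborel)"
    by (subst lborel_pair.Fubini') (simp_all add: split_beta')
  also have "\<dots> = (\<integral>\<^sup>+z. u z \<partial>lborel)"
    by (subst nn_integral_complex_cart) simp_all
  finally show ?thesis .
qed

lemma nn_integral_periodic_shift:
  fixes g :: "real \<Rightarrow> ennreal"
  assumes [measurable]: "g \<in> borel_measurable borel" and per: "\<And>t. g (t + P) = g t" and a: "0 \<le> a" "a \<le> P"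
  shows "(\<integral>\<^sup>+t\<in>{0..<P}. g (t + a) \<partial>lborel) = (\<integral>\<^sup>+t\<in>{0..<P}. g t \<partial>lborel)"
proof -
  have shift: "(\<integral>\<^sup>+t. f t \<partial>lborel) = (\<integral>\<^sup>+t. f (b + t) \<partial>lborel)"
    if "f \<in> borel_measurable borel" for f :: "real \<Rightarrow> ennreal" and b
    using nn_integral_real_affine[OF that, of 1 b] by simp
  have "(\<integral>\<^sup>+t\<in>{0..<P}. g (t + a) \<partial>lborel) = (\<integral>\<^sup>+t\<in>{a..<P + a}. g t \<partial>lborel)"
    by (subst (2) shift[of _ a]) (auto intro!: nn_integral_cong simp: indicator_def add.commute)
  also have "\<dots> = (\<integral>\<^sup>+t. g t * indicator {a..<P} t + g t * indicator {P..<P + a} t \<partial>lborel)"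
    using a by (intro nn_integral_cong) (auto simp: indicator_def)
  also have "\<dots> = (\<integral>\<^sup>+t\<in>{a..<P}. g t \<partial>lborel) + (\<integral>\<^sup>+t\<in>{P..<P + a}. g t \<partial>lborel)"
    by (rule nn_integral_add) measurable
  also have "(\<integral>\<^sup>+t\<in>{P..<P + a}. g t \<partial>lborel) = (\<integral>\<^sup>+t\<in>{0..<a}. g t \<partial>lborel)"
    by (subst shift[of _ P]) (auto intro!: nn_integral_cong simp: indicator_def per add.commute[of P])
  also have "(\<integral>\<^sup>+t\<in>{a..<P}. g t \<partial>lborel) + (\<integral>\<^sup>+t\<in>{0..<a}. g t \<partial>lborel)
      = (\<integral>\<^sup>+t. g t * indicator {a..<P} t + g t * indicator {0..<a} t \<partial>lborel)"
    by (rule nn_integral_add[symmetric]) measurable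
  also have "\<dots> = (\<integral>\<^sup>+t\<in>{0..<P}. g t \<partial>lborel)"
    using a by (intro nn_integral_cong) (auto simp: indicator_def)
  finally show ?thesis .
qed

text \<open>Not normalised: constants have mass \<open>2 * pi\<close>. The argument is a complex
  number instead of a radius, so that a factor inside the integrand can be moved into it, see
  \<open>circle_nn_mult_right\<close>.\<close>

definition circle_nn :: "(complex \<Rightarrow> ennreal) \<Rightarrow> complex \<Rightarrow> ennreal" where
  "circle_nn u c = (\<integral>\<^sup>+t\<in>{0..<2 * pi}. u (c * cis t) \<partial>lborel)"

lemma measurable_cis [measurable]: "cis \<in> borel_measurable borel"
  by (intro borel_measurable_continuous_onI continuous_intros)

text \<open>Passing from \<open>c\<close> to \<open>norm c\<close> shifts the angle by the argument
  of \<open>c\<close>, which a full period does not notice.\<close>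

lemma circle_nn_norm:
  assumes [measurable]: "u \<in> borel_measurable borel"
  shows "circle_nn u c = circle_nn u (of_real (norm c))"
proof -
  obtain a where a: "c = of_real (norm c) * cis a" "0 \<le> a" "a < 2 * pi"
    using Arg2pi_eq[of c] Arg2pi[of c] by (metis cis_conv_exp)
  have "circle_nn u c = (\<integral>\<^sup>+t\<in>{0..<2 * pi}. u (of_real (norm c) * cis (t + a)) \<partial>lborel)"
    unfolding circle_nn_def by (subst a(1)) (simp add: cis_mult mult.assoc add.commute)
  also have "\<dots> = circle_nn u (of_real (norm c))"
    unfolding circle_nn_def
    by (rule nn_integral_periodic_shift) (use a in \<open>auto simp flip: cis_mult\<close>)
  finally show ?thesis .
qed

lemma emeasure_annulus:
  assumes "0 \<le> x" "x \<le> 1"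
  shows "emeasure lborel (disc \<inter> {z. x < norm z}) = ennreal (pi - pi * x\<^sup>2)"
proof -
  have "disc \<inter> {z. x < norm z} = disc - cball 0 x" by auto
  then have "emeasure lborel (disc \<inter> {z. x < norm z}) = emeasure lborel (disc - cball (0::complex) x)" by simp
  also have "\<dots> = emeasure lborel disc - emeasure lborel (disc \<inter> cball (0::complex) x)"
    by (subst emeasure_Diff[symmetric])
       (use emeasure_bounded_finite[of "disc \<inter> cball 0 x"] in
         \<open>auto simp: bounded_Int intro!: arg_cong[where f = "emeasure lborel"]\<close>)
  also have "emeasure lborel (disc \<inter> cball (0::complex) x) = ennreal (pi * x\<^sup>2)"
  proof (cases "x < 1")
    case True
    then have "disc \<inter> cball (0::complex) x = cball 0 x" by auto
    then show ?thesis using assms by (simp add: emeasure_cball unit_ball_vol_2)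
  next
    case False
    with assms have "x = 1" by simp
    then have "disc \<inter> cball (0::complex) x = disc" by auto
    then show ?thesis using \<open>x = 1\<close> by (simp add: emeasure_ball unit_ball_vol_2)
  qed
  finally show ?thesis
    using assms by (simp add: emeasure_ball unit_ball_vol_2 ennreal_minus)
qed

text \<open>The image of planar measure under the modulus and the measure with density
  \<open>2 * pi * r\<close> agree on half-lines, because the preimage of a half-line is an annulus
  of known area.\<close>

lemma nn_integral_norm:
  assumes [measurable]: "h \<in> borel_measurable borel"
  shows "(\<integral>\<^sup>+z\<in>disc. h (norm z) \<partial>lborel) = (\<integral>\<^sup>+r\<in>{0..<1}. ennreal (2 * pi * r) * h r \<partial>lborel)"
proof -
  define M where "M = distr (density lborel (indicator disc :: complex \<Rightarrow> ennreal)) borel (norm :: complex \<Rightarrow> real)"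
  define N where "N = density lborel (\<lambda>r::real. ennreal (2 * pi * r) * indicator {0..<1} r)"
  have M: "emeasure M {x<..} = ennreal (pi - pi * (max 0 (min 1 x))\<^sup>2)" for x
  proof -
    have "emeasure M {x<..} = emeasure lborel (disc \<inter> {z::complex. x < norm z})"
      unfolding M_def by (subst emeasure_distr) (auto simp: emeasure_restricted vimage_def)
    also have "\<dots> = ennreal (pi - pi * (max 0 (min 1 x))\<^sup>2)"
    proof (cases "0 \<le> x \<and> x \<le> 1")
      case True
      then show ?thesis by (simp add: emeasure_annulus)
    next
      case False
      then consider "x < 0" | "1 < x" by linarith
      then show ?thesis
      proof cases
        case 1
        then have "disc \<inter> {z::complex. x < norm z} = disc" by (auto intro: less_le_trans)
        with 1 show ?thesis by (simp add: emeasure_ball unit_ball_vol_2)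
      next
        case 2
        then have "disc \<inter> {z::complex. x < norm z} = {}" by auto
        with 2 show ?thesis by simp
      qed
    qed
    finally show ?thesis .
  qed
  have N: "emeasure N {x<..} = ennreal (pi - pi * (max 0 (min 1 x))\<^sup>2)" for x
  proof -
    define y where "y = max 0 (min 1 x)"
    have "emeasure N {x<..} = (\<integral>\<^sup>+r. ennreal (2 * pi * r) * indicator {0..<1} r * indicator {x<..} r \<partial>lborel)"
      unfolding N_def by (simp add: emeasure_density)
    also have "\<dots> = (\<integral>\<^sup>+r. ennreal (2 * pi * r) * indicator {y..1} r \<partial>lborel)"
      by (rule nn_integral_cong_AE, use AE_lborel_singleton[of 1] AE_lborel_singleton[of y] in eventually_elim)
         (auto simp: y_def indicator_def)
    also have "\<dots> = ennreal (pi * 1\<^sup>2 - pi * y\<^sup>2)"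
      by (rule nn_integral_FTC_Icc) (auto simp: y_def intro!: derivative_eq_intros)
    finally show ?thesis by (simp add: y_def)
  qed
  have [measurable]: "(indicator disc :: complex \<Rightarrow> ennreal) \<in> borel_measurable borel"
    by (rule borel_measurable_indicator) (simp add: borel_open)
  have "M = N"
    by (rule measure_eqI_lessThan) (simp_all add: M N, simp_all add: M_def N_def)
  then have "(\<integral>\<^sup>+r. h r \<partial>M) = (\<integral>\<^sup>+r. h r \<partial>N)" by simp
  then show ?thesis
    by (simp add: M_def N_def nn_integral_distr nn_integral_density mult_ac)
qed

lemma AE_cos_nonzero: "AE t in lborel. cos t \<noteq> (0::real)"
proof (rule AE_I')
  show "{t \<in> space lborel. \<not> cos t \<noteq> 0} \<subseteq> range (\<lambda>i::int. of_int i * (pi / 2))"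
    by (auto simp: cos_zero_iff_int)
  show "range (\<lambda>i::int. of_int i * (pi / 2)) \<in> null_sets lborel"
    by (rule countable_imp_null_set_lborel) auto
qed

text \<open>Averaging over all rotations replaces \<open>u\<close> by its circle integral without
  changing the integral beyond the factor \<open>2 * pi\<close>. The averaged function depends on
  the modulus only, so \<open>nn_integral_norm\<close> applies to it.\<close>

lemma nn_integral_polar:
  fixes u :: "complex \<Rightarrow> ennreal"
  assumes [measurable]: "u \<in> borel_measurable borel"
  shows "(\<integral>\<^sup>+z\<in>disc. u z \<partial>lborel) = (\<integral>\<^sup>+r\<in>{0..<1}. ennreal r * circle_nn u (of_real r) \<partial>lborel)"
proof -
  have [measurable]: "(\<lambda>c. circle_nn u c) \<in> borel_measurable borel"
    unfolding circle_nn_def by measurable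
  have [measurable (raw)]: "Measurable.pred M (\<lambda>x. f x \<in> disc)"
    if [measurable]: "f \<in> borel_measurable M" for f and M :: "'x measure"
    by (simp add: dist_norm)
  have "(\<integral>\<^sup>+z\<in>disc. circle_nn u (of_real (norm z)) \<partial>lborel) = (\<integral>\<^sup>+z. circle_nn u z * indicator disc z \<partial>lborel)"
    by (simp add: circle_nn_norm[symmetric])
  also have "\<dots> = (\<integral>\<^sup>+z. \<integral>\<^sup>+t. u (z * cis t) * indicator disc (z * cis t) * indicator {0..<2 * pi} t \<partial>lborel \<partial>lborel)"
    unfolding circle_nn_def
    by (intro nn_integral_cong) (auto simp: nn_integral_multc[symmetric] indicator_def norm_mult intro!: nn_integral_cong)
  also have "\<dots> = (\<integral>\<^sup>+t. \<integral>\<^sup>+z. u (z * cis t) * indicator disc (z * cis t) * indicator {0..<2 * pi} t \<partial>lborel \<partial>lborel)"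
    by (rule lborel_pair.Fubini') measurable
  also have "\<dots> = (\<integral>\<^sup>+t. (\<integral>\<^sup>+z. u z * indicator disc z \<partial>lborel) * indicator {0..<2 * pi} t \<partial>lborel)"
  proof (rule nn_integral_cong_AE, use AE_cos_nonzero in eventually_elim)
    fix t :: real assume "cos t \<noteq> 0"
    then show "(\<integral>\<^sup>+z. u (z * cis t) * indicator disc (z * cis t) * indicator {0..<2 * pi} t \<partial>lborel)
      = (\<integral>\<^sup>+z. u z * indicator disc z \<partial>lborel) * indicator {0..<2 * pi} t"
      by (subst nn_integral_rotate[of "\<lambda>z. u z * indicator disc z", symmetric]) (auto simp: nn_integral_multc)
  qed
  also have "\<dots> = (\<integral>\<^sup>+z. u z * indicator disc z \<partial>lborel) * ennreal (2 * pi)"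
    by (subst nn_integral_cmult) auto
  finally have "ennreal (2 * pi) * (\<integral>\<^sup>+z\<in>disc. u z \<partial>lborel) = (\<integral>\<^sup>+z\<in>disc. circle_nn u (of_real (norm z)) \<partial>lborel)"
    by (simp add: mult.commute)
  also have "\<dots> = (\<integral>\<^sup>+r\<in>{0..<1}. ennreal (2 * pi * r) * circle_nn u (of_real r) \<partial>lborel)"
    by (rule nn_integral_norm[where h = "\<lambda>r. circle_nn u (of_real r)"]) measurable
  also have "\<dots> = (\<integral>\<^sup>+r. ennreal (2 * pi) * (ennreal r * circle_nn u (of_real r) * indicator {0..<1} r) \<partial>lborel)"
    by (intro nn_integral_cong) (auto simp: indicator_def ennreal_mult mult_ac)
  also have "\<dots> = ennreal (2 * pi) * (\<integral>\<^sup>+r\<in>{0..<1}. ennreal r * circle_nn u (of_real r) \<partial>lborel)"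
    by (rule nn_integral_cmult) measurable
  finally show ?thesis
    by (simp add: ennreal_mult_cancel_left)
qed

text \<open>Lives on the whole plane with Borel sets; confinement to the disc is left to the
  profile, which vanishes from radius 1 on in all uses.\<close>

definition radial_measure :: "(real \<Rightarrow> real) \<Rightarrow> complex measure" where
  "radial_measure \<tau> = density lborel (\<lambda>z. ennreal (\<tau> (norm z)))"

lemma sets_radial_measure [simp, measurable_cong]: "sets (radial_measure \<tau>) = sets borel"
  and space_radial_measure [simp]: "space (radial_measure \<tau>) = UNIV"
  by (simp_all add: radial_measure_def)

lemma sigma_finite_radial_measure:
  assumes [measurable]: "\<tau> \<in> borel_measurable borel"
  shows "sigma_finite_measure (radial_measure \<tau>)"
  unfolding radial_measure_def by (subst sigma_finite_measure.sigma_finite_iff_density_finite[OF sigma_finite_lborel]) auto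

lemma nn_integral_radial_measure:
  assumes [measurable]: "\<tau> \<in> borel_measurable borel" "u \<in> borel_measurable borel"
    and zero: "\<And>r. 1 \<le> r \<Longrightarrow> \<tau> r = 0"
  shows "(\<integral>\<^sup>+z. u z \<partial>radial_measure \<tau>)
    = (\<integral>\<^sup>+r\<in>{0..<1}. ennreal (r * \<tau> r) * circle_nn u (of_real r) \<partial>lborel)"
proof -
  have "(\<integral>\<^sup>+z. u z \<partial>radial_measure \<tau>) = (\<integral>\<^sup>+z. ennreal (\<tau> (norm z)) * u z \<partial>lborel)"
    unfolding radial_measure_def by (rule nn_integral_density) auto
  also have "\<dots> = (\<integral>\<^sup>+z\<in>disc. ennreal (\<tau> (norm z)) * u z \<partial>lborel)"
    by (intro nn_integral_cong) (auto simp: indicator_def zero not_less)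
  also have "\<dots> = (\<integral>\<^sup>+r\<in>{0..<1}. ennreal r * circle_nn (\<lambda>z. ennreal (\<tau> (norm z)) * u z) (of_real r) \<partial>lborel)"
    by (rule nn_integral_polar) measurable
  also have "\<dots> = (\<integral>\<^sup>+r\<in>{0..<1}. ennreal (r * \<tau> r) * circle_nn u (of_real r) \<partial>lborel)"
  proof (rule nn_integral_cong)
    fix r :: real
    have "circle_nn (\<lambda>z. ennreal (\<tau> (norm z)) * u z) (of_real r) = ennreal (\<tau> r) * circle_nn u (of_real r)" if "0 \<le> r"
      using that unfolding circle_nn_def
      by (subst nn_integral_cmult[symmetric]) (auto intro!: nn_integral_cong simp: norm_mult mult_ac)
    then show "ennreal r * circle_nn (\<lambda>z. ennreal (\<tau> (norm z)) * u z) (of_real r) * indicator {0..<1} r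
      = ennreal (r * \<tau> r) * circle_nn u (of_real r) * indicator {0..<1} r"
      by (auto simp: indicator_def ennreal_mult' mult.assoc)
  qed
  finally show ?thesis .
qed

text \<open>An increasing function is a superposition of indicators of intervals that reach up to 1.
  For such an indicator the inequality is the hypothesis on tails, and the layer-cake formula adds
  these up.\<close>

lemma nn_integral_mono_comparison:
  fixes \<phi> \<alpha> \<beta> :: "real \<Rightarrow> ennreal"
  assumes [measurable]: "\<phi> \<in> borel_measurable borel" "\<alpha> \<in> borel_measurable borel" "\<beta> \<in> borel_measurable borel"
    and mono: "\<And>r s. 0 \<le> r \<Longrightarrow> r \<le> s \<Longrightarrow> s < 1 \<Longrightarrow> \<phi> r \<le> \<phi> s"
    and tails: "\<And>r. 0 \<le> r \<Longrightarrow> r < 1 \<Longrightarrow> (\<integral>\<^sup>+s\<in>{r..<1}. \<alpha> s \<partial>lborel) \<le> C * (\<integral>\<^sup>+s\<in>{r..<1}. \<beta> s \<partial>lborel)"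
  shows "(\<integral>\<^sup>+s\<in>{0..<1}. \<alpha> s * \<phi> s \<partial>lborel) \<le> C * (\<integral>\<^sup>+s\<in>{0..<1}. \<beta> s * \<phi> s \<partial>lborel)"
proof -
  \<comment> \<open>The condition \<open>0 \<le> t\<close> belongs to the level set because
    \<open>ennreal\<close> maps negative numbers to 0.\<close>
  define E where "E t = {s \<in> {0..<1}. 0 \<le> t \<and> ennreal t < \<phi> s}" for t
  have layer: "(\<integral>\<^sup>+s\<in>{0..<1}. \<gamma> s * \<phi> s \<partial>lborel) = (\<integral>\<^sup>+t. \<integral>\<^sup>+s. \<gamma> s * indicator (E t) s \<partial>lborel \<partial>lborel)"
    if [measurable]: "\<gamma> \<in> borel_measurable borel" for \<gamma>
  proof -
    have eq: "\<phi> s = (\<integral>\<^sup>+t. indicator {t. 0 \<le> t \<and> ennreal t < \<phi> s} t \<partial>lborel)" for s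
    proof (cases "\<phi> s")
      case (real r)
      then have "{t. 0 \<le> t \<and> ennreal t < \<phi> s} = {0..<r}" by (auto simp: ennreal_less_iff)
      with real show ?thesis by simp
    next
      case top
      then have "{t. 0 \<le> t \<and> ennreal t < \<phi> s} = {0..}" by auto
      moreover have "emeasure lborel {0::real..} = \<infinity>"
      proof (cases "emeasure lborel {0::real..}")
        case (real x)
        have "emeasure lborel {0..x + 1} \<le> emeasure lborel {0::real..}"
          by (rule emeasure_mono) auto
        with real show ?thesis by simp
      qed simp
      ultimately show ?thesis using top by simp
    qed
    have "(\<integral>\<^sup>+s\<in>{0..<1}. \<gamma> s * \<phi> s \<partial>lborel)
      = (\<integral>\<^sup>+s. \<integral>\<^sup>+t. \<gamma> s * indicator {0..<1} s * indicator {t. 0 \<le> t \<and> ennreal t < \<phi> s} t \<partial>lborel \<partial>lborel)"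
      by (intro nn_integral_cong, subst eq, subst nn_integral_cmult) (auto simp: mult_ac)
    also have "\<dots> = (\<integral>\<^sup>+t. \<integral>\<^sup>+s. \<gamma> s * indicator {0..<1} s * indicator {t. 0 \<le> t \<and> ennreal t < \<phi> s} t \<partial>lborel \<partial>lborel)"
      by (rule lborel_pair.Fubini') measurable
    also have "\<dots> = (\<integral>\<^sup>+t. \<integral>\<^sup>+s. \<gamma> s * indicator (E t) s \<partial>lborel \<partial>lborel)"
      by (intro nn_integral_cong) (auto simp: E_def indicator_def)
    finally show ?thesis .
  qed
  have le: "(\<integral>\<^sup>+s. \<alpha> s * indicator (E t) s \<partial>lborel) \<le> C * (\<integral>\<^sup>+s. \<beta> s * indicator (E t) s \<partial>lborel)" for t
  proof (cases "E t = {}")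
    case False
    \<comment> \<open>By monotonicity the level set contains everything in \<open>{c<..<1}\<close>
      and nothing below \<open>c\<close>, so it differs from \<open>{c..<1}\<close> by at most one
      point.\<close>
    define c where "c = Inf (E t)"
    have bdd: "bdd_below (E t)" by (auto simp: E_def)
    obtain s0 where s0: "s0 \<in> E t" using False by auto
    have c: "0 \<le> c" "c < 1"
      using False s0 cInf_lower[OF s0 bdd] by (auto simp: c_def E_def intro!: cInf_greatest)
    have up: "s \<in> E t" if "c < s" "s < 1" for s
    proof -
      obtain x where "x \<in> E t" "x < s"
        using \<open>c < s\<close> cInf_lessD[OF False, of s] by (auto simp: c_def)
      with that show ?thesis using mono[of x s] by (auto simp: E_def intro: less_le_trans)
    qed
    have "c \<le> s" if "s \<in> E t" for s using cInf_lower[OF that bdd] by (simp add: c_def)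
    then have E: "indicator (E t) s = (indicator {c..<1} s :: ennreal)" if "s \<noteq> c" for s
      using that up[of s] by (force simp: indicator_def E_def)
    have AE: "AE s in lborel. indicator (E t) s = (indicator {c..<1} s :: ennreal)"
      using AE_lborel_singleton[of c] by eventually_elim (rule E)
    have "(\<integral>\<^sup>+s. \<alpha> s * indicator (E t) s \<partial>lborel) = (\<integral>\<^sup>+s\<in>{c..<1}. \<alpha> s \<partial>lborel)"
      by (rule nn_integral_cong_AE, use AE in eventually_elim) simp
    also have "\<dots> \<le> C * (\<integral>\<^sup>+s\<in>{c..<1}. \<beta> s \<partial>lborel)" by (rule tails) (use c in auto)
    also have "(\<integral>\<^sup>+s\<in>{c..<1}. \<beta> s \<partial>lborel) = (\<integral>\<^sup>+s. \<beta> s * indicator (E t) s \<partial>lborel)"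
      by (rule nn_integral_cong_AE, use AE in eventually_elim) simp
    finally show ?thesis .
  qed simp
  have "(\<integral>\<^sup>+s\<in>{0..<1}. \<alpha> s * \<phi> s \<partial>lborel) \<le> (\<integral>\<^sup>+t. C * (\<integral>\<^sup>+s. \<beta> s * indicator (E t) s \<partial>lborel) \<partial>lborel)"
    unfolding layer[OF assms(2)] by (intro nn_integral_mono le)
  also have "\<dots> = C * (\<integral>\<^sup>+t. \<integral>\<^sup>+s. \<beta> s * indicator (E t) s \<partial>lborel \<partial>lborel)"
  proof (rule nn_integral_cmult)
    have "(\<lambda>t. \<integral>\<^sup>+s. \<beta> s * indicator {0..<1} s * indicator {t. 0 \<le> t \<and> ennreal t < \<phi> s} t \<partial>lborel) \<in> borel_measurable lborel"
      by measurable
    also have "(\<lambda>t. \<integral>\<^sup>+s. \<beta> s * indicator {0..<1} s * indicator {t. 0 \<le> t \<and> ennreal t < \<phi> s} t \<partial>lborel)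
      = (\<lambda>t. \<integral>\<^sup>+s. \<beta> s * indicator (E t) s \<partial>lborel)"
      by (intro ext nn_integral_cong) (auto simp: E_def indicator_def)
    finally show "(\<lambda>t. \<integral>\<^sup>+s. \<beta> s * indicator (E t) s \<partial>lborel) \<in> borel_measurable lborel" .
  qed
  finally show ?thesis unfolding layer[OF assms(3)] .
qed

section \<open>Regular radial weights\<close>

text \<open>A radial weight is only Lebesgue measurable on its interval and arbitrary outside,
  whereas Tonelli over products of Borel spaces wants a Borel profile on the whole line.
  \<open>borel_weight_representative\<close> provides one.\<close>

locale borel_weight =
  fixes \<omega> :: "real \<Rightarrow> real"
  assumes borel [measurable]: "\<omega> \<in> borel_measurable borel"
    and nonneg: "0 \<le> \<omega> r"
    and zero: "r \<notin> {0..<1} \<Longrightarrow> \<omega> r = 0"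
    and integrable: "integrable lborel \<omega>"
    and tail_pos: "0 \<le> r \<Longrightarrow> r < 1 \<Longrightarrow> 0 < weight_tail \<omega> r"

text \<open>A null set of radii sweeps out a null set of the disc, by
  \<open>nn_integral_norm\<close>. Hence changing the profile on a null set affects none of the
  three objects from which everything else is built.\<close>

lemma weight_cong:
  assumes ae: "AE r in lborel. r \<in> {0..<1} \<longrightarrow> \<omega> r = \<omega>' r"
    and m: "set_borel_measurable lebesgue {0..<1} \<omega>" "set_borel_measurable lebesgue {0..<1} \<omega>'"
  shows "weighted_area \<omega> = weighted_area \<omega>'"
    and "0 \<le> r \<Longrightarrow> weight_tail \<omega> r = weight_tail \<omega>' r"
    and "weight_moment \<omega> x = weight_moment \<omega>' x"
proof -
  obtain N where N: "N \<in> null_sets lborel" "{r. \<not> (r \<in> {0..<1} \<longrightarrow> \<omega> r = \<omega>' r)} \<subseteq> N"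
    using ae by (auto elim!: AE_E simp: null_sets_def)
  have [measurable]: "N \<in> sets borel" using N by (auto simp: null_sets_def)
  have "AE r in lborel. indicator N r = (0::ennreal)"
    using AE_not_in[OF N(1)] by eventually_elim simp
  then have "(\<integral>\<^sup>+r\<in>{0..<1}. ennreal (2 * pi * r) * indicator N r \<partial>lborel) = 0"
    by (subst nn_integral_0_iff_AE) (auto elim!: eventually_mono)
  then have "(\<integral>\<^sup>+z\<in>disc. indicator N (norm z) \<partial>(lborel :: complex measure)) = 0"
    by (subst nn_integral_norm) auto
  moreover have [measurable]: "(indicator disc :: complex \<Rightarrow> ennreal) \<in> borel_measurable borel"
    by (rule borel_measurable_indicator) (simp add: borel_open)
  ultimately have "AE z in lborel. indicator N (norm z) * indicator disc (z::complex) = (0::ennreal)"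
    by (subst (asm) nn_integral_0_iff_AE) auto
  then have "AE z in lborel. z \<in> disc \<longrightarrow> \<omega> (norm (z::complex)) = \<omega>' (norm z)"
  proof eventually_elim
    case (elim z)
    then have "z \<in> disc \<Longrightarrow> norm z \<notin> N" by (simp add: indicator_def split: if_splits)
    moreover have "norm z \<in> N" if "z \<in> disc" "\<omega> (norm z) \<noteq> \<omega>' (norm z)"
      by (rule subsetD[OF N(2)]) (use that in auto)
    ultimately show ?case by auto
  qed
  then have "AE z in lebesgue. z \<in> disc \<longrightarrow> \<omega> (norm (z::complex)) = \<omega>' (norm z)"
    by (rule AE_completion)
  then have "AE z in lebesgue_on disc. \<omega> (norm (z::complex)) = \<omega>' (norm z)"
    by (subst AE_restrict_space_iff) auto
  then have "AE z in disc_area. \<omega> (norm z) = \<omega>' (norm z)"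
    unfolding disc_area_def by (subst AE_density) auto
  then show "weighted_area \<omega> = weighted_area \<omega>'"
    unfolding weighted_area_def density_def
    by (intro arg_cong[where f = "measure_of _ _"] ext nn_integral_cong_AE) (auto elim!: eventually_mono)
  have ae': "AE r in lebesgue. r \<in> {0..<1} \<longrightarrow> \<omega> r = \<omega>' r"
    by (rule AE_completion) (rule ae)
  show "weight_tail \<omega> r = weight_tail \<omega>' r" if "0 \<le> r"
  proof -
    have eq: "indicator {r..<1} s *\<^sub>R v s = indicator {r..} s *\<^sub>R (indicator {0..<1} s *\<^sub>R v s)" for s and v :: "real \<Rightarrow> real"
      using that by (auto simp: indicator_def)
    have ind: "(indicator {r..} :: real \<Rightarrow> real) \<in> borel_measurable lebesgue"
      by (intro measurable_completion) auto
    show ?thesis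
      unfolding weight_tail_def set_lebesgue_integral_def eq
    proof (rule integral_cong_AE)
      show "AE s in lebesgue. indicator {r..} s *\<^sub>R (indicator {0..<1} s *\<^sub>R \<omega> s)
          = indicator {r..} s *\<^sub>R (indicator {0..<1} s *\<^sub>R \<omega>' s)"
        using ae' by eventually_elim (auto simp: indicator_def)
    qed (rule borel_measurable_scaleR[OF ind], use m in \<open>simp add: set_borel_measurable_def\<close>)+
  qed
  have pm: "(\<lambda>r::real. r powr x) \<in> borel_measurable lebesgue"
    by (intro measurable_completion) auto
  have eq: "indicator {0..<1} s *\<^sub>R (s powr x * v s) = s powr x * (indicator {0..<1} s *\<^sub>R v s)" for s and v :: "real \<Rightarrow> real"
    by (auto simp: indicator_def)
  show "weight_moment \<omega> x = weight_moment \<omega>' x"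
    unfolding weight_moment_def set_lebesgue_integral_def eq
  proof (rule integral_cong_AE)
    show "AE s in lebesgue. s powr x * (indicator {0..<1} s *\<^sub>R \<omega> s) = s powr x * (indicator {0..<1} s *\<^sub>R \<omega>' s)"
      using ae' by eventually_elim (auto simp: indicator_def)
  qed (rule borel_measurable_times[OF pm], use m in \<open>simp add: set_borel_measurable_def\<close>)+
qed

lemma borel_weight_representative:
  assumes "radial_weight \<omega>"
  obtains \<omega>' where "borel_weight \<omega>'" "weighted_area \<omega>' = weighted_area \<omega>"
    "\<And>r. 0 \<le> r \<Longrightarrow> weight_tail \<omega>' r = weight_tail \<omega> r" "weight_moment \<omega>' = weight_moment \<omega>"
proof -
  have int: "integrable lebesgue (\<lambda>r. indicator {0..<1} r *\<^sub>R \<omega> r)"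
    using assms by (simp add: radial_weight_def set_integrable_def)
  then have "(\<lambda>r. indicator {0..<1} r *\<^sub>R \<omega> r) \<in> borel_measurable lebesgue" by auto
  then obtain g where [measurable]: "g \<in> borel_measurable lborel"
    and g: "AE r in lborel. indicator {0..<1} r *\<^sub>R \<omega> r = g r"
    using completion_ex_borel_measurable_real by blast
  \<comment> \<open>The truncation at 0 makes positivity hold everywhere instead of almost
    everywhere, and the indicator fixes the values off the interval.\<close>
  define \<omega>' where "\<omega>' r = indicator {0..<1} r * max 0 (g r)" for r
  have [measurable]: "\<omega>' \<in> borel_measurable borel"
    unfolding \<omega>'_def by measurable
  have ae: "AE r in lborel. indicator {0..<1} r *\<^sub>R \<omega> r = \<omega>' r"
    using g
  proof eventually_elim
    case (elim r)
    moreover have "r \<in> {0..<1} \<Longrightarrow> 0 \<le> \<omega> r"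
      using assms by (simp add: radial_weight_def)
    ultimately show ?case by (auto simp: \<omega>'_def indicator_def)
  qed
  then have ae': "AE r in lborel. r \<in> {0..<1} \<longrightarrow> \<omega>' r = \<omega> r"
    by eventually_elim auto
  have "(\<lambda>r. indicator {0..<1} r *\<^sub>R \<omega>' r) = \<omega>'" by (auto simp: \<omega>'_def indicator_def)
  then have m: "set_borel_measurable lebesgue {0..<1} \<omega>'"
    by (simp add: set_borel_measurable_def measurable_completion)
  have m': "set_borel_measurable lebesgue {0..<1} \<omega>"
    unfolding set_borel_measurable_def using int by auto
  note eqs = weight_cong[OF ae' m m']
  have "integrable lebesgue \<omega>'"
    using int by (rule integrable_cong_AE_imp) (use ae[THEN AE_completion] in \<open>auto simp: measurable_completion elim!: eventually_mono\<close>)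
  then have "integrable lborel \<omega>'"
    by (subst (asm) integrable_completion) auto
  then have "borel_weight \<omega>'"
    using assms by unfold_locales (auto simp: eqs(2) radial_weight_def, auto simp: \<omega>'_def)
  then show ?thesis
    by (rule that) (auto simp: eqs)
qed

text \<open>Differentiability is asked for in the open interval only, since antiderivatives such as
  \<open>(1 - s) powr \<gamma>\<close> may fail to be differentiable at the endpoint 1.\<close>

lemma nn_integral_FTC_interior:
  fixes F f :: "real \<Rightarrow> real"
  assumes "a \<le> b" and nonneg: "\<And>x. a \<le> x \<Longrightarrow> x \<le> b \<Longrightarrow> 0 \<le> f x"
    and "continuous_on {a..b} F" and "\<And>x. a < x \<Longrightarrow> x < b \<Longrightarrow> (F has_real_derivative f x) (at x)"
  shows "(\<integral>\<^sup>+x\<in>{a..<b}. ennreal (f x) \<partial>lborel) = ennreal (F b - F a)"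
proof -
  have "(f has_integral (F b - F a)) {a..b}"
    using assms by (intro fundamental_theorem_of_calculus_interior)
      (auto simp: has_real_derivative_iff_has_vector_derivative)
  then have "(\<integral>\<^sup>+x. ennreal (indicator {a..b} x * f x) \<partial>lborel) = ennreal (F b - F a)"
    by (intro nn_integral_has_integral_lebesgue) (auto intro: nonneg)
  moreover have "(\<integral>\<^sup>+x\<in>{a..<b}. ennreal (f x) \<partial>lborel) = (\<integral>\<^sup>+x. ennreal (indicator {a..b} x * f x) \<partial>lborel)"
    by (rule nn_integral_cong_AE, use AE_lborel_singleton[of b] in eventually_elim) (auto simp: indicator_def)
  ultimately show ?thesis by simp
qed

text \<open>About \<open>log 2 (y / x)\<close> doublings lead from \<open>x\<close> past
  \<open>y\<close>. They cost \<open>A ^ n\<close>, at most \<open>(2 ^ n) ^ b\<close>, and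
  \<open>2 ^ n\<close> exceeds \<open>y / x\<close> by at most a factor 2. The exponent is made a
  natural number because it later counts summations by parts.\<close>

lemma doubling_power_bound:
  fixes h :: "real \<Rightarrow> real"
  assumes A: "1 \<le> A" and dbl: "\<And>x. 1 \<le> x \<Longrightarrow> h x \<le> A * h (2 * x)"
    and anti: "\<And>x y. 1 \<le> x \<Longrightarrow> x \<le> y \<Longrightarrow> h y \<le> h x" and nonneg: "\<And>x. 1 \<le> x \<Longrightarrow> 0 \<le> h x"
  obtains b :: nat where "0 < b" "\<And>x y. 1 \<le> x \<Longrightarrow> x \<le> y \<Longrightarrow> h x \<le> (2 * (y / x)) ^ b * h y"
proof -
  obtain b0 :: nat where "A < 2 ^ b0" using real_arch_pow[of 2 A] by auto
  define b where "b = Suc b0"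
  have b: "A \<le> 2 ^ b" using \<open>A < 2 ^ b0\<close> A by (simp add: b_def)
  have iter: "h x \<le> A ^ n * h (2 ^ n * x)" if "1 \<le> x" for x n
  proof (induction n)
    case (Suc n)
    have "1 \<le> 2 ^ n * x" using that mult_mono[of 1 "2 ^ n" 1 x] by simp
    then have "A ^ n * h (2 ^ n * x) \<le> A ^ n * (A * h (2 * (2 ^ n * x)))"
      using A by (intro mult_left_mono dbl) auto
    with Suc show ?case by (simp add: mult_ac)
  qed simp
  show ?thesis
  proof (rule that[of b])
    fix x y :: real assume xy: "1 \<le> x" "x \<le> y"
    define q where "q = y / x"
    have q: "1 \<le> q" "y = q * x" using xy by (auto simp: q_def)
    define n where "n = nat \<lceil>log 2 q\<rceil>"
    have "0 \<le> log 2 q" using q by simp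
    then have n: "log 2 q \<le> real n" "real n \<le> log 2 q + 1" by (auto simp: n_def)
    have "q \<le> 2 powr real n" using n(1) q by (simp add: log_le_iff)
    then have n1: "q \<le> 2 ^ n" by (simp add: powr_realpow)
    have "2 powr real n \<le> 2 powr (log 2 q + 1)" using n(2) by (intro powr_mono) auto
    then have n2: "2 ^ n \<le> 2 * q" using q by (simp add: powr_add powr_realpow)
    have "h x \<le> A ^ n * h (2 ^ n * x)" by (rule iter) fact
    also have "\<dots> \<le> A ^ n * h y"
    proof (intro mult_left_mono anti)
      show "1 \<le> y" using xy by simp
      show "y \<le> 2 ^ n * x" using n1 xy unfolding q(2) by (intro mult_right_mono) auto
    qed (use A in auto)
    also have "\<dots> \<le> (2 ^ b) ^ n * h y"
      using A b xy nonneg[of y] by (intro mult_right_mono power_mono) auto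
    also have "(2 ^ b) ^ n = (2 ^ n :: real) ^ b" by (simp add: mult.commute flip: power_mult)
    also have "(2 ^ n) ^ b * h y \<le> (2 * q) ^ b * h y"
      using n2 xy nonneg[of y] by (intro mult_right_mono power_mono) auto
    finally show "h x \<le> (2 * (y / x)) ^ b * h y" by (simp add: q_def)
  qed (simp add: b_def)
qed

text \<open>The mirror image of the previous iteration, with steps of ratio \<open>K\<close>;
  rounding the number of steps down costs the one factor \<open>C\<close> in the conclusion.\<close>

lemma decay_power_bound:
  fixes h :: "real \<Rightarrow> real"
  assumes C: "1 < C" and K: "1 < K" and dec: "\<And>x. 1 \<le> x \<Longrightarrow> C * h (K * x) \<le> h x"
    and anti: "\<And>x y. 1 \<le> x \<Longrightarrow> x \<le> y \<Longrightarrow> h y \<le> h x" and nonneg: "\<And>x. 1 \<le> x \<Longrightarrow> 0 \<le> h x"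
  obtains a where "0 < a" "a < 1" "\<And>x y. 1 \<le> x \<Longrightarrow> x \<le> y \<Longrightarrow> h y \<le> C * (x / y) powr a * h x"
proof -
  define a0 where "a0 = log K C"
  have a0: "0 < a0" "K powr a0 = C" using C K by (auto simp: a0_def)
  \<comment> \<open>The natural exponent is \<open>log K C\<close>. The cap secures
    \<open>a < 1\<close>, and lowering the exponent only weakens the bound because
    \<open>x \<le> y\<close>.\<close>
  define a where "a = min a0 (1 / 2)"
  have iter: "C ^ n * h (K ^ n * x) \<le> h x" if "1 \<le> x" for x n
  proof (induction n)
    case (Suc n)
    have "1 \<le> K ^ n * x" using that K mult_mono[of 1 "K ^ n" 1 x] by simp
    then have "C ^ n * (C * h (K * (K ^ n * x))) \<le> C ^ n * h (K ^ n * x)"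
      using C by (intro mult_left_mono dec) auto
    with Suc show ?case by (simp add: mult_ac)
  qed simp
  show ?thesis
  proof (rule that[of a])
    fix x y :: real assume xy: "1 \<le> x" "x \<le> y"
    define q where "q = y / x"
    have q: "1 \<le> q" "y = q * x" using xy by (auto simp: q_def)
    define n where "n = nat \<lfloor>log K q\<rfloor>"
    have "0 \<le> log K q" using q K by simp
    then have n: "real n \<le> log K q" "log K q \<le> real n + 1" by (auto simp: n_def)
    have "K powr real n \<le> q" using n(1) q K by (simp add: le_log_iff)
    then have n1: "K ^ n \<le> q" using K by (simp add: powr_realpow)
    have "q \<le> K powr (real n + 1)" using n(2) q K by (simp add: log_le_iff)
    then have "q powr a0 \<le> (K powr (real n + 1)) powr a0" using q a0 by (intro powr_mono2) auto
    also have "\<dots> = (K powr a0) powr (real n + 1)" by (simp add: powr_powr mult.commute)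
    also have "\<dots> = C ^ n * C" using a0 C by (simp add: powr_add powr_realpow)
    finally have qa: "q powr a0 \<le> C ^ n * C" .
    have "1 \<le> K ^ n * x" using xy K mult_mono[of 1 "K ^ n" 1 x] by simp
    then have "h y \<le> h (K ^ n * x)" using xy q n1 by (intro anti) auto
    then have "C ^ n * h y \<le> h x" using iter[OF xy(1), of n] C
      by (meson mult_left_mono order_trans zero_le_power less_imp_le zero_less_one less_trans)
    then have "C * (C ^ n * h y) \<le> C * h x" using C by simp
    moreover have "q powr a0 * h y \<le> C ^ n * C * h y" using qa nonneg[of y] xy by (intro mult_right_mono) auto
    ultimately have 1: "q powr a0 * h y \<le> C * h x" by (simp add: mult_ac)
    have "q powr a \<le> q powr a0" using q by (intro powr_mono) (auto simp: a_def)
    then have "q powr a * h y \<le> C * h x"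
      using 1 nonneg[of y] xy by (meson mult_right_mono order_trans)
    moreover have "(x / y) powr a = 1 / q powr a"
      using xy by (simp add: q_def powr_divide)
    moreover have "0 < q powr a" using q by simp
    ultimately show "h y \<le> C * (x / y) powr a * h x"
      by (simp only: times_divide_eq_left times_divide_eq_right mult_1_right pos_le_divide_eq mult.commute[of _ "q powr a"])
  qed (use a0 in \<open>auto simp: a_def\<close>)
qed

section \<open>Tails and moments of a Borel weight\<close>

context borel_weight
begin

lemma nn_integral_tail: "(\<integral>\<^sup>+s\<in>{r..<1}. ennreal (\<omega> s) \<partial>lborel) = ennreal (weight_tail \<omega> r)"
proof -
  have "integrable lborel (\<lambda>s. indicator {r..<1} s *\<^sub>R \<omega> s)"
    by (intro integrable_mult_indicator integrable) auto
  moreover from this have "weight_tail \<omega> r = (\<integral>s. indicator {r..<1} s *\<^sub>R \<omega> s \<partial>lborel)"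
    unfolding weight_tail_def set_lebesgue_integral_def by (subst integral_completion) auto
  ultimately have "(\<integral>\<^sup>+s. ennreal (indicator {r..<1} s *\<^sub>R \<omega> s) \<partial>lborel) = ennreal (weight_tail \<omega> r)"
    using nonneg by (simp add: nn_integral_eq_integral)
  moreover have "(\<integral>\<^sup>+s. ennreal (indicator {r..<1} s *\<^sub>R \<omega> s) \<partial>lborel) = (\<integral>\<^sup>+s\<in>{r..<1}. ennreal (\<omega> s) \<partial>lborel)"
    by (intro nn_integral_cong) (auto simp: indicator_def)
  ultimately show ?thesis by simp
qed

lemma nn_integral_moment:
  assumes "0 \<le> x"
  shows "(\<integral>\<^sup>+r\<in>{0..<1}. ennreal (r powr x * \<omega> r) \<partial>lborel) = ennreal (weight_moment \<omega> x)"
proof -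
  have le: "r powr x \<le> 1" if "0 \<le> r" "r < 1" for r :: real
    using that assms powr_mono2[of x r 1] by auto
  have "integrable lborel (\<lambda>s. indicator {0..<1} s *\<^sub>R (s powr x * \<omega> s))"
    by (rule Bochner_Integration.integrable_bound[OF integrable])
       (use nonneg le in \<open>auto simp: indicator_def abs_mult intro!: mult_left_le_one_le\<close>)
  moreover from this have "weight_moment \<omega> x = (\<integral>s. indicator {0..<1} s *\<^sub>R (s powr x * \<omega> s) \<partial>lborel)"
    unfolding weight_moment_def set_lebesgue_integral_def by (subst integral_completion) auto
  ultimately have "(\<integral>\<^sup>+s. ennreal (indicator {0..<1} s *\<^sub>R (s powr x * \<omega> s)) \<partial>lborel) = ennreal (weight_moment \<omega> x)"
    using nonneg by (simp add: nn_integral_eq_integral)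
  moreover have "(\<integral>\<^sup>+s. ennreal (indicator {0..<1} s *\<^sub>R (s powr x * \<omega> s)) \<partial>lborel)
      = (\<integral>\<^sup>+r\<in>{0..<1}. ennreal (r powr x * \<omega> r) \<partial>lborel)"
    by (intro nn_integral_cong) (auto simp: indicator_def)
  ultimately show ?thesis by simp
qed

lemma tail_nonneg: "0 \<le> weight_tail \<omega> r"
  unfolding weight_tail_def set_lebesgue_integral_def
  by (rule Bochner_Integration.integral_nonneg) (simp add: nonneg)

lemma moment_nonneg: "0 \<le> weight_moment \<omega> x"
  unfolding weight_moment_def set_lebesgue_integral_def
  by (rule Bochner_Integration.integral_nonneg) (simp add: nonneg)

lemma tail_antimono:
  assumes "r \<le> s"
  shows "weight_tail \<omega> s \<le> weight_tail \<omega> r"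
proof -
  have "ennreal (weight_tail \<omega> s) \<le> ennreal (weight_tail \<omega> r)"
    unfolding nn_integral_tail[symmetric]
    using assms by (intro nn_integral_mono) (auto simp: indicator_def)
  then show ?thesis by (simp add: tail_nonneg)
qed

lemma measurable_tail [measurable]: "weight_tail \<omega> \<in> borel_measurable borel"
proof -
  have "(\<lambda>r. - weight_tail \<omega> r) \<in> borel_measurable borel"
    by (intro borel_measurable_mono monoI) (simp add: tail_antimono)
  from borel_measurable_uminus[OF this] show ?thesis by simp
qed

lemma moment_antimono:
  assumes "0 \<le> x" "x \<le> y"
  shows "weight_moment \<omega> y \<le> weight_moment \<omega> x"
proof -
  have "ennreal (weight_moment \<omega> y) \<le> ennreal (weight_moment \<omega> x)"
    using assms nonneg unfolding nn_integral_moment[OF assms(1), symmetric] nn_integral_moment[OF order_trans[OF assms], symmetric]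
    by (intro nn_integral_mono) (auto simp: indicator_def intro!: ennreal_leI mult_right_mono powr_mono')
  then show ?thesis by (simp add: moment_nonneg)
qed

lemma tail_le_moment:
  assumes "0 \<le> x" "0 \<le> r" "r < 1"
  shows "r powr x * weight_tail \<omega> r \<le> weight_moment \<omega> x"
proof -
  have "ennreal (r powr x * weight_tail \<omega> r) = (\<integral>\<^sup>+s\<in>{r..<1}. ennreal (r powr x) * ennreal (\<omega> s) \<partial>lborel)"
    by (simp add: ennreal_mult tail_nonneg nn_integral_tail[symmetric] nn_integral_cmult mult.assoc)
  also have "\<dots> \<le> (\<integral>\<^sup>+s\<in>{0..<1}. ennreal (s powr x * \<omega> s) \<partial>lborel)"
    using assms nonneg
    by (intro nn_integral_mono) (auto simp: indicator_def ennreal_mult[symmetric] intro!: ennreal_leI mult_right_mono powr_mono2)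
  also have "\<dots> = ennreal (weight_moment \<omega> x)" by (rule nn_integral_moment) fact
  finally show ?thesis by (simp add: moment_nonneg)
qed

lemma moment_pos:
  assumes "0 \<le> x"
  shows "0 < weight_moment \<omega> x"
proof -
  have "0 < (1 / 2) powr x * weight_tail \<omega> (1 / 2)" using tail_pos[of "1 / 2"] by simp
  also have "\<dots> \<le> weight_moment \<omega> x" using assms by (intro tail_le_moment) auto
  finally show ?thesis .
qed

text \<open>Substituting \<open>v = (1 + s) / 2\<close> and using \<open>2 * v - 1 \<le> v\<^sup>2\<close> converts tail doubling into moment doubling.\<close>

lemma moment_doubling:
  assumes C: "0 \<le> C" and dbl: "\<And>r. 0 \<le> r \<Longrightarrow> r < 1 \<Longrightarrow> weight_tail \<omega> r \<le> C * weight_tail \<omega> ((1 + r) / 2)"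
    and x: "0 \<le> x"
  shows "weight_moment \<omega> x \<le> C * weight_moment \<omega> (2 * x)"
proof -
  define \<beta> where "\<beta> s = ennreal (1 / 2) * ennreal (\<omega> (1 / 2 + 1 / 2 * s))" for s
  have [measurable]: "\<beta> \<in> borel_measurable borel" unfolding \<beta>_def by measurable
  have sub: "(\<integral>\<^sup>+s\<in>{r..<1}. \<beta> s * f s \<partial>lborel)
      = (\<integral>\<^sup>+v\<in>{(1 + r) / 2..<1}. ennreal (\<omega> v) * f (2 * v - 1) \<partial>lborel)"
    if [measurable]: "f \<in> borel_measurable borel" for f r
  proof -
    have "(\<integral>\<^sup>+v\<in>{(1 + r) / 2..<1}. ennreal (\<omega> v) * f (2 * v - 1) \<partial>lborel)
      = ennreal \<bar>1 / 2\<bar> * (\<integral>\<^sup>+s. ennreal (\<omega> (1 / 2 + 1 / 2 * s)) * f (2 * (1 / 2 + 1 / 2 * s) - 1)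
          * indicator {(1 + r) / 2..<1} (1 / 2 + 1 / 2 * s) \<partial>lborel)"
      by (rule nn_integral_real_affine) auto
    also have "\<dots> = (\<integral>\<^sup>+s. ennreal (1 / 2) * (ennreal (\<omega> (1 / 2 + 1 / 2 * s)) * f (2 * (1 / 2 + 1 / 2 * s) - 1)
          * indicator {(1 + r) / 2..<1} (1 / 2 + 1 / 2 * s)) \<partial>lborel)"
      by (subst nn_integral_cmult) auto
    also have "\<dots> = (\<integral>\<^sup>+s\<in>{r..<1}. \<beta> s * f s \<partial>lborel)"
      by (intro nn_integral_cong) (auto simp: \<beta>_def indicator_def mult_ac)
    finally show ?thesis ..
  qed
  have "ennreal (weight_moment \<omega> x) = (\<integral>\<^sup>+r\<in>{0..<1}. ennreal (\<omega> r) * ennreal (r powr x) \<partial>lborel)"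
    using nonneg by (simp add: nn_integral_moment[OF x, symmetric] ennreal_mult mult_ac)
  also have "\<dots> \<le> ennreal C * (\<integral>\<^sup>+r\<in>{0..<1}. \<beta> r * ennreal (r powr x) \<partial>lborel)"
  proof (rule nn_integral_mono_comparison)
    fix r :: real assume r: "0 \<le> r" "r < 1"
    have "(\<integral>\<^sup>+s\<in>{r..<1}. ennreal (\<omega> s) \<partial>lborel) \<le> ennreal C * ennreal (weight_tail \<omega> ((1 + r) / 2))"
      using dbl[OF r] C by (simp add: nn_integral_tail ennreal_mult[symmetric] tail_nonneg ennreal_leI)
    also have "ennreal (weight_tail \<omega> ((1 + r) / 2)) = (\<integral>\<^sup>+s\<in>{r..<1}. \<beta> s * 1 \<partial>lborel)"
      by (subst sub) (simp_all add: nn_integral_tail)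
    finally show "(\<integral>\<^sup>+s\<in>{r..<1}. ennreal (\<omega> s) \<partial>lborel) \<le> ennreal C * (\<integral>\<^sup>+s\<in>{r..<1}. \<beta> s \<partial>lborel)" by simp
  qed (use x in \<open>auto intro!: ennreal_leI powr_mono2\<close>)
  also have "(\<integral>\<^sup>+r\<in>{0..<1}. \<beta> r * ennreal (r powr x) \<partial>lborel)
      = (\<integral>\<^sup>+v\<in>{(1 + 0) / 2..<1}. ennreal (\<omega> v) * ennreal ((2 * v - 1) powr x) \<partial>lborel)"
    by (rule sub) measurable
  also have "\<dots> \<le> (\<integral>\<^sup>+v\<in>{0..<1}. ennreal (v powr (2 * x) * \<omega> v) \<partial>lborel)"
  proof (rule nn_integral_mono)
    fix v :: real
    have "(2 * v - 1) powr x \<le> v powr (2 * x)" if "1 / 2 \<le> v"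
    proof -
      have "2 * v - 1 \<le> v * v" using zero_le_power2[of "v - 1"] by (simp add: power2_eq_square algebra_simps)
      then have "(2 * v - 1) powr x \<le> (v * v) powr x" using that x by (intro powr_mono2) auto
      also have "\<dots> = v powr (2 * x)" using that by (simp add: powr_mult flip: powr_add)
      finally show ?thesis .
    qed
    then show "ennreal (\<omega> v) * ennreal ((2 * v - 1) powr x) * indicator {(1 + 0) / 2..<1} v
      \<le> ennreal (v powr (2 * x) * \<omega> v) * indicator {0..<1} v"
      using nonneg by (auto simp: indicator_def ennreal_mult[symmetric] mult.commute[of "\<omega> v"] intro!: ennreal_leI mult_right_mono)
  qed
  also have "\<dots> = ennreal (weight_moment \<omega> (2 * x))" using x by (intro nn_integral_moment) auto
  finally have "ennreal (weight_moment \<omega> x) \<le> ennreal C * ennreal (weight_moment \<omega> (2 * x))"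
    by (simp add: mult_left_mono)
  then show ?thesis
    using C by (simp add: ennreal_mult[symmetric] moment_nonneg)
qed

text \<open>The integral is cut at \<open>1 - 1 / x\<close>. To the right the power is at most 1; to
  the left \<open>r \<le> exp (- (1 / x))\<close>, so the surplus power
  \<open>r powr ((L - 1) * x)\<close> is exponentially small in \<open>L\<close>.\<close>

lemma moment_le_split:
  assumes x: "1 \<le> x" and L: "1 \<le> L"
  shows "weight_moment \<omega> (L * x) \<le> exp (- (L - 1)) * weight_moment \<omega> x + weight_tail \<omega> (1 - 1 / x)"
proof -
  have Lx: "0 \<le> L * x" using x L by simp
  have "ennreal (weight_moment \<omega> (L * x)) = (\<integral>\<^sup>+r\<in>{0..<1}. ennreal (r powr (L * x) * \<omega> r) \<partial>lborel)"
    by (rule nn_integral_moment[symmetric]) fact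
  also have "\<dots> \<le> (\<integral>\<^sup>+r. ennreal (exp (- (L - 1))) * (ennreal (r powr x * \<omega> r) * indicator {0..<1} r)
      + ennreal (\<omega> r) * indicator {1 - 1 / x..<1} r \<partial>lborel)"
  proof (rule nn_integral_mono)
    fix r :: real
    show "ennreal (r powr (L * x) * \<omega> r) * indicator {0..<1} r
      \<le> ennreal (exp (- (L - 1))) * (ennreal (r powr x * \<omega> r) * indicator {0..<1} r)
        + ennreal (\<omega> r) * indicator {1 - 1 / x..<1} r"
    proof (cases "0 < r \<and> r < 1")
      case True
      show ?thesis
      proof (cases "1 - 1 / x \<le> r")
        case True
        have "r powr (L * x) \<le> 1" using \<open>0 < r \<and> r < 1\<close> Lx powr_mono2[of "L * x" r 1] by auto
        then have "ennreal (r powr (L * x) * \<omega> r) \<le> ennreal (\<omega> r)"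
          using nonneg by (intro ennreal_leI mult_left_le_one_le) auto
        with True \<open>0 < r \<and> r < 1\<close> show ?thesis by (simp add: add_increasing)
      next
        case False
        have "r \<le> exp (- (1 / x))" using exp_ge_add_one_self[of "- (1 / x)"] False by linarith
        then have "r powr ((L - 1) * x) \<le> exp (- (1 / x)) powr ((L - 1) * x)"
          using True L x by (intro powr_mono2) auto
        also have "\<dots> = exp (- (L - 1))" using x by (simp add: powr_def)
        finally have "r powr ((L - 1) * x) * r powr x \<le> exp (- (L - 1)) * r powr x"
          by (rule mult_right_mono) auto
        then have "r powr (L * x) \<le> exp (- (L - 1)) * r powr x"
          by (simp flip: powr_add add: algebra_simps)
        then have "r powr (L * x) * \<omega> r \<le> exp (- (L - 1)) * (r powr x * \<omega> r)"
          using mult_right_mono[OF _ nonneg] by (simp add: mult.assoc[symmetric])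
        then show ?thesis
          using True False nonneg by (simp add: ennreal_mult[symmetric] ennreal_leI)
      qed
    next
      case False
      then show ?thesis using Lx x L by (cases "r = 0") auto
    qed
  qed
  also have "\<dots> = ennreal (exp (- (L - 1))) * ennreal (weight_moment \<omega> x) + ennreal (weight_tail \<omega> (1 - 1 / x))"
    using x by (subst nn_integral_add) (auto simp: nn_integral_cmult nn_integral_moment nn_integral_tail)
  also have "\<dots> = ennreal (exp (- (L - 1)) * weight_moment \<omega> x + weight_tail \<omega> (1 - 1 / x))"
    by (simp add: ennreal_mult[symmetric] moment_nonneg tail_nonneg)
  finally show ?thesis
    by (subst (asm) ennreal_le_iff) (auto intro!: add_nonneg_nonneg mult_nonneg_nonneg moment_nonneg tail_nonneg)
qed

end

text \<open>From here on membership in the class is used only through these properties: growth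
  exponent \<open>b\<close> and decay exponent \<open>a\<close> of the moments, and comparability of
  the tail at \<open>r\<close> with the moment of order \<open>1 / (1 - r)\<close>. One constant
  \<open>A\<close> serves all four.\<close>

locale regular_weight = borel_weight +
  fixes a A :: real and b :: nat
  assumes a: "0 < a" "a < 1" and A: "1 \<le> A" and b: "0 < b"
    and moment_growth: "\<And>x y. 1 \<le> x \<Longrightarrow> x \<le> y \<Longrightarrow> weight_moment \<omega> x \<le> A * (y / x) ^ b * weight_moment \<omega> y"
    and moment_decay: "\<And>x y. 1 \<le> x \<Longrightarrow> x \<le> y \<Longrightarrow> weight_moment \<omega> y \<le> A * (x / y) powr a * weight_moment \<omega> x"
    and tail_le_moment_A: "\<And>r. 0 \<le> r \<Longrightarrow> r < 1 \<Longrightarrow> weight_tail \<omega> r \<le> A * weight_moment \<omega> (1 / (1 - r))"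
    and moment_le_tail_A: "\<And>r. 0 \<le> r \<Longrightarrow> r < 1 \<Longrightarrow> weight_moment \<omega> (1 / (1 - r)) \<le> A * weight_tail \<omega> r"

lemma (in borel_weight) regular_weightI:
  assumes dhat: "\<exists>C>1. \<forall>r\<in>{0..<1}. weight_tail \<omega> r \<le> C * weight_tail \<omega> ((1 + r) / 2)"
    and M: "\<exists>C>1. \<exists>K>1. \<forall>x\<ge>1. weight_moment \<omega> x \<ge> C * weight_moment \<omega> (K * x)"
  obtains a A b where "regular_weight \<omega> a A b"
proof -
  obtain C where C: "1 < C" and dhat: "\<And>r. 0 \<le> r \<Longrightarrow> r < 1 \<Longrightarrow> weight_tail \<omega> r \<le> C * weight_tail \<omega> ((1 + r) / 2)"
    using dhat by auto
  obtain C' K where C': "1 < C'" "1 < K" and M: "\<And>x. 1 \<le> x \<Longrightarrow> C' * weight_moment \<omega> (K * x) \<le> weight_moment \<omega> x"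
    using M by auto
  have dbl: "weight_moment \<omega> x \<le> C * weight_moment \<omega> (2 * x)" if "1 \<le> x" for x
    by (rule moment_doubling[OF _ dhat]) (use C that in auto)
  obtain b :: nat where b: "0 < b"
    and growth: "\<And>x y. 1 \<le> x \<Longrightarrow> x \<le> y \<Longrightarrow> weight_moment \<omega> x \<le> (2 * (y / x)) ^ b * weight_moment \<omega> y"
  proof (rule doubling_power_bound[of C "weight_moment \<omega>"])
    show "weight_moment \<omega> y \<le> weight_moment \<omega> x" if "1 \<le> x" "x \<le> y" for x y
      using that by (intro moment_antimono) auto
  qed (use C in \<open>simp_all add: dbl moment_nonneg\<close>)
  obtain a where a: "0 < a" "a < 1"
    and decay: "\<And>x y. 1 \<le> x \<Longrightarrow> x \<le> y \<Longrightarrow> weight_moment \<omega> y \<le> C' * (x / y) powr a * weight_moment \<omega> x"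
  proof (rule decay_power_bound[of C' K "weight_moment \<omega>"])
    show "weight_moment \<omega> y \<le> weight_moment \<omega> x" if "1 \<le> x" "x \<le> y" for x y
      using that by (intro moment_antimono) auto
  qed (simp_all add: C' M moment_nonneg)
  \<comment> \<open>The moment at \<open>x\<close> is at most \<open>(2 * L) ^ b\<close> times the
    moment at \<open>L * x\<close>, and \<open>moment_le_split\<close> returns a small multiple of
    the moment at \<open>x\<close> plus a tail. This \<open>L\<close> makes the returned multiple at
    most one half, so that it can be absorbed.\<close>
  have "((\<lambda>L::real. (2 * L) ^ b * exp (- (L - 1))) \<longlongrightarrow> 0) at_top"
    by real_asymp
  then have "eventually (\<lambda>L::real. (2 * L) ^ b * exp (- (L - 1)) < 1 / 2) at_top"
    by (rule order_tendstoD) simp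
  then have "eventually (\<lambda>L::real. 1 \<le> L \<and> (2 * L) ^ b * exp (- (L - 1)) < 1 / 2) at_top"
    using eventually_ge_at_top[of 1] by eventually_elim auto
  then obtain L :: real where L: "1 \<le> L" "(2 * L) ^ b * exp (- (L - 1)) < 1 / 2"
    using eventually_happens'[OF trivial_limit_at_top_linorder] by blast
  define A where "A = 2 ^ b + C' + exp 1 * C + 2 * (2 * L) ^ b"
  have A: "2 ^ b \<le> A" "C' \<le> A" "exp 1 * C \<le> A" "2 * (2 * L) ^ b \<le> A" "1 \<le> A"
    using C C' L by (auto simp: A_def intro!: add_increasing add_increasing2)
  show ?thesis
  proof (rule that, unfold_locales)
    fix x y :: real assume xy: "1 \<le> x" "x \<le> y"
    have "weight_moment \<omega> x \<le> (2 * (y / x)) ^ b * weight_moment \<omega> y" by (rule growth) fact+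
    also have "(2 * (y / x)) ^ b = 2 ^ b * (y / x) ^ b" by (rule power_mult_distrib)
    also have "2 ^ b * (y / x) ^ b * weight_moment \<omega> y \<le> A * (y / x) ^ b * weight_moment \<omega> y"
      using A xy by (intro mult_right_mono moment_nonneg) auto
    finally show "weight_moment \<omega> x \<le> A * (y / x) ^ b * weight_moment \<omega> y" .
    have "weight_moment \<omega> y \<le> C' * (x / y) powr a * weight_moment \<omega> x" by (rule decay) fact+
    also have "\<dots> \<le> A * (x / y) powr a * weight_moment \<omega> x"
      using A by (intro mult_right_mono moment_nonneg) auto
    finally show "weight_moment \<omega> y \<le> A * (x / y) powr a * weight_moment \<omega> x" .
  next
    fix r :: real assume r: "0 \<le> r" "r < 1"
    define x where "x = 1 / (1 - r)"
    have x: "1 \<le> x" "r = 1 - 1 / x" using r by (auto simp: x_def field_simps)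
    \<comment> \<open>The comparison is made at the midpoint because \<open>r powr x\<close> is
      useless for \<open>r = 0\<close>. Here \<open>(1 - t) * x = 1 / 2\<close> and
      \<open>1 / 2 \<le> t\<close> keep \<open>t powr x\<close> above \<open>exp (-1)\<close>, and
      tail doubling leads back to \<open>r\<close>.\<close>
    define t where "t = (1 + r) / 2"
    have t: "0 \<le> t" "t < 1" "1 / 2 \<le> t" "(1 - t) * x = 1 / 2" using r by (auto simp: t_def x_def field_simps)
    have "- ((1 - t) / t) \<le> ln t"
    proof -
      have "ln (1 / t) \<le> 1 / t - 1" using t by (intro ln_le_minus_one) auto
      then show ?thesis using t by (simp add: ln_div field_simps)
    qed
    then have "- ((1 - t) / t) * x \<le> ln t * x" using x by (intro mult_right_mono) auto
    moreover have "(1 - t) / t * x \<le> 1"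
    proof -
      have "(1 - t) / t * x = (1 - t) * x / t" by simp
      then show ?thesis using t by (simp add: divide_le_eq)
    qed
    moreover have "- ((1 - t) / t) * x = - ((1 - t) / t * x)" by simp
    ultimately have "-1 \<le> x * ln t" unfolding mult.commute[of x] by linarith
    then have "exp (-1) \<le> t powr x"
      using t by (simp add: powr_def)
    then have "exp (-1) * weight_tail \<omega> t \<le> t powr x * weight_tail \<omega> t"
      by (intro mult_right_mono tail_nonneg)
    also have "\<dots> \<le> weight_moment \<omega> x" using x t by (intro tail_le_moment) auto
    finally have "weight_tail \<omega> t \<le> exp 1 * weight_moment \<omega> x"
      by (simp add: exp_minus field_simps)
    then have "weight_tail \<omega> r \<le> C * (exp 1 * weight_moment \<omega> x)"
      using dhat[OF r] C unfolding t_def by (meson mult_left_mono less_imp_le order_trans zero_less_one less_trans)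
    also have "\<dots> \<le> A * weight_moment \<omega> x"
      using mult_right_mono[OF A(3) moment_nonneg[of x]] by (simp add: mult_ac)
    finally show "weight_tail \<omega> r \<le> A * weight_moment \<omega> (1 / (1 - r))" by (simp add: x_def)
    have "x \<le> L * x" using L x by simp
    then have "weight_moment \<omega> x \<le> (2 * (L * x / x)) ^ b * weight_moment \<omega> (L * x)"
      using x by (intro growth)
    also have "\<dots> = (2 * L) ^ b * weight_moment \<omega> (L * x)" using x by simp
    also have "\<dots> \<le> (2 * L) ^ b * (exp (- (L - 1)) * weight_moment \<omega> x + weight_tail \<omega> (1 - 1 / x))"
      using L x by (intro mult_left_mono moment_le_split) auto
    also have "\<dots> = (2 * L) ^ b * exp (- (L - 1)) * weight_moment \<omega> x + (2 * L) ^ b * weight_tail \<omega> r"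
      unfolding x(2)[symmetric] by (simp add: algebra_simps)
    also have "\<dots> \<le> 1 / 2 * weight_moment \<omega> x + (2 * L) ^ b * weight_tail \<omega> r"
      using L by (intro add_right_mono mult_right_mono moment_nonneg) auto
    finally have "weight_moment \<omega> x \<le> 2 * (2 * L) ^ b * weight_tail \<omega> r" by simp
    also have "\<dots> \<le> A * weight_tail \<omega> r" using A by (intro mult_right_mono tail_nonneg) auto
    finally show "weight_moment \<omega> (1 / (1 - r)) \<le> A * weight_tail \<omega> r" by (simp add: x_def)
  qed (use a b A in auto)
qed

section \<open>Regularity of the tail and the comparison of the two measures\<close>

context regular_weight
begin

abbreviation W :: "real \<Rightarrow> real" where "W \<equiv> weight_tail \<omega>"

text \<open>Moment growth read through \<open>x = 1 / (1 - r)\<close>; one factor \<open>A\<close>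
  is due to the growth and two to the conversions between tails and moments.\<close>

lemma tail_growth:
  assumes "0 \<le> r" "r \<le> t" "t < 1"
  shows "W r \<le> A ^ 3 * ((1 - r) / (1 - t)) ^ b * W t"
proof -
  have "W r \<le> A * weight_moment \<omega> (1 / (1 - r))" using assms by (intro tail_le_moment_A) auto
  also have "weight_moment \<omega> (1 / (1 - r)) \<le> A * ((1 / (1 - t)) / (1 / (1 - r))) ^ b * weight_moment \<omega> (1 / (1 - t))"
    using assms by (intro moment_growth) (auto simp: field_simps)
  also have "(1 / (1 - t)) / (1 / (1 - r)) = (1 - r) / (1 - t)" by simp
  also have "weight_moment \<omega> (1 / (1 - t)) \<le> A * W t" using assms by (intro moment_le_tail_A) auto
  finally show ?thesis
    using A assms by (simp add: mult_left_mono power3_eq_cube mult_ac)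
qed

lemma tail_decay:
  assumes "0 \<le> r" "r \<le> t" "t < 1"
  shows "W t \<le> A ^ 3 * ((1 - t) / (1 - r)) powr a * W r"
proof -
  have "W t \<le> A * weight_moment \<omega> (1 / (1 - t))" using assms by (intro tail_le_moment_A) auto
  also have "weight_moment \<omega> (1 / (1 - t)) \<le> A * ((1 / (1 - r)) / (1 / (1 - t))) powr a * weight_moment \<omega> (1 / (1 - r))"
    using assms by (intro moment_decay) (auto simp: field_simps)
  also have "(1 / (1 - r)) / (1 / (1 - t)) = (1 - t) / (1 - r)" by simp
  also have "weight_moment \<omega> (1 / (1 - r)) \<le> A * W r" using assms by (intro moment_le_tail_A) auto
  finally show ?thesis
    using A assms by (simp add: mult_left_mono power3_eq_cube mult_ac)
qed

lemma tail_half: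
  assumes "0 \<le> r" "r < 1"
  shows "W r \<le> A ^ 3 * 2 ^ b * W ((1 + r) / 2)"
proof -
  have "(1 - r) / (1 - (1 + r) / 2) = 2" using assms by (simp add: field_simps)
  then show ?thesis using tail_growth[of r "(1 + r) / 2"] assms by simp
qed

lemma nn_integral_powr_right:
  fixes r \<gamma> :: real
  assumes "0 < \<gamma>" "r \<le> 1"
  shows "(\<integral>\<^sup>+s\<in>{r..<1}. ennreal ((1 - s) powr (\<gamma> - 1)) \<partial>lborel) = ennreal ((1 - r) powr \<gamma> / \<gamma>)"
proof -
  have "(\<integral>\<^sup>+s\<in>{r..<1}. ennreal ((1 - s) powr (\<gamma> - 1)) \<partial>lborel)
      = ennreal (- ((1 - 1) powr \<gamma> / \<gamma>) - (- ((1 - r) powr \<gamma> / \<gamma>)))"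
  proof (rule nn_integral_FTC_interior)
    show "continuous_on {r..1} (\<lambda>s. - ((1 - s) powr \<gamma> / \<gamma>))"
      using assms by (intro continuous_intros continuous_on_powr') auto
    show "((\<lambda>s. - ((1 - s) powr \<gamma> / \<gamma>)) has_real_derivative (1 - x) powr (\<gamma> - 1)) (at x)" if "x < 1" for x
      using that assms by (auto intro!: derivative_eq_intros simp: powr_diff)
  qed (use assms in auto)
  then show ?thesis by simp
qed

text \<open>The decay of the tail bounds the integrand by a multiple of
  \<open>(1 - s) powr (a - d - 1)\<close>, which is integrable up to 1 because \<open>d < a\<close>.
  The case \<open>d = 0\<close> compares the two measures; positive \<open>d\<close> is what the
  Schur test functions require.\<close>

lemma nn_integral_tail_upper:
  assumes r: "0 \<le> r" "r < 1" and d: "0 \<le> d" "d < a"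
  shows "(\<integral>\<^sup>+s\<in>{r..<1}. ennreal (W s / (1 - s) * (1 - s) powr (-d)) \<partial>lborel)
    \<le> ennreal (A ^ 3 / (a - d) * W r * (1 - r) powr (-d))"
proof -
  have "(\<integral>\<^sup>+s\<in>{r..<1}. ennreal (W s / (1 - s) * (1 - s) powr (-d)) \<partial>lborel)
    \<le> (\<integral>\<^sup>+s. ennreal (A ^ 3 * (1 - r) powr (-a) * W r) * (ennreal ((1 - s) powr (a - d - 1)) * indicator {r..<1} s) \<partial>lborel)"
  proof (rule nn_integral_mono)
    fix s :: real
    have "W s / (1 - s) * (1 - s) powr (-d) \<le> A ^ 3 * (1 - r) powr (-a) * W r * (1 - s) powr (a - d - 1)" if s: "r \<le> s" "s < 1"
    proof -
      have e: "(1 - s) powr a / (1 - s) * (1 - s) powr (-d) = (1 - s) powr (a - d - 1)"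
        using s by (simp add: powr_diff powr_minus_divide)
      have "W s \<le> A ^ 3 * ((1 - s) / (1 - r)) powr a * W r" using s r by (intro tail_decay) auto
      then have "W s / (1 - s) * (1 - s) powr (-d) \<le> A ^ 3 * ((1 - s) / (1 - r)) powr a * W r / (1 - s) * (1 - s) powr (-d)"
        using s by (intro mult_right_mono divide_right_mono) auto
      also have "\<dots> = A ^ 3 * (1 - r) powr (-a) * W r * ((1 - s) powr a / (1 - s) * (1 - s) powr (-d))"
        using s r by (simp add: powr_divide powr_minus_divide mult_ac)
      finally show ?thesis by (simp only: e)
    qed
    then show "ennreal (W s / (1 - s) * (1 - s) powr (-d)) * indicator {r..<1} s
      \<le> ennreal (A ^ 3 * (1 - r) powr (-a) * W r) * (ennreal ((1 - s) powr (a - d - 1)) * indicator {r..<1} s)"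
      using A tail_nonneg[of r] by (auto simp: indicator_def ennreal_mult[symmetric] intro!: ennreal_leI)
  qed
  also have "\<dots> = ennreal (A ^ 3 * (1 - r) powr (-a) * W r) * ennreal ((1 - r) powr (a - d) / (a - d))"
    using nn_integral_powr_right[of "a - d" r] d r by (subst nn_integral_cmult) auto
  also have "\<dots> = ennreal (A ^ 3 * (1 - r) powr (-a) * W r * ((1 - r) powr (a - d) / (a - d)))"
    using A d tail_nonneg[of r] by (simp add: ennreal_mult[symmetric])
  also have "A ^ 3 * (1 - r) powr (-a) * W r * ((1 - r) powr (a - d) / (a - d)) = A ^ 3 / (a - d) * W r * (1 - r) powr (-d)"
  proof -
    have "(1 - r) powr (-a) * (1 - r) powr (a - d) = (1 - r) powr (-d)" by (simp flip: powr_add)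
    then show ?thesis by (simp add: field_simps)
  qed
  finally show ?thesis .
qed

text \<open>Everything is compared with the tail at the midpoint \<open>t\<close>. For the first
  bound the left half of the interval suffices, where the integrand is at least
  \<open>W t / (1 - r)\<close>; for the second the right half suffices, where the Jacobian factor
  \<open>s\<close> is at least \<open>1 / 2\<close>. Doubling then replaces \<open>W t\<close> by
  \<open>W r\<close>.\<close>

lemma tail_le_nn_integral:
  assumes r: "0 \<le> r" "r < 1"
  shows "ennreal (W r) \<le> ennreal (2 * (A ^ 3 * 2 ^ b)) * (\<integral>\<^sup>+s\<in>{r..<1}. ennreal (W s / (1 - s)) \<partial>lborel)"
    and "ennreal (W r) \<le> ennreal (2 * (A ^ 3 * 2 ^ b)) * (\<integral>\<^sup>+s\<in>{r..<1}. ennreal (s * \<omega> s) \<partial>lborel)"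
proof -
  define t where "t = (1 + r) / 2"
  have t: "r \<le> t" "1 / 2 \<le> t" "t < 1" "t - r = (1 - r) / 2" using r by (auto simp: t_def field_simps)
  define B where "B = A ^ 3 * 2 ^ b"
  have B: "0 \<le> B" using A by (simp add: B_def)
  have W: "W r \<le> B * W t" using tail_half[OF r] by (simp add: t_def B_def)
  have main: "ennreal (W r) \<le> ennreal (2 * B) * I" if "ennreal (W t / 2) \<le> I" for I
  proof -
    have "ennreal (W r) \<le> ennreal (2 * B) * ennreal (W t / 2)"
      using W B tail_nonneg[of t] by (simp add: ennreal_mult[symmetric] ennreal_leI)
    also have "\<dots> \<le> ennreal (2 * B) * I" using that by (rule mult_left_mono) simp
    finally show ?thesis .
  qed
  have "W t / (1 - r) * (t - r) = W t / 2" unfolding t(4) using r by simp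
  then have "ennreal (W t / 2) = (\<integral>\<^sup>+s. ennreal (W t / (1 - r)) * indicator {r..<t} s \<partial>lborel)"
    using t(1) r tail_nonneg[of t] by (subst nn_integral_cmult_indicator) (auto simp: ennreal_mult[symmetric])
  also have "\<dots> \<le> (\<integral>\<^sup>+s\<in>{r..<1}. ennreal (W s / (1 - s)) \<partial>lborel)"
  proof (rule nn_integral_mono)
    fix s :: real
    have "W t / (1 - r) \<le> W s / (1 - s)" if "r \<le> s" "s < t"
      using that t r tail_nonneg[of s] by (intro frac_le tail_antimono) auto
    then show "ennreal (W t / (1 - r)) * indicator {r..<t} s \<le> ennreal (W s / (1 - s)) * indicator {r..<1} s"
      using t by (auto simp: indicator_def intro!: ennreal_leI)
  qed
  finally show "ennreal (W r) \<le> ennreal (2 * (A ^ 3 * 2 ^ b)) * (\<integral>\<^sup>+s\<in>{r..<1}. ennreal (W s / (1 - s)) \<partial>lborel)"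
    using main by (simp add: B_def)
  have "ennreal (W t / 2) = ennreal (1 / 2) * ennreal (W t)"
    using tail_nonneg[of t] ennreal_mult[of "1 / 2" "W t"] by simp
  also have "\<dots> = (\<integral>\<^sup>+s. ennreal (1 / 2) * (ennreal (\<omega> s) * indicator {t..<1} s) \<partial>lborel)"
    by (subst nn_integral_cmult) (auto simp: nn_integral_tail)
  also have "\<dots> \<le> (\<integral>\<^sup>+s\<in>{r..<1}. ennreal (s * \<omega> s) \<partial>lborel)"
  proof (rule nn_integral_mono)
    fix s :: real
    have "ennreal (1 / 2) * ennreal (\<omega> s) \<le> ennreal (s * \<omega> s)" if "t \<le> s"
    proof -
      have "1 / 2 * \<omega> s \<le> s * \<omega> s" using that t nonneg by (intro mult_right_mono) auto
      then show ?thesis using nonneg[of s] by (subst ennreal_mult[symmetric]) (auto intro!: ennreal_leI)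
    qed
    then show "ennreal (1 / 2) * (ennreal (\<omega> s) * indicator {t..<1} s) \<le> ennreal (s * \<omega> s) * indicator {r..<1} s"
      using t by (auto simp: indicator_def)
  qed
  finally show "ennreal (W r) \<le> ennreal (2 * (A ^ 3 * 2 ^ b)) * (\<integral>\<^sup>+s\<in>{r..<1}. ennreal (s * \<omega> s) \<partial>lborel)"
    using main by (simp add: B_def)
qed

text \<open>The Borel counterpart of \<open>weighted_area \<omega>\<close> on the whole plane;
  \<open>distr_weighted_area\<close> identifies it as the image under the identity.\<close>

definition area :: "complex measure" where
  "area = radial_measure (\<lambda>r. \<omega> r / pi)"

text \<open>The factor \<open>1 / r\<close> cancels the polar Jacobian.\<close>

definition \<nu> :: "complex measure" where
  "\<nu> = radial_measure (\<lambda>r. W r / ((1 - r) * r))"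

lemma tail_eq_0: "1 \<le> r \<Longrightarrow> W r = 0"
  unfolding weight_tail_def set_lebesgue_integral_def by simp

lemma sets_area [simp, measurable_cong]: "sets area = sets borel"
  and space_area [simp]: "space area = UNIV"
  and sets_\<nu> [simp, measurable_cong]: "sets \<nu> = sets borel"
  and space_\<nu> [simp]: "space \<nu> = UNIV"
  by (simp_all add: area_def \<nu>_def)

lemma sigma_finite_\<nu>: "sigma_finite_measure \<nu>"
  unfolding \<nu>_def by (rule sigma_finite_radial_measure) measurable

lemma measurable_circle_nn [measurable]:
  assumes [measurable]: "u \<in> borel_measurable borel"
  shows "(\<lambda>c. circle_nn u c) \<in> borel_measurable borel"
  unfolding circle_nn_def by measurable

lemma nn_integral_area:
  assumes [measurable]: "u \<in> borel_measurable borel"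
  shows "(\<integral>\<^sup>+z. u z \<partial>area) = ennreal (1 / pi) * (\<integral>\<^sup>+r\<in>{0..<1}. ennreal (r * \<omega> r) * circle_nn u (of_real r) \<partial>lborel)"
proof -
  have "(\<integral>\<^sup>+z. u z \<partial>area) = (\<integral>\<^sup>+r\<in>{0..<1}. ennreal (r * (\<omega> r / pi)) * circle_nn u (of_real r) \<partial>lborel)"
    unfolding area_def by (rule nn_integral_radial_measure) (auto simp: zero)
  also have "\<dots> = (\<integral>\<^sup>+r. ennreal (1 / pi) * (ennreal (r * \<omega> r) * circle_nn u (of_real r) * indicator {0..<1} r) \<partial>lborel)"
    using nonneg by (intro nn_integral_cong) (auto simp: indicator_def ennreal_mult[symmetric] mult.assoc[symmetric])
  also have "\<dots> = ennreal (1 / pi) * (\<integral>\<^sup>+r\<in>{0..<1}. ennreal (r * \<omega> r) * circle_nn u (of_real r) \<partial>lborel)"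
    by (rule nn_integral_cmult) measurable
  finally show ?thesis .
qed

lemma nn_integral_\<nu>:
  assumes [measurable]: "u \<in> borel_measurable borel"
  shows "(\<integral>\<^sup>+z. u z \<partial>\<nu>) = (\<integral>\<^sup>+r\<in>{0..<1}. ennreal (W r / (1 - r)) * circle_nn u (of_real r) \<partial>lborel)"
proof -
  have "(\<integral>\<^sup>+z. u z \<partial>\<nu>) = (\<integral>\<^sup>+r\<in>{0..<1}. ennreal (r * (W r / ((1 - r) * r))) * circle_nn u (of_real r) \<partial>lborel)"
    unfolding \<nu>_def by (rule nn_integral_radial_measure) (auto simp: tail_eq_0)
  also have "\<dots> = (\<integral>\<^sup>+r\<in>{0..<1}. ennreal (W r / (1 - r)) * circle_nn u (of_real r) \<partial>lborel)"
    by (rule nn_integral_cong_AE, use AE_lborel_singleton[of 0] in eventually_elim) simp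
  finally show ?thesis .
qed

text \<open>One constant for both directions of the comparison: \<open>2 * (A ^ 3 * 2 ^ b)\<close>
  stems from \<open>tail_le_nn_integral\<close>, \<open>A ^ 3 / a\<close> from
  \<open>nn_integral_tail_upper\<close> at exponent 0, and \<open>pi\<close> undoes the
  normalisation of area.\<close>

definition \<kappa> :: real where
  "\<kappa> = pi * (2 * (A ^ 3 * 2 ^ b)) * (1 + A ^ 3 / a)"

lemma \<kappa>_pos: "0 < \<kappa>"
  using a A by (auto simp: \<kappa>_def intro!: mult_pos_pos add_pos_pos)

lemma area_\<nu>_comparison:
  assumes [measurable]: "u \<in> borel_measurable borel"
    and mono: "\<And>r s. 0 \<le> r \<Longrightarrow> r \<le> s \<Longrightarrow> s < 1 \<Longrightarrow> circle_nn u (of_real r) \<le> circle_nn u (of_real s)"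
  shows "(\<integral>\<^sup>+z. u z \<partial>area) \<le> ennreal \<kappa> * (\<integral>\<^sup>+z. u z \<partial>\<nu>)"
    and "(\<integral>\<^sup>+z. u z \<partial>\<nu>) \<le> ennreal \<kappa> * (\<integral>\<^sup>+z. u z \<partial>area)"
proof -
  define B where "B = 2 * (A ^ 3 * 2 ^ b)"
  have B: "0 \<le> B" using A by (simp add: B_def)
  have D: "0 \<le> A ^ 3 / a" using A a by simp
  have "(\<integral>\<^sup>+r\<in>{0..<1}. ennreal (r * \<omega> r) * circle_nn u (of_real r) \<partial>lborel)
    \<le> ennreal B * (\<integral>\<^sup>+r\<in>{0..<1}. ennreal (W r / (1 - r)) * circle_nn u (of_real r) \<partial>lborel)"
  proof (rule nn_integral_mono_comparison)
    fix r :: real assume r: "0 \<le> r" "r < 1"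
    have "(\<integral>\<^sup>+s\<in>{r..<1}. ennreal (s * \<omega> s) \<partial>lborel) \<le> (\<integral>\<^sup>+s\<in>{r..<1}. ennreal (\<omega> s) \<partial>lborel)"
      using nonneg r by (intro nn_integral_mono) (auto simp: indicator_def intro!: ennreal_leI mult_left_le_one_le)
    also have "\<dots> = ennreal (W r)" by (rule nn_integral_tail)
    also have "\<dots> \<le> ennreal B * (\<integral>\<^sup>+s\<in>{r..<1}. ennreal (W s / (1 - s)) \<partial>lborel)"
      unfolding B_def by (rule tail_le_nn_integral(1)[OF r])
    finally show "(\<integral>\<^sup>+s\<in>{r..<1}. ennreal (s * \<omega> s) \<partial>lborel)
      \<le> ennreal B * (\<integral>\<^sup>+s\<in>{r..<1}. ennreal (W s / (1 - s)) \<partial>lborel)" .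
  qed (use mono in auto)
  then have "(\<integral>\<^sup>+z. u z \<partial>area) \<le> ennreal (1 / pi) * (ennreal B * (\<integral>\<^sup>+z. u z \<partial>\<nu>))"
    unfolding nn_integral_area[OF assms(1)] nn_integral_\<nu>[OF assms(1)] by (rule mult_left_mono) simp
  also have "\<dots> = ennreal (B / pi) * (\<integral>\<^sup>+z. u z \<partial>\<nu>)"
    using B by (simp add: mult.assoc[symmetric] ennreal_mult[symmetric])
  also have "\<dots> \<le> ennreal \<kappa> * (\<integral>\<^sup>+z. u z \<partial>\<nu>)"
  proof (intro mult_right_mono ennreal_leI)
    have "B / pi \<le> B * 1" using B pi_ge_two mult_left_mono[of 1 pi B] by (simp add: divide_le_eq)
    also have "\<dots> \<le> B * (pi * (1 + A ^ 3 / a))"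
      using B D pi_ge_two mult_mono[of 1 pi 1 "1 + A ^ 3 / a"] by (intro mult_left_mono) auto
    finally show "B / pi \<le> \<kappa>" by (simp add: \<kappa>_def B_def mult_ac)
  qed simp
  finally show "(\<integral>\<^sup>+z. u z \<partial>area) \<le> ennreal \<kappa> * (\<integral>\<^sup>+z. u z \<partial>\<nu>)" .
  have "(\<integral>\<^sup>+r\<in>{0..<1}. ennreal (W r / (1 - r)) * circle_nn u (of_real r) \<partial>lborel)
    \<le> ennreal (A ^ 3 / a * B) * (\<integral>\<^sup>+r\<in>{0..<1}. ennreal (r * \<omega> r) * circle_nn u (of_real r) \<partial>lborel)"
  proof (rule nn_integral_mono_comparison)
    fix r :: real assume r: "0 \<le> r" "r < 1"
    have "(\<integral>\<^sup>+s\<in>{r..<1}. ennreal (W s / (1 - s)) \<partial>lborel)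
        = (\<integral>\<^sup>+s\<in>{r..<1}. ennreal (W s / (1 - s) * (1 - s) powr (-0)) \<partial>lborel)"
      by (intro nn_integral_cong) (auto simp: indicator_def)
    also have "\<dots> \<le> ennreal (A ^ 3 / (a - 0) * W r * (1 - r) powr (-0))"
      by (rule nn_integral_tail_upper) (use r a in auto)
    also have "\<dots> = ennreal (A ^ 3 / a) * ennreal (W r)"
      using r D tail_nonneg[of r] by (simp add: ennreal_mult[symmetric])
    also have "\<dots> \<le> ennreal (A ^ 3 / a) * (ennreal B * (\<integral>\<^sup>+s\<in>{r..<1}. ennreal (s * \<omega> s) \<partial>lborel))"
      unfolding B_def by (intro mult_left_mono tail_le_nn_integral(2)[OF r]) simp
    also have "\<dots> = ennreal (A ^ 3 / a * B) * (\<integral>\<^sup>+s\<in>{r..<1}. ennreal (s * \<omega> s) \<partial>lborel)"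
      using B D by (subst ennreal_mult) (auto simp: mult.assoc)
    finally show "(\<integral>\<^sup>+s\<in>{r..<1}. ennreal (W s / (1 - s)) \<partial>lborel)
      \<le> ennreal (A ^ 3 / a * B) * (\<integral>\<^sup>+s\<in>{r..<1}. ennreal (s * \<omega> s) \<partial>lborel)" .
  qed (use mono in auto)
  then have "(\<integral>\<^sup>+z. u z \<partial>\<nu>) \<le> ennreal (A ^ 3 / a * B) * (\<integral>\<^sup>+r\<in>{0..<1}. ennreal (r * \<omega> r) * circle_nn u (of_real r) \<partial>lborel)"
    unfolding nn_integral_\<nu>[OF assms(1)] .
  also have "ennreal (A ^ 3 / a * B) = ennreal (A ^ 3 / a * B * pi) * ennreal (1 / pi)"
    using mult_nonneg_nonneg[OF mult_nonneg_nonneg[OF D B], of pi] by (subst ennreal_mult[symmetric]) auto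
  also have "\<dots> * (\<integral>\<^sup>+r\<in>{0..<1}. ennreal (r * \<omega> r) * circle_nn u (of_real r) \<partial>lborel)
      = ennreal (A ^ 3 / a * B * pi) * (\<integral>\<^sup>+z. u z \<partial>area)"
    unfolding nn_integral_area[OF assms(1)] by (simp add: mult.assoc)
  also have "\<dots> \<le> ennreal \<kappa> * (\<integral>\<^sup>+z. u z \<partial>area)"
  proof (intro mult_right_mono ennreal_leI)
    have "A ^ 3 / a * B * pi = pi * B * (A ^ 3 / a)" by (simp only: mult_ac)
    also have "\<dots> \<le> pi * B * (1 + A ^ 3 / a)" using B by (intro mult_left_mono) auto
    finally show "A ^ 3 / a * B * pi \<le> \<kappa>" by (simp only: \<kappa>_def B_def)
  qed simp
  finally show "(\<integral>\<^sup>+z. u z \<partial>\<nu>) \<le> ennreal \<kappa> * (\<integral>\<^sup>+z. u z \<partial>area)" .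
qed

end

section \<open>Kernel estimates\<close>

text \<open>
  A discrete analogue of symbol classes: the \<open>j\<close>-th difference of \<open>c\<close> is \<open>O(\<phi> n / n ^ j)\<close> for all \<open>j \<le> k\<close>.
\<close>

primrec symb :: "nat \<Rightarrow> (nat \<Rightarrow> real) \<Rightarrow> (nat \<Rightarrow> real) \<Rightarrow> bool" where
  "symb 0 \<phi> c \<longleftrightarrow> (\<exists>C\<ge>0. \<forall>n. \<bar>c n\<bar> \<le> C * \<phi> n)"
| "symb (Suc k) \<phi> c \<longleftrightarrow> (\<exists>C\<ge>0. \<forall>n. \<bar>c n\<bar> \<le> C * \<phi> n) \<and>
     symb k (\<lambda>n. \<phi> n / real (Suc n)) (\<lambda>n. c (Suc n) - c n)"

lemma symb_bound: "symb k \<phi> c \<Longrightarrow> \<exists>C\<ge>0. \<forall>n. \<bar>c n\<bar> \<le> C * \<phi> n"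
  by (cases k) simp_all

lemma symb_mono_size:
  assumes "symb k \<phi> c" "0 \<le> D" "\<And>n. \<phi> n \<le> D * \<psi> n"
  shows "symb k \<psi> c"
  using assms
proof (induction k arbitrary: \<phi> \<psi> c)
  have *: "\<exists>C\<ge>0. \<forall>n. \<bar>c n\<bar> \<le> C * \<psi> n"
    if "\<exists>C\<ge>0. \<forall>n. \<bar>c n\<bar> \<le> C * \<phi> n" and D: "0 \<le> D" "\<And>n. \<phi> n \<le> D * \<psi> n"
    for \<phi> \<psi> c :: "nat \<Rightarrow> real"
  proof -
    from that obtain C where C: "0 \<le> C" "\<And>n. \<bar>c n\<bar> \<le> C * \<phi> n" by auto
    have "\<bar>c n\<bar> \<le> C * D * \<psi> n" for n
      using C(2)[of n] mult_left_mono[OF D(2)[of n] C(1)] by simp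
    then show ?thesis using C D by (intro exI[of _ "C * D"]) auto
  qed
  {
    case 0
    then show ?case using *[of c \<phi> \<psi>] by simp
  next
    case (Suc k)
    have "symb k (\<lambda>n. \<psi> n / real (Suc n)) (\<lambda>n. c (Suc n) - c n)"
    proof (rule Suc.IH[of "\<lambda>n. \<phi> n / real (Suc n)"])
      show "symb k (\<lambda>n. \<phi> n / real (Suc n)) (\<lambda>n. c (Suc n) - c n)" using Suc.prems(1) by simp
      show "\<phi> n / real (Suc n) \<le> D * (\<psi> n / real (Suc n))" for n
        using divide_right_mono[OF Suc.prems(3)[of n], of "real (Suc n)"] by simp
    qed (rule Suc.prems(2))
    then show ?case using Suc.prems *[of c \<phi> \<psi>] by simp
  }
qed

lemma symb_mono_order: "symb (Suc k) \<phi> c \<Longrightarrow> symb k \<phi> c"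
proof (induction k arbitrary: \<phi> c)
  case (Suc k)
  have "symb (Suc k) (\<lambda>n. \<phi> n / real (Suc n)) (\<lambda>n. c (Suc n) - c n)"
    using Suc.prems by (simp only: symb.simps(2)[of "Suc k"])
  then have "symb k (\<lambda>n. \<phi> n / real (Suc n)) (\<lambda>n. c (Suc n) - c n)" by (rule Suc.IH)
  then show ?case using symb_bound[OF Suc.prems] by simp
qed simp

lemma symb_add:
  assumes "symb k \<phi> c" "symb k \<phi> d"
  shows "symb k \<phi> (\<lambda>n. c n + d n)"
  using assms
proof (induction k arbitrary: \<phi> c d)
  have *: "\<exists>C\<ge>0. \<forall>n. \<bar>c n + d n\<bar> \<le> C * \<phi> n"
    if "\<exists>C\<ge>0. \<forall>n. \<bar>c n\<bar> \<le> C * \<phi> n" "\<exists>C\<ge>0. \<forall>n. \<bar>d n\<bar> \<le> C * \<phi> n" for c d \<phi> :: "nat \<Rightarrow> real"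
  proof -
    from that obtain C D where C: "0 \<le> C" "\<And>n. \<bar>c n\<bar> \<le> C * \<phi> n" and D: "0 \<le> D" "\<And>n. \<bar>d n\<bar> \<le> D * \<phi> n" by auto
    have "\<bar>c n + d n\<bar> \<le> (C + D) * \<phi> n" for n
      using C(2)[of n] D(2)[of n] by (simp add: distrib_right)
    then show ?thesis using C D by (intro exI[of _ "C + D"]) auto
  qed
  {
    case 0
    then show ?case using *[of c \<phi> d] by simp
  next
    case (Suc k)
    have "symb k (\<lambda>n. \<phi> n / real (Suc n)) (\<lambda>n. (c (Suc n) - c n) + (d (Suc n) - d n))"
      using Suc.prems by (intro Suc.IH) auto
    moreover have "(\<lambda>n. (c (Suc n) - c n) + (d (Suc n) - d n)) = (\<lambda>n. (c (Suc n) + d (Suc n)) - (c n + d n))"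
      by auto
    ultimately show ?case using Suc.prems *[of c \<phi> d] by simp
  }
qed

lemma symb_shift:
  assumes "symb k \<phi> c" "\<And>n. 0 \<le> \<phi> n" "0 \<le> D" "\<And>n. \<phi> (Suc n) \<le> D * \<phi> n"
  shows "symb k \<phi> (\<lambda>n. c (Suc n))"
  using assms
proof (induction k arbitrary: \<phi> c)
  have *: "\<exists>C\<ge>0. \<forall>n. \<bar>c (Suc n)\<bar> \<le> C * \<phi> n"
    if "\<exists>C\<ge>0. \<forall>n. \<bar>c n\<bar> \<le> C * \<phi> n" and D: "0 \<le> D" "\<And>n. \<phi> (Suc n) \<le> D * \<phi> n" for c \<phi> :: "nat \<Rightarrow> real"
  proof -
    from that obtain C where C: "0 \<le> C" "\<And>n. \<bar>c n\<bar> \<le> C * \<phi> n" by auto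
    have "\<bar>c (Suc n)\<bar> \<le> C * D * \<phi> n" for n
      using C(2)[of "Suc n"] mult_left_mono[OF D(2)[of n] C(1)] by simp
    then show ?thesis using C D by (intro exI[of _ "C * D"]) auto
  qed
  {
    case 0
    then show ?case using *[of c \<phi>] by simp
  next
    case (Suc k)
    have "symb k (\<lambda>n. \<phi> n / real (Suc n)) (\<lambda>n. c (Suc (Suc n)) - c (Suc n))"
    proof (rule Suc.IH[of "\<lambda>n. \<phi> n / real (Suc n)" "\<lambda>n. c (Suc n) - c n"])
      fix n
      have "\<phi> (Suc n) / real (Suc (Suc n)) \<le> \<phi> (Suc n) / real (Suc n)"
        using Suc.prems by (intro divide_left_mono) auto
      also have "\<dots> \<le> D * \<phi> n / real (Suc n)" using Suc.prems by (intro divide_right_mono) auto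
      finally show "\<phi> (Suc n) / real (Suc (Suc n)) \<le> D * (\<phi> n / real (Suc n))" by simp
    qed (use Suc.prems in auto)
    then show ?case using Suc.prems *[of c \<phi>] by simp
  }
qed

text \<open>The discrete Leibniz rule: the difference of a product is \<open>c (Suc n)\<close> times
  the difference of \<open>d\<close> plus the difference of \<open>c\<close> times
  \<open>d n\<close>. The shifted factor is why \<open>\<phi>\<close> must grow by at most a bounded
  ratio.\<close>

lemma symb_mult:
  assumes "symb k \<phi> c" "symb k \<psi> d" "\<And>n. 0 \<le> \<phi> n" "\<And>n. 0 \<le> \<psi> n" "0 \<le> D" "\<And>n. \<phi> (Suc n) \<le> D * \<phi> n"
  shows "symb k (\<lambda>n. \<phi> n * \<psi> n) (\<lambda>n. c n * d n)"
  using assms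
proof (induction k arbitrary: \<phi> c \<psi> d)
  have *: "\<exists>C\<ge>0. \<forall>n. \<bar>c n * d n\<bar> \<le> C * (\<phi> n * \<psi> n)"
    if "\<exists>C\<ge>0. \<forall>n. \<bar>c n\<bar> \<le> C * \<phi> n" "\<exists>C\<ge>0. \<forall>n. \<bar>d n\<bar> \<le> C * \<psi> n" "\<And>n. 0 \<le> \<phi> n" for c d \<phi> \<psi> :: "nat \<Rightarrow> real"
  proof -
    from that obtain C D where C: "0 \<le> C" "\<And>n. \<bar>c n\<bar> \<le> C * \<phi> n" and D: "0 \<le> D" "\<And>n. \<bar>d n\<bar> \<le> D * \<psi> n" by auto
    have "\<bar>c n * d n\<bar> \<le> (C * \<phi> n) * (D * \<psi> n)" for n
      unfolding abs_mult using C D that(3) by (intro mult_mono) auto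
    then show ?thesis using C D by (intro exI[of _ "C * D"]) (auto simp: mult_ac)
  qed
  {
    case 0
    then show ?case using *[of c \<phi> d \<psi>] by simp
  next
    case (Suc k)
    have c: "symb k \<phi> (\<lambda>n. c (Suc n))"
      by (rule symb_shift[OF symb_mono_order[OF Suc.prems(1)] Suc.prems(3,5,6)])
    have dd: "symb k (\<lambda>n. \<psi> n / real (Suc n)) (\<lambda>n. d (Suc n) - d n)"
      using Suc.prems by simp
    have dc: "symb k (\<lambda>n. \<phi> n / real (Suc n)) (\<lambda>n. c (Suc n) - c n)"
      using Suc.prems by simp
    have d: "symb k \<psi> d"
      by (rule symb_mono_order[OF Suc.prems(2)])
    have 1: "symb k (\<lambda>n. \<phi> n * (\<psi> n / real (Suc n))) (\<lambda>n. c (Suc n) * (d (Suc n) - d n))"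
      using Suc.prems by (intro Suc.IH[OF c dd]) auto
    have 2: "symb k (\<lambda>n. \<phi> n / real (Suc n) * \<psi> n) (\<lambda>n. (c (Suc n) - c n) * d n)"
    proof (rule Suc.IH[OF dc d])
      fix n
      have "\<phi> (Suc n) / real (Suc (Suc n)) \<le> \<phi> (Suc n) / real (Suc n)"
        using Suc.prems by (intro divide_left_mono) auto
      also have "\<dots> \<le> D * \<phi> n / real (Suc n)" using Suc.prems by (intro divide_right_mono) auto
      finally show "\<phi> (Suc n) / real (Suc (Suc n)) \<le> D * (\<phi> n / real (Suc n))" by simp
    qed (use Suc.prems in auto)
    have "symb k (\<lambda>n. \<phi> n * \<psi> n / real (Suc n))
        (\<lambda>n. c (Suc n) * (d (Suc n) - d n) + (c (Suc n) - c n) * d n)"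
      using 1 2 by (intro symb_add) simp_all
    then show ?case using Suc.prems *[of c \<phi> d \<psi>] by (simp add: algebra_simps)
  }
qed

text \<open>The difference of \<open>1 / c\<close> is minus the difference of \<open>c\<close>
  divided by \<open>c n * c (Suc n)\<close>. So the claim at one order, together with the product
  rule, yields the claim at the next.\<close>

lemma symb_inverse:
  assumes "symb k \<phi> c" "\<And>n. 0 < \<phi> n" "\<And>n. 0 < c n" "0 \<le> D" "\<And>n. \<phi> n \<le> D * c n" "\<And>n. \<phi> n \<le> D * \<phi> (Suc n)"
  shows "symb k (\<lambda>n. 1 / \<phi> n) (\<lambda>n. 1 / c n)"
  using assms(1)
proof (induction k)
  case 0
  have "\<bar>1 / c n\<bar> \<le> D * (1 / \<phi> n)" for n
    using assms(2,3)[of n] assms(5)[of n] by (simp add: field_simps)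
  then show ?case using assms(4) by auto
next
  case (Suc k)
  have bd: "\<bar>1 / c n\<bar> \<le> D * (1 / \<phi> n)" for n
    using assms(2,3)[of n] assms(5)[of n] by (simp add: field_simps)
  have inv: "symb k (\<lambda>n. 1 / \<phi> n) (\<lambda>n. 1 / c n)"
    by (rule Suc.IH) (rule symb_mono_order, fact)
  have ratio: "1 / \<phi> (Suc n) \<le> D * (1 / \<phi> n)" for n
    using assms(2)[of n] assms(2)[of "Suc n"] assms(6)[of n] by (simp add: field_simps)
  have pos: "0 \<le> 1 / \<phi> n" for n using assms(2)[of n] by simp
  have inv': "symb k (\<lambda>n. 1 / \<phi> n) (\<lambda>n. 1 / c (Suc n))"
    by (rule symb_shift[OF inv pos assms(4) ratio])
  have dc: "symb k (\<lambda>n. \<phi> n / real (Suc n)) (\<lambda>n. c (Suc n) - c n)" using Suc.prems by simp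
  have ne: "\<phi> n \<noteq> 0" "c n \<noteq> 0" for n using assms(2,3)[of n] by auto
  have "symb k (\<lambda>n. 1 / \<phi> n * (\<phi> n / real (Suc n))) (\<lambda>n. 1 / c n * (c (Suc n) - c n))"
    using assms(2)[THEN less_imp_le] by (intro symb_mult[OF inv dc pos _ assms(4) ratio]) auto
  then have "symb k (\<lambda>n. 1 / \<phi> n * (1 / \<phi> n * (\<phi> n / real (Suc n)))) (\<lambda>n. 1 / c (Suc n) * (1 / c n * (c (Suc n) - c n)))"
    using assms(2)[THEN less_imp_le] by (intro symb_mult[OF inv' _ pos _ assms(4) ratio]) auto
  moreover have "(\<lambda>n. 1 / \<phi> n * (1 / \<phi> n * (\<phi> n / real (Suc n)))) = (\<lambda>n. 1 / \<phi> n / real (Suc n))"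
    using ne by (intro ext) simp
  moreover have "(\<lambda>n. 1 / c (Suc n) * (1 / c n * (c (Suc n) - c n))) = (\<lambda>n. 1 / c n - 1 / c (Suc n))"
    using ne by (intro ext) (simp add: field_simps)
  ultimately have A: "symb k (\<lambda>n. 1 / \<phi> n / real (Suc n)) (\<lambda>n. 1 / c n - 1 / c (Suc n))" by simp
  have neg: "symb k \<psi> (\<lambda>n. - e n)" if "symb k \<psi> e" for \<psi> e
    using that
  proof (induction k arbitrary: \<psi> e)
    case (Suc k)
    then have "symb k (\<lambda>n. \<psi> n / real (Suc n)) (\<lambda>n. - (e (Suc n) - e n))" by (intro Suc.IH) simp
    then show ?case using Suc.prems by simp
  qed simp
  show ?case using neg[OF A] bd assms(4) by auto
qed

lemma symb_const: "symb k (\<lambda>n. 1) (\<lambda>n. c)"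
proof -
  have 0: "symb k \<phi> (\<lambda>n. 0)" if "\<And>n. 0 \<le> \<phi> n" for \<phi> :: "nat \<Rightarrow> real" and k
    using that by (induction k arbitrary: \<phi>) (auto intro!: exI[of _ 0])
  show ?thesis
  proof (cases k)
    case (Suc j)
    have "symb j (\<lambda>n. 1 / real (Suc n)) (\<lambda>n. 0)" by (rule 0) simp
    then show ?thesis using Suc by (auto intro!: exI[of _ "\<bar>c\<bar>"])
  qed (auto intro!: exI[of _ "\<bar>c\<bar>"])
qed

lemma symb_Suc_power: "symb k (\<lambda>n. real (Suc n) ^ m) (\<lambda>n. real (Suc n) ^ m)"
proof (induction m)
  case 0
  then show ?case using symb_const by simp
next
  case (Suc m)
  have "symb k (\<lambda>n. real (Suc n)) (\<lambda>n. real (Suc n))"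
    using symb_const by (cases k) (auto intro!: exI[of _ 1])
  then have "symb k (\<lambda>n. real (Suc n) * real (Suc n) ^ m) (\<lambda>n. real (Suc n) * real (Suc n) ^ m)"
    using Suc by (rule symb_mult[where D = 2]) auto
  then show ?case by simp
qed

lemma summable_Suc_power_geometric:
  fixes x :: real
  assumes "0 \<le> x" "x < 1"
  shows "summable (\<lambda>n. real (Suc n) ^ k * x ^ n)"
proof -
  have "(\<lambda>n. (real (Suc n) / real (Suc (Suc n))) ^ k) \<longlonglongrightarrow> 1 ^ k"
    by (intro tendsto_power) real_asymp
  then have "conv_radius (\<lambda>n. real (Suc n) ^ k) = 1"
    by (intro conv_radius_ratio_limit_nonzero[where c = 1])
      (auto simp: power_divide one_ereal_def)
  then show ?thesis
    using assms by (intro summable_in_conv_radius) (auto simp: one_ereal_def)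
qed

text \<open>
  Each summation by parts costs a factor \<open>1 / norm (1 - w) \<le> N + 1\<close> and gains a difference of \<open>c\<close>, so \<open>k\<close> of
  them make the tail absolutely summable without losing against the size \<open>\<phi> N * (N + 1)\<close> of a block of length
  about \<open>1 / norm (1 - w)\<close>.
\<close>

lemma symb_tail:
  assumes "symb k \<phi> c" "\<And>n. 0 \<le> \<phi> n" "summable (\<lambda>n. \<phi> n / real (Suc n) ^ k)" "0 \<le> C"
    and "\<And>N. (\<Sum>n. \<phi> (N + n) / real (Suc (N + n)) ^ k) \<le> C * (\<phi> N * real (Suc N) / real (Suc N) ^ k)"
  shows "\<exists>C'\<ge>0. \<forall>N. \<forall>w::complex. norm w < 1 \<longrightarrow> 1 \<le> norm (1 - w) * real (Suc N) \<longrightarrow>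
    norm (\<Sum>n. of_real (c (N + n)) * w ^ (N + n)) \<le> C' * (\<phi> N * real (Suc N))"
  using assms(1-3,5)
proof (induction k arbitrary: \<phi> c)
  case 0
  obtain D where D: "0 \<le> D" "\<And>n. \<bar>c n\<bar> \<le> D * \<phi> n" using symb_bound[OF 0(1)] by auto
  have "norm (\<Sum>n. of_real (c (N + n)) * w ^ (N + n)) \<le> D * C * (\<phi> N * real (Suc N))" if "norm w < 1" for N and w :: complex
  proof -
    have sm: "summable (\<lambda>n. \<phi> (N + n))"
      using 0(3) summable_iff_shift[of \<phi> N] by (simp add: add.commute)
    have le: "norm (of_real (c (N + n)) * w ^ (N + n)) \<le> D * \<phi> (N + n)" for n
    proof -
      have "norm (of_real (c (N + n)) * w ^ (N + n)) \<le> \<bar>c (N + n)\<bar> * 1"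
        unfolding norm_mult norm_power norm_of_real using that by (intro mult_left_mono power_le_one) auto
      then show ?thesis using D(2)[of "N + n"] by simp
    qed
    have "norm (\<Sum>n. of_real (c (N + n)) * w ^ (N + n)) \<le> (\<Sum>n. D * \<phi> (N + n))"
      by (rule norm_suminf_le[OF le summable_mult[OF sm]])
    also have "\<dots> = D * (\<Sum>n. \<phi> (N + n))" by (rule suminf_mult[OF sm])
    also have "\<dots> \<le> D * (C * (\<phi> N * real (Suc N)))"
      using 0(4)[of N] D(1) by (intro mult_left_mono) simp_all
    finally show ?thesis by (simp add: mult_ac)
  qed
  then show ?case using D(1) assms(4) by (intro exI[of _ "D * C"]) auto
next
  case (Suc k)
  obtain D where D: "0 \<le> D" "\<And>n. \<bar>c n\<bar> \<le> D * \<phi> n" using symb_bound[OF Suc.prems(1)] by auto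
  define \<Delta> where "\<Delta> n = c (Suc n) - c n" for n
  have eq: "\<phi> n / real (Suc n) / real (Suc n) ^ k = \<phi> n / real (Suc n) ^ Suc k" for n
    by simp
  have "\<exists>C'\<ge>0. \<forall>N. \<forall>w::complex. norm w < 1 \<longrightarrow> 1 \<le> norm (1 - w) * real (Suc N) \<longrightarrow>
    norm (\<Sum>n. of_real (\<Delta> (N + n)) * w ^ (N + n)) \<le> C' * (\<phi> N / real (Suc N) * real (Suc N))"
  proof (rule Suc.IH)
    show "symb k (\<lambda>n. \<phi> n / real (Suc n)) \<Delta>" using Suc.prems(1) by (simp add: \<Delta>_def[abs_def])
    show "summable (\<lambda>n. \<phi> n / real (Suc n) / real (Suc n) ^ k)" using Suc.prems(3) by (simp only: eq)
    show "(\<Sum>n. \<phi> (N + n) / real (Suc (N + n)) / real (Suc (N + n)) ^ k)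
      \<le> C * (\<phi> N / real (Suc N) * real (Suc N) / real (Suc N) ^ k)" for N
      using Suc.prems(4)[of N] unfolding eq by simp
  qed (use Suc.prems(2) in auto)
  then obtain C' where C': "0 \<le> C'" and tail: "\<And>N (w::complex). norm w < 1 \<Longrightarrow> 1 \<le> norm (1 - w) * real (Suc N) \<Longrightarrow>
    norm (\<Sum>n. of_real (\<Delta> (N + n)) * w ^ (N + n)) \<le> C' * \<phi> N"
    by auto
  have "norm (\<Sum>n. of_real (c (N + n)) * w ^ (N + n)) \<le> (D + C') * (\<phi> N * real (Suc N))"
    if w: "norm w < 1" "1 \<le> norm (1 - w) * real (Suc N)" for N and w :: complex
  proof -
    \<comment> \<open>The summability hypothesis is used here just to bound \<open>\<phi>\<close> by
      a polynomial, enough for convergence at every \<open>w\<close> inside the disc.\<close>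
    obtain B where B: "\<And>n. norm (\<phi> n / real (Suc n) ^ Suc k) \<le> B"
      using summable_imp_Bseq[OF Suc.prems(3)] by (auto simp: Bseq_def)
    have "summable (\<lambda>n. D * B * (real (Suc n) ^ Suc k * norm w ^ n))"
      using w(1) by (intro summable_mult summable_Suc_power_geometric) auto
    then have sm: "summable (\<lambda>n. of_real (c n) * w ^ n)"
    proof (rule summable_comparison_test')
      fix n :: nat
      have "\<phi> n \<le> B * real (Suc n) ^ Suc k"
        using B[of n] by (simp add: pos_divide_le_eq abs_le_iff)
      then have "\<bar>c n\<bar> \<le> D * (B * real (Suc n) ^ Suc k)"
        using D(2)[of n] mult_left_mono[of "\<phi> n" "B * real (Suc n) ^ Suc k" D] D(1) by linarith
      then have "\<bar>c n\<bar> * norm w ^ n \<le> D * (B * real (Suc n) ^ Suc k) * norm w ^ n"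
        by (intro mult_right_mono) auto
      then show "norm (of_real (c n) * w ^ n) \<le> D * B * (real (Suc n) ^ Suc k * norm w ^ n)"
        by (simp only: norm_mult norm_power norm_of_real mult.assoc)
    qed
    define g where "g n = of_real (c (N + n)) * w ^ (N + n)" for n
    have g: "summable g"
      using sm summable_iff_shift[of "\<lambda>n. of_real (c n) * w ^ n" N] by (simp add: g_def[abs_def] add.commute)
    then have gS: "summable (\<lambda>n. g (Suc n))" by (rule summable_Suc_iff[THEN iffD2])
    define T where "T = (\<Sum>n. g n)"
    have "T = g 0 + (\<Sum>n. g (Suc n))"
      unfolding T_def using suminf_split_head[OF g] by simp
    moreover have "w * T = (\<Sum>n. w * g n)"
      unfolding T_def using suminf_mult[OF g] by simp
    ultimately have "(1 - w) * T = g 0 + ((\<Sum>n. g (Suc n)) - (\<Sum>n. w * g n))"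
      by (simp add: algebra_simps)
    also have "(\<Sum>n. g (Suc n)) - (\<Sum>n. w * g n) = (\<Sum>n. g (Suc n) - w * g n)"
      by (rule suminf_diff[OF gS summable_mult[OF g]])
    also have "(\<lambda>n. g (Suc n) - w * g n) = (\<lambda>n. w * (of_real (\<Delta> (N + n)) * w ^ (N + n)))"
      by (auto simp: g_def \<Delta>_def algebra_simps)
    also have "(\<Sum>n. w * (of_real (\<Delta> (N + n)) * w ^ (N + n))) = w * (\<Sum>n. of_real (\<Delta> (N + n)) * w ^ (N + n))"
    \<comment> \<open>Summability of the differenced series is obtained by cancelling the factor
      \<open>w\<close>, so \<open>w = 0\<close> is treated apart; there both sides are 0.\<close>
    proof (cases "w = 0")
      case False
      have "summable (\<lambda>n. w * (of_real (\<Delta> (N + n)) * w ^ (N + n)))"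
        using summable_diff[OF gS summable_mult[OF g, of w]]
        by (rule back_subst[of summable]) (auto simp: g_def \<Delta>_def algebra_simps)
      then have "summable (\<lambda>n. of_real (\<Delta> (N + n)) * w ^ (N + n))"
        using False by (simp add: summable_cmult_iff)
      then show ?thesis by (rule suminf_mult)
    qed simp
    finally have "norm ((1 - w) * T) = norm (g 0 + w * (\<Sum>n. of_real (\<Delta> (N + n)) * w ^ (N + n)))" by simp
    also have "\<dots> \<le> norm (g 0) + norm w * norm (\<Sum>n. of_real (\<Delta> (N + n)) * w ^ (N + n))"
      by (rule norm_triangle_le) (simp add: norm_mult)
    also have "\<dots> \<le> D * \<phi> N + 1 * (C' * \<phi> N)"
    proof (intro add_mono mult_mono tail w)
      have "norm (g 0) \<le> \<bar>c N\<bar> * 1"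
        unfolding g_def add_0_right norm_mult norm_power norm_of_real
        using w by (intro mult_left_mono power_le_one) auto
      then show "norm (g 0) \<le> D * \<phi> N" using D(2)[of N] by simp
    qed (use w in auto)
    finally have "norm (1 - w) * norm T \<le> (D + C') * \<phi> N"
      by (simp add: norm_mult distrib_right)
    then have "norm (1 - w) * norm T * real (Suc N) \<le> (D + C') * \<phi> N * real (Suc N)"
      by (rule mult_right_mono) simp
    moreover have "norm (1 - w) * real (Suc N) * norm T = norm (1 - w) * norm T * real (Suc N)"
      by (simp only: mult_ac)
    moreover have "1 * norm T \<le> norm (1 - w) * real (Suc N) * norm T"
      using w by (intro mult_right_mono) auto
    ultimately have "norm T \<le> (D + C') * \<phi> N * real (Suc N)" by linarith
    then show ?thesis by (simp only: T_def g_def mult.assoc)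
  qed
  then show ?case using D(1) C' by (intro exI[of _ "D + C'"]) auto
qed

text \<open>Up to a binomial coefficient the left side is one term of the expansion of
  \<open>((1 - r) + r) ^ (n + j) = 1\<close>, and that coefficient is at least
  \<open>real (Suc n) ^ j / fact j\<close>.\<close>

lemma power_mult_power_le:
  fixes r :: real
  assumes "0 \<le> r" "r \<le> 1"
  shows "r ^ n * (1 - r) ^ j \<le> fact j / real (Suc n) ^ j"
proof -
  have "real ((n + j) choose j) * r ^ n * (1 - r) ^ j \<le> (\<Sum>k\<le>n + j. real ((n + j) choose k) * (1 - r) ^ k * r ^ (n + j - k))"
    using assms member_le_sum[of j "{..n + j}" "\<lambda>k. real ((n + j) choose k) * (1 - r) ^ k * r ^ (n + j - k)"]
    by (simp add: mult_ac)
  also have "\<dots> = ((1 - r) + r) ^ (n + j)" by (rule binomial_ring[symmetric])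
  finally have 1: "real ((n + j) choose j) * (r ^ n * (1 - r) ^ j) \<le> 1" by (simp add: mult_ac)
  have "real (Suc n) ^ j \<le> fact j * real ((n + j) choose j)"
  proof (induction j)
    case (Suc j)
    have "fact (Suc j) * real ((n + Suc j) choose Suc j) = (fact j * real ((n + j) choose j)) * real (n + Suc j)"
      using Suc_times_binomial_eq[of "n + j" j] by (simp add: algebra_simps flip: of_nat_mult of_nat_Suc)
    moreover have "real (Suc n) ^ j * real (Suc n) \<le> (fact j * real ((n + j) choose j)) * real (n + Suc j)"
      using Suc by (intro mult_mono) auto
    ultimately show ?case by (simp add: mult_ac)
  qed simp
  then have "real (Suc n) ^ j * (r ^ n * (1 - r) ^ j) \<le> fact j * real ((n + j) choose j) * (r ^ n * (1 - r) ^ j)"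
    using assms by (intro mult_right_mono) auto
  also have "\<dots> = fact j * (real ((n + j) choose j) * (r ^ n * (1 - r) ^ j))" by (rule mult.assoc)
  also have "\<dots> \<le> fact j * 1"
    using 1 by (intro mult_left_mono) auto
  finally show ?thesis by (simp add: field_simps)
qed

section \<open>Regularity of the kernel coefficients and pointwise kernel bounds\<close>

context regular_weight
begin

definition mom :: "nat \<Rightarrow> real" where
  "mom n = weight_moment \<omega> (real (2 * n + 1))"

definition lam :: "nat \<Rightarrow> real" where
  "lam n = 1 / (2 * mom n)"

definition kern :: "nat \<Rightarrow> complex \<Rightarrow> complex" where
  "kern m \<eta> = (\<Sum>n. of_real (real (Suc n) ^ m * lam n) * \<eta> ^ n)"

lemma mom_pos: "0 < mom n"
  unfolding mom_def by (rule moment_pos) simp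

lemma lam_pos: "0 < lam n"
  using mom_pos[of n] by (simp add: lam_def)

lemma bergman_kernel_eq_kern: "bergman_kernel \<omega> z \<zeta> = kern 0 (cnj z * \<zeta>)"
  unfolding bergman_kernel_def kern_def by (intro suminf_cong) (simp add: lam_def mom_def)

lemma moment_integral: "weight_moment \<omega> (real (Suc n)) = (\<integral>r. r ^ Suc n * \<omega> r \<partial>lborel)"
proof -
  have eq: "(\<lambda>r. indicator {0..<1} r *\<^sub>R (r powr real (Suc n) * \<omega> r)) = (\<lambda>r. r ^ Suc n * \<omega> r)"
  proof
    fix r :: real
    have "r powr real (Suc n) = r ^ Suc n" if "0 \<le> r"
      using that powr_realpow[of r "Suc n"] by (cases "r = 0") auto
    then show "indicator {0..<1} r *\<^sub>R (r powr real (Suc n) * \<omega> r) = r ^ Suc n * \<omega> r"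
      using zero[of r] by (cases "r \<in> {0..<1}") (simp_all add: indicator_def)
  qed
  show ?thesis
    unfolding weight_moment_def set_lebesgue_integral_def eq by (subst integral_completion) auto
qed

lemma integrable_power_weight: "integrable lborel (\<lambda>r. r ^ n * (1 - r\<^sup>2) ^ j * \<omega> r)"
proof (rule Bochner_Integration.integrable_bound[OF integrable])
  have "\<bar>r ^ n * (1 - r\<^sup>2) ^ j * \<omega> r\<bar> \<le> \<bar>\<omega> r\<bar>" for r
  proof (cases "r \<in> {0..<1}")
    case True
    have "r\<^sup>2 \<le> 1" using True by (intro power_le_one) auto
    then have "r ^ n * (1 - r\<^sup>2) ^ j \<le> 1"
      using True by (intro mult_le_one power_le_one zero_le_power) auto
    moreover have "0 \<le> r ^ n * (1 - r\<^sup>2) ^ j" using True \<open>r\<^sup>2 \<le> 1\<close> by auto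
    ultimately show ?thesis unfolding abs_mult[of _ "\<omega> r"] by (intro mult_left_le_one_le) auto
  qed (simp add: zero)
  then show "AE r in lborel. norm (r ^ n * (1 - r\<^sup>2) ^ j * \<omega> r) \<le> norm (\<omega> r)" by simp
qed auto

text \<open>Differencing \<open>\<omega>\<^sub>2\<^sub>n\<^sub>+\<^sub>1\<close> in \<open>n\<close> inserts a factor \<open>r\<^sup>2 - 1\<close> into the integral, which is worth \<open>1 / n\<close>.\<close>

lemma symb_mom_diff:
  "symb k (\<lambda>n. mom n / real (Suc n) ^ j) (\<lambda>n. \<integral>r. r ^ (2 * n + 1) * (1 - r\<^sup>2) ^ j * \<omega> r \<partial>lborel)"
proof (induction k arbitrary: j)
  have bound: "\<exists>C\<ge>0. \<forall>n. \<bar>\<integral>r. r ^ (2 * n + 1) * (1 - r\<^sup>2) ^ j * \<omega> r \<partial>lborel\<bar> \<le> C * (mom n / real (Suc n) ^ j)" for j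
  proof (intro exI[of _ "2 ^ j * fact j * (A * 2 ^ b)"] conjI allI)
    fix n
    let ?c = "2 ^ j * fact j / real (Suc n) ^ j"
    \<comment> \<open>The power of \<open>r\<close> is shared: \<open>r ^ n\<close> pays for the
      factors \<open>1 - r\<close>, and the remaining \<open>r ^ (n + 1)\<close> still integrates to
      a moment, comparable with \<open>mom n\<close> by \<open>moment_growth\<close>.\<close>
    have "r ^ (2 * n + 1) * (1 - r\<^sup>2) ^ j * \<omega> r \<le> ?c * (r ^ (n + 1) * (1 - r\<^sup>2) ^ 0 * \<omega> r)" for r
    proof (cases "r \<in> {0..<1}")
      case True
      have "(1 - r\<^sup>2) ^ j \<le> (2 * (1 - r)) ^ j"
      proof (rule power_mono)
        have "1 - r\<^sup>2 = (1 + r) * (1 - r)" by (simp add: power2_eq_square algebra_simps)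
        also have "\<dots> \<le> 2 * (1 - r)" using True by (intro mult_right_mono) auto
        finally show "1 - r\<^sup>2 \<le> 2 * (1 - r)" .
        show "0 \<le> 1 - r\<^sup>2" using True power_le_one[of r 2] by auto
      qed
      also have "\<dots> = 2 ^ j * (1 - r) ^ j" by (rule power_mult_distrib)
      finally have "r ^ n * (1 - r\<^sup>2) ^ j \<le> r ^ n * (2 ^ j * (1 - r) ^ j)"
        using True by (intro mult_left_mono) auto
      also have "\<dots> = 2 ^ j * (r ^ n * (1 - r) ^ j)" by (simp only: mult_ac)
      also have "\<dots> \<le> 2 ^ j * (fact j / real (Suc n) ^ j)"
        using True by (intro mult_left_mono power_mult_power_le) auto
      finally have "r ^ n * (1 - r\<^sup>2) ^ j \<le> ?c" by simp
      then have "(r ^ n * (1 - r\<^sup>2) ^ j) * (r ^ (n + 1) * \<omega> r) \<le> ?c * (r ^ (n + 1) * \<omega> r)"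
        using True nonneg[of r] by (intro mult_right_mono) auto
      moreover have "r ^ (2 * n + 1) = r ^ n * r ^ (n + 1)" by (simp flip: power_add add: mult_2)
      ultimately show ?thesis by (simp only: mult_ac power_0 mult_1_right)
    qed (simp add: zero)
    then have "(\<integral>r. r ^ (2 * n + 1) * (1 - r\<^sup>2) ^ j * \<omega> r \<partial>lborel) \<le> (\<integral>r. ?c * (r ^ (n + 1) * (1 - r\<^sup>2) ^ 0 * \<omega> r) \<partial>lborel)"
      by (intro integral_mono integrable_power_weight integrable_mult_right)
    also have "\<dots> = ?c * (\<integral>r. r ^ (n + 1) * (1 - r\<^sup>2) ^ 0 * \<omega> r \<partial>lborel)"
      by (rule integral_mult_right_zero)
    also have "(\<integral>r. r ^ (n + 1) * (1 - r\<^sup>2) ^ 0 * \<omega> r \<partial>lborel) = weight_moment \<omega> (real (Suc n))"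
      by (simp only: moment_integral power_0 mult_1_right Suc_eq_plus1[symmetric])
    also have "?c * weight_moment \<omega> (real (Suc n)) \<le> ?c * (A * 2 ^ b * mom n)"
    proof (rule mult_left_mono)
      have "weight_moment \<omega> (real (Suc n)) \<le> A * (real (2 * n + 1) / real (Suc n)) ^ b * mom n"
        unfolding mom_def by (rule moment_growth) auto
      also have "\<dots> \<le> A * 2 ^ b * mom n"
        using A mom_pos[of n] by (intro mult_right_mono mult_left_mono power_mono) (auto simp: divide_le_eq)
      finally show "weight_moment \<omega> (real (Suc n)) \<le> A * 2 ^ b * mom n" .
    qed simp
    finally have "(\<integral>r. r ^ (2 * n + 1) * (1 - r\<^sup>2) ^ j * \<omega> r \<partial>lborel) \<le> 2 ^ j * fact j * (A * 2 ^ b) * (mom n / real (Suc n) ^ j)"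
      by (simp add: mult_ac)
    moreover have "0 \<le> (\<integral>r. r ^ (2 * n + 1) * (1 - r\<^sup>2) ^ j * \<omega> r \<partial>lborel)"
    proof (rule Bochner_Integration.integral_nonneg)
      fix r :: real
      show "0 \<le> r ^ (2 * n + 1) * (1 - r\<^sup>2) ^ j * \<omega> r"
      proof (cases "r \<in> {0..<1}")
        case True
        then have "0 \<le> 1 - r\<^sup>2" using power_le_one[of r 2] by auto
        then show ?thesis using True nonneg[of r] by (intro mult_nonneg_nonneg zero_le_power) auto
      qed (simp add: zero)
    qed
    ultimately show "\<bar>\<integral>r. r ^ (2 * n + 1) * (1 - r\<^sup>2) ^ j * \<omega> r \<partial>lborel\<bar> \<le> 2 ^ j * fact j * (A * 2 ^ b) * (mom n / real (Suc n) ^ j)"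
      by simp
  qed (use A in auto)
  {
    case 0
    show ?case using bound by simp
  next
    case (Suc k)
    have "symb k (\<lambda>n. mom n / real (Suc n) ^ j / real (Suc n))
        (\<lambda>n. (\<integral>r. r ^ (2 * Suc n + 1) * (1 - r\<^sup>2) ^ j * \<omega> r \<partial>lborel) - (\<integral>r. r ^ (2 * n + 1) * (1 - r\<^sup>2) ^ j * \<omega> r \<partial>lborel))"
    proof -
      have "(\<integral>r. r ^ (2 * Suc n + 1) * (1 - r\<^sup>2) ^ j * \<omega> r \<partial>lborel) - (\<integral>r. r ^ (2 * n + 1) * (1 - r\<^sup>2) ^ j * \<omega> r \<partial>lborel)
        = (- 1) * (\<integral>r. r ^ (2 * n + 1) * (1 - r\<^sup>2) ^ Suc j * \<omega> r \<partial>lborel)" for n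
      proof -
        have "(\<integral>r. r ^ (2 * Suc n + 1) * (1 - r\<^sup>2) ^ j * \<omega> r \<partial>lborel) - (\<integral>r. r ^ (2 * n + 1) * (1 - r\<^sup>2) ^ j * \<omega> r \<partial>lborel)
          = (\<integral>r. r ^ (2 * Suc n + 1) * (1 - r\<^sup>2) ^ j * \<omega> r - r ^ (2 * n + 1) * (1 - r\<^sup>2) ^ j * \<omega> r \<partial>lborel)"
          by (rule Bochner_Integration.integral_diff[symmetric]) (rule integrable_power_weight)+
        also have "\<dots> = (\<integral>r. (- 1) * (r ^ (2 * n + 1) * (1 - r\<^sup>2) ^ Suc j * \<omega> r) \<partial>lborel)"
          by (intro Bochner_Integration.integral_cong refl) (simp add: algebra_simps power2_eq_square)
        finally show ?thesis by simp
      qed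
      moreover have "symb k (\<lambda>n. mom n / real (Suc n) ^ j / real (Suc n))
         (\<lambda>n. (- 1) * (\<integral>r. r ^ (2 * n + 1) * (1 - r\<^sup>2) ^ Suc j * \<omega> r \<partial>lborel))"
      proof -
        have "symb k (\<lambda>n. 1 * (mom n / real (Suc n) ^ Suc j)) (\<lambda>n. (- 1) * (\<integral>r. r ^ (2 * n + 1) * (1 - r\<^sup>2) ^ Suc j * \<omega> r \<partial>lborel))"
          by (rule symb_mult[where D = 1, OF symb_const Suc.IH]) (simp_all add: mom_pos less_imp_le)
        moreover have "(\<lambda>n. 1 * (mom n / real (Suc n) ^ Suc j)) = (\<lambda>n. mom n / real (Suc n) ^ j / real (Suc n))"
          by (simp add: fun_eq_iff mult.commute)
        ultimately show ?thesis by simp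
      qed
      ultimately show ?thesis by presburger
    qed
    then show ?case using bound[of j] by (simp only: symb.simps simp_thms)
  }
qed

lemma mom_Suc: "mom (Suc n) \<le> mom n" "mom n \<le> A * 3 ^ b * mom (Suc n)"
proof -
  show "mom (Suc n) \<le> mom n" unfolding mom_def by (rule moment_antimono) auto
  have "mom n \<le> A * (real (2 * Suc n + 1) / real (2 * n + 1)) ^ b * mom (Suc n)"
    unfolding mom_def by (rule moment_growth) auto
  also have "\<dots> \<le> A * 3 ^ b * mom (Suc n)"
    using A mom_pos[of "Suc n"] by (intro mult_right_mono mult_left_mono power_mono) (auto simp: divide_le_eq)
  finally show "mom n \<le> A * 3 ^ b * mom (Suc n)" .
qed

text \<open>The case \<open>j = 0\<close> of \<open>symb_mom_diff\<close> concerns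
  \<open>mom\<close> itself, and \<open>lam\<close> is half its reciprocal. The size function is
  \<open>lam\<close> too, so each difference gains a full factor \<open>1 / n\<close> relative to
  the sequence.\<close>

lemma symb_lam: "symb k lam lam"
proof -
  have "symb k mom mom"
  proof -
    have "(\<lambda>n. \<integral>r. r ^ (2 * n + 1) * (1 - r\<^sup>2) ^ 0 * \<omega> r \<partial>lborel) = mom"
    proof
      fix n
      show "(\<integral>r. r ^ (2 * n + 1) * (1 - r\<^sup>2) ^ 0 * \<omega> r \<partial>lborel) = mom n"
        using moment_integral[of "2 * n"] by (simp add: mom_def algebra_simps)
    qed
    then show ?thesis using symb_mom_diff[of k 0] by simp
  qed
  then have "symb k (\<lambda>n. 1 / mom n) (\<lambda>n. 1 / mom n)"
  proof (rule symb_inverse[where D = "A * 3 ^ b"])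
    show "mom n \<le> A * 3 ^ b * mom n" for n
      using mom_pos[of n] A mult_mono[of 1 A 1 "3 ^ b"] by simp
  qed (use mom_Suc mom_pos A in auto)
  then have "symb k (\<lambda>n. 1 * (1 / mom n)) (\<lambda>n. 1 / 2 * (1 / mom n))"
    by (rule symb_mult[OF symb_const, of _ _ _ 1]) (auto intro!: mom_pos[THEN less_imp_le])
  then have "symb k (\<lambda>n. 1 / mom n) lam" by (simp add: lam_def[abs_def])
  then show ?thesis
    by (rule symb_mono_size[where D = 2]) (simp_all add: lam_def)
qed

lemma lam_mono: "n \<le> N \<Longrightarrow> lam n \<le> lam N"
  unfolding lam_def mom_def using moment_pos moment_antimono[of "real (2 * n + 1)" "real (2 * N + 1)"]
  by (intro divide_left_mono mult_pos_pos) auto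

lemma lam_growth:
  assumes "N \<le> n"
  shows "lam n \<le> A * 2 ^ b * (real (Suc n) / real (Suc N)) ^ b * lam N"
proof -
  have "mom N \<le> A * (real (2 * n + 1) / real (2 * N + 1)) ^ b * mom n"
    unfolding mom_def using assms by (intro moment_growth) auto
  also have "\<dots> \<le> A * (2 * (real (Suc n) / real (Suc N))) ^ b * mom n"
  proof (intro mult_right_mono mult_left_mono power_mono)
    have "(2 * n + 1) * Suc N \<le> 2 * Suc n * (2 * N + 1)" by (simp add: algebra_simps)
    from of_nat_mono[OF this, where 'a = real]
    have "real (2 * n + 1) * real (Suc N) \<le> 2 * real (Suc n) * real (2 * N + 1)"
      by (simp only: of_nat_mult of_nat_numeral)
    then show "real (2 * n + 1) / real (2 * N + 1) \<le> 2 * (real (Suc n) / real (Suc N))"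
      by (simp add: frac_le_eq divide_simps del: of_nat_Suc of_nat_add of_nat_mult)
  qed (use A mom_pos[of n] in auto)
  finally have "mom N \<le> A * 2 ^ b * (real (Suc n) / real (Suc N)) ^ b * mom n"
    by (simp only: power_mult_distrib mult.assoc)
  then have "mom N / (2 * mom n * mom N) \<le> A * 2 ^ b * (real (Suc n) / real (Suc N)) ^ b * mom n / (2 * mom n * mom N)"
    using mom_pos[of n] mom_pos[of N] by (intro divide_right_mono) auto
  then show ?thesis
    using mom_pos[of n] mom_pos[of N] unfolding lam_def by simp
qed

lemma summable_kern:
  fixes \<eta> :: complex
  assumes "norm \<eta> < 1"
  shows "summable (\<lambda>n. norm (of_real (real (Suc n) ^ m * lam n) * \<eta> ^ n))"
proof (rule summable_comparison_test')
  show "summable (\<lambda>n. A * 2 ^ b * lam 0 * (real (Suc n) ^ (m + b) * norm \<eta> ^ n))"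
    using assms by (intro summable_mult summable_Suc_power_geometric) auto
  fix n :: nat
  have "real (Suc n) ^ m * lam n \<le> real (Suc n) ^ m * (A * 2 ^ b * (real (Suc n) / real (Suc 0)) ^ b * lam 0)"
    by (intro mult_left_mono lam_growth) auto
  also have "\<dots> = A * 2 ^ b * lam 0 * real (Suc n) ^ (m + b)" by (simp add: power_add)
  finally have "real (Suc n) ^ m * lam n * norm \<eta> ^ n \<le> A * 2 ^ b * lam 0 * real (Suc n) ^ (m + b) * norm \<eta> ^ n"
    by (intro mult_right_mono) auto
  moreover have "norm (of_real (real (Suc n) ^ m * lam n) * \<eta> ^ n) = real (Suc n) ^ m * lam n * norm \<eta> ^ n"
    unfolding norm_mult norm_power norm_of_real using lam_pos[of n] by (simp add: abs_mult)
  ultimately have "norm (of_real (real (Suc n) ^ m * lam n) * \<eta> ^ n) \<le> A * 2 ^ b * lam 0 * (real (Suc n) ^ (m + b) * norm \<eta> ^ n)"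
    by (simp only: mult.assoc)
  then show "norm (norm (of_real (real (Suc n) ^ m * lam n) * \<eta> ^ n)) \<le> A * 2 ^ b * lam 0 * (real (Suc n) ^ (m + b) * norm \<eta> ^ n)"
    by (subst real_norm_def, subst abs_norm_cancel)
qed

text \<open>Each term lies below the telescoping difference \<open>2 / x - 2 / (x + 1)\<close>,
  valid for \<open>1 \<le> x\<close>.\<close>

lemma sums_inverse_squares_bound:
  "summable (\<lambda>n. 1 / real (Suc (N + n)) ^ 2)" "(\<Sum>n. 1 / real (Suc (N + n)) ^ 2) \<le> 2 / real (Suc N)"
proof -
  have le: "1 / real (Suc (N + n)) ^ 2 \<le> 2 / real (Suc (N + n)) - 2 / real (Suc (N + Suc n))" for n
  proof -
    define x where "x = real (Suc (N + n))"
    have x: "1 \<le> x" by (simp add: x_def)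
    have "1 * (x + 1) \<le> 2 * x" using x by simp
    then have "1 * (x * (x + 1)) \<le> 2 * x\<^sup>2" using x mult_left_mono[of "x + 1" "2 * x" x] by (simp add: power2_eq_square algebra_simps)
    then have "1 / x\<^sup>2 \<le> 2 / (x * (x + 1))" using x by (simp add: divide_simps mult_ac)
    also have "\<dots> = 2 / x - 2 / (x + 1)" using x by (simp add: field_simps)
    also have "x + 1 = real (Suc (N + Suc n))" by (simp add: x_def)
    finally show ?thesis by (simp only: x_def)
  qed
  have "(\<lambda>n. 2 / real (Suc (N + n)) - 2 / real (Suc (N + Suc n))) sums (2 / real (Suc (N + 0)) - 0)"
    by (rule telescope_sums') real_asymp
  then have s: "(\<lambda>n. 2 / real (Suc (N + n)) - 2 / real (Suc (N + Suc n))) sums (2 / real (Suc N))" by simp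
  show sm: "summable (\<lambda>n. 1 / real (Suc (N + n)) ^ 2)"
  proof (rule summable_comparison_test'[OF sums_summable[OF s]])
    show "norm (1 / real (Suc (N + n)) ^ 2) \<le> 2 / real (Suc (N + n)) - 2 / real (Suc (N + Suc n))" for n
      using le[of n] by simp
  qed
  show "(\<Sum>n. 1 / real (Suc (N + n)) ^ 2) \<le> 2 / real (Suc N)"
    using suminf_le[OF le sm sums_summable[OF s]] sums_unique[OF s] by simp
qed

text \<open>Of the \<open>m + b + 2\<close> summations by parts, \<open>m\<close> compensate the
  factor \<open>real (Suc n) ^ m\<close>, \<open>b\<close> compensate the growth of
  \<open>lam\<close>, and the last two leave a convergent series of inverse squares.\<close>

lemma kern_tail:
  "\<exists>C\<ge>0. \<forall>N. \<forall>w::complex. norm w < 1 \<longrightarrow> 1 \<le> norm (1 - w) * real (Suc N) \<longrightarrow>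
    norm (\<Sum>n. of_real (real (Suc (N + n)) ^ m * lam (N + n)) * w ^ (N + n)) \<le> C * (real (Suc N) ^ m * lam N * real (Suc N))"
proof (rule symb_tail[where k = "m + b + 2" and C = "2 * A * 2 ^ b"])
  have bd: "real (Suc (N + n)) ^ m * lam (N + n) / real (Suc (N + n)) ^ (m + b + 2)
    \<le> A * 2 ^ b * lam N / real (Suc N) ^ b * (1 / real (Suc (N + n)) ^ 2)" for N n
  proof -
    have "real (Suc (N + n)) ^ m * lam (N + n) / real (Suc (N + n)) ^ (m + b + 2) = lam (N + n) / real (Suc (N + n)) ^ (b + 2)"
      by (simp add: power_add del: of_nat_Suc)
    also have "\<dots> \<le> (A * 2 ^ b * (real (Suc (N + n)) / real (Suc N)) ^ b * lam N) / real (Suc (N + n)) ^ (b + 2)"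
      by (intro divide_right_mono lam_growth) auto
    also have "\<dots> = A * 2 ^ b * lam N / real (Suc N) ^ b * (1 / real (Suc (N + n)) ^ 2)"
      by (simp add: power_add power_divide power2_eq_square del: of_nat_Suc)
    finally show ?thesis .
  qed
  have sm: "summable (\<lambda>n. real (Suc (N + n)) ^ m * lam (N + n) / real (Suc (N + n)) ^ (m + b + 2))" for N
  proof (rule summable_comparison_test'[OF summable_mult[OF sums_inverse_squares_bound(1)]])
    show "norm (real (Suc (N + n)) ^ m * lam (N + n) / real (Suc (N + n)) ^ (m + b + 2))
      \<le> A * 2 ^ b * lam N / real (Suc N) ^ b * (1 / real (Suc (N + n)) ^ 2)" for n
      using bd[of N n] lam_pos[of "N + n"] by simp
  qed
  show "symb (m + b + 2) (\<lambda>n. real (Suc n) ^ m * lam n) (\<lambda>n. real (Suc n) ^ m * lam n)"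
  proof (rule symb_mult[OF symb_Suc_power symb_lam, where D = "2 ^ m"])
    show "real (Suc (Suc n)) ^ m \<le> 2 ^ m * real (Suc n) ^ m" for n
      unfolding power_mult_distrib[symmetric] by (intro power_mono) auto
  qed (auto intro!: lam_pos[THEN less_imp_le])
  show "summable (\<lambda>n. real (Suc n) ^ m * lam n / real (Suc n) ^ (m + b + 2))"
    using sm[of 0] by simp
  show "(\<Sum>n. real (Suc (N + n)) ^ m * lam (N + n) / real (Suc (N + n)) ^ (m + b + 2))
    \<le> 2 * A * 2 ^ b * (real (Suc N) ^ m * lam N * real (Suc N) / real (Suc N) ^ (m + b + 2))" for N
  proof -
    have "(\<Sum>n. real (Suc (N + n)) ^ m * lam (N + n) / real (Suc (N + n)) ^ (m + b + 2))
      \<le> (\<Sum>n. A * 2 ^ b * lam N / real (Suc N) ^ b * (1 / real (Suc (N + n)) ^ 2))"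
      by (rule suminf_le[OF bd sm summable_mult[OF sums_inverse_squares_bound(1)]])
    also have "\<dots> = A * 2 ^ b * lam N / real (Suc N) ^ b * (\<Sum>n. 1 / real (Suc (N + n)) ^ 2)"
      by (rule suminf_mult[OF sums_inverse_squares_bound(1)])
    also have "\<dots> \<le> A * 2 ^ b * lam N / real (Suc N) ^ b * (2 / real (Suc N))"
      using A lam_pos[of N] by (intro mult_left_mono sums_inverse_squares_bound(2)) auto
    also have "\<dots> = 2 * A * 2 ^ b * (real (Suc N) ^ m * lam N * real (Suc N) / real (Suc N) ^ (m + b + 2))"
      by (simp add: power_add power2_eq_square mult_ac del: of_nat_Suc)
    finally show ?thesis .
  qed
qed (use A lam_pos[THEN less_imp_le] in auto)

lemma kern_bound_aux:
  "\<exists>C\<ge>0. \<forall>N. \<forall>w. norm w < 1 \<longrightarrow> 1 \<le> norm (1 - w) * real (Suc N) \<longrightarrow> norm (kern m w) \<le> C * (real (Suc N) ^ m * lam N * real (Suc N))"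
proof -
  obtain C where C: "0 \<le> C" and tail: "\<And>N w. norm w < 1 \<Longrightarrow> 1 \<le> norm (1 - w) * real (Suc N) \<Longrightarrow>
    norm (\<Sum>n. of_real (real (Suc (N + n)) ^ m * lam (N + n)) * w ^ (N + n) :: complex) \<le> C * (real (Suc N) ^ m * lam N * real (Suc N))"
    using kern_tail by blast
  have "norm (kern m w) \<le> (1 + C) * (real (Suc N) ^ m * lam N * real (Suc N))"
    if w: "norm w < 1" "1 \<le> norm (1 - w) * real (Suc N)" for N w
  proof -
    let ?f = "\<lambda>n. of_real (real (Suc n) ^ m * lam n) * w ^ n :: complex"
    have "summable ?f" using summable_norm_cancel[OF summable_kern[OF w(1)]] .
    then have "kern m w = (\<Sum>n. ?f (n + N)) + (\<Sum>n<N. ?f n)"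
      unfolding kern_def by (rule suminf_split_initial_segment)
    also have "(\<lambda>n. ?f (n + N)) = (\<lambda>n. ?f (N + n))" by (simp only: add.commute)
    finally have "norm (kern m w) \<le> norm (\<Sum>n. ?f (N + n)) + norm (\<Sum>n<N. ?f n)"
      by (simp only: norm_triangle_ineq)
    also have "\<dots> \<le> C * (real (Suc N) ^ m * lam N * real (Suc N)) + real N * (real (Suc N) ^ m * lam N)"
    proof (rule add_mono[OF tail[OF w]])
      have "norm (\<Sum>n<N. ?f n) \<le> real (card {..<N}) * (real (Suc N) ^ m * lam N)"
      proof (rule sum_norm_bound)
        fix n assume "n \<in> {..<N}"
        have "norm (?f n) = real (Suc n) ^ m * lam n * norm w ^ n"
          unfolding norm_mult norm_power norm_of_real using lam_pos[of n] by (simp add: abs_mult)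
        also have "\<dots> \<le> real (Suc N) ^ m * lam N * 1"
          using \<open>n \<in> {..<N}\<close> w lam_pos[THEN less_imp_le]
          by (intro mult_mono power_mono lam_mono power_le_one mult_nonneg_nonneg) auto
        finally show "norm (?f n) \<le> real (Suc N) ^ m * lam N" by simp
      qed
      then show "norm (\<Sum>n<N. ?f n) \<le> real N * (real (Suc N) ^ m * lam N)" by simp
    qed
    also have "real N * (real (Suc N) ^ m * lam N) \<le> real (Suc N) ^ m * lam N * real (Suc N)"
      using lam_pos[of N] by (simp add: mult_left_mono mult_ac)
    finally show ?thesis by (simp add: distrib_right)
  qed
  then show ?thesis using C by (intro exI[of _ "1 + C"]) auto
qed

text \<open>Two scales meet: \<open>1 / d\<close>, at which cancellation in the kernel sets in, and
  the larger \<open>1 / (1 - \<rho>)\<close> attached to the tail at \<open>\<rho>\<close>. Moment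
  decay between them produces the factor \<open>((1 - \<rho>) / d) powr a\<close>. The factor 4
  ensures that \<open>2 * N + 1\<close> lies below the upper end of the comparison.\<close>

lemma lam_le:
  assumes d: "0 < d" "d \<le> 2" "1 - \<rho> \<le> d" "real N * d \<le> 1" and \<rho>: "0 \<le> \<rho>" "\<rho> < 1"
  shows "lam N \<le> A ^ 3 * 4 ^ b * ((1 - \<rho>) / d) powr a / W \<rho>"
proof -
  define x where "x = 1 / (1 - \<rho>)"
  define y where "y = real (2 * N + 1)"
  have x: "1 \<le> x" "1 / d \<le> x" using \<rho> d by (auto simp: x_def field_simps)
  have "y \<le> 4 / d" using d by (simp add: y_def field_simps)
  moreover have "4 / d \<le> 4 * x" using x by simp
  ultimately have y: "1 \<le> y" "y \<le> 4 * x" "y / (4 * x) \<le> (1 - \<rho>) / d"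
  proof -
    have "y / (4 * x) \<le> (4 / d) / (4 * x)" using x \<open>y \<le> 4 / d\<close> by (intro divide_right_mono) auto
    also have "\<dots> = (1 - \<rho>) / d" using \<rho> d by (simp add: x_def field_simps)
    finally show "y / (4 * x) \<le> (1 - \<rho>) / d" .
  qed (auto simp: y_def)
  have "W \<rho> \<le> A * weight_moment \<omega> x" unfolding x_def using \<rho> by (intro tail_le_moment_A)
  also have "weight_moment \<omega> x \<le> A * (4 * x / x) ^ b * weight_moment \<omega> (4 * x)" using x by (intro moment_growth) auto
  also have "4 * x / x = 4" using x by simp
  also have "weight_moment \<omega> (4 * x) \<le> A * (y / (4 * x)) powr a * weight_moment \<omega> y" using y by (intro moment_decay)
  also have "\<dots> \<le> A * ((1 - \<rho>) / d) powr a * weight_moment \<omega> y"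
    using y x A a by (intro mult_right_mono mult_left_mono powr_mono2 moment_nonneg) auto
  finally have "W \<rho> \<le> A ^ 3 * 4 ^ b * ((1 - \<rho>) / d) powr a * weight_moment \<omega> y"
    using A by (simp add: mult_left_mono power3_eq_cube mult_ac)
  moreover have "0 < W \<rho>" using tail_pos \<rho> by simp
  moreover have "0 < weight_moment \<omega> y" using y by (intro moment_pos) auto
  ultimately have "1 / weight_moment \<omega> y \<le> A ^ 3 * 4 ^ b * ((1 - \<rho>) / d) powr a / W \<rho>"
    by (simp add: field_simps)
  moreover have "lam N \<le> 1 / weight_moment \<omega> y"
    using \<open>0 < weight_moment \<omega> y\<close> by (simp add: lam_def mom_def y_def field_simps)
  ultimately show ?thesis by linarith
qed

lemma kern_bound:
  "\<exists>C>0. \<forall>w. norm w < 1 \<longrightarrow>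
     norm (kern m w) \<le> C * (norm (1 - w) powr (- (1 + real m + a)) * (1 - norm w) powr a / W (norm w))"
proof -
  obtain C where C: "0 \<le> C" and bd: "\<And>N w. norm w < 1 \<Longrightarrow> 1 \<le> norm (1 - w) * real (Suc N) \<Longrightarrow>
    norm (kern m w) \<le> C * (real (Suc N) ^ m * lam N * real (Suc N))"
    using kern_bound_aux by blast
  define D where "D = 3 ^ Suc m * (A ^ 3 * 4 ^ b)"
  have D: "0 < D" using A by (simp add: D_def)
  have "norm (kern m w) \<le> (C + 1) * D * (norm (1 - w) powr (- (1 + real m + a)) * (1 - norm w) powr a / W (norm w))"
    if w: "norm w < 1" for w
  proof -
    define d where "d = norm (1 - w)"
    have d: "0 < d" "d \<le> 2" "1 - norm w \<le> d"
      using w norm_triangle_ineq4[of 1 w] norm_triangle_ineq2[of 1 w] by (auto simp: d_def)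
    \<comment> \<open>The smallest admissible scale; since \<open>d \<le> 2\<close>, also
      \<open>N + 1\<close> is at most \<open>3 / d\<close>.\<close>
    define N where "N = nat \<lfloor>1 / d\<rfloor>"
    have "real N = of_int \<lfloor>1 / d\<rfloor>" using d by (simp add: N_def)
    then have "real N \<le> 1 / d" "1 / d \<le> real (Suc N)" by linarith+
    then have N: "real N * d \<le> 1" "1 \<le> d * real (Suc N)" using d by (auto simp: field_simps)
    have SN: "real (Suc N) \<le> 3 / d"
      using N(1) d by (simp add: field_simps)
    have "norm (kern m w) \<le> C * (real (Suc N) ^ m * lam N * real (Suc N))"
      using bd[OF w] N by (simp add: d_def)
    also have "\<dots> \<le> (C + 1) * (real (Suc N) ^ Suc m * lam N)"
      using lam_pos[of N] by (simp add: mult_ac mult_right_mono distrib_right)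
    also have "\<dots> \<le> (C + 1) * ((3 / d) ^ Suc m * (A ^ 3 * 4 ^ b * ((1 - norm w) / d) powr a / W (norm w)))"
      using C SN lam_pos[of N] d w N
      by (intro mult_left_mono mult_mono power_mono lam_le) auto
    also have "(3 / d) ^ Suc m * (A ^ 3 * 4 ^ b * ((1 - norm w) / d) powr a / W (norm w))
      = D * ((1 / d ^ Suc m * (1 / d powr a)) * (1 - norm w) powr a / W (norm w))"
      using d w by (simp add: D_def power_divide powr_divide)
    also have "1 / d ^ Suc m * (1 / d powr a) = d powr (- (1 + real m + a))"
    proof -
      have "d ^ Suc m = d powr (1 + real m)" using d powr_realpow[of d "Suc m"] by (simp add: add.commute)
      then show ?thesis using d by (simp add: powr_minus_divide[symmetric] powr_add[symmetric])
    qed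
    finally show ?thesis by (simp only: d_def mult.assoc)
  qed
  then show ?thesis using C D by (intro exI[of _ "(C + 1) * D"]) auto
qed

end

section \<open>Circle means\<close>

text \<open>Cauchy's formula is applied to \<open>f\<close>, which agrees with \<open>u\<close> at
  \<open>w\<close> and is holomorphic on the closed disc of radius \<open>R\<close>. On the circle
  \<open>of_real (R\<^sup>2) - cnj w * \<zeta>\<close> equals
  \<open>\<zeta> * cnj (\<zeta> - w)\<close>, which turns the Cauchy kernel into the Poisson
  kernel.\<close>

lemma Poisson_has_integral:
  assumes u: "u holomorphic_on disc" and R: "0 < R" "R < 1" and w: "norm w < R"
  shows "((\<lambda>t. of_real ((R\<^sup>2 - (norm w)\<^sup>2) / (norm (of_real R * cis t - w))\<^sup>2) * u (of_real R * cis t))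
    has_integral (of_real (2 * pi) * u w)) {0..2 * pi}"
proof -
  define f where "f \<zeta> = u \<zeta> * of_real (R\<^sup>2 - (norm w)\<^sup>2) / (of_real (R\<^sup>2) - cnj w * \<zeta>)" for \<zeta>
  have nz: "of_real (R\<^sup>2) - cnj w * \<zeta> \<noteq> 0" if "norm \<zeta> \<le> R" for \<zeta>
  proof
    assume "of_real (R\<^sup>2) - cnj w * \<zeta> = 0"
    then have "norm (cnj w * \<zeta>) = norm (complex_of_real (R\<^sup>2))" by (simp add: algebra_simps)
    then have "norm w * norm \<zeta> = R\<^sup>2" using R by (simp add: norm_mult norm_power)
    moreover have "norm w * norm \<zeta> < R * R"
    proof (cases "\<zeta> = 0")
      case False
      then show ?thesis using that w R by (intro mult_less_le_imp_less) auto
    qed (use R in auto)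
    ultimately show False by (simp add: power2_eq_square)
  qed
  have "f holomorphic_on cball 0 R"
    unfolding f_def using R nz
    by (intro holomorphic_intros holomorphic_on_subset[OF u]) (auto simp del: of_real_power)
  then have "((\<lambda>\<zeta>. f \<zeta> / (\<zeta> - w)) has_contour_integral (2 * of_real pi * \<i> * f w)) (circlepath 0 R)"
    using w by (intro Cauchy_integral_circlepath) (auto intro: holomorphic_on_imp_continuous_on holomorphic_on_subset)
  then have "((\<lambda>t. f (0 + of_real R * cis t) / (0 + of_real R * cis t - w) * of_real R * \<i> * cis t)
      has_integral (2 * of_real pi * \<i> * f w)) {0..2 * pi}"
    unfolding circlepath_def by (subst (asm) has_contour_integral_part_circlepath_iff) auto
  then have "((\<lambda>t. (- \<i>) * (f (of_real R * cis t) / (of_real R * cis t - w) * of_real R * \<i> * cis t))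
      has_integral ((- \<i>) * (2 * of_real pi * \<i> * f w))) {0..2 * pi}"
    by (intro has_integral_mult_right) simp
  moreover have "f w = u w"
  proof -
    have "of_real (R\<^sup>2) - cnj w * w = of_real (R\<^sup>2 - (norm w)\<^sup>2)"
      by (simp add: mult.commute[of "cnj w"] complex_norm_square[symmetric] del: of_real_power)
    moreover have "of_real (R\<^sup>2) - cnj w * w \<noteq> 0" using w by (intro nz) auto
    ultimately show ?thesis by (simp add: f_def del: of_real_power of_real_diff)
  qed
  moreover have "(- \<i>) * (f (of_real R * cis t) / (of_real R * cis t - w) * of_real R * \<i> * cis t)
      = of_real ((R\<^sup>2 - (norm w)\<^sup>2) / (norm (of_real R * cis t - w))\<^sup>2) * u (of_real R * cis t)" for t
  proof -
    define \<zeta> where "\<zeta> = of_real R * cis t"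
    have n: "norm \<zeta> = R" using R by (simp add: \<zeta>_def norm_mult)
    then have "\<zeta> * cnj \<zeta> = of_real (R\<^sup>2)" by (simp add: complex_norm_square[symmetric] flip: of_real_power)
    then have e: "of_real (R\<^sup>2) - cnj w * \<zeta> = \<zeta> * cnj (\<zeta> - w)" by (simp add: algebra_simps)
    have "\<zeta> \<noteq> 0" "\<zeta> - w \<noteq> 0" using n R w by auto
    have "(- \<i>) * (f \<zeta> / (\<zeta> - w) * of_real R * \<i> * cis t) = f \<zeta> * \<zeta> / (\<zeta> - w)"
    proof -
      have "(- \<i>) * (x / y * r * \<i> * c) = x * (r * c) / y" for x y r c :: complex
      proof -
        have "(- \<i>) * (x / y * r * \<i> * c) = (- \<i> * \<i>) * (x * (r * c) / y)"
          by (simp only: mult_ac times_divide_eq_left times_divide_eq_right)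
        then show ?thesis by simp
      qed
      then show ?thesis by (simp only: \<zeta>_def)
    qed
    also have "\<dots> = u \<zeta> * of_real (R\<^sup>2 - (norm w)\<^sup>2) / ((\<zeta> - w) * cnj (\<zeta> - w))"
      unfolding f_def e using \<open>\<zeta> \<noteq> 0\<close> \<open>\<zeta> - w \<noteq> 0\<close> by (simp add: divide_simps)
    also have "(\<zeta> - w) * cnj (\<zeta> - w) = of_real ((norm (\<zeta> - w))\<^sup>2)" by (rule complex_norm_square[symmetric])
    finally show ?thesis by (simp add: \<zeta>_def)
  qed
  moreover have "(- \<i>) * (2 * of_real pi * \<i> * u w) = of_real (2 * pi) * u w"
  proof -
    have "(- \<i>) * (2 * of_real pi * \<i> * u w) = (- \<i> * \<i>) * (2 * of_real pi * u w)"
      by (simp only: mult_ac)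
    then show ?thesis by simp
  qed
  ultimately show ?thesis by (simp only:)
qed

text \<open>
  The Poisson kernel \<open>k\<close> on the circle is symmetric with mass one, so the Schur test with constant test functions
  shows that it is a contraction on \<open>L\<^sup>p\<close>.
\<close>

lemma circle_mean_mono:
  assumes u: "u holomorphic_on disc" and p: "1 < p" and r: "0 \<le> r" "r \<le> R" "R < 1"
  shows "circle_nn (\<lambda>z. ennreal (norm (u z) powr p)) (of_real r) \<le> circle_nn (\<lambda>z. ennreal (norm (u z) powr p)) (of_real R)"
proof (cases "r = R")
  case False
  with r have R: "r < R" "0 < R" by auto
  define L where "L = density lborel (indicator {0..<2 * pi} :: real \<Rightarrow> ennreal)"
  have [measurable_cong]: "sets L = sets borel" by (simp add: L_def)
  have L: "sigma_finite_measure L"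
    unfolding L_def by (subst sigma_finite_measure.sigma_finite_iff_density_finite[OF sigma_finite_lborel]) (auto simp: indicator_def)
  have int_L: "(\<integral>\<^sup>+t. f t \<partial>L) = (\<integral>\<^sup>+t\<in>{0..<2 * pi}. f t \<partial>lborel)" if "f \<in> borel_measurable borel" for f
    unfolding L_def using that by (subst nn_integral_density) (auto simp: mult.commute)
  define k where "k = (\<lambda>(\<theta>, t). (R\<^sup>2 - r\<^sup>2) / (norm (of_real R * cis t - of_real r * cis \<theta>))\<^sup>2 / (2 * pi))"
  have k: "k \<in> borel_measurable (borel \<Otimes>\<^sub>M borel)"
    unfolding k_def by measurable
  have k_nonneg: "0 \<le> k z" for z
    using R r by (cases z) (auto simp: k_def intro!: divide_nonneg_nonneg power_mono)
  \<comment> \<open>The distance depends on the two angles only through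
    \<open>cos (t - \<theta>)\<close>, an even function of the difference.\<close>
  have k_sym: "k (\<theta>, t) = k (t, \<theta>)" for \<theta> t
  proof -
    have e: "(norm (of_real R * cis t - of_real r * cis \<theta>))\<^sup>2 = R\<^sup>2 + r\<^sup>2 - 2 * R * r * cos (t - \<theta>)" for t \<theta>
    proof -
      have "(norm (of_real R * cis t - of_real r * cis \<theta>))\<^sup>2
        = (R * cos t - r * cos \<theta>)\<^sup>2 + (R * sin t - r * sin \<theta>)\<^sup>2"
        by (simp add: cmod_power2)
      also have "\<dots> = R\<^sup>2 * ((cos t)\<^sup>2 + (sin t)\<^sup>2) + r\<^sup>2 * ((cos \<theta>)\<^sup>2 + (sin \<theta>)\<^sup>2) - 2 * R * r * cos (t - \<theta>)"
      proof -
        have "(R * c - r * c')\<^sup>2 + (R * s - r * s')\<^sup>2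
          = R\<^sup>2 * (c\<^sup>2 + s\<^sup>2) + r\<^sup>2 * (c'\<^sup>2 + s'\<^sup>2) - 2 * R * r * (c * c' + s * s')" for c s c' s'
          by (simp add: power2_eq_square algebra_simps)
        then show ?thesis unfolding cos_diff .
      qed
      finally show ?thesis by simp
    qed
    show ?thesis unfolding k_def prod.case e using cos_minus[of "t - \<theta>"] by simp
  qed
  have nn: "(\<integral>\<^sup>+t\<in>{0..<2 * pi}. ennreal (f t) \<partial>lborel) = ennreal I"
    if "(f has_integral I) {0..2 * pi}" "\<And>t. 0 \<le> f t" for f I
  proof -
    have "(\<integral>\<^sup>+t. ennreal (indicator {0..2 * pi} t * f t) \<partial>lborel) = ennreal I"
      using that by (intro nn_integral_has_integral_lebesgue)
    moreover have "(\<integral>\<^sup>+t\<in>{0..<2 * pi}. ennreal (f t) \<partial>lborel) = (\<integral>\<^sup>+t. ennreal (indicator {0..2 * pi} t * f t) \<partial>lborel)"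
      by (rule nn_integral_cong_AE, use AE_lborel_singleton[of "2 * pi"] in eventually_elim) (auto simp: indicator_def)
    ultimately show ?thesis by simp
  qed
  have nw: "norm (of_real r * cis \<theta>) = r" for \<theta> using r by (simp add: norm_mult)
  have mass: "(\<integral>\<^sup>+t. ennreal (k (\<theta>, t)) \<partial>L) = 1" for \<theta>
  proof -
    have "((\<lambda>t. of_real ((R\<^sup>2 - r\<^sup>2) / (norm (of_real R * cis t - of_real r * cis \<theta>))\<^sup>2) * 1)
      has_integral (of_real (2 * pi) * (1::complex))) {0..2 * pi}"
      using Poisson_has_integral[of "\<lambda>_. 1" R "of_real r * cis \<theta>"] R r unfolding nw by simp
    then have "((\<lambda>t. Re (of_real ((R\<^sup>2 - r\<^sup>2) / (norm (of_real R * cis t - of_real r * cis \<theta>))\<^sup>2) * 1)) has_integral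
        Re (of_real (2 * pi) * (1::complex))) {0..2 * pi}"
      by (rule has_integral_linear[OF _ bounded_linear_Re, unfolded o_def])
    then have "((\<lambda>t. (R\<^sup>2 - r\<^sup>2) / (norm (of_real R * cis t - of_real r * cis \<theta>))\<^sup>2) has_integral (2 * pi)) {0..2 * pi}"
      by simp
    then have "((\<lambda>t. k (\<theta>, t)) has_integral (2 * pi / (2 * pi))) {0..2 * pi}"
      unfolding k_def prod.case by (rule has_integral_divide)
    then have "(\<integral>\<^sup>+t\<in>{0..<2 * pi}. ennreal (k (\<theta>, t)) \<partial>lborel) = ennreal (2 * pi / (2 * pi))"
      by (rule nn) (rule k_nonneg)
    then show ?thesis using k by (subst int_L) auto
  qed
  have cont: "continuous_on UNIV (\<lambda>t. u (of_real \<rho> * cis t))" if "0 \<le> \<rho>" "\<rho> < 1" for \<rho>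
    by (rule continuous_on_compose2[OF holomorphic_on_imp_continuous_on[OF u]])
       (use that in \<open>auto intro!: continuous_intros simp: norm_mult\<close>)
  have meas [measurable]: "(\<lambda>t. u (of_real \<rho> * cis t)) \<in> borel_measurable borel" if "0 \<le> \<rho>" "\<rho> < 1" for \<rho>
    using cont[OF that] by (rule borel_measurable_continuous_onI)
  have le: "ennreal (norm (u (of_real r * cis \<theta>))) \<le> (\<integral>\<^sup>+t. ennreal (k (\<theta>, t) * norm (u (of_real R * cis t))) \<partial>L)" for \<theta>
  proof -
    let ?P = "\<lambda>t. (R\<^sup>2 - r\<^sup>2) / (norm (of_real R * cis t - of_real r * cis \<theta>))\<^sup>2"
    have P: "continuous_on {0..2 * pi} ?P"
    proof -
      have "of_real R * cis t \<noteq> of_real r * cis \<theta>" for t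
        using nw[of \<theta>] R by (metis less_irrefl norm_cis norm_mult norm_of_real abs_of_pos mult.right_neutral)
      then show ?thesis by (intro continuous_intros) auto
    qed
    have P_nonneg: "0 \<le> ?P t" for t
      using R r by (intro divide_nonneg_nonneg) (auto intro!: power_mono)
    have hi: "((\<lambda>t. of_real (?P t) * u (of_real R * cis t)) has_integral (of_real (2 * pi) * u (of_real r * cis \<theta>))) {0..2 * pi}"
      using Poisson_has_integral[OF u R(2) r(3), of "of_real r * cis \<theta>"] R unfolding nw by simp
    have int: "(\<lambda>t. ?P t * norm (u (of_real R * cis t))) integrable_on {0..2 * pi}"
      using R r by (intro integrable_continuous_real continuous_on_mult P continuous_on_norm continuous_on_subset[OF cont]) auto
    have "norm (of_real (2 * pi) * u (of_real r * cis \<theta>)) \<le> integral {0..2 * pi} (\<lambda>t. ?P t * norm (u (of_real R * cis t)))"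
      unfolding integral_unique[OF hi, symmetric]
    proof (rule integral_norm_bound_integral[OF has_integral_integrable[OF hi] int])
      show "norm (of_real (?P t) * u (of_real R * cis t)) \<le> ?P t * norm (u (of_real R * cis t))" for t
        by (simp only: norm_mult norm_of_real abs_of_nonneg[OF P_nonneg] order_refl)
    qed
    then have "norm (u (of_real r * cis \<theta>)) \<le> integral {0..2 * pi} (\<lambda>t. ?P t * norm (u (of_real R * cis t))) / (2 * pi)"
      by (simp add: norm_mult field_simps)
    then have "ennreal (norm (u (of_real r * cis \<theta>))) \<le> ennreal (integral {0..2 * pi} (\<lambda>t. ?P t * norm (u (of_real R * cis t))) / (2 * pi))"
      by (rule ennreal_leI)
    also have "\<dots> = (\<integral>\<^sup>+t\<in>{0..<2 * pi}. ennreal (?P t * norm (u (of_real R * cis t)) / (2 * pi)) \<partial>lborel)"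
      by (intro nn[symmetric] has_integral_divide integrable_integral int divide_nonneg_pos mult_nonneg_nonneg P_nonneg) auto
    also have "\<dots> = (\<integral>\<^sup>+t. ennreal (k (\<theta>, t) * norm (u (of_real R * cis t))) \<partial>L)"
      using k R r by (subst int_L) (auto simp: k_def)
    finally show ?thesis .
  qed
  have "(\<integral>\<^sup>+\<theta>. ennreal (norm (u (of_real r * cis \<theta>)) powr p) \<partial>L)
    \<le> ennreal (1 powr (p - 1) * 1) * (\<integral>\<^sup>+t. ennreal (norm (u (of_real R * cis t)) powr p) \<partial>L)"
  proof (rule schur_test[where k = k and hM = "\<lambda>_. 1" and hN = "\<lambda>_. 1" and q = "p / (p - 1)"])
    show "ennreal (norm (u (of_real r * cis x))) \<le> (\<integral>\<^sup>+y. ennreal (k (x, y) * norm (u (of_real R * cis y))) \<partial>L)" for x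
      by (rule le)
    show "(\<integral>\<^sup>+y. ennreal (k (x, y) * 1 powr (p / (p - 1))) \<partial>L) \<le> ennreal (1 * 1 powr (p / (p - 1)))" for x
      by (simp add: mass)
    show "(\<integral>\<^sup>+x. ennreal (k (x, y) * 1 powr p) \<partial>L) \<le> ennreal (1 * 1 powr p)" for y
      using mass[of y] by (simp add: k_sym[of _ y])
    show "k \<in> borel_measurable (L \<Otimes>\<^sub>M L)" using k by measurable
    show "(\<lambda>y. norm (u (of_real R * cis y))) \<in> borel_measurable L"
      using measurable_compose[OF meas[of R] borel_measurable_norm] R r by (simp add: L_def)
  qed (use p L k_nonneg in auto)
  then have "(\<integral>\<^sup>+\<theta>. ennreal (norm (u (of_real r * cis \<theta>)) powr p) \<partial>L) \<le> (\<integral>\<^sup>+t. ennreal (norm (u (of_real R * cis t)) powr p) \<partial>L)"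
    by simp
  then show ?thesis
    unfolding circle_nn_def using R r by (subst (asm) (1 2) int_L) auto
qed simp

text \<open>The right side dominates both \<open>(1 - \<rho>) / pi\<close> and
  \<open>t / pi\<close>, hence their mean. The bound by \<open>t / pi\<close> needs three ranges: up
  to \<open>pi / 3\<close> the sine is at least \<open>t / 2\<close>, up to \<open>pi / 2\<close> it
  is at least \<open>1 / 2\<close>, and beyond that the distance itself is at least 1.\<close>

lemma norm_one_minus_cis_ge:
  assumes \<rho>: "0 \<le> \<rho>" "\<rho> < 1" and t: "0 \<le> t" "t \<le> pi"
  shows "(1 - \<rho> + t) / (2 * pi) \<le> norm (1 - of_real \<rho> * cis t)"
proof -
  have sq: "(norm (1 - of_real \<rho> * cis t))\<^sup>2 = (\<rho> - cos t)\<^sup>2 + (sin t)\<^sup>2"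
  proof -
    have "(norm (1 - of_real \<rho> * cis t))\<^sup>2 = (1 - \<rho> * cos t)\<^sup>2 + (\<rho> * sin t)\<^sup>2"
      by (simp add: cmod_power2)
    also have "\<dots> = 1 + \<rho>\<^sup>2 * ((cos t)\<^sup>2 + (sin t)\<^sup>2) - 2 * \<rho> * cos t"
    proof -
      have "(1 - \<rho> * c)\<^sup>2 + (\<rho> * s)\<^sup>2 = 1 + \<rho>\<^sup>2 * (c\<^sup>2 + s\<^sup>2) - 2 * \<rho> * c" for c s
        by (simp add: power2_eq_square algebra_simps)
      then show ?thesis .
    qed
    also have "\<dots> = ((cos t)\<^sup>2 + (sin t)\<^sup>2) + \<rho>\<^sup>2 - 2 * \<rho> * cos t" by simp
    also have "\<dots> = (\<rho> - cos t)\<^sup>2 + (sin t)\<^sup>2" by (simp only: power2_diff)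
    finally show ?thesis .
  qed
  have sin_le: "sin t \<le> norm (1 - of_real \<rho> * cis t)"
    by (rule power2_le_imp_le) (simp_all only: sq zero_le_power2 le_add_same_cancel2 norm_ge_zero)
  have "t / pi \<le> norm (1 - of_real \<rho> * cis t)"
  proof -
    consider "t \<le> pi / 3" | "pi / 3 \<le> t" "t \<le> pi / 2" | "pi / 2 \<le> t" by linarith
    then show ?thesis
    proof cases
      case 1
      have "t / 2 \<le> sin t"
      proof (cases "t = 0")
        case False
        then obtain z where z: "0 < z" "z < t" "sin t - sin 0 = (t - 0) * cos z"
          using MVT2[of 0 t sin cos] t by auto
        have "cos (pi / 3) \<le> cos z" using z 1 by (intro cos_monotone_0_pi_le) auto
        then have "t * (1 / 2) \<le> t * cos z" using t by (intro mult_left_mono) (auto simp: cos_60)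
        then show ?thesis using z by simp
      qed simp
      moreover have "t / pi \<le> t / 2" using t pi_ge_two by (intro divide_left_mono) auto
      moreover note sin_le
      ultimately show ?thesis by linarith
    next
      case 2
      have "sin (pi / 6) \<le> sin t" using 2 by (intro sin_monotone_2pi_le) auto
      moreover have "t / pi \<le> 1 / 2" using 2 by (simp add: field_simps)
      moreover note sin_le
      ultimately show ?thesis unfolding sin_30 by linarith
    next
      case 3
      have "cos t \<le> cos (pi / 2)" using 3 t by (intro cos_monotone_0_pi_le) auto
      then have c: "cos t \<le> 0" by simp
      have "1\<^sup>2 = (cos t)\<^sup>2 + (sin t)\<^sup>2" by simp
      also have "\<dots> \<le> (\<rho> - cos t)\<^sup>2 + (sin t)\<^sup>2"
        using c \<rho> power_mono[of "- cos t" "\<rho> - cos t" 2] by (intro add_right_mono) simp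
      finally have "1 \<le> norm (1 - of_real \<rho> * cis t)" unfolding sq[symmetric] by (rule power2_le_imp_le) simp
      moreover have "t / pi \<le> 1" using t by simp
      ultimately show ?thesis by linarith
    qed
  qed
  moreover have "(1 - \<rho>) / pi \<le> norm (1 - of_real \<rho> * cis t)"
  proof -
    have "norm (1::complex) - norm (of_real \<rho> * cis t) \<le> norm (1 - of_real \<rho> * cis t)" by (rule norm_triangle_ineq2)
    moreover have "(1 - \<rho>) / pi \<le> 1 - \<rho>" using \<rho> pi_ge_two mult_left_mono[of 1 pi "1 - \<rho>"] by (simp add: divide_le_eq)
    ultimately show ?thesis using \<rho> by (simp add: norm_mult)
  qed
  moreover have "(1 - \<rho> + t) / (2 * pi) = ((1 - \<rho>) / pi + t / pi) / 2" by (simp add: field_simps)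
  moreover have "(x + y) / 2 \<le> z" if "x \<le> z" "y \<le> z" for x y z :: real using that by simp
  ultimately show ?thesis by (simp only:)
qed

text \<open>Reflection of the angle reduces to a half circle, where
  \<open>norm_one_minus_cis_ge\<close> replaces the distance by a multiple of
  \<open>1 - \<rho> + t\<close>, whose power is integrated explicitly. The condition
  \<open>1 < q\<close> makes the point \<open>t = 0\<close> dominate.\<close>

lemma circle_nn_one_minus:
  assumes q: "1 < q" and c: "norm c < 1"
  shows "circle_nn (\<lambda>z. ennreal (norm (1 - z) powr (-q))) c \<le> ennreal (2 * (2 * pi) powr q / (q - 1) * (1 - norm c) powr (1 - q))"
proof -
  define \<rho> where "\<rho> = norm c"
  have \<rho>: "0 \<le> \<rho>" "\<rho> < 1" using c by (auto simp: \<rho>_def)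
  define h where "h t = ennreal (norm (1 - of_real \<rho> * cis t) powr (-q))" for t
  have [measurable]: "h \<in> borel_measurable borel" unfolding h_def by measurable
  have refl: "h (2 * pi + (-1) * t) = h t" for t
  proof -
    have "1 - of_real \<rho> * cis (2 * pi + (-1) * t) = cnj (1 - of_real \<rho> * cis t)"
      by (simp add: complex_eq_iff sin_diff cos_diff)
    then show ?thesis by (simp only: h_def complex_mod_cnj)
  qed
  have "circle_nn (\<lambda>z. ennreal (norm (1 - z) powr (-q))) c = (\<integral>\<^sup>+t\<in>{0..<2 * pi}. h t \<partial>lborel)"
    by (subst circle_nn_norm) (auto simp: circle_nn_def h_def \<rho>_def)
  also have "\<dots> = (\<integral>\<^sup>+t. h t * indicator {0..<pi} t + h t * indicator {pi..<2 * pi} t \<partial>lborel)"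
    by (intro nn_integral_cong) (auto simp: indicator_def)
  also have "\<dots> = (\<integral>\<^sup>+t\<in>{0..<pi}. h t \<partial>lborel) + (\<integral>\<^sup>+t\<in>{pi..<2 * pi}. h t \<partial>lborel)"
    by (rule nn_integral_add) measurable
  also have "(\<integral>\<^sup>+t\<in>{pi..<2 * pi}. h t \<partial>lborel) = ennreal \<bar>-1\<bar> * (\<integral>\<^sup>+t. h (2 * pi + (-1) * t) * indicator {pi..<2 * pi} (2 * pi + (-1) * t) \<partial>lborel)"
    by (rule nn_integral_real_affine[where c = "-1" and t = "2 * pi"]) auto
  also have "\<dots> = (\<integral>\<^sup>+t\<in>{0..<pi}. h t \<partial>lborel)"
    unfolding refl
    by (simp, rule nn_integral_cong_AE, use AE_lborel_singleton[of 0] AE_lborel_singleton[of pi] in eventually_elim)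
       (auto simp: indicator_def)
  also have "(\<integral>\<^sup>+t\<in>{0..<pi}. h t \<partial>lborel) + (\<integral>\<^sup>+t\<in>{0..<pi}. h t \<partial>lborel) = 2 * (\<integral>\<^sup>+t\<in>{0..<pi}. h t \<partial>lborel)"
    by (simp add: mult_2)
  also have "(\<integral>\<^sup>+t\<in>{0..<pi}. h t \<partial>lborel) \<le> (\<integral>\<^sup>+t. ennreal ((2 * pi) powr q) * (ennreal ((1 - \<rho> + t) powr (-q)) * indicator {0..<pi} t) \<partial>lborel)"
  proof (rule nn_integral_mono)
    fix t :: real
    have "norm (1 - of_real \<rho> * cis t) powr (-q) \<le> (2 * pi) powr q * (1 - \<rho> + t) powr (-q)" if "0 \<le> t" "t < pi"
    proof -
      have "norm (1 - of_real \<rho> * cis t) powr (-q) \<le> ((1 - \<rho> + t) / (2 * pi)) powr (-q)"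
        using that \<rho> q by (intro powr_mono2' norm_one_minus_cis_ge) auto
      also have "\<dots> = (2 * pi) powr q * (1 - \<rho> + t) powr (-q)"
        using that \<rho> by (simp add: powr_divide powr_minus field_simps)
      finally show ?thesis .
    qed
    then show "h t * indicator {0..<pi} t \<le> ennreal ((2 * pi) powr q) * (ennreal ((1 - \<rho> + t) powr (-q)) * indicator {0..<pi} t)"
      by (auto simp: h_def indicator_def ennreal_mult[symmetric] intro!: ennreal_leI)
  qed
  also have "\<dots> = ennreal ((2 * pi) powr q) * (\<integral>\<^sup>+t\<in>{0..<pi}. ennreal ((1 - \<rho> + t) powr (-q)) \<partial>lborel)"
    by (rule nn_integral_cmult) measurable
  also have "(\<integral>\<^sup>+t\<in>{0..<pi}. ennreal ((1 - \<rho> + t) powr (-q)) \<partial>lborel)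
    = ennreal (- ((1 - \<rho> + pi) powr (1 - q) / (q - 1)) - (- ((1 - \<rho> + 0) powr (1 - q) / (q - 1))))"
  proof (rule nn_integral_FTC_interior)
    show "continuous_on {0..pi} (\<lambda>t. - ((1 - \<rho> + t) powr (1 - q) / (q - 1)))"
      using \<rho> q by (intro continuous_intros) auto
    show "((\<lambda>t. - ((1 - \<rho> + t) powr (1 - q) / (q - 1))) has_real_derivative (1 - \<rho> + x) powr (- q)) (at x)" if "0 < x" for x
    proof -
      have "((\<lambda>t. - ((1 - \<rho> + t) powr (1 - q) / (q - 1))) has_real_derivative - ((1 - q) * (1 - \<rho> + x) powr (1 - q - 1) / (q - 1))) (at x)"
        using that \<rho> q by (auto intro!: derivative_eq_intros)
      moreover have "- ((1 - q) * (1 - \<rho> + x) powr (1 - q - 1) / (q - 1)) = (1 - \<rho> + x) powr (- q)"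
        using q by (simp add: field_simps)
      ultimately show ?thesis by simp
    qed
  qed auto
  also have "\<dots> \<le> ennreal ((1 - \<rho>) powr (1 - q) / (q - 1))"
    using q by (intro ennreal_leI) auto
  finally have "circle_nn (\<lambda>z. ennreal (norm (1 - z) powr (-q))) c
    \<le> 2 * (ennreal ((2 * pi) powr q) * ennreal ((1 - \<rho>) powr (1 - q) / (q - 1)))"
    by (simp add: mult_left_mono)
  also have "\<dots> = ennreal (2 * (2 * pi) powr q / (q - 1) * (1 - norm c) powr (1 - q))"
    using q by (simp add: \<rho>_def ennreal_mult[symmetric] ennreal_numeral[symmetric] del: ennreal_numeral)
  finally show ?thesis .
qed

section \<open>Fourier series on circles, Taylor coefficients and Parseval's formula\<close>

lemma measurable_cnj [measurable]: "cnj \<in> borel_measurable borel"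
  by (intro borel_measurable_continuous_onI continuous_intros)

text \<open>Accompanies \<open>circle_nn\<close> because Fourier coefficients are complex-valued
  integrals; as a finite measure it makes bounded functions integrable.\<close>

definition circle_measure :: "real measure" where
  "circle_measure = density lborel (indicator {0..<2 * pi})"

lemma sets_circle_measure [simp, measurable_cong]: "sets circle_measure = sets borel"
  and space_circle_measure [simp]: "space circle_measure = UNIV"
  by (simp_all add: circle_measure_def)

lemma nn_integral_circle_measure:
  assumes [measurable]: "f \<in> borel_measurable borel"
  shows "(\<integral>\<^sup>+t. f t \<partial>circle_measure) = (\<integral>\<^sup>+t\<in>{0..<2 * pi}. f t \<partial>lborel)"
  unfolding circle_measure_def by (subst nn_integral_density) (auto simp: mult.commute)

lemma emeasure_circle_measure: "emeasure circle_measure UNIV = ennreal (2 * pi)"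
  using nn_integral_circle_measure[of "\<lambda>_. 1"] by simp

interpretation circle: finite_measure circle_measure
  by standard (simp add: emeasure_circle_measure)

lemma measure_circle_measure: "measure circle_measure UNIV = 2 * pi"
  by (simp add: measure_def emeasure_circle_measure)

lemma integrable_circle_bounded:
  fixes f :: "real \<Rightarrow> complex"
  assumes "f \<in> borel_measurable borel" "\<And>t. norm (f t) \<le> B"
  shows "integrable circle_measure f"
  using assms by (intro circle.integrable_const_bound[where B = B]) auto

lemma integral_cis_circle: "(\<integral>t. cis (real_of_int k * t) \<partial>circle_measure) = (if k = 0 then of_real (2 * pi) else 0)"
proof (cases "k = 0")
  case False
  have "((\<lambda>t. cis (real_of_int k * t)) has_integral (- \<i> * cis (real_of_int k * (2 * pi)) / of_int k - (- \<i> * cis (real_of_int k * 0) / of_int k))) {0..2 * pi}"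
  proof (rule fundamental_theorem_of_calculus)
    fix x :: real
    have "((\<lambda>z. - \<i> * exp (\<i> * of_int k * z) / of_int k) has_field_derivative exp (\<i> * of_int k * of_real x)) (at (of_real x))"
      using False by (auto intro!: derivative_eq_intros)
    from has_vector_derivative_real_field[OF this]
    show "((\<lambda>t. - \<i> * cis (real_of_int k * t) / of_int k) has_vector_derivative cis (real_of_int k * x)) (at x within {0..2 * pi})"
      by (simp add: cis_conv_exp mult.assoc)
  qed simp
  moreover have "cis (real_of_int k * (2 * pi)) = 1"
    by (metis cis_2pi cis_multiple_2pi Ints_of_int mult.commute)
  ultimately have hi: "((\<lambda>t. cis (real_of_int k * t)) has_integral 0) {0..2 * pi}" by simp
  have int: "set_integrable lborel {0..<2 * pi} (\<lambda>t. cis (real_of_int k * t))"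
    unfolding set_integrable_def
    by (rule integrableI_bounded_set_indicator[where B = 1]) auto
  have "(\<integral>t. cis (real_of_int k * t) \<partial>circle_measure) = (\<integral>t. indicator {0..<2 * pi} t *\<^sub>R cis (real_of_int k * t) \<partial>lborel)"
    unfolding circle_measure_def ennreal_indicator[symmetric] by (subst integral_density) auto
  also have "\<dots> = integral {0..<2 * pi} (\<lambda>t. cis (real_of_int k * t))"
    using set_borel_integral_eq_integral(2)[OF int] by (simp add: set_lebesgue_integral_def)
  also have "\<dots> = integral {0..2 * pi} (\<lambda>t. cis (real_of_int k * t))"
    by (rule integral_subset_negligible)
       (auto intro!: negligible_subset[OF negligible_sing[of "2 * pi"]])
  also have "\<dots> = 0" using hi by (rule integral_unique)
  finally show ?thesis using False by simp
qed (simp add: measure_circle_measure scaleR_conv_of_real)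

lemma integral_circle_power_orthogonal:
  "(\<integral>t. (of_real r * cis t) ^ n * cnj ((of_real r * cis t) ^ m) \<partial>circle_measure) = (if n = m then of_real (2 * pi * r ^ (2 * n)) else 0)"
proof -
  have "(of_real r * cis t) ^ n * cnj ((of_real r * cis t) ^ m) = of_real (r ^ (n + m)) * cis (real_of_int (int n - int m) * t)" for t
    by (simp add: power_mult_distrib Complex.DeMoivre cis_cnj cis_mult power_add algebra_simps)
  then have "(\<integral>t. (of_real r * cis t) ^ n * cnj ((of_real r * cis t) ^ m) \<partial>circle_measure)
    = of_real (r ^ (n + m)) * (\<integral>t. cis (real_of_int (int n - int m) * t) \<partial>circle_measure)"
    by simp
  also have "\<dots> = (if n = m then of_real (2 * pi * r ^ (2 * n)) else 0)"
    unfolding integral_cis_circle mult_2[of n] by (simp add: mult.commute)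
  finally show ?thesis .
qed

text \<open>Absolute convergence at radius \<open>r\<close> dominates all partial sums uniformly in
  the angle. The factor \<open>\<phi>\<close> is an arbitrary bounded function so that Parseval's
  formula can expand first one and then the other of its two functions.\<close>

lemma circle_integral_power_series:
  fixes \<phi> :: "real \<Rightarrow> complex"
  assumes s: "summable (\<lambda>n. norm (a n) * r ^ n)" and r: "0 \<le> r"
    and \<phi> [measurable]: "\<phi> \<in> borel_measurable borel" and B: "\<And>t. norm (\<phi> t) \<le> B"
  shows "(\<integral>t. (\<Sum>n. a n * (of_real r * cis t) ^ n) * \<phi> t \<partial>circle_measure)
      = (\<Sum>n. a n * (\<integral>t. (of_real r * cis t) ^ n * \<phi> t \<partial>circle_measure))"
    and "summable (\<lambda>n. norm (a n * (\<integral>t. (of_real r * cis t) ^ n * \<phi> t \<partial>circle_measure)))"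
proof -
  have bd: "norm (a n * (of_real r * cis t) ^ n * \<phi> t) \<le> norm (a n) * r ^ n * B" for n t
    using B[of t] r by (simp add: norm_mult norm_power mult_left_mono)
  have int: "integrable circle_measure (\<lambda>t. a n * (of_real r * cis t) ^ n * \<phi> t)" for n
    by (rule integrable_circle_bounded[OF _ bd]) measurable
  have sB: "summable (\<lambda>n. norm (a n) * r ^ n * B)" using s by (rule summable_mult2)
  have sn: "summable (\<lambda>n. norm (a n * (of_real r * cis t) ^ n * \<phi> t))" for t
    by (rule summable_comparison_test'[OF sB]) (use bd in auto)
  have si: "summable (\<lambda>n. \<integral>t. norm (a n * (of_real r * cis t) ^ n * \<phi> t) \<partial>circle_measure)"
  proof (rule summable_comparison_test'[OF summable_mult2[OF sB, of "2 * pi"]])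
    fix n :: nat
    have "(\<integral>t. norm (a n * (of_real r * cis t) ^ n * \<phi> t) \<partial>circle_measure) \<le> (\<integral>t. norm (a n) * r ^ n * B \<partial>circle_measure)"
      by (intro integral_mono integrable_norm int bd) simp
    then show "norm (\<integral>t. norm (a n * (of_real r * cis t) ^ n * \<phi> t) \<partial>circle_measure) \<le> norm (a n) * r ^ n * B * (2 * pi)"
      by (simp add: measure_circle_measure mult_ac)
  qed
  have sp: "summable (\<lambda>n. a n * (of_real r * cis t) ^ n)" for t
    by (rule summable_norm_cancel, rule summable_comparison_test'[OF s]) (use r in \<open>simp add: norm_mult norm_power\<close>)
  have "(\<integral>t. (\<Sum>n. a n * (of_real r * cis t) ^ n) * \<phi> t \<partial>circle_measure)
      = (\<integral>t. (\<Sum>n. a n * (of_real r * cis t) ^ n * \<phi> t) \<partial>circle_measure)"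
    by (intro Bochner_Integration.integral_cong refl suminf_mult2[OF sp])
  also have "\<dots> = (\<Sum>n. \<integral>t. a n * (of_real r * cis t) ^ n * \<phi> t \<partial>circle_measure)"
    by (rule integral_suminf[OF int _ si]) (use sn in auto)
  also have "\<dots> = (\<Sum>n. a n * (\<integral>t. (of_real r * cis t) ^ n * \<phi> t \<partial>circle_measure))"
    by (simp add: mult.assoc)
  finally show "(\<integral>t. (\<Sum>n. a n * (of_real r * cis t) ^ n) * \<phi> t \<partial>circle_measure)
      = (\<Sum>n. a n * (\<integral>t. (of_real r * cis t) ^ n * \<phi> t \<partial>circle_measure))" .
  have eq: "(\<integral>t. a n * (of_real r * cis t) ^ n * \<phi> t \<partial>circle_measure)
      = a n * (\<integral>t. (of_real r * cis t) ^ n * \<phi> t \<partial>circle_measure)" for n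
    by (simp add: mult.assoc)
  show "summable (\<lambda>n. norm (a n * (\<integral>t. (of_real r * cis t) ^ n * \<phi> t \<partial>circle_measure)))"
  proof (rule summable_comparison_test'[OF si])
    fix n :: nat
    have "norm (\<integral>t. a n * (of_real r * cis t) ^ n * \<phi> t \<partial>circle_measure) \<le> (\<integral>t. norm (a n * (of_real r * cis t) ^ n * \<phi> t) \<partial>circle_measure)"
      by (rule integral_norm_bound)
    then show "norm (norm (a n * (\<integral>t. (of_real r * cis t) ^ n * \<phi> t \<partial>circle_measure))) \<le> (\<integral>t. norm (a n * (of_real r * cis t) ^ n * \<phi> t) \<partial>circle_measure)"
      by (simp only: eq real_norm_def abs_norm_cancel)
  qed
qed

text \<open>The coefficients appear as an explicit sequence, so that multipliers such as
  \<open>n + 1\<close> and \<open>lam n\<close> can be applied to them directly.\<close>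

definition taylor :: "(complex \<Rightarrow> complex) \<Rightarrow> (nat \<Rightarrow> complex) \<Rightarrow> bool" where
  "taylor f a \<longleftrightarrow> (\<forall>z\<in>disc. (\<lambda>n. a n * z ^ n) sums f z)"

lemma taylor_exists:
  assumes "f holomorphic_on disc"
  obtains a where "taylor f a"
proof (rule that)
  show "taylor f (\<lambda>n. (deriv ^^ n) f 0 / fact n)"
    unfolding taylor_def using holomorphic_power_series[OF assms] by simp
qed

lemma taylor_conv_radius:
  assumes "taylor f a"
  shows "1 \<le> conv_radius a"
proof (rule conv_radius_geI_ex)
  fix r :: real assume r: "0 < r" "ereal r < 1"
  then have "complex_of_real r \<in> disc" by simp
  then have "(\<lambda>n. a n * of_real r ^ n) sums f (of_real r)"
    using assms unfolding taylor_def by blast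
  then have "summable (\<lambda>n. a n * of_real r ^ n)" by (rule sums_summable)
  then show "\<exists>z. norm z = r \<and> summable (\<lambda>n. a n * z ^ n)"
    using r by (intro exI[of _ "of_real r"]) auto
qed

lemma taylor_abs_summable:
  assumes "taylor f a" "0 \<le> r" "r < 1"
  shows "summable (\<lambda>n. norm (a n) * r ^ n)"
proof -
  have "ereal (norm (complex_of_real r)) < 1" using assms by simp
  also have "1 \<le> conv_radius a" by (rule taylor_conv_radius) fact
  finally have "summable (\<lambda>n. norm (a n * of_real r ^ n))"
    by (rule abs_summable_in_conv_radius)
  then show ?thesis using assms by (simp add: norm_mult norm_power)
qed

lemma taylor_eq: "taylor f a \<Longrightarrow> norm z < 1 \<Longrightarrow> f z = (\<Sum>n. a n * z ^ n)"
  unfolding taylor_def by (auto simp: sums_iff)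

lemma taylor_holomorphic:
  assumes "taylor f a"
  shows "f holomorphic_on disc"
proof -
  have "(\<lambda>n. a n * (z - 0) ^ n) sums f z" if "z \<in> disc" for z
    using assms that by (simp add: taylor_def)
  then show ?thesis by (rule power_series_holomorphic)
qed

lemma taylorI: "(\<And>z. norm z < 1 \<Longrightarrow> summable (\<lambda>n. a n * z ^ n)) \<Longrightarrow> taylor (\<lambda>z. \<Sum>n. a n * z ^ n) a"
  unfolding taylor_def by (auto intro: summable_sums)

lemma holomorphic_circle_measurable:
  assumes u: "continuous_on disc u" and r: "0 \<le> r" "r < 1"
  shows "(\<lambda>t. u (of_real r * cis t)) \<in> borel_measurable borel"
proof (rule borel_measurable_continuous_onI)
  show "continuous_on UNIV (\<lambda>t. u (of_real r * cis t))"
    by (rule continuous_on_compose2[OF u]) (use r in \<open>auto intro!: continuous_intros simp: norm_mult\<close>)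
qed

lemma circle_bounded:
  fixes u :: "complex \<Rightarrow> complex"
  assumes u: "continuous_on disc u" and r: "0 \<le> r" "r < 1"
  obtains B where "\<And>t. norm (u (of_real r * cis t)) \<le> B"
proof -
  have "compact (u ` cball 0 r)"
    using u r by (intro compact_continuous_image continuous_on_subset[OF u]) auto
  then obtain B where "\<And>x. x \<in> u ` cball 0 r \<Longrightarrow> norm x \<le> B"
    using compact_imp_bounded bounded_iff by metis
  then show ?thesis using r by (intro that[of B]) (auto simp: norm_mult)
qed

text \<open>Expanding \<open>f\<close> leaves integrals of monomials against the conjugate of
  \<open>h\<close>. Expanding \<open>h\<close> in these, orthogonality retains a single
  coefficient.\<close>

lemma Parseval_circle:
  assumes f: "taylor f a" and h: "taylor h b" and r: "0 \<le> r" "r < 1"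
  shows "(\<integral>t. f (of_real r * cis t) * cnj (h (of_real r * cis t)) \<partial>circle_measure)
    = of_real (2 * pi) * (\<Sum>n. a n * cnj (b n) * of_real (r ^ (2 * n)))"
    and "summable (\<lambda>n. norm (a n * cnj (b n)) * r ^ (2 * n))"
proof -
  have ch: "continuous_on disc h" using taylor_holomorphic[OF h] holomorphic_on_imp_continuous_on by blast
  obtain B where B: "\<And>t. norm (h (of_real r * cis t)) \<le> B" using circle_bounded[OF ch r] by blast
  have [measurable]: "(\<lambda>t. h (of_real r * cis t)) \<in> borel_measurable borel"
    by (rule holomorphic_circle_measurable[OF ch r])
  have nr: "norm (of_real r * cis t) < 1" for t using r by (simp add: norm_mult)
  have inner: "(\<integral>t. (of_real r * cis t) ^ n * cnj (h (of_real r * cis t)) \<partial>circle_measure) = cnj (b n) * of_real (2 * pi * r ^ (2 * n))" for n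
  proof -
    have "(\<integral>t. h (of_real r * cis t) * cnj ((of_real r * cis t) ^ n) \<partial>circle_measure)
      = (\<integral>t. (\<Sum>m. b m * (of_real r * cis t) ^ m) * cnj ((of_real r * cis t) ^ n) \<partial>circle_measure)"
    proof (rule Bochner_Integration.integral_cong)
      fix t :: real
      have "h (of_real r * cis t) = (\<Sum>m. b m * (of_real r * cis t) ^ m)" by (rule taylor_eq[OF h nr])
      then show "h (of_real r * cis t) * cnj ((of_real r * cis t) ^ n) = (\<Sum>m. b m * (of_real r * cis t) ^ m) * cnj ((of_real r * cis t) ^ n)"
        by (rule arg_cong)
    qed (rule refl)
    also have "\<dots> = (\<Sum>m. b m * (\<integral>t. (of_real r * cis t) ^ m * cnj ((of_real r * cis t) ^ n) \<partial>circle_measure))"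
    proof (rule circle_integral_power_series(1)[OF taylor_abs_summable[OF h r] r(1)])
      show "(\<lambda>t. cnj ((of_real r * cis t) ^ n)) \<in> borel_measurable borel" by measurable
      show "norm (cnj ((of_real r * cis t) ^ n)) \<le> 1" for t
        unfolding complex_mod_cnj norm_power using nr[of t] by (intro power_le_one) auto
    qed
    also have "\<dots> = (\<Sum>m. if m = n then b n * of_real (2 * pi * r ^ (2 * n)) else 0)"
      unfolding integral_circle_power_orthogonal by (intro suminf_cong) auto
    also have "\<dots> = b n * of_real (2 * pi * r ^ (2 * n))" by (subst suminf_finite[of "{n}"]) auto
    finally have "cnj (\<integral>t. h (of_real r * cis t) * cnj ((of_real r * cis t) ^ n) \<partial>circle_measure) = cnj (b n * of_real (2 * pi * r ^ (2 * n)))"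
      by simp
    also have "cnj (\<integral>t. h (of_real r * cis t) * cnj ((of_real r * cis t) ^ n) \<partial>circle_measure)
      = (\<integral>t. cnj (h (of_real r * cis t) * cnj ((of_real r * cis t) ^ n)) \<partial>circle_measure)"
      by (rule Bochner_Integration.integral_cnj[symmetric])
    finally show ?thesis by (simp add: mult.commute)
  qed
  have hm: "(\<lambda>t. cnj (h (of_real r * cis t))) \<in> borel_measurable borel" by measurable
  have B': "norm (cnj (h (of_real r * cis t))) \<le> B" for t using B by simp
  have "(\<integral>t. f (of_real r * cis t) * cnj (h (of_real r * cis t)) \<partial>circle_measure)
    = (\<integral>t. (\<Sum>n. a n * (of_real r * cis t) ^ n) * cnj (h (of_real r * cis t)) \<partial>circle_measure)"
  proof (rule Bochner_Integration.integral_cong)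
    fix t :: real
    have "f (of_real r * cis t) = (\<Sum>n. a n * (of_real r * cis t) ^ n)" by (rule taylor_eq[OF f nr])
    then show "f (of_real r * cis t) * cnj (h (of_real r * cis t)) = (\<Sum>n. a n * (of_real r * cis t) ^ n) * cnj (h (of_real r * cis t))"
      by (rule arg_cong)
  qed (rule refl)
  also have "\<dots> = (\<Sum>n. a n * (\<integral>t. (of_real r * cis t) ^ n * cnj (h (of_real r * cis t)) \<partial>circle_measure))"
    by (rule circle_integral_power_series(1)[OF taylor_abs_summable[OF f r] r(1) _ B']) measurable
  also have "\<dots> = (\<Sum>n. of_real (2 * pi) * (a n * cnj (b n) * of_real (r ^ (2 * n))))"
    unfolding inner by (intro suminf_cong) simp
  also have "\<dots> = of_real (2 * pi) * (\<Sum>n. a n * cnj (b n) * of_real (r ^ (2 * n)))"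
  proof (rule suminf_mult)
    have "summable (\<lambda>n. norm (a n * (cnj (b n) * of_real (2 * pi * r ^ (2 * n)))))"
      by (rule circle_integral_power_series(2)[OF taylor_abs_summable[OF f r] r(1) hm B', unfolded inner])
    then have "summable (\<lambda>n. a n * (cnj (b n) * of_real (2 * pi * r ^ (2 * n))))" by (rule summable_norm_cancel)
    then have "summable (\<lambda>n. of_real (2 * pi) * (a n * cnj (b n) * of_real (r ^ (2 * n))))"
      by (rule back_subst[of summable]) (auto simp: fun_eq_iff)
    then show "summable (\<lambda>n. a n * cnj (b n) * of_real (r ^ (2 * n)))"
      by (subst (asm) summable_cmult_iff) auto
  qed
  finally show "(\<integral>t. f (of_real r * cis t) * cnj (h (of_real r * cis t)) \<partial>circle_measure)
    = of_real (2 * pi) * (\<Sum>n. a n * cnj (b n) * of_real (r ^ (2 * n)))" .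
  have "summable (\<lambda>n. norm (a n * (cnj (b n) * of_real (2 * pi * r ^ (2 * n)))))"
    by (rule circle_integral_power_series(2)[OF taylor_abs_summable[OF f r] r(1) hm B', unfolded inner])
  then have "summable (\<lambda>n. (2 * pi) * (norm (a n * cnj (b n)) * r ^ (2 * n)))"
    by (rule back_subst[of summable]) (use r in \<open>auto simp: fun_eq_iff norm_mult norm_power\<close>)
  then show "summable (\<lambda>n. norm (a n * cnj (b n)) * r ^ (2 * n))"
    by (subst (asm) summable_cmult_iff) auto
qed

section \<open>Pairings over the weighted disc\<close>

text \<open>Extension by 0 makes a function that is continuous on the open disc Borel on the plane,
  as integration against \<open>area\<close> and \<open>\<nu>\<close> requires.\<close>

definition on_disc :: "(complex \<Rightarrow> 'a) \<Rightarrow> complex \<Rightarrow> 'a::zero" where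
  "on_disc u z = (if z \<in> disc then u z else 0)"

lemma borel_measurable_on_disc:
  fixes u :: "complex \<Rightarrow> 'a::real_normed_vector"
  assumes "continuous_on disc u"
  shows "on_disc u \<in> borel_measurable borel"
proof -
  have "(\<lambda>z. indicator disc z *\<^sub>R u z) \<in> borel_measurable borel"
    using assms by (intro borel_measurable_continuous_on_indicator) auto
  moreover have "(\<lambda>z. indicator disc z *\<^sub>R u z) = on_disc u"
    by (auto simp: on_disc_def indicator_def)
  ultimately show ?thesis by simp
qed

lemma circle_nn_cong_disc:
  assumes "\<And>z. norm z < 1 \<Longrightarrow> u z = v z" "norm c < 1"
  shows "circle_nn u c = circle_nn v c"
  unfolding circle_nn_def using assms by (intro nn_integral_cong) (simp add: norm_mult)

context regular_weight
begin

lemma sets_weighted_area: "sets (weighted_area \<omega>) = sets (lebesgue_on disc)"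
  and space_weighted_area [simp]: "space (weighted_area \<omega>) = disc"
  by (simp_all add: weighted_area_def disc_area_def)

lemma measurable_weighted_areaI:
  assumes "f \<in> borel_measurable borel"
  shows "f \<in> borel_measurable (weighted_area \<omega>)"
proof -
  have "f \<in> borel_measurable (lebesgue_on disc)"
    using assms by (intro measurable_restrict_space1 measurable_completion) auto
  then show ?thesis by (simp add: sets_weighted_area cong: measurable_cong_sets)
qed

lemma measurable_weighted_area_continuous:
  fixes u :: "complex \<Rightarrow> 'a::real_normed_vector"
  assumes "continuous_on disc u"
  shows "u \<in> borel_measurable (weighted_area \<omega>)"
proof -
  have "on_disc u \<in> borel_measurable (weighted_area \<omega>)"
    by (intro measurable_weighted_areaI borel_measurable_on_disc assms)
  then show ?thesis by (rule measurable_cong[THEN iffD1, rotated]) (simp add: on_disc_def)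
qed

lemma nn_integral_weighted_area:
  assumes [measurable]: "u \<in> borel_measurable borel"
  shows "(\<integral>\<^sup>+z. u z \<partial>weighted_area \<omega>) = (\<integral>\<^sup>+z. u z \<partial>area)"
proof -
  have m: "f \<in> borel_measurable (lebesgue_on disc)" if "f \<in> borel_measurable borel" for f :: "complex \<Rightarrow> ennreal"
    using that by (intro measurable_restrict_space1 measurable_completion) auto
  have "(\<integral>\<^sup>+z. u z \<partial>weighted_area \<omega>) = (\<integral>\<^sup>+z. ennreal (\<omega> (norm z)) * u z \<partial>disc_area)"
    unfolding weighted_area_def by (rule nn_integral_density) (auto simp: disc_area_def intro!: m)
  also have "\<dots> = (\<integral>\<^sup>+z. ennreal (1 / pi) * (ennreal (\<omega> (norm z)) * u z) \<partial>lebesgue_on disc)"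
    unfolding disc_area_def by (rule nn_integral_density) (auto intro!: m)
  also have "\<dots> = (\<integral>\<^sup>+z\<in>disc. ennreal (1 / pi) * (ennreal (\<omega> (norm z)) * u z) \<partial>lebesgue)"
    by (rule nn_integral_restrict_space) auto
  also have "\<dots> = (\<integral>\<^sup>+z\<in>disc. ennreal (1 / pi) * (ennreal (\<omega> (norm z)) * u z) \<partial>lborel)"
    by (rule nn_integral_completion)
  also have "\<dots> = (\<integral>\<^sup>+z. ennreal (\<omega> (norm z) / pi) * u z \<partial>lborel)"
  proof (rule nn_integral_cong)
    fix z :: complex
    have "ennreal (1 / pi) * ennreal (\<omega> (norm z)) = ennreal (\<omega> (norm z) / pi)"
      using nonneg by (subst ennreal_mult[symmetric]) auto
    then show "ennreal (1 / pi) * (ennreal (\<omega> (norm z)) * u z) * indicator disc z = ennreal (\<omega> (norm z) / pi) * u z"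
      using zero[of "norm z"] by (simp add: mult.assoc[symmetric] indicator_def)
  qed
  also have "\<dots> = (\<integral>\<^sup>+z. u z \<partial>area)"
    unfolding area_def radial_measure_def by (rule nn_integral_density[symmetric]) auto
  finally show ?thesis .
qed

text \<open>Carries Bochner integrals from Lebesgue sets of the disc to Borel sets of the
  plane.\<close>

lemma distr_weighted_area: "distr (weighted_area \<omega>) borel (\<lambda>z. z) = area"
proof (rule measure_eqI)
  fix X assume "X \<in> sets (distr (weighted_area \<omega>) borel (\<lambda>z. z))"
  then have [measurable]: "X \<in> sets borel" by simp
  have "emeasure (distr (weighted_area \<omega>) borel (\<lambda>z. z)) X = (\<integral>\<^sup>+z. indicator X z \<partial>distr (weighted_area \<omega>) borel (\<lambda>z. z))"
    by simp
  also have "\<dots> = (\<integral>\<^sup>+z. indicator X z \<partial>weighted_area \<omega>)"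
    by (rule nn_integral_distr) (auto intro!: measurable_weighted_areaI)
  also have "\<dots> = (\<integral>\<^sup>+z. indicator X z \<partial>area)" by (rule nn_integral_weighted_area) auto
  finally show "emeasure (distr (weighted_area \<omega>) borel (\<lambda>z. z)) X = emeasure area X" by simp
qed simp

lemma integrable_weighted_area_iff:
  fixes \<phi> :: "complex \<Rightarrow> complex"
  assumes "continuous_on disc \<phi>"
  shows "integrable (weighted_area \<omega>) \<phi> \<longleftrightarrow> integrable area (on_disc \<phi>)"
proof -
  have "integrable area (on_disc \<phi>) \<longleftrightarrow> integrable (weighted_area \<omega>) (on_disc \<phi>)"
    unfolding distr_weighted_area[symmetric]
    by (rule integrable_distr_eq) (auto intro!: measurable_weighted_areaI borel_measurable_on_disc assms)
  also have "\<dots> \<longleftrightarrow> integrable (weighted_area \<omega>) \<phi>"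
    by (rule Bochner_Integration.integrable_cong) (auto simp: on_disc_def)
  finally show ?thesis ..
qed

lemma integral_weighted_area:
  fixes \<phi> :: "complex \<Rightarrow> complex"
  assumes "continuous_on disc \<phi>"
  shows "(\<integral>z. \<phi> z \<partial>weighted_area \<omega>) = (\<integral>z. on_disc \<phi> z \<partial>area)"
proof -
  have "(\<integral>z. on_disc \<phi> z \<partial>area) = (\<integral>z. on_disc \<phi> z \<partial>weighted_area \<omega>)"
    unfolding distr_weighted_area[symmetric]
    by (rule integral_distr) (auto intro!: measurable_weighted_areaI borel_measurable_on_disc assms)
  also have "\<dots> = (\<integral>z. \<phi> z \<partial>weighted_area \<omega>)"
    by (rule Bochner_Integration.integral_cong) (auto simp: on_disc_def)
  finally show ?thesis ..
qed

lemma nn_integral_weighted_area_on_disc: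
  fixes u :: "complex \<Rightarrow> real"
  assumes "continuous_on disc u"
  shows "(\<integral>\<^sup>+z. ennreal (u z) \<partial>weighted_area \<omega>) = (\<integral>\<^sup>+z. ennreal (on_disc u z) \<partial>area)"
proof -
  have [measurable]: "on_disc u \<in> borel_measurable borel" by (rule borel_measurable_on_disc) fact
  have "(\<integral>\<^sup>+z. ennreal (u z) \<partial>weighted_area \<omega>) = (\<integral>\<^sup>+z. ennreal (on_disc u z) \<partial>weighted_area \<omega>)"
    by (rule nn_integral_cong) (simp add: on_disc_def)
  also have "\<dots> = (\<integral>\<^sup>+z. ennreal (on_disc u z) \<partial>area)" by (rule nn_integral_weighted_area) measurable
  finally show ?thesis .
qed

text \<open>The radial factor of \<open>area\<close> in polar coordinates, Jacobian included; a
  measure of its own is needed for Fubini with complex-valued integrands.\<close>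

definition radial_part :: "real measure" where
  "radial_part = density lborel (\<lambda>r. ennreal (r * \<omega> r / pi))"

lemma sets_radial_part [simp, measurable_cong]: "sets radial_part = sets borel"
  by (simp add: radial_part_def)

lemma sigma_finite_radial_part: "sigma_finite_measure radial_part"
  unfolding radial_part_def
  by (subst sigma_finite_measure.sigma_finite_iff_density_finite[OF sigma_finite_lborel]) auto

lemma area_polar: "area = distr (radial_part \<Otimes>\<^sub>M circle_measure) borel (\<lambda>(r, t). of_real r * cis t)"
proof (rule measure_eqI)
  fix X assume "X \<in> sets area"
  then have [measurable]: "X \<in> sets borel" by simp
  have [measurable]: "(\<lambda>(r, t). of_real r * cis t) \<in> borel_measurable (borel \<Otimes>\<^sub>M borel)"
    by measurable
  have "emeasure (distr (radial_part \<Otimes>\<^sub>M circle_measure) borel (\<lambda>(r, t). of_real r * cis t)) X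
      = (\<integral>\<^sup>+z. indicator X z \<partial>distr (radial_part \<Otimes>\<^sub>M circle_measure) borel (\<lambda>(r, t). of_real r * cis t))"
    by simp
  also have "\<dots> = (\<integral>\<^sup>+x. indicator X (case x of (r, t) \<Rightarrow> of_real r * cis t) \<partial>(radial_part \<Otimes>\<^sub>M circle_measure))"
    by (rule nn_integral_distr) auto
  also have "\<dots> = (\<integral>\<^sup>+r. \<integral>\<^sup>+t. indicator X (of_real r * cis t) \<partial>circle_measure \<partial>radial_part)"
    by (subst circle.nn_integral_fst[symmetric]) auto
  also have "\<dots> = (\<integral>\<^sup>+r. circle_nn (indicator X) (of_real r) \<partial>radial_part)"
    unfolding circle_nn_def by (intro nn_integral_cong nn_integral_circle_measure) measurable
  also have "\<dots> = (\<integral>\<^sup>+r. ennreal (r * \<omega> r / pi) * circle_nn (indicator X) (of_real r) \<partial>lborel)"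
    unfolding radial_part_def by (rule nn_integral_density) auto
  also have "\<dots> = (\<integral>\<^sup>+r. ennreal (1 / pi) * (ennreal (r * \<omega> r) * circle_nn (indicator X) (of_real r) * indicator {0..<1} r) \<partial>lborel)"
  proof (rule nn_integral_cong)
    fix r :: real
    show "ennreal (r * \<omega> r / pi) * circle_nn (indicator X) (of_real r)
      = ennreal (1 / pi) * (ennreal (r * \<omega> r) * circle_nn (indicator X) (of_real r) * indicator {0..<1} r)"
    proof (cases "r \<in> {0..<1}")
      case True
      have "ennreal (1 / pi) * ennreal (r * \<omega> r) = ennreal (r * \<omega> r / pi)"
        using True nonneg[of r] by (subst ennreal_mult[symmetric]) auto
      then show ?thesis using True by (simp add: mult.assoc[symmetric])
    qed (simp add: zero)
  qed
  also have "\<dots> = ennreal (1 / pi) * (\<integral>\<^sup>+r\<in>{0..<1}. ennreal (r * \<omega> r) * circle_nn (indicator X) (of_real r) \<partial>lborel)"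
    by (rule nn_integral_cmult) measurable
  also have "\<dots> = (\<integral>\<^sup>+z. indicator X z \<partial>area)"
    by (rule nn_integral_area[symmetric]) measurable
  finally show "emeasure area X = emeasure (distr (radial_part \<Otimes>\<^sub>M circle_measure) borel (\<lambda>(r, t). of_real r * cis t)) X"
    by simp
qed simp

lemma integral_area_polar:
  fixes \<phi> :: "complex \<Rightarrow> complex"
  assumes int: "integrable area \<phi>"
  shows "(\<integral>z. \<phi> z \<partial>area) = (\<integral>r. (r * \<omega> r / pi) *\<^sub>R (\<integral>t. \<phi> (of_real r * cis t) \<partial>circle_measure) \<partial>lborel)"
proof -
  interpret R: sigma_finite_measure radial_part by (rule sigma_finite_radial_part)
  interpret P: pair_sigma_finite radial_part circle_measure ..
  have [measurable]: "\<phi> \<in> borel_measurable borel" using int by auto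
  have pm: "(\<lambda>(r, t). of_real r * cis t) \<in> (radial_part \<Otimes>\<^sub>M circle_measure) \<rightarrow>\<^sub>M (borel :: complex measure)"
    by measurable
  have "(\<integral>z. \<phi> z \<partial>area) = (\<integral>x. \<phi> (case x of (r, t) \<Rightarrow> of_real r * cis t) \<partial>(radial_part \<Otimes>\<^sub>M circle_measure))"
    by (subst area_polar) (rule integral_distr[OF pm], measurable)
  also have "\<dots> = (\<integral>(r, t). \<phi> (of_real r * cis t) \<partial>(radial_part \<Otimes>\<^sub>M circle_measure))"
    by (simp add: split_beta')
  also have "\<dots> = (\<integral>r. (\<integral>t. \<phi> (of_real r * cis t) \<partial>circle_measure) \<partial>radial_part)"
  proof (rule P.integral_fst[symmetric])
    have "integrable (radial_part \<Otimes>\<^sub>M circle_measure) (\<lambda>x. \<phi> (case x of (r, t) \<Rightarrow> of_real r * cis t))"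
      using int unfolding area_polar by (subst (asm) integrable_distr_eq[OF pm]) auto
    then show "integrable (radial_part \<Otimes>\<^sub>M circle_measure) (\<lambda>(r, t). \<phi> (of_real r * cis t))"
      by (simp add: split_beta')
  qed
  also have "\<dots> = (\<integral>r. (r * \<omega> r / pi) *\<^sub>R (\<integral>t. \<phi> (of_real r * cis t) \<partial>circle_measure) \<partial>lborel)"
    unfolding radial_part_def
  proof (rule integral_density)
    show "AE r in lborel. 0 \<le> r * \<omega> r / pi"
    proof (rule AE_I2)
      fix r :: real
      show "0 \<le> r * \<omega> r / pi" using nonneg[of r] zero[of r] by (cases "r \<in> {0..<1}") auto
    qed
  qed measurable
  finally show ?thesis .
qed

text \<open>The sum stays inside the radial integral: pulling it out would require the absolute
  summability that \<open>pairing_taylor\<close> assumes, and \<open>duality_bound\<close> has to do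
  without it.\<close>

lemma integral_weighted_area_taylor:
  assumes f: "taylor f \<alpha>" and h: "taylor h \<beta>" and int: "integrable (weighted_area \<omega>) (\<lambda>z. f z * cnj (h z))"
  shows "(\<integral>z. f z * cnj (h z) \<partial>weighted_area \<omega>) = (\<integral>r. of_real (2 * r * \<omega> r) * (\<Sum>n. \<alpha> n * cnj (\<beta> n) * of_real (r ^ (2 * n))) \<partial>lborel)"
proof -
  have cont: "continuous_on disc (\<lambda>z. f z * cnj (h z))"
    using f h by (intro continuous_intros holomorphic_on_imp_continuous_on taylor_holomorphic)
  have "(\<integral>z. f z * cnj (h z) \<partial>weighted_area \<omega>) = (\<integral>z. on_disc (\<lambda>z. f z * cnj (h z)) z \<partial>area)"
    by (rule integral_weighted_area[OF cont])
  also have "\<dots> = (\<integral>r. (r * \<omega> r / pi) *\<^sub>R (\<integral>t. on_disc (\<lambda>z. f z * cnj (h z)) (of_real r * cis t) \<partial>circle_measure) \<partial>lborel)"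
    using int by (intro integral_area_polar) (simp add: integrable_weighted_area_iff[OF cont])
  also have "\<dots> = (\<integral>r. of_real (2 * r * \<omega> r) * (\<Sum>n. \<alpha> n * cnj (\<beta> n) * of_real (r ^ (2 * n))) \<partial>lborel)"
  proof (rule Bochner_Integration.integral_cong[OF refl])
    fix r :: real
    show "(r * \<omega> r / pi) *\<^sub>R (\<integral>t. on_disc (\<lambda>z. f z * cnj (h z)) (of_real r * cis t) \<partial>circle_measure)
      = of_real (2 * r * \<omega> r) * (\<Sum>n. \<alpha> n * cnj (\<beta> n) * of_real (r ^ (2 * n)))"
    proof (cases "r \<in> {0..<1}")
      case True
      then have "(\<integral>t. on_disc (\<lambda>z. f z * cnj (h z)) (of_real r * cis t) \<partial>circle_measure)
        = (\<integral>t. f (of_real r * cis t) * cnj (h (of_real r * cis t)) \<partial>circle_measure)"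
        by (intro Bochner_Integration.integral_cong) (auto simp: on_disc_def norm_mult)
      also have "\<dots> = of_real (2 * pi) * (\<Sum>n. \<alpha> n * cnj (\<beta> n) * of_real (r ^ (2 * n)))"
        using True by (intro Parseval_circle(1)[OF f h]) auto
      finally show ?thesis by (simp add: scaleR_conv_of_real)
    qed (simp add: zero)
  qed
  finally show ?thesis .
qed

text \<open>Monomials are orthogonal over the weighted disc, and \<open>2 * mom n\<close> is the
  squared norm of the monomial of degree \<open>n\<close>.\<close>

lemma pairing_taylor:
  assumes f: "taylor f \<alpha>" and h: "taylor h \<beta>" and int: "integrable (weighted_area \<omega>) (\<lambda>z. f z * cnj (h z))"
    and s: "summable (\<lambda>n. norm (\<alpha> n * cnj (\<beta> n)) * mom n)"
  shows "(\<integral>z. f z * cnj (h z) \<partial>weighted_area \<omega>) = (\<Sum>n. \<alpha> n * cnj (\<beta> n) * of_real (2 * mom n))"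
proof -
  define F where "F n r = (\<alpha> n * cnj (\<beta> n) * 2) * of_real (r ^ (2 * n + 1) * (1 - r\<^sup>2) ^ 0 * \<omega> r)" for n and r :: real
  have F: "integrable lborel (F n)" for n
    unfolding F_def[abs_def] by (intro integrable_mult_right integrable_of_real integrable_power_weight)
  have mom: "(\<integral>r. r ^ (2 * n + 1) * (1 - r\<^sup>2) ^ 0 * \<omega> r \<partial>lborel) = mom n" for n
    using moment_integral[of "2 * n"] by (simp add: mom_def algebra_simps)
  have normF: "norm (F n r) = norm (\<alpha> n * cnj (\<beta> n)) * 2 * (r ^ (2 * n + 1) * (1 - r\<^sup>2) ^ 0 * \<omega> r)" for n r
  proof -
    have "0 \<le> r ^ (2 * n + 1) * (1 - r\<^sup>2) ^ 0 * \<omega> r"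
      using nonneg[of r] zero[of r] by (cases "r \<in> {0..<1}") auto
    then show ?thesis unfolding F_def norm_mult norm_of_real by simp
  qed
  have "(\<integral>z. f z * cnj (h z) \<partial>weighted_area \<omega>) = (\<integral>r. (\<Sum>n. F n r) \<partial>lborel)"
    unfolding integral_weighted_area_taylor[OF f h int]
  proof (rule Bochner_Integration.integral_cong[OF refl])
    fix r :: real
    show "of_real (2 * r * \<omega> r) * (\<Sum>n. \<alpha> n * cnj (\<beta> n) * of_real (r ^ (2 * n))) = (\<Sum>n. F n r)"
    proof (cases "r \<in> {0..<1}")
      case True
      then have "summable (\<lambda>n. norm (\<alpha> n * cnj (\<beta> n)) * r ^ (2 * n))" by (intro Parseval_circle(2)[OF f h]) auto
      then have "summable (\<lambda>n. norm (\<alpha> n * cnj (\<beta> n) * of_real (r ^ (2 * n))))"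
        by (rule back_subst[of summable]) (use True in \<open>auto simp: fun_eq_iff norm_mult norm_power\<close>)
      then have "summable (\<lambda>n. \<alpha> n * cnj (\<beta> n) * of_real (r ^ (2 * n)))" by (rule summable_norm_cancel)
      then have "of_real (2 * r * \<omega> r) * (\<Sum>n. \<alpha> n * cnj (\<beta> n) * of_real (r ^ (2 * n)))
        = (\<Sum>n. of_real (2 * r * \<omega> r) * (\<alpha> n * cnj (\<beta> n) * of_real (r ^ (2 * n))))"
        by (rule suminf_mult[symmetric])
      also have "\<dots> = (\<Sum>n. F n r)" by (intro suminf_cong) (simp add: F_def)
      finally show ?thesis .
    qed (simp add: zero F_def)
  qed
  also have "\<dots> = (\<Sum>n. \<integral>r. F n r \<partial>lborel)"
  proof (rule integral_suminf[OF F])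
    show "AE r in lborel. summable (\<lambda>n. norm (F n r))"
    proof (rule AE_I2)
      fix r :: real
      show "summable (\<lambda>n. norm (F n r))"
      proof (cases "r \<in> {0..<1}")
        case True
        then have "summable (\<lambda>n. norm (\<alpha> n * cnj (\<beta> n)) * r ^ (2 * n))" by (intro Parseval_circle(2)[OF f h]) auto
        then have "summable (\<lambda>n. norm (\<alpha> n * cnj (\<beta> n)) * r ^ (2 * n) * (2 * r * \<omega> r))" by (rule summable_mult2)
        then show ?thesis unfolding normF by (rule back_subst[of summable]) (auto simp: fun_eq_iff)
      qed (simp add: zero F_def)
    qed
    have "(\<lambda>n. \<integral>r. norm (F n r) \<partial>lborel) = (\<lambda>n. norm (\<alpha> n * cnj (\<beta> n)) * mom n * 2)"
      unfolding normF integral_mult_right_zero mom by (simp add: fun_eq_iff)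
    then show "summable (\<lambda>n. \<integral>r. norm (F n r) \<partial>lborel)"
      using summable_mult2[OF s, of 2] by simp
  qed
  also have "\<dots> = (\<Sum>n. \<alpha> n * cnj (\<beta> n) * of_real (2 * mom n))"
  proof (rule suminf_cong)
    fix n
    have "(\<integral>r. F n r \<partial>lborel) = (\<alpha> n * cnj (\<beta> n) * 2) * of_real (mom n)"
      unfolding F_def integral_mult_right_zero integral_complex_of_real mom ..
    then show "(\<integral>r. F n r \<partial>lborel) = \<alpha> n * cnj (\<beta> n) * of_real (2 * mom n)" by simp
  qed
  finally show ?thesis .
qed

text \<open>
  With \<open>C r\<close> the circle mean of \<open>f * cnj h\<close> and \<open>\<Xi>\<close> that of \<open>F * cnj h\<close>, the hypothesis on \<open>F\<close> says
  \<open>(r * C r)' = \<Xi> r\<close>.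
\<close>

lemma duality_bound:
  assumes f: "taylor f \<alpha>" and h: "taylor h \<beta>" and F: "taylor F (\<lambda>n. of_nat (2 * n + 1) * \<alpha> n)"
    and int: "integrable (weighted_area \<omega>) (\<lambda>z. f z * cnj (h z))"
    and B: "0 \<le> B" "\<And>z. norm z < 1 \<Longrightarrow> norm (F z) * (1 - norm z) \<le> B"
  shows "ennreal (norm (\<integral>z. f z * cnj (h z) \<partial>weighted_area \<omega>)) \<le> ennreal (B / pi) * (\<integral>\<^sup>+z. ennreal (norm (on_disc h z)) \<partial>\<nu>)"
proof -
  define c where "c n = \<alpha> n * cnj (\<beta> n)" for n
  define C where "C r = (\<Sum>n. c n * of_real (r ^ (2 * n)))" for r :: real
  have contF: "continuous_on disc F" and conth: "continuous_on disc h"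
    using F h by (auto intro: holomorphic_on_imp_continuous_on taylor_holomorphic)
  have [measurable]: "on_disc F \<in> borel_measurable borel" "on_disc h \<in> borel_measurable borel"
    by (auto intro!: borel_measurable_on_disc contF conth)
  define U where "U z = ennreal (norm (on_disc F z) * norm (on_disc h z))" for z
  have [measurable]: "U \<in> borel_measurable borel" unfolding U_def by measurable
  define \<Xi> where "\<Xi> s = (\<Sum>n. of_nat (2 * n + 1) * c n * of_real (s ^ (2 * n)))" for s :: real
  have Xi: "ennreal (2 * pi * norm (\<Xi> s)) \<le> circle_nn U (of_real s)" if s: "0 \<le> s" "s < 1" for s
  proof -
    have ns: "norm (of_real s * cis t) < 1" for t using s by (simp add: norm_mult)
    obtain B1 where B1: "\<And>t. norm (F (of_real s * cis t)) \<le> B1" using circle_bounded[OF contF s] by blast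
    obtain B2 where B2: "\<And>t. norm (h (of_real s * cis t)) \<le> B2" using circle_bounded[OF conth s] by blast
    have [measurable]: "(\<lambda>t. F (of_real s * cis t)) \<in> borel_measurable borel" "(\<lambda>t. h (of_real s * cis t)) \<in> borel_measurable borel"
      by (rule holomorphic_circle_measurable[OF _ s], fact)+
    have i: "integrable circle_measure (\<lambda>t. F (of_real s * cis t) * cnj (h (of_real s * cis t)))"
    proof (rule integrable_circle_bounded)
      show "norm (F (of_real s * cis t) * cnj (h (of_real s * cis t))) \<le> B1 * B2" for t
        unfolding norm_mult complex_mod_cnj using B1[of t] B2[of t]
        by (intro mult_mono) (auto intro: order_trans[OF norm_ge_zero])
    qed measurable
    have "of_real (2 * pi) * \<Xi> s = (\<integral>t. F (of_real s * cis t) * cnj (h (of_real s * cis t)) \<partial>circle_measure)"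
      unfolding \<Xi>_def c_def using Parseval_circle(1)[OF F h s] by (simp add: mult.assoc)
    moreover have "norm (of_real (2 * pi) * \<Xi> s) = 2 * pi * norm (\<Xi> s)"
      unfolding norm_mult norm_of_real by simp
    ultimately have "2 * pi * norm (\<Xi> s) = norm (\<integral>t. F (of_real s * cis t) * cnj (h (of_real s * cis t)) \<partial>circle_measure)"
      by (simp only:)
    also have "ennreal \<dots> \<le> (\<integral>\<^sup>+t. ennreal (norm (F (of_real s * cis t) * cnj (h (of_real s * cis t)))) \<partial>circle_measure)"
      by (rule integral_norm_bound_ennreal[OF i])
    also have "\<dots> = circle_nn U (of_real s)"
      unfolding circle_nn_def using ns by (subst nn_integral_circle_measure) (auto simp: U_def on_disc_def norm_mult)
    finally show ?thesis .
  qed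
  \<comment> \<open>The differential relation in integrated form: integrating
    \<open>s ^ (2 * n)\<close> from 0 to \<open>r\<close> cancels the factor
    \<open>2 * n + 1\<close> term by term.\<close>
  have rC: "ennreal (r * norm (C r)) \<le> (\<integral>\<^sup>+s\<in>{0..<r}. ennreal (norm (\<Xi> s)) \<partial>lborel)" if r: "0 \<le> r" "r < 1" for r
  proof -
    define G where "G n s = of_nat (2 * n + 1) * c n * of_real (indicator {0..<r} s * s ^ (2 * n))" for n and s :: real
    have nn: "(\<integral>\<^sup>+s\<in>{0..<r}. ennreal (s ^ (2 * n)) \<partial>lborel) = ennreal (r ^ (2 * n + 1) / real (2 * n + 1))" for n
    proof -
      have "(\<integral>\<^sup>+s\<in>{0..<r}. ennreal (s ^ (2 * n)) \<partial>lborel) = ennreal (r ^ (2 * n + 1) / real (2 * n + 1) - 0 ^ (2 * n + 1) / real (2 * n + 1))"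
      proof (rule nn_integral_FTC_interior)
        show "((\<lambda>s. s ^ (2 * n + 1) / real (2 * n + 1)) has_real_derivative x ^ (2 * n)) (at x)" for x :: real
          by (rule derivative_eq_intros refl | simp)+
      qed (use r in \<open>auto intro!: continuous_intros\<close>)
      then show ?thesis by simp
    qed
    have hb: "has_bochner_integral lborel (\<lambda>s. indicator {0..<r} s * s ^ (2 * n)) (r ^ (2 * n + 1) / real (2 * n + 1))" for n
    proof (rule has_bochner_integral_nn_integral)
      show "(\<integral>\<^sup>+s. ennreal (indicator {0..<r} s * s ^ (2 * n)) \<partial>lborel) = ennreal (r ^ (2 * n + 1) / real (2 * n + 1))"
        unfolding nn[symmetric] by (intro nn_integral_cong) (auto simp: indicator_def)
    qed (use r in \<open>auto simp: indicator_def\<close>)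
    have G: "integrable lborel (G n)" for n
      unfolding G_def[abs_def] by (intro integrable_mult_right integrable_of_real integrable.intros[OF hb])
    have normG: "norm (G n s) = real (2 * n + 1) * norm (c n) * (indicator {0..<r} s * s ^ (2 * n))" for n s
      unfolding G_def norm_mult norm_of_real norm_of_nat by (auto simp: indicator_def)
    have sc: "summable (\<lambda>n. norm (c n) * r ^ (2 * n))" unfolding c_def by (rule Parseval_circle(2)[OF f h r])
    have sG: "summable (\<lambda>n. norm (G n s))" for s
    proof (cases "s \<in> {0..<r}")
      case True
      then have "summable (\<lambda>n. norm (of_nat (2 * n + 1) * \<alpha> n * cnj (\<beta> n)) * s ^ (2 * n))"
        using r by (intro Parseval_circle(2)[OF F h]) auto
      moreover have "norm (of_nat (2 * n + 1) * \<alpha> n * cnj (\<beta> n)) * s ^ (2 * n) = norm (G n s)" for n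
        unfolding normG c_def norm_mult norm_of_nat using True by (simp add: mult.assoc)
      ultimately show ?thesis by (simp only:)
    qed (simp add: G_def)
    have "complex_of_real r * C r = (\<Sum>n. \<integral>s. G n s \<partial>lborel)"
    proof -
      have "summable (\<lambda>n. c n * of_real (r ^ (2 * n)))"
        by (rule summable_norm_cancel, rule back_subst[of summable, OF sc]) (use r in \<open>auto simp: fun_eq_iff norm_mult norm_power\<close>)
      then have "complex_of_real r * C r = (\<Sum>n. of_real r * (c n * of_real (r ^ (2 * n))))"
        unfolding C_def by (rule suminf_mult[symmetric])
      also have "\<dots> = (\<Sum>n. \<integral>s. G n s \<partial>lborel)"
      proof (rule suminf_cong)
        fix n
        have "(\<integral>s. G n s \<partial>lborel) = of_nat (2 * n + 1) * c n * of_real (r ^ (2 * n + 1) / real (2 * n + 1))"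
          unfolding G_def integral_mult_right_zero integral_complex_of_real has_bochner_integral_integral_eq[OF hb] ..
        also have "\<dots> = (of_nat (2 * n + 1) / of_nat (2 * n + 1)) * (of_real r * (c n * of_real (r ^ (2 * n))))"
          by (simp del: of_nat_Suc of_nat_add of_nat_mult)
        also have "of_nat (2 * n + 1) / of_nat (2 * n + 1) = (1 :: complex)"
          by (rule divide_self) (simp del: of_nat_Suc of_nat_add of_nat_mult)
        finally show "of_real r * (c n * of_real (r ^ (2 * n))) = (\<integral>s. G n s \<partial>lborel)" by simp
      qed
      finally show ?thesis .
    qed
    also have "\<dots> = (\<integral>s. (\<Sum>n. G n s) \<partial>lborel)"
    proof (rule integral_suminf[symmetric, OF G])
      have "(\<lambda>n. \<integral>s. norm (G n s) \<partial>lborel) = (\<lambda>n. norm (c n) * r ^ (2 * n) * r)"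
        unfolding normG integral_mult_right_zero has_bochner_integral_integral_eq[OF hb]
        by (auto simp: fun_eq_iff simp del: of_nat_Suc of_nat_add of_nat_mult)
      then show "summable (\<lambda>n. \<integral>s. norm (G n s) \<partial>lborel)" using summable_mult2[OF sc, of r] by simp
    qed (use sG in auto)
    also have "(\<lambda>s. \<Sum>n. G n s) = (\<lambda>s. if s \<in> {0..<r} then \<Xi> s else 0)"
      by (auto simp: G_def \<Xi>_def fun_eq_iff)
    finally have eq: "complex_of_real r * C r = (\<integral>s. (if s \<in> {0..<r} then \<Xi> s else 0) \<partial>lborel)" .
    show ?thesis
    \<comment> \<open>The Bochner integral of a non-integrable function is 0, and then
      \<open>r * norm (C r)\<close> is 0 as well, so the bound holds in either case.\<close>
    proof (cases "integrable lborel (\<lambda>s. if s \<in> {0..<r} then \<Xi> s else 0)")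
      case True
      have "ennreal (norm (complex_of_real r * C r)) \<le> (\<integral>\<^sup>+s. ennreal (norm (if s \<in> {0..<r} then \<Xi> s else 0)) \<partial>lborel)"
        unfolding eq by (rule integral_norm_bound_ennreal[OF True])
      also have "\<dots> = (\<integral>\<^sup>+s\<in>{0..<r}. ennreal (norm (\<Xi> s)) \<partial>lborel)"
        by (intro nn_integral_cong) auto
      finally show ?thesis using r by (simp add: norm_mult)
    next
      case False
      then have "complex_of_real r * C r = 0" unfolding eq by (rule not_integrable_integral_eq)
      then have "norm (complex_of_real r * C r) = 0" by simp
      then have "r * norm (C r) = 0" using r by (simp add: norm_mult)
      then show ?thesis by (simp only: ennreal_0 zero_le)
    qed
  qed
  have eq: "(\<integral>z. f z * cnj (h z) \<partial>weighted_area \<omega>) = (\<integral>r. of_real (2 * r * \<omega> r) * C r \<partial>lborel)"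
    unfolding C_def c_def by (rule integral_weighted_area_taylor[OF f h int])
  have "ennreal (norm (\<integral>z. f z * cnj (h z) \<partial>weighted_area \<omega>)) \<le> (\<integral>\<^sup>+r. ennreal (norm (of_real (2 * r * \<omega> r) * C r)) \<partial>lborel)"
  proof (cases "integrable lborel (\<lambda>r. of_real (2 * r * \<omega> r) * C r)")
    case False
    then have "(\<integral>z. f z * cnj (h z) \<partial>weighted_area \<omega>) = 0" unfolding eq by (rule not_integrable_integral_eq)
    then show ?thesis by simp
  next
    case True
    then show ?thesis unfolding eq by (rule integral_norm_bound_ennreal)
  qed
  \<comment> \<open>A double integral over \<open>s < r\<close>. Exchanging the order lets
    \<open>\<omega>\<close> be integrated over \<open>r\<close> first, which produces the tail
    \<open>W s\<close>.\<close>
  also have "\<dots> \<le> (\<integral>\<^sup>+r. \<integral>\<^sup>+s. ennreal (1 / pi) * (ennreal (\<omega> r) * indicator {s<..<1} r * (circle_nn U (of_real s) * indicator {0..<1} s)) \<partial>lborel \<partial>lborel)"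
  proof (rule nn_integral_mono)
    fix r :: real
    show "ennreal (norm (of_real (2 * r * \<omega> r) * C r)) \<le> (\<integral>\<^sup>+s. ennreal (1 / pi) * (ennreal (\<omega> r) * indicator {s<..<1} r * (circle_nn U (of_real s) * indicator {0..<1} s)) \<partial>lborel)"
    proof (cases "r \<in> {0..<1}")
      case True
      have "ennreal (norm (of_real (2 * r * \<omega> r) * C r)) = ennreal (2 * \<omega> r) * ennreal (r * norm (C r))"
        using True nonneg[of r] by (simp add: norm_mult ennreal_mult[symmetric] abs_mult mult_ac)
      also have "\<dots> \<le> ennreal (2 * \<omega> r) * (\<integral>\<^sup>+s\<in>{0..<r}. ennreal (norm (\<Xi> s)) \<partial>lborel)"
        using True by (intro mult_left_mono rC) auto
      also have "\<dots> \<le> ennreal (2 * \<omega> r) * (\<integral>\<^sup>+s. ennreal (1 / (2 * pi)) * (circle_nn U (of_real s) * indicator {0..<r} s) \<partial>lborel)"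
      proof (intro mult_left_mono nn_integral_mono)
        fix s :: real
        have "ennreal (norm (\<Xi> s)) \<le> ennreal (1 / (2 * pi)) * circle_nn U (of_real s)" if "0 \<le> s" "s < r"
        proof -
          have "ennreal (norm (\<Xi> s)) = ennreal (1 / (2 * pi)) * ennreal (2 * pi * norm (\<Xi> s))"
            by (subst ennreal_mult[symmetric]) auto
          also have "\<dots> \<le> ennreal (1 / (2 * pi)) * circle_nn U (of_real s)"
            using that True by (intro mult_left_mono Xi) auto
          finally show ?thesis .
        qed
        then show "ennreal (norm (\<Xi> s)) * indicator {0..<r} s \<le> ennreal (1 / (2 * pi)) * (circle_nn U (of_real s) * indicator {0..<r} s)"
          by (auto simp: indicator_def)
      qed simp
      also have "\<dots> = (\<integral>\<^sup>+s. ennreal (2 * \<omega> r) * (ennreal (1 / (2 * pi)) * (circle_nn U (of_real s) * indicator {0..<r} s)) \<partial>lborel)"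
        by (rule nn_integral_cmult[symmetric]) measurable
      also have "\<dots> = (\<integral>\<^sup>+s. ennreal (1 / pi) * (ennreal (\<omega> r) * indicator {s<..<1} r * (circle_nn U (of_real s) * indicator {0..<1} s)) \<partial>lborel)"
      proof (rule nn_integral_cong)
        fix s :: real
        have "ennreal (2 * \<omega> r) * ennreal (1 / (2 * pi)) = ennreal (1 / pi) * ennreal (\<omega> r)"
          using nonneg[of r] by (simp only: ennreal_mult[symmetric] mult_nonneg_nonneg zero_le_numeral divide_nonneg_nonneg zero_le_one pi_ge_zero) simp
        then show "ennreal (2 * \<omega> r) * (ennreal (1 / (2 * pi)) * (circle_nn U (of_real s) * indicator {0..<r} s))
          = ennreal (1 / pi) * (ennreal (\<omega> r) * indicator {s<..<1} r * (circle_nn U (of_real s) * indicator {0..<1} s))"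
          using True by (auto simp: indicator_def mult.assoc[symmetric])
      qed
      finally show ?thesis .
    qed (simp add: zero)
  qed
  also have "\<dots> = (\<integral>\<^sup>+s. \<integral>\<^sup>+r. ennreal (1 / pi) * (ennreal (\<omega> r) * indicator {s<..<1} r * (circle_nn U (of_real s) * indicator {0..<1} s)) \<partial>lborel \<partial>lborel)"
  proof (rule lborel_pair.Fubini'[symmetric])
    have "(\<lambda>(r, s). ennreal (1 / pi) * (ennreal (\<omega> r) * (if s < r \<and> r < 1 then 1 else 0) * (circle_nn U (of_real s) * indicator {0..<1} s))) \<in> borel_measurable (lborel \<Otimes>\<^sub>M lborel)"
      by measurable
    then show "(\<lambda>(r, s). ennreal (1 / pi) * (ennreal (\<omega> r) * indicator {s<..<1} r * (circle_nn U (of_real s) * indicator {0..<1} s))) \<in> borel_measurable (lborel \<Otimes>\<^sub>M lborel)"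
      by (simp add: indicator_def of_bool_def)
  qed
  \<comment> \<open>The hypothesis bounds \<open>F\<close> by \<open>B / (1 - s)\<close> on the
    circle of radius \<open>s\<close>; together with \<open>W s\<close> this is the density of
    \<open>\<nu>\<close>.\<close>
  also have "\<dots> \<le> (\<integral>\<^sup>+s. ennreal (B / pi) * (ennreal (W s / (1 - s)) * circle_nn (\<lambda>z. ennreal (norm (on_disc h z))) (of_real s) * indicator {0..<1} s) \<partial>lborel)"
  proof (rule nn_integral_mono)
    fix s :: real
    show "(\<integral>\<^sup>+r. ennreal (1 / pi) * (ennreal (\<omega> r) * indicator {s<..<1} r * (circle_nn U (of_real s) * indicator {0..<1} s)) \<partial>lborel)
      \<le> ennreal (B / pi) * (ennreal (W s / (1 - s)) * circle_nn (\<lambda>z. ennreal (norm (on_disc h z))) (of_real s) * indicator {0..<1} s)"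
    proof (cases "s \<in> {0..<1}")
      case True
      have "(\<integral>\<^sup>+r. ennreal (1 / pi) * (ennreal (\<omega> r) * indicator {s<..<1} r * (circle_nn U (of_real s) * indicator {0..<1} s)) \<partial>lborel)
        \<le> (\<integral>\<^sup>+r. ennreal (1 / pi) * circle_nn U (of_real s) * (ennreal (\<omega> r) * indicator {s..<1} r) \<partial>lborel)"
        using True by (intro nn_integral_mono) (auto simp: indicator_def mult_ac)
      also have "\<dots> = ennreal (1 / pi) * circle_nn U (of_real s) * ennreal (W s)"
        by (subst nn_integral_cmult) (auto simp: nn_integral_tail)
      also have "circle_nn U (of_real s) \<le> ennreal (B / (1 - s)) * circle_nn (\<lambda>z. ennreal (norm (on_disc h z))) (of_real s)"
      proof -
        have "circle_nn U (of_real s) \<le> (\<integral>\<^sup>+t. ennreal (B / (1 - s)) * (ennreal (norm (on_disc h (of_real s * cis t))) * indicator {0..<2 * pi} t) \<partial>lborel)"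
          unfolding circle_nn_def
        proof (rule nn_integral_mono)
          fix t :: real
          have ns: "norm (of_real s * cis t) = s" using True by (simp add: norm_mult)
          have "norm (F (of_real s * cis t)) \<le> B / (1 - s)"
            using B(2)[of "of_real s * cis t"] True unfolding ns by (simp add: field_simps)
          then have "norm (on_disc F (of_real s * cis t)) * norm (on_disc h (of_real s * cis t)) \<le> B / (1 - s) * norm (on_disc h (of_real s * cis t))"
            using True B by (intro mult_right_mono) (auto simp: on_disc_def)
          then have "U (of_real s * cis t) \<le> ennreal (B / (1 - s)) * ennreal (norm (on_disc h (of_real s * cis t)))"
            using True B by (simp add: U_def ennreal_mult[symmetric] ennreal_leI)
          then show "U (of_real s * cis t) * indicator {0..<2 * pi} t \<le> ennreal (B / (1 - s)) * (ennreal (norm (on_disc h (of_real s * cis t))) * indicator {0..<2 * pi} t)"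
            by (auto simp: indicator_def)
        qed
        also have "\<dots> = ennreal (B / (1 - s)) * circle_nn (\<lambda>z. ennreal (norm (on_disc h z))) (of_real s)"
          unfolding circle_nn_def by (rule nn_integral_cmult) measurable
        finally show ?thesis .
      qed
      finally have "(\<integral>\<^sup>+r. ennreal (1 / pi) * (ennreal (\<omega> r) * indicator {s<..<1} r * (circle_nn U (of_real s) * indicator {0..<1} s)) \<partial>lborel)
        \<le> ennreal (1 / pi) * (ennreal (B / (1 - s)) * circle_nn (\<lambda>z. ennreal (norm (on_disc h z))) (of_real s)) * ennreal (W s)"
        by (simp add: mult_left_mono mult_right_mono)
      also have "\<dots> = (ennreal (1 / pi) * ennreal (B / (1 - s)) * ennreal (W s)) * circle_nn (\<lambda>z. ennreal (norm (on_disc h z))) (of_real s)"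
        by (simp only: mult_ac)
      also have "ennreal (1 / pi) * ennreal (B / (1 - s)) * ennreal (W s) = ennreal (B / pi) * ennreal (W s / (1 - s))"
      proof -
        have "ennreal (1 / pi) * ennreal (B / (1 - s)) * ennreal (W s) = ennreal (1 / pi * (B / (1 - s)) * W s)"
        proof -
          have "ennreal x * ennreal y * ennreal z = ennreal (x * y * z)" if "0 \<le> x" "0 \<le> y" "0 \<le> z" for x y z
            using that by (simp add: ennreal_mult)
          then show ?thesis using True B tail_nonneg[of s] by auto
        qed
        also have "1 / pi * (B / (1 - s)) * W s = B / pi * (W s / (1 - s))" by simp
        also have "ennreal \<dots> = ennreal (B / pi) * ennreal (W s / (1 - s))"
          using True B tail_nonneg[of s] by (intro ennreal_mult) auto
        finally show ?thesis .
      qed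
      finally show ?thesis using True by (simp add: mult.assoc)
    qed simp
  qed
  also have "\<dots> = ennreal (B / pi) * (\<integral>\<^sup>+z. ennreal (norm (on_disc h z)) \<partial>\<nu>)"
    by (subst nn_integral_cmult) (simp_all add: nn_integral_\<nu>)
  finally show ?thesis .
qed

end

lemma circle_nn_mult_right: "circle_nn (\<lambda>z. u (c * z)) (of_real s) = circle_nn u (c * of_real s)"
  by (simp add: circle_nn_def mult.assoc)

lemma circle_nn_le_cmult:
  assumes [measurable]: "v \<in> borel_measurable borel" and le: "\<And>z. norm z = norm c \<Longrightarrow> u z \<le> k * v z"
  shows "circle_nn u c \<le> k * circle_nn v c"
proof -
  have "circle_nn u c \<le> (\<integral>\<^sup>+t. k * (v (c * cis t) * indicator {0..<2 * pi} t) \<partial>lborel)"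
    unfolding circle_nn_def using le by (intro nn_integral_mono) (auto simp: indicator_def norm_mult)
  also have "\<dots> = k * circle_nn v c"
    unfolding circle_nn_def by (rule nn_integral_cmult) measurable
  finally show ?thesis .
qed

lemma norm_one_minus_ge: "1 - norm z \<le> norm (1 - z)" for z :: complex
  using norm_triangle_ineq2[of 1 z] by simp

section \<open>Integral estimates against the auxiliary measure\<close>

context regular_weight
begin

lemma tail_mult_le:
  assumes "0 \<le> r" "r < 1" "0 \<le> s" "s < 1"
  shows "W s \<le> W (r * s)" "W r \<le> W (r * s)" "0 < W (r * s)" "r * s < 1"
proof -
  show "W s \<le> W (r * s)" using assms by (intro tail_antimono mult_left_le_one_le) auto
  show "W r \<le> W (r * s)" using assms by (intro tail_antimono mult_right_le_one_le) auto
  have "r * s \<le> r" using assms by (intro mult_right_le_one_le) auto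
  then show "r * s < 1" using assms by simp
  then show "0 < W (r * s)" using assms by (intro tail_pos) auto
qed

text \<open>The common pattern of the three estimates that follow. Below \<open>r\<close> the
  integrand is a power of \<open>1 - s\<close> of exponent less than -1, whose integral is governed
  by the endpoint \<open>r\<close>; above \<open>r\<close> it is controlled by
  \<open>nn_integral_tail_upper\<close>.\<close>

lemma nn_integral_split_bound:
  assumes r: "0 \<le> r" "r < 1" and \<gamma>: "0 < \<gamma>" and d: "0 \<le> d" "d < a" and M: "0 \<le> M1" "0 \<le> M2"
    and le1: "\<And>s. 0 \<le> s \<Longrightarrow> s < r \<Longrightarrow> f s \<le> M1 * (1 - s) powr (- \<gamma> - 1)"
    and le2: "\<And>s. r \<le> s \<Longrightarrow> s < 1 \<Longrightarrow> f s \<le> M2 * (W s / (1 - s) * (1 - s) powr (- d))"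
  shows "(\<integral>\<^sup>+s\<in>{0..<1}. ennreal (f s) \<partial>lborel)
    \<le> ennreal (M1 * (1 - r) powr (- \<gamma>) / \<gamma> + M2 * (A ^ 3 / (a - d) * W r * (1 - r) powr (- d)))"
proof -
  have 1: "(\<integral>\<^sup>+s\<in>{0..<r}. ennreal ((1 - s) powr (- \<gamma> - 1)) \<partial>lborel) \<le> ennreal ((1 - r) powr (- \<gamma>) / \<gamma>)"
  proof -
    have "(\<integral>\<^sup>+s\<in>{0..<r}. ennreal ((1 - s) powr (- \<gamma> - 1)) \<partial>lborel) = ennreal ((1 - r) powr (- \<gamma>) / \<gamma> - (1 - 0) powr (- \<gamma>) / \<gamma>)"
    proof (rule nn_integral_FTC_interior)
      show "continuous_on {0..r} (\<lambda>s. (1 - s) powr (- \<gamma>) / \<gamma>)"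
        using r \<gamma> by (intro continuous_intros) auto
      show "((\<lambda>s. (1 - s) powr (- \<gamma>) / \<gamma>) has_real_derivative (1 - x) powr (- \<gamma> - 1)) (at x)" if "x < r" for x
        using that r \<gamma> by (auto intro!: derivative_eq_intros)
    qed (use r in auto)
    also have "\<dots> \<le> ennreal ((1 - r) powr (- \<gamma>) / \<gamma>)" using \<gamma> by (intro ennreal_leI) simp
    finally show ?thesis .
  qed
  have "(\<integral>\<^sup>+s\<in>{0..<1}. ennreal (f s) \<partial>lborel)
    \<le> (\<integral>\<^sup>+s. ennreal M1 * (ennreal ((1 - s) powr (- \<gamma> - 1)) * indicator {0..<r} s)
        + ennreal M2 * (ennreal (W s / (1 - s) * (1 - s) powr (- d)) * indicator {r..<1} s) \<partial>lborel)"
  proof (rule nn_integral_mono)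
    fix s :: real
    consider "s \<in> {0..<r}" | "s \<in> {r..<1}" | "s \<notin> {0..<1}" by fastforce
    then show "ennreal (f s) * indicator {0..<1} s \<le> ennreal M1 * (ennreal ((1 - s) powr (- \<gamma> - 1)) * indicator {0..<r} s)
        + ennreal M2 * (ennreal (W s / (1 - s) * (1 - s) powr (- d)) * indicator {r..<1} s)"
    proof cases
      case 1
      then have "ennreal (f s) \<le> ennreal (M1 * (1 - s) powr (- \<gamma> - 1))" by (intro ennreal_leI le1) auto
      then show ?thesis using 1 r M by (simp add: ennreal_mult)
    next
      case 2
      then have "ennreal (f s) \<le> ennreal (M2 * (W s / (1 - s) * (1 - s) powr (- d)))" by (intro ennreal_leI le2) auto
      also have "\<dots> = ennreal M2 * ennreal (W s / (1 - s) * (1 - s) powr (- d))"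
        using M 2 tail_nonneg[of s] by (intro ennreal_mult) auto
      finally show ?thesis using 2 r by simp
    qed simp
  qed
  also have "\<dots> = ennreal M1 * (\<integral>\<^sup>+s\<in>{0..<r}. ennreal ((1 - s) powr (- \<gamma> - 1)) \<partial>lborel)
      + ennreal M2 * (\<integral>\<^sup>+s\<in>{r..<1}. ennreal (W s / (1 - s) * (1 - s) powr (- d)) \<partial>lborel)"
    by (subst nn_integral_add) (auto simp: nn_integral_cmult)
  also have "\<dots> \<le> ennreal M1 * ennreal ((1 - r) powr (- \<gamma>) / \<gamma>) + ennreal M2 * ennreal (A ^ 3 / (a - d) * W r * (1 - r) powr (- d))"
    by (intro add_mono mult_left_mono 1 nn_integral_tail_upper r d) auto
  also have "\<dots> = ennreal (M1 * ((1 - r) powr (- \<gamma>) / \<gamma>)) + ennreal (M2 * (A ^ 3 / (a - d) * W r * (1 - r) powr (- d)))"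
    using M \<gamma> by (simp add: ennreal_mult'[symmetric])
  also have "\<dots> = ennreal (M1 * (1 - r) powr (- \<gamma>) / \<gamma> + M2 * (A ^ 3 / (a - d) * W r * (1 - r) powr (- d)))"
    using M \<gamma> A d tail_nonneg[of r] by (subst ennreal_plus[symmetric]) (auto intro!: mult_nonneg_nonneg divide_nonneg_nonneg)
  finally show ?thesis .
qed

lemma nn_integral_\<nu>_circle_le:
  assumes [measurable]: "u \<in> borel_measurable borel"
    and le: "\<And>s. 0 \<le> s \<Longrightarrow> s < 1 \<Longrightarrow> circle_nn u (of_real s) \<le> ennreal (c s)" and c: "\<And>s. 0 \<le> s \<Longrightarrow> s < 1 \<Longrightarrow> 0 \<le> c s"
  shows "(\<integral>\<^sup>+z. u z \<partial>\<nu>) \<le> (\<integral>\<^sup>+s\<in>{0..<1}. ennreal (W s / (1 - s) * c s) \<partial>lborel)"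
  unfolding nn_integral_\<nu>[OF assms(1)]
proof (rule nn_integral_mono)
  fix s :: real
  show "ennreal (W s / (1 - s)) * circle_nn u (of_real s) * indicator {0..<1} s \<le> ennreal (W s / (1 - s) * c s) * indicator {0..<1} s"
  proof (cases "s \<in> {0..<1}")
    case True
    then have "ennreal (W s / (1 - s)) * circle_nn u (of_real s) \<le> ennreal (W s / (1 - s)) * ennreal (c s)"
      by (intro mult_left_mono le) auto
    also have "\<dots> = ennreal (W s / (1 - s) * c s)"
      using True c[of s] tail_nonneg[of s] by (intro ennreal_mult[symmetric]) auto
    finally show ?thesis using True by simp
  qed simp
qed

lemma kern_holomorphic: "kern m holomorphic_on disc" and taylor_kern: "taylor (kern m) (\<lambda>n. of_real (real (Suc n) ^ m * lam n))"
proof -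
  have "kern m = (\<lambda>z. \<Sum>n. of_real (real (Suc n) ^ m * lam n) * z ^ n)" by (rule ext) (simp only: kern_def)
  then show t: "taylor (kern m) (\<lambda>n. of_real (real (Suc n) ^ m * lam n))"
    by (simp only:) (rule taylorI, rule summable_norm_cancel[OF summable_kern])
  show "kern m holomorphic_on disc" by (rule taylor_holomorphic[OF t])
qed

lemma measurable_kern [measurable]: "on_disc (kern m) \<in> borel_measurable borel"
  by (intro borel_measurable_on_disc holomorphic_on_imp_continuous_on kern_holomorphic)

text \<open>The kernel bound has the singular exponent \<open>1 + a\<close>, which exceeds 1, so its
  circle integral is of order \<open>(1 - norm c) powr (- a)\<close>. This cancels the numerator of
  the bound and leaves only the tail.\<close>

lemma circle_nn_kern:
  "\<exists>C>0. \<forall>c. norm c < 1 \<longrightarrow> circle_nn (\<lambda>z. ennreal (norm (on_disc (kern 0) z))) c \<le> ennreal (C / W (norm c))"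
proof -
  obtain C where C: "0 < C" and bd: "\<And>w. norm w < 1 \<Longrightarrow> norm (kern 0 w) \<le> C * (norm (1 - w) powr (- (1 + real 0 + a)) * (1 - norm w) powr a / W (norm w))"
    using kern_bound[of 0] by blast
  define D where "D = 2 * (2 * pi) powr (1 + a) / a"
  have D: "0 < D" using a by (simp add: D_def)
  have "circle_nn (\<lambda>z. ennreal (norm (on_disc (kern 0) z))) c \<le> ennreal (C * D / W (norm c))" if c: "norm c < 1" for c
  proof -
    define k where "k = C * (1 - norm c) powr a / W (norm c)"
    have Wc: "0 < W (norm c)" using c by (intro tail_pos) auto
    have k: "0 \<le> k" using C Wc by (simp add: k_def)
    have "circle_nn (\<lambda>z. ennreal (norm (on_disc (kern 0) z))) c \<le> ennreal k * circle_nn (\<lambda>z. ennreal (norm (1 - z) powr (- (1 + a)))) c"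
    proof (rule circle_nn_le_cmult)
      fix z :: complex assume z: "norm z = norm c"
      have "norm (on_disc (kern 0) z) \<le> k * norm (1 - z) powr (- (1 + a))"
        using bd[of z] c z by (simp add: on_disc_def k_def mult_ac)
      then show "ennreal (norm (on_disc (kern 0) z)) \<le> ennreal k * ennreal (norm (1 - z) powr (- (1 + a)))"
        using k by (simp add: ennreal_mult[symmetric] ennreal_leI)
    qed measurable
    also have "\<dots> \<le> ennreal k * ennreal (2 * (2 * pi) powr (1 + a) / (1 + a - 1) * (1 - norm c) powr (1 - (1 + a)))"
      using a c by (intro mult_left_mono circle_nn_one_minus) auto
    also have "\<dots> = ennreal k * ennreal (D * (1 - norm c) powr (- a))" by (simp add: D_def)
    also have "\<dots> = ennreal (k * (D * (1 - norm c) powr (- a)))"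
      using k D by (intro ennreal_mult[symmetric]) auto
    also have "k * (D * (1 - norm c) powr (- a)) = C * D / W (norm c)"
    proof -
      have "(1 - norm c) powr a * (1 - norm c) powr (- a) = 1" using c by (simp flip: powr_add)
      then show ?thesis unfolding k_def by (simp add: mult_ac)
    qed
    finally show ?thesis .
  qed
  then show ?thesis using C D by (intro exI[of _ "C * D"]) auto
qed

text \<open>On the circle of radius \<open>s\<close> the kernel integrates to about
  \<open>1 / W (r * s)\<close>. Both \<open>W s\<close> and \<open>W r\<close> are at most
  \<open>W (r * s)\<close>; the first is used for \<open>s < r\<close> and the second beyond.
  Convergence above \<open>r\<close> requires \<open>d < a\<close>, and \<open>0 < d\<close> avoids
  a logarithm below \<open>r\<close>.\<close>

lemma kern_Schur_integral:
  assumes d: "0 < d" "d < a"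
  shows "\<exists>C>0. \<forall>z. norm z < 1 \<longrightarrow>
    (\<integral>\<^sup>+\<zeta>. ennreal (norm (on_disc (kern 0) (cnj z * \<zeta>)) * (1 - norm \<zeta>) powr (- d)) \<partial>\<nu>) \<le> ennreal (C * (1 - norm z) powr (- d))"
proof -
  obtain C where C: "0 < C" and circ: "\<And>c. norm c < 1 \<Longrightarrow> circle_nn (\<lambda>z. ennreal (norm (on_disc (kern 0) z))) c \<le> ennreal (C / W (norm c))"
    using circle_nn_kern by blast
  define D where "D = C / d + C * (A ^ 3 / (a - d))"
  have D: "0 < D" using C d A by (auto simp: D_def intro!: add_pos_nonneg)
  have "(\<integral>\<^sup>+\<zeta>. ennreal (norm (on_disc (kern 0) (cnj z * \<zeta>)) * (1 - norm \<zeta>) powr (- d)) \<partial>\<nu>) \<le> ennreal (D * (1 - norm z) powr (- d))"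
    if z: "norm z < 1" for z
  proof -
    define r where "r = norm z"
    have r: "0 \<le> r" "r < 1" using z by (auto simp: r_def)
    have Wr: "0 < W r" using r by (intro tail_pos)
    have "(\<integral>\<^sup>+\<zeta>. ennreal (norm (on_disc (kern 0) (cnj z * \<zeta>)) * (1 - norm \<zeta>) powr (- d)) \<partial>\<nu>)
      \<le> (\<integral>\<^sup>+s\<in>{0..<1}. ennreal (W s / (1 - s) * ((1 - s) powr (- d) * (C / W (r * s)))) \<partial>lborel)"
    proof (rule nn_integral_\<nu>_circle_le)
      fix s :: real assume s: "0 \<le> s" "s < 1"
      note Ws = tail_mult_le[OF r s]
      have nc: "norm (cnj z * of_real s) = r * s" using s by (simp add: norm_mult r_def)
      have "circle_nn (\<lambda>\<zeta>. ennreal (norm (on_disc (kern 0) (cnj z * \<zeta>)) * (1 - norm \<zeta>) powr (- d))) (of_real s)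
        \<le> ennreal ((1 - s) powr (- d)) * circle_nn (\<lambda>\<zeta>. ennreal (norm (on_disc (kern 0) (cnj z * \<zeta>)))) (of_real s)"
        by (rule circle_nn_le_cmult) (use s in \<open>auto simp: ennreal_mult[symmetric] mult.commute\<close>)
      also have "\<dots> \<le> ennreal ((1 - s) powr (- d)) * ennreal (C / W (r * s))"
      proof (rule mult_left_mono)
        show "circle_nn (\<lambda>\<zeta>. ennreal (norm (on_disc (kern 0) (cnj z * \<zeta>)))) (of_real s) \<le> ennreal (C / W (r * s))"
          using circ[of "cnj z * of_real s"] Ws nc
          by (subst circle_nn_mult_right[where u = "\<lambda>\<zeta>. ennreal (norm (on_disc (kern 0) \<zeta>))"]) simp
      qed simp
      also have "\<dots> = ennreal ((1 - s) powr (- d) * (C / W (r * s)))"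
        using C Ws by (intro ennreal_mult[symmetric]) auto
      finally show "circle_nn (\<lambda>\<zeta>. ennreal (norm (on_disc (kern 0) (cnj z * \<zeta>)) * (1 - norm \<zeta>) powr (- d))) (of_real s)
        \<le> ennreal ((1 - s) powr (- d) * (C / W (r * s)))" .
      show "0 \<le> (1 - s) powr (- d) * (C / W (r * s))" using C Ws by simp
    qed measurable
    also have "\<dots> \<le> ennreal (C * (1 - r) powr (- d) / d + C / W r * (A ^ 3 / (a - d) * W r * (1 - r) powr (- d)))"
    proof (rule nn_integral_split_bound)
      fix s :: real assume s: "0 \<le> s" "s < r"
      note Ws = tail_mult_le[OF r s(1) less_trans[OF s(2) r(2)]]
      have "W s / (1 - s) * ((1 - s) powr (- d) * (C / W (r * s))) = C * ((1 - s) powr (- d) / (1 - s)) * (W s / W (r * s))"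
        by simp
      also have "\<dots> \<le> C * ((1 - s) powr (- d) / (1 - s)) * 1"
        using Ws C s r by (intro mult_left_mono) (auto simp: divide_le_eq)
      also have "\<dots> = C * (1 - s) powr (- d - 1)" using s r by (simp add: powr_diff)
      finally show "W s / (1 - s) * ((1 - s) powr (- d) * (C / W (r * s))) \<le> C * (1 - s) powr (- d - 1)" .
    next
      fix s :: real assume s: "r \<le> s" "s < 1"
      then have s0: "0 \<le> s" using r by simp
      note Ws = tail_mult_le[OF r s0 s(2)]
      have "W s / (1 - s) * ((1 - s) powr (- d) * (C / W (r * s))) = C / W (r * s) * (W s / (1 - s) * (1 - s) powr (- d))"
        by (simp add: mult_ac)
      also have "\<dots> \<le> C / W r * (W s / (1 - s) * (1 - s) powr (- d))"
        using Ws Wr C s tail_nonneg[of s] by (intro mult_right_mono divide_left_mono) auto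
      finally show "W s / (1 - s) * ((1 - s) powr (- d) * (C / W (r * s))) \<le> C / W r * (W s / (1 - s) * (1 - s) powr (- d))" .
    qed (use r d C Wr in auto)
    also have "C * (1 - r) powr (- d) / d + C / W r * (A ^ 3 / (a - d) * W r * (1 - r) powr (- d)) = D * (1 - r) powr (- d)"
      using Wr by (simp add: D_def distrib_right)
    finally show ?thesis by (simp add: r_def)
  qed
  then show ?thesis using D by (intro exI[of _ D]) auto
qed

text \<open>The functions \<open>S\<close> and \<open>g\<close> are quantified inside so that one
  constant works for all symbols and all arguments of the operator.\<close>

lemma kern_Schur:
  assumes p: "1 < p"
  shows "\<exists>C>0. \<forall>S g. (\<forall>z. 0 \<le> S z) \<longrightarrow> (\<forall>\<zeta>. 0 \<le> g \<zeta>) \<longrightarrow> g \<in> borel_measurable borel \<longrightarrow> (\<forall>z. 1 \<le> norm z \<longrightarrow> S z = 0) \<longrightarrow>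
    (\<forall>z. norm z < 1 \<longrightarrow> ennreal (S z) \<le> (\<integral>\<^sup>+\<zeta>. ennreal (norm (on_disc (kern 0) (cnj z * \<zeta>)) * g \<zeta>) \<partial>\<nu>)) \<longrightarrow>
    (\<integral>\<^sup>+z. ennreal (S z powr p) \<partial>\<nu>) \<le> ennreal C * (\<integral>\<^sup>+\<zeta>. ennreal (g \<zeta> powr p) \<partial>\<nu>)"
proof -
  define q where "q = p / (p - 1)"
  have q: "0 < q" using p by (simp add: q_def)
  \<comment> \<open>One exponent for both Schur conditions: \<open>e * p\<close> and
    \<open>e * q\<close> are positive and below \<open>a / 2\<close>.\<close>
  define e where "e = a / (2 * (p + q))"
  have e: "0 < e * p" "0 < e * q" "e * p < a" "e * q < a"
    using p q a mult_pos_pos[of a p] mult_pos_pos[of a q] by (auto simp: e_def field_simps intro!: add_pos_pos)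
  obtain C1 where C1: "0 < C1" and S1: "\<And>z. norm z < 1 \<Longrightarrow>
      (\<integral>\<^sup>+\<zeta>. ennreal (norm (on_disc (kern 0) (cnj z * \<zeta>)) * (1 - norm \<zeta>) powr (- (e * q))) \<partial>\<nu>) \<le> ennreal (C1 * (1 - norm z) powr (- (e * q)))"
    using kern_Schur_integral[OF e(2,4)] by blast
  obtain C2 where C2: "0 < C2" and S2: "\<And>z. norm z < 1 \<Longrightarrow>
      (\<integral>\<^sup>+\<zeta>. ennreal (norm (on_disc (kern 0) (cnj z * \<zeta>)) * (1 - norm \<zeta>) powr (- (e * p))) \<partial>\<nu>) \<le> ennreal (C2 * (1 - norm z) powr (- (e * p)))"
    using kern_Schur_integral[OF e(1,3)] by blast
  \<comment> \<open>The value 1 off the disc keeps the test function positive everywhere, as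
    \<open>schur_test\<close> demands; the kernel \<open>k\<close> vanishes there.\<close>
  define h :: "complex \<Rightarrow> real" where "h z = (if norm z < 1 then (1 - norm z) powr (- e) else 1)" for z
  have [measurable]: "h \<in> borel_measurable borel" unfolding h_def by measurable
  have h_pos: "0 < h z" for z by (simp add: h_def)
  define k :: "complex \<times> complex \<Rightarrow> real" where
    "k = (\<lambda>(z, \<zeta>). if norm z < 1 \<and> norm \<zeta> < 1 then norm (on_disc (kern 0) (cnj z * \<zeta>)) else 0)"
  have km: "k \<in> borel_measurable (borel \<Otimes>\<^sub>M borel)"
    unfolding k_def by measurable
  have h_powr: "h \<zeta> powr x = (1 - norm \<zeta>) powr (- (e * x))" if "norm \<zeta> < 1" for \<zeta> x
    using that by (simp add: h_def powr_powr)
  have \<nu>_cong: "(\<integral>\<^sup>+z. u z \<partial>\<nu>) = (\<integral>\<^sup>+z. v z \<partial>\<nu>)"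
    if "\<And>z. norm z < 1 \<Longrightarrow> u z = v z" "u \<in> borel_measurable borel" "v \<in> borel_measurable borel" for u v
    unfolding nn_integral_\<nu>[OF that(2)] nn_integral_\<nu>[OF that(3)]
    by (intro nn_integral_cong) (auto simp: indicator_def intro!: arg_cong2[where f = "(*)"] circle_nn_cong_disc that(1))
  have "(\<integral>\<^sup>+z. ennreal (S z powr p) \<partial>\<nu>) \<le> ennreal (C1 powr (p - 1) * C2) * (\<integral>\<^sup>+\<zeta>. ennreal (g \<zeta> powr p) \<partial>\<nu>)"
    if S: "\<And>z. 0 \<le> S z" and g: "\<And>\<zeta>. 0 \<le> g \<zeta>" and gm [measurable]: "g \<in> borel_measurable borel"
      and S0: "\<And>z. 1 \<le> norm z \<Longrightarrow> S z = 0"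
      and le: "\<And>z. norm z < 1 \<Longrightarrow> ennreal (S z) \<le> (\<integral>\<^sup>+\<zeta>. ennreal (norm (on_disc (kern 0) (cnj z * \<zeta>)) * g \<zeta>) \<partial>\<nu>)" for S g
  proof (rule schur_test[where k = k and hM = h and hN = h and q = q])
    show "ennreal (S z) \<le> (\<integral>\<^sup>+\<zeta>. ennreal (k (z, \<zeta>) * g \<zeta>) \<partial>\<nu>)" for z
    proof (cases "norm z < 1")
      case True
      have "(\<integral>\<^sup>+\<zeta>. ennreal (norm (on_disc (kern 0) (cnj z * \<zeta>)) * g \<zeta>) \<partial>\<nu>) = (\<integral>\<^sup>+\<zeta>. ennreal (k (z, \<zeta>) * g \<zeta>) \<partial>\<nu>)"
        using True km by (intro \<nu>_cong) (auto simp: k_def)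
      then show ?thesis using le[OF True] by simp
    qed (simp add: S0)
    show "(\<integral>\<^sup>+\<zeta>. ennreal (k (z, \<zeta>) * h \<zeta> powr q) \<partial>\<nu>) \<le> ennreal (C1 * h z powr q)" for z
    proof (cases "norm z < 1")
      case True
      have "(\<integral>\<^sup>+\<zeta>. ennreal (k (z, \<zeta>) * h \<zeta> powr q) \<partial>\<nu>)
        = (\<integral>\<^sup>+\<zeta>. ennreal (norm (on_disc (kern 0) (cnj z * \<zeta>)) * (1 - norm \<zeta>) powr (- (e * q))) \<partial>\<nu>)"
        using True km by (intro \<nu>_cong) (auto simp: k_def h_powr)
      then show ?thesis using S1[OF True] True by (simp add: h_powr)
    qed (simp add: k_def)
    show "(\<integral>\<^sup>+z. ennreal (k (z, \<zeta>) * h z powr p) \<partial>\<nu>) \<le> ennreal (C2 * h \<zeta> powr p)" for \<zeta>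
    proof (cases "norm \<zeta> < 1")
      case True
      have "(\<integral>\<^sup>+z. ennreal (k (z, \<zeta>) * h z powr p) \<partial>\<nu>)
        = (\<integral>\<^sup>+z. ennreal (norm (on_disc (kern 0) (cnj \<zeta> * z)) * (1 - norm z) powr (- (e * p))) \<partial>\<nu>)"
      proof (rule \<nu>_cong)
        fix z :: complex assume z: "norm z < 1"
        \<comment> \<open>The coefficients are real, so conjugating the argument conjugates the
          value. This gives the symmetry of \<open>k\<close> that reduces the second Schur condition
          to the same integral estimate.\<close>
        have "norm (kern 0 (cnj w)) = norm (kern 0 w)" if "norm w < 1" for w
        proof -
          have "(\<lambda>n. of_real (real (Suc n) ^ 0 * lam n) * w ^ n) sums kern 0 w"
            using taylor_kern[of 0] that unfolding taylor_def by simp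
          then have "(\<lambda>n. cnj (of_real (real (Suc n) ^ 0 * lam n) * w ^ n)) sums cnj (kern 0 w)"
            by (subst sums_cnj)
          moreover have "(\<lambda>n. of_real (real (Suc n) ^ 0 * lam n) * cnj w ^ n) sums kern 0 (cnj w)"
            using taylor_kern[of 0] that unfolding taylor_def by simp
          ultimately have "kern 0 (cnj w) = cnj (kern 0 w)" using sums_unique2 by simp
          then show ?thesis by simp
        qed
        moreover have "norm (cnj \<zeta> * z) < 1"
          using True z mult_strict_mono'[of "norm \<zeta>" 1 "norm z" 1] by (simp add: norm_mult)
        ultimately have "norm (on_disc (kern 0) (cnj (cnj \<zeta> * z))) = norm (on_disc (kern 0) (cnj \<zeta> * z))"
          by (simp only: on_disc_def mem_ball_0 complex_mod_cnj if_True)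
        then have "norm (on_disc (kern 0) (cnj z * \<zeta>)) = norm (on_disc (kern 0) (cnj \<zeta> * z))"
          by (simp add: mult.commute)
        then show "ennreal (k (z, \<zeta>) * h z powr p) = ennreal (norm (on_disc (kern 0) (cnj \<zeta> * z)) * (1 - norm z) powr (- (e * p)))"
          using True z by (simp add: k_def h_powr)
      qed (use km in measurable)
      then show ?thesis using S2[OF True] True by (simp add: h_powr)
    qed (simp add: k_def)
    show "k \<in> borel_measurable (\<nu> \<Otimes>\<^sub>M \<nu>)" using km by measurable
    show "0 \<le> k z" for z by (cases z) (simp add: k_def)
  qed (use S g p q_def C1 C2 h_pos sigma_finite_\<nu> h_pos[THEN less_imp_le] in auto)
  then show ?thesis using C1 C2 by (intro exI[of _ "C1 powr (p - 1) * C2"]) auto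
qed

text \<open>For \<open>s < r\<close> the tail may exceed \<open>W r\<close> by the factor
  \<open>((1 - s) / (1 - r)) ^ b\<close>. The hypothesis on \<open>q\<close> says that the remaining
  power still favours the endpoint \<open>r\<close>, so both parts of the integral have the same
  size.\<close>

lemma test_function_norm:
  assumes q: "real b + 1 < q"
  shows "\<exists>C>0. \<forall>w. norm w < 1 \<longrightarrow>
    (\<integral>\<^sup>+\<zeta>. ennreal (norm (1 - cnj w * \<zeta>) powr (- q)) \<partial>\<nu>) \<le> ennreal (C * W (norm w) * (1 - norm w) powr (1 - q))"
proof -
  define D where "D = 2 * (2 * pi) powr q / (q - 1)"
  have D: "0 < D" using q by (simp add: D_def)
  define E where "E = D * (A ^ 3 / (q - 1 - real b) + A ^ 3 / a)"
  have E: "0 < E" using D A a q by (auto simp: E_def intro!: mult_pos_pos add_pos_pos)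
  have "(\<integral>\<^sup>+\<zeta>. ennreal (norm (1 - cnj w * \<zeta>) powr (- q)) \<partial>\<nu>) \<le> ennreal (E * W (norm w) * (1 - norm w) powr (1 - q))"
    if w: "norm w < 1" for w
  proof -
    define r where "r = norm w"
    have r: "0 \<le> r" "r < 1" using w by (auto simp: r_def)
    have Wr: "0 < W r" using r by (intro tail_pos)
    have "(\<integral>\<^sup>+\<zeta>. ennreal (norm (1 - cnj w * \<zeta>) powr (- q)) \<partial>\<nu>)
      \<le> (\<integral>\<^sup>+s\<in>{0..<1}. ennreal (W s / (1 - s) * (D * (1 - r * s) powr (1 - q))) \<partial>lborel)"
    proof (rule nn_integral_\<nu>_circle_le)
      fix s :: real assume s: "0 \<le> s" "s < 1"
      have nc: "norm (cnj w * of_real s) = r * s" using s by (simp add: norm_mult r_def)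
      show "circle_nn (\<lambda>\<zeta>. ennreal (norm (1 - cnj w * \<zeta>) powr (- q))) (of_real s) \<le> ennreal (D * (1 - r * s) powr (1 - q))"
        using circle_nn_one_minus[of q "cnj w * of_real s"] q tail_mult_le(4)[OF r s] unfolding nc D_def
        by (subst circle_nn_mult_right[where u = "\<lambda>z. ennreal (norm (1 - z) powr (- q))"]) simp
      show "0 \<le> D * (1 - r * s) powr (1 - q)" using D by simp
    qed measurable
    also have "\<dots> \<le> ennreal ((D * A ^ 3 * (1 - r) powr (- real b) * W r) * (1 - r) powr (- (q - 1 - real b)) / (q - 1 - real b)
        + (D * (1 - r) powr (1 - q)) * (A ^ 3 / (a - 0) * W r * (1 - r) powr (- 0)))"
    proof (rule nn_integral_split_bound)
      fix s :: real assume s: "0 \<le> s" "s < r"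
      have "W s \<le> A ^ 3 * ((1 - s) / (1 - r)) ^ b * W r" using s r by (intro tail_growth) auto
      also have "((1 - s) / (1 - r)) ^ b = (1 - s) powr real b * (1 - r) powr (- real b)"
        using s r by (simp add: powr_realpow powr_minus power_divide field_simps)
      finally have 1: "W s \<le> A ^ 3 * ((1 - s) powr real b * (1 - r) powr (- real b)) * W r" .
      have "r * s \<le> s" using s r by (intro mult_left_le_one_le) auto
      then have 2: "(1 - r * s) powr (1 - q) \<le> (1 - s) powr (1 - q)"
        using s r q by (intro powr_mono2') auto
      have "W s / (1 - s) * (D * (1 - r * s) powr (1 - q))
        \<le> (A ^ 3 * ((1 - s) powr real b * (1 - r) powr (- real b)) * W r) / (1 - s) * (D * (1 - s) powr (1 - q))"
        using 1 2 s r D A Wr by (intro mult_mono divide_right_mono mult_left_mono) (auto intro!: divide_nonneg_nonneg)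
      also have "\<dots> = (D * A ^ 3 * (1 - r) powr (- real b) * W r) * ((1 - s) powr real b / (1 - s) * (1 - s) powr (1 - q))"
        by simp
      also have "(1 - s) powr real b / (1 - s) * (1 - s) powr (1 - q) = (1 - s) powr (- (q - 1 - real b) - 1)"
      proof -
        have "(1 - s) powr real b / (1 - s) = (1 - s) powr (real b - 1)" using s r by (simp add: powr_diff)
        then show ?thesis by (simp flip: powr_add add: algebra_simps)
      qed
      finally show "W s / (1 - s) * (D * (1 - r * s) powr (1 - q))
        \<le> (D * A ^ 3 * (1 - r) powr (- real b) * W r) * (1 - s) powr (- (q - 1 - real b) - 1)" .
    next
      fix s :: real assume s: "r \<le> s" "s < 1"
      have "r * s \<le> r" using s r by (intro mult_right_le_one_le) auto
      then have "(1 - r * s) powr (1 - q) \<le> (1 - r) powr (1 - q)"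
        using s r q by (intro powr_mono2') auto
      then have "W s / (1 - s) * (D * (1 - r * s) powr (1 - q)) \<le> W s / (1 - s) * (D * (1 - r) powr (1 - q))"
        using D s tail_nonneg[of s] by (intro mult_left_mono) auto
      then show "W s / (1 - s) * (D * (1 - r * s) powr (1 - q)) \<le> D * (1 - r) powr (1 - q) * (W s / (1 - s) * (1 - s) powr (- 0))"
        using s by (simp add: mult_ac)
    qed (use r q D A Wr a in auto)
    also have "(D * A ^ 3 * (1 - r) powr (- real b) * W r) * (1 - r) powr (- (q - 1 - real b)) / (q - 1 - real b)
        + (D * (1 - r) powr (1 - q)) * (A ^ 3 / (a - 0) * W r * (1 - r) powr (- 0)) = E * W r * (1 - r) powr (1 - q)"
    proof -
      have "(1 - r) powr (- real b) * (1 - r) powr (- (q - 1 - real b)) = (1 - r) powr (1 - q)" by (simp flip: powr_add)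
      moreover have "(D * A ^ 3 * (1 - r) powr (- real b) * W r) * (1 - r) powr (- (q - 1 - real b))
          = D * A ^ 3 * W r * ((1 - r) powr (- real b) * (1 - r) powr (- (q - 1 - real b)))"
        by (simp only: mult_ac)
      ultimately have 1: "(D * A ^ 3 * (1 - r) powr (- real b) * W r) * (1 - r) powr (- (q - 1 - real b)) = D * A ^ 3 * W r * (1 - r) powr (1 - q)"
        by (simp only:)
      show ?thesis unfolding E_def 1 using r by (simp add: algebra_simps)
    qed
    finally show ?thesis by (simp add: r_def)
  qed
  then show ?thesis using E by (intro exI[of _ E]) auto
qed

text \<open>The factor \<open>(1 - \<eta>) ^ m\<close> lowers the singularity of
  \<open>kern m\<close> to \<open>norm (1 - \<eta>) powr (- 1) / W (norm \<eta>)\<close>, because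
  \<open>1 - norm \<eta>\<close> is at most \<open>norm (1 - \<eta>)\<close>. Below \<open>r\<close>
  only monotonicity of the tail is used: \<open>W s powr (1 - q)\<close> increases with
  \<open>s\<close>, so the exponent \<open>b\<close> does not enter.\<close>

lemma test_kernel_norm:
  assumes q: "1 < q"
  shows "\<exists>C>0. \<forall>w. norm w < 1 \<longrightarrow>
    (\<integral>\<^sup>+\<zeta>. ennreal (norm (on_disc (\<lambda>\<eta>. kern m \<eta> * (1 - \<eta>) ^ m) (cnj w * \<zeta>)) powr q) \<partial>\<nu>)
      \<le> ennreal (C * (W (norm w) * (1 - norm w)) powr (1 - q))"
proof -
  obtain C where C: "0 < C" and bd: "\<And>w. norm w < 1 \<Longrightarrow> norm (kern m w) \<le> C * (norm (1 - w) powr (- (1 + real m + a)) * (1 - norm w) powr a / W (norm w))"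
    using kern_bound[of m] by blast
  have U: "norm (kern m \<eta> * (1 - \<eta>) ^ m) \<le> C * (norm (1 - \<eta>) powr (- 1) / W (norm \<eta>))" if "norm \<eta> < 1" for \<eta>
  proof -
    have W: "0 < W (norm \<eta>)" using that by (intro tail_pos) auto
    have pos: "0 < norm (1 - \<eta>)" using that by auto
    have "norm (kern m \<eta> * (1 - \<eta>) ^ m) \<le> C * (norm (1 - \<eta>) powr (- (1 + real m + a)) * (1 - norm \<eta>) powr a / W (norm \<eta>)) * norm (1 - \<eta>) ^ m"
      unfolding norm_mult norm_power using bd[OF that] by (intro mult_right_mono) auto
    also have "\<dots> \<le> C * (norm (1 - \<eta>) powr (- (1 + real m + a)) * norm (1 - \<eta>) powr a / W (norm \<eta>)) * norm (1 - \<eta>) ^ m"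
      using C W that a norm_one_minus_ge[of \<eta>]
      by (intro mult_right_mono mult_left_mono divide_right_mono powr_mono2) auto
    also have "norm (1 - \<eta>) ^ m = norm (1 - \<eta>) powr real m" using pos by (simp add: powr_realpow)
    also have "C * (norm (1 - \<eta>) powr (- (1 + real m + a)) * norm (1 - \<eta>) powr a / W (norm \<eta>)) * norm (1 - \<eta>) powr real m
      = C * ((norm (1 - \<eta>) powr (- (1 + real m + a)) * norm (1 - \<eta>) powr a * norm (1 - \<eta>) powr real m) / W (norm \<eta>))"
      by simp
    also have "norm (1 - \<eta>) powr (- (1 + real m + a)) * norm (1 - \<eta>) powr a * norm (1 - \<eta>) powr real m = norm (1 - \<eta>) powr (- 1)"
      by (simp flip: powr_add)
    finally show ?thesis .
  qed
  have [measurable]: "on_disc (\<lambda>\<eta>. kern m \<eta> * (1 - \<eta>) ^ m) \<in> borel_measurable borel"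
    by (intro borel_measurable_on_disc continuous_intros holomorphic_on_imp_continuous_on kern_holomorphic)
  define D where "D = C powr q * (2 * (2 * pi) powr q / (q - 1))"
  have D: "0 < D" using q C by (simp add: D_def)
  define E where "E = D / (q - 1) + D * (A ^ 3 / a)"
  have E: "0 < E" using D A a q by (auto simp: E_def intro!: mult_pos_pos add_pos_pos)
  have "(\<integral>\<^sup>+\<zeta>. ennreal (norm (on_disc (\<lambda>\<eta>. kern m \<eta> * (1 - \<eta>) ^ m) (cnj w * \<zeta>)) powr q) \<partial>\<nu>)
      \<le> ennreal (E * (W (norm w) * (1 - norm w)) powr (1 - q))"
    if w: "norm w < 1" for w
  proof -
    define r where "r = norm w"
    have r: "0 \<le> r" "r < 1" using w by (auto simp: r_def)
    have Wr: "0 < W r" using r by (intro tail_pos)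
    have "(\<integral>\<^sup>+\<zeta>. ennreal (norm (on_disc (\<lambda>\<eta>. kern m \<eta> * (1 - \<eta>) ^ m) (cnj w * \<zeta>)) powr q) \<partial>\<nu>)
      \<le> (\<integral>\<^sup>+s\<in>{0..<1}. ennreal (W s / (1 - s) * (D * W (r * s) powr (- q) * (1 - r * s) powr (1 - q))) \<partial>lborel)"
    proof (rule nn_integral_\<nu>_circle_le)
      fix s :: real assume s: "0 \<le> s" "s < 1"
      note Ws = tail_mult_le[OF r s]
      have nc: "norm (cnj w * of_real s) = r * s" using s by (simp add: norm_mult r_def)
      have "circle_nn (\<lambda>\<zeta>. ennreal (norm (on_disc (\<lambda>\<eta>. kern m \<eta> * (1 - \<eta>) ^ m) (cnj w * \<zeta>)) powr q)) (of_real s)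
        = circle_nn (\<lambda>\<eta>. ennreal (norm (on_disc (\<lambda>\<eta>. kern m \<eta> * (1 - \<eta>) ^ m) \<eta>) powr q)) (cnj w * of_real s)"
        by (rule circle_nn_mult_right[where u = "\<lambda>\<eta>. ennreal (norm (on_disc (\<lambda>\<eta>. kern m \<eta> * (1 - \<eta>) ^ m) \<eta>) powr q)"])
      also have "\<dots> \<le> ennreal (C powr q * W (r * s) powr (- q)) * circle_nn (\<lambda>z. ennreal (norm (1 - z) powr (- q))) (cnj w * of_real s)"
      proof (rule circle_nn_le_cmult)
        fix \<eta> :: complex assume "norm \<eta> = norm (cnj w * of_real s)"
        then have \<eta>: "norm \<eta> = r * s" "norm \<eta> < 1" using nc Ws by auto
        have "norm (on_disc (\<lambda>\<eta>. kern m \<eta> * (1 - \<eta>) ^ m) \<eta>) powr q \<le> (C * (norm (1 - \<eta>) powr (- 1) / W (norm \<eta>))) powr q"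
          using U[OF \<eta>(2)] \<eta> q by (intro powr_mono2) (auto simp: on_disc_def)
        also have "\<dots> = C powr q * W (r * s) powr (- q) * norm (1 - \<eta>) powr (- q)"
          using C Ws q by (simp add: \<eta>(1) powr_mult powr_divide powr_powr powr_minus_divide)
        finally show "ennreal (norm (on_disc (\<lambda>\<eta>. kern m \<eta> * (1 - \<eta>) ^ m) \<eta>) powr q)
          \<le> ennreal (C powr q * W (r * s) powr (- q)) * ennreal (norm (1 - \<eta>) powr (- q))"
          by (simp add: ennreal_mult[symmetric] ennreal_leI)
      qed measurable
      also have "\<dots> \<le> ennreal (C powr q * W (r * s) powr (- q)) * ennreal (2 * (2 * pi) powr q / (q - 1) * (1 - r * s) powr (1 - q))"
        using circle_nn_one_minus[of q "cnj w * of_real s"] q Ws unfolding nc by (intro mult_left_mono) auto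
      also have "\<dots> = ennreal (D * W (r * s) powr (- q) * (1 - r * s) powr (1 - q))"
        using q by (subst ennreal_mult[symmetric]) (auto simp: D_def mult_ac)
      finally show "circle_nn (\<lambda>\<zeta>. ennreal (norm (on_disc (\<lambda>\<eta>. kern m \<eta> * (1 - \<eta>) ^ m) (cnj w * \<zeta>)) powr q)) (of_real s)
        \<le> ennreal (D * W (r * s) powr (- q) * (1 - r * s) powr (1 - q))" .
      show "0 \<le> D * W (r * s) powr (- q) * (1 - r * s) powr (1 - q)" using D by simp
    qed measurable
    also have "\<dots> \<le> ennreal ((D * W r powr (1 - q)) * (1 - r) powr (- (q - 1)) / (q - 1)
        + (D * W r powr (- q) * (1 - r) powr (1 - q)) * (A ^ 3 / (a - 0) * W r * (1 - r) powr (- 0)))"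
    proof (rule nn_integral_split_bound)
      fix s :: real assume s: "0 \<le> s" "s < r"
      then have s1: "s < 1" using r by simp
      note Ws = tail_mult_le[OF r s(1) s1]
      have W0: "0 < W s" using s s1 by (intro tail_pos)
      have "r * s \<le> s" using s r by (intro mult_left_le_one_le) auto
      then have 2: "(1 - r * s) powr (1 - q) \<le> (1 - s) powr (1 - q)"
        using s r q by (intro powr_mono2') auto
      have 1: "W (r * s) powr (- q) \<le> W s powr (- q)" using Ws W0 q by (intro powr_mono2') auto
      have "W s / (1 - s) * (D * W (r * s) powr (- q) * (1 - r * s) powr (1 - q))
        \<le> W s / (1 - s) * (D * W s powr (- q) * (1 - s) powr (1 - q))"
        using 1 2 D W0 s1 by (intro mult_left_mono mult_mono) auto
      also have "\<dots> = D * (W s * W s powr (- q)) * ((1 - s) powr (1 - q) / (1 - s))" by simp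
      also have "W s * W s powr (- q) = W s powr (1 - q)" using W0 powr_add[of "W s" 1 "- q"] by simp
      also have "(1 - s) powr (1 - q) / (1 - s) = (1 - s) powr (- (q - 1) - 1)"
      proof -
        have "(1 - s) powr (1 - q - 1) = (1 - s) powr (1 - q) / (1 - s)" using s1 powr_diff[of "1 - s" "1 - q" 1] by simp
        then show ?thesis by simp
      qed
      also have "D * W s powr (1 - q) * (1 - s) powr (- (q - 1) - 1) \<le> D * W r powr (1 - q) * (1 - s) powr (- (q - 1) - 1)"
        using D W0 Wr s q by (intro mult_right_mono mult_left_mono powr_mono2' tail_antimono) auto
      finally show "W s / (1 - s) * (D * W (r * s) powr (- q) * (1 - r * s) powr (1 - q))
        \<le> D * W r powr (1 - q) * (1 - s) powr (- (q - 1) - 1)" .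
    next
      fix s :: real assume s: "r \<le> s" "s < 1"
      then have s0: "0 \<le> s" using r by simp
      note Ws = tail_mult_le[OF r s0 s(2)]
      have "r * s \<le> r" using s r by (intro mult_right_le_one_le) auto
      then have 2: "(1 - r * s) powr (1 - q) \<le> (1 - r) powr (1 - q)"
        using s r q by (intro powr_mono2') auto
      have 1: "W (r * s) powr (- q) \<le> W r powr (- q)" using Ws Wr q by (intro powr_mono2') auto
      have "W s / (1 - s) * (D * W (r * s) powr (- q) * (1 - r * s) powr (1 - q)) \<le> W s / (1 - s) * (D * W r powr (- q) * (1 - r) powr (1 - q))"
        using 1 2 D s tail_nonneg[of s] by (intro mult_left_mono mult_mono) auto
      then show "W s / (1 - s) * (D * W (r * s) powr (- q) * (1 - r * s) powr (1 - q))
        \<le> D * W r powr (- q) * (1 - r) powr (1 - q) * (W s / (1 - s) * (1 - s) powr (- 0))"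
        using s by (simp add: mult_ac)
    qed (use r q D A Wr a in auto)
    also have "(D * W r powr (1 - q)) * (1 - r) powr (- (q - 1)) / (q - 1)
        + (D * W r powr (- q) * (1 - r) powr (1 - q)) * (A ^ 3 / (a - 0) * W r * (1 - r) powr (- 0)) = E * (W r * (1 - r)) powr (1 - q)"
    proof -
      have "W r * W r powr (- q) = W r powr (1 - q)" using Wr powr_add[of "W r" 1 "- q"] by simp
      then have "(D * W r powr (- q) * (1 - r) powr (1 - q)) * (A ^ 3 / (a - 0) * W r * (1 - r) powr (- 0))
        = D * (A ^ 3 / a) * (W r powr (1 - q) * (1 - r) powr (1 - q))"
        using r by (simp add: mult_ac)
      moreover have "(W r * (1 - r)) powr (1 - q) = W r powr (1 - q) * (1 - r) powr (1 - q)"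
        using Wr r by (intro powr_mult)
      ultimately show ?thesis unfolding E_def by (simp add: algebra_simps)
    qed
    finally show ?thesis by (simp add: r_def)
  qed
  then show ?thesis using E by (intro exI[of _ E]) auto
qed

end

section \<open>Sufficiency\<close>

lemma taylor_mult_deriv:
  assumes "taylor f \<alpha>"
  shows "taylor (\<lambda>z. z * deriv f z) (\<lambda>n. of_nat n * \<alpha> n)"
  unfolding taylor_def
proof
  fix z :: complex assume z: "z \<in> disc"
  have "f field_differentiable at z"
    using holomorphic_on_imp_differentiable_at[OF taylor_holomorphic[OF assms]] z by auto
  then have "(f has_field_derivative deriv f z) (at z)" by (rule field_differentiable_derivI)
  then have "(\<lambda>n. diffs \<alpha> n * z ^ n) sums deriv f z"
    using assms z by (intro termdiffs_sums_strong[where K = 1 and f = f]) (auto simp: taylor_def)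
  then have "(\<lambda>n. z * (diffs \<alpha> n * z ^ n)) sums (z * deriv f z)" by (rule sums_mult)
  then have "(\<lambda>n. of_nat (Suc n) * \<alpha> (Suc n) * z ^ Suc n) sums (z * deriv f z)"
    by (rule back_subst[of "\<lambda>h. h sums _"]) (auto simp: diffs_def fun_eq_iff)
  then show "(\<lambda>n. of_nat n * \<alpha> n * z ^ n) sums (z * deriv f z)"
    by (subst (asm) sums_Suc_iff) simp
qed

lemma taylor_add: "taylor f \<alpha> \<Longrightarrow> taylor g \<beta> \<Longrightarrow> taylor (\<lambda>z. f z + g z) (\<lambda>n. \<alpha> n + \<beta> n)"
  unfolding taylor_def by (auto simp: distrib_right intro: sums_add)

text \<open>A majorant \<open>\<phi>\<close> in place of a constant bound lets each application
  choose the antiderivative of its own derivative estimate along the radius.\<close>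

lemma radial_growth:
  fixes f :: "complex \<Rightarrow> complex" and \<phi> \<phi>' :: "real \<Rightarrow> real"
  assumes f: "f holomorphic_on disc" and z: "z \<in> disc"
    and \<phi>: "continuous_on {0..1} \<phi>" "\<And>t. 0 < t \<Longrightarrow> t < 1 \<Longrightarrow> (\<phi> has_real_derivative \<phi>' t) (at t)"
    and le: "\<And>t. 0 < t \<Longrightarrow> t < 1 \<Longrightarrow> norm z * norm (deriv f (of_real t * z)) \<le> \<phi>' t"
  shows "norm (f z - f 0) \<le> \<phi> 1 - \<phi> 0"
proof -
  have in_disc: "of_real t * z \<in> disc" if "0 \<le> t" "t \<le> 1" for t
    using that z mult_left_le_one_le[of "norm z" t] by (simp add: norm_mult)
  have "norm (f (of_real 1 * z) - f (of_real 0 * z)) \<le> \<phi> 1 - \<phi> 0"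
  proof (rule differentiable_bound_general[where f = "\<lambda>t. f (of_real t * z)" and f' = "\<lambda>t. z * deriv f (of_real t * z)"])
    show "continuous_on {0..1} (\<lambda>t. f (of_real t * z))"
      by (rule continuous_on_compose2[OF holomorphic_on_imp_continuous_on[OF f]])
         (use in_disc in \<open>auto intro!: continuous_intros\<close>)
    fix t :: real assume t: "0 < t" "t < 1"
    have "f field_differentiable at (of_real t * z)"
      using holomorphic_on_imp_differentiable_at[OF f] in_disc[of t] t by auto
    then have d: "(f has_field_derivative deriv f (of_real t * z)) (at (of_real t * z))" by (rule field_differentiable_derivI)
    have "((\<lambda>w. f (w * z)) has_field_derivative deriv f (of_real t * z) * z) (at (of_real t))"
      by (rule DERIV_chain2[where g = "\<lambda>w. w * z" and x = "of_real t", OF d]) (auto intro!: derivative_eq_intros)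
    from has_vector_derivative_real_field[OF this]
    show "((\<lambda>t. f (of_real t * z)) has_vector_derivative z * deriv f (of_real t * z)) (at t)"
      by (simp add: mult.commute)
    show "(\<phi> has_vector_derivative \<phi>' t) (at t)"
      using \<phi>(2)[OF t] by (simp add: has_real_derivative_iff_has_vector_derivative)
    show "norm (z * deriv f (of_real t * z)) \<le> \<phi>' t"
      using le[OF t] by (simp add: norm_mult)
  qed (use \<phi> in auto)
  then show ?thesis by simp
qed

lemma bloch_deriv_bound:
  assumes f: "f \<in> bloch_space" and z: "z \<in> disc"
  shows "norm (f 0) + norm (deriv f z) * (1 - norm z) \<le> bloch_norm f"
proof -
  have bdd: "bdd_above ((\<lambda>z. norm (deriv f z) * (1 - (norm z)\<^sup>2)) ` disc)" using f by (simp add: bloch_space_def)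
  have "norm (deriv f z) * (1 - norm z) \<le> norm (deriv f z) * (1 - (norm z)\<^sup>2)"
    using z mult_right_le_one_le[of "norm z" "norm z"] by (intro mult_left_mono) (auto simp: power2_eq_square)
  also have "\<dots> \<le> (SUP z\<in>disc. norm (deriv f z) * (1 - (norm z)\<^sup>2))" using z bdd by (intro cSUP_upper)
  finally show ?thesis by (simp add: bloch_norm_def)
qed

lemma bloch_norm_nonneg: "f \<in> bloch_space \<Longrightarrow> 0 \<le> bloch_norm f"
  using bloch_deriv_bound[of f 0] by (auto intro: order_trans[rotated])

text \<open>The derivative bound \<open>B / (1 - norm z)\<close> integrates along the radius to a
  logarithm.\<close>

lemma bloch_growth:
  assumes f: "f \<in> bloch_space" and z: "z \<in> disc"
  shows "norm (f z) \<le> bloch_norm f * (1 - ln (1 - norm z))"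
proof -
  have hol: "f holomorphic_on disc" using f by (simp add: bloch_space_def)
  define B where "B = bloch_norm f"
  have B: "0 \<le> B" using bloch_norm_nonneg[OF f] by (simp add: B_def)
  define r where "r = norm z"
  have r: "0 \<le> r" "r < 1" using z by (auto simp: r_def)
  have tr: "t * r < 1" if "0 \<le> t" "t \<le> 1" for t using that r mult_left_le_one_le[of r t] by simp
  have "norm (f z - f 0) \<le> - B * ln (1 - 1 * r) - (- B * ln (1 - 0 * r))"
  proof (rule radial_growth[OF hol z, where \<phi>' = "\<lambda>t. B * r / (1 - t * r)"])
    show "continuous_on {0..1} (\<lambda>t. - B * ln (1 - t * r))"
      using tr by (intro continuous_intros) force
    show "((\<lambda>t. - B * ln (1 - t * r)) has_real_derivative B * r / (1 - t * r)) (at t)" if "0 < t" "t < 1" for t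
      using that tr[of t] by (auto intro!: derivative_eq_intros simp: field_simps)
    show "norm z * norm (deriv f (of_real t * z)) \<le> B * r / (1 - t * r)" if t: "0 < t" "t < 1" for t
    proof -
      have nt: "norm (of_real t * z) = t * r" using t by (simp add: norm_mult r_def)
      then have "of_real t * z \<in> disc" using tr[of t] t by simp
      from bloch_deriv_bound[OF f this] have "norm (f 0) + norm (deriv f (of_real t * z)) * (1 - t * r) \<le> B"
        unfolding nt B_def .
      then have "norm (deriv f (of_real t * z)) * (1 - t * r) \<le> B" using norm_ge_zero[of "f 0"] by linarith
      then have "norm (deriv f (of_real t * z)) \<le> B / (1 - t * r)" using tr[of t] t by (simp add: pos_le_divide_eq)
      then show ?thesis using mult_left_mono[of _ _ r] r by (fastforce simp: r_def mult.commute)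
    qed
  qed
  then have "norm (f z - f 0) \<le> - B * ln (1 - r)" by simp
  moreover have "norm (f 0) \<le> B"
  proof -
    have "norm (f 0) + norm (deriv f 0) \<le> B" using bloch_deriv_bound[OF f, of 0] by (simp add: B_def)
    then show ?thesis using norm_ge_zero[of "deriv f 0"] by linarith
  qed
  ultimately have "norm (f z) \<le> B + - B * ln (1 - r)" using norm_triangle_ineq[of "f z - f 0" "f 0"] by simp
  then show ?thesis by (simp add: B_def r_def algebra_simps)
qed

text \<open>Supplies the hypothesis on \<open>F\<close> in \<open>duality_bound\<close>. The
  derivative contributes 2 to the constant, and the logarithmic growth of \<open>f\<close>, which is
  at most \<open>1 / (1 - norm z)\<close>, contributes 1.\<close>

lemma bloch_radial_derivative_bound:
  assumes f: "f \<in> bloch_space" and z: "z \<in> disc"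
  shows "norm (2 * (z * deriv f z) + f z) * (1 - norm z) \<le> 3 * bloch_norm f"
proof -
  define r where "r = norm z"
  have r: "0 \<le> r" "r < 1" using z by (auto simp: r_def)
  have B: "0 \<le> bloch_norm f" using bloch_norm_nonneg[OF f] .
  have "ln (1 / (1 - r)) \<le> 1 / (1 - r) - 1" using r by (intro ln_le_minus_one) auto
  then have "1 - ln (1 - r) \<le> 1 / (1 - r)" using r by (simp add: ln_div)
  then have "bloch_norm f * (1 - ln (1 - r)) * (1 - r) \<le> bloch_norm f * (1 / (1 - r)) * (1 - r)" (is "?x \<le> ?y")
    using B r by (intro mult_right_mono mult_left_mono) auto
  also have "?y = bloch_norm f" using r by simp
  finally have "?x \<le> bloch_norm f" .
  moreover have "norm (f z) * (1 - r) \<le> ?x"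
    using bloch_growth[OF f z] r unfolding r_def by (intro mult_right_mono) auto
  ultimately have 1: "norm (f z) * (1 - r) \<le> bloch_norm f" by (rule order_trans[rotated])
  have 2: "norm (deriv f z) * (1 - r) \<le> bloch_norm f"
    using bloch_deriv_bound[OF f z] norm_ge_zero[of "f 0"] unfolding r_def by linarith
  have "norm (2 * (z * deriv f z) + f z) \<le> 2 * norm (deriv f z) + norm (f z)"
    using r mult_left_le_one_le[of "norm (deriv f z)" r]
    by (intro order_trans[OF norm_triangle_ineq]) (simp add: norm_mult r_def)
  then have "norm (2 * (z * deriv f z) + f z) * (1 - r) \<le> (2 * norm (deriv f z) + norm (f z)) * (1 - r)"
    using r by (intro mult_right_mono) auto
  also have "\<dots> \<le> 3 * bloch_norm f" using 1 2 by (simp add: distrib_right)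
  finally show ?thesis by (simp add: r_def)
qed

lemma H_infinity_bounded:
  assumes "g \<in> H_infinity"
  obtains B where "\<And>z. z \<in> disc \<Longrightarrow> norm (g z) \<le> B"
proof -
  have "bounded (g ` disc)" using assms by (simp add: H_infinity_def)
  then obtain B where "\<forall>x\<in>g ` disc. norm x \<le> B" unfolding bounded_iff by blast
  then show ?thesis by (intro that[of B]) blast
qed

section \<open>Integrability and the upper bound for the Hankel operator\<close>

context regular_weight
begin

lemma emeasure_weighted_area_finite: "emeasure (weighted_area \<omega>) (space (weighted_area \<omega>)) < \<infinity>"
proof -
  have c: "circle_nn (\<lambda>_. 1) c = ennreal (2 * pi)" for c
    unfolding circle_nn_def by simp
  have "emeasure (weighted_area \<omega>) (space (weighted_area \<omega>)) = (\<integral>\<^sup>+z. 1 \<partial>area)"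
    by (subst nn_integral_weighted_area[symmetric]) auto
  also have "\<dots> = ennreal (1 / pi) * (\<integral>\<^sup>+r\<in>{0..<1}. ennreal (r * \<omega> r) * ennreal (2 * pi) \<partial>lborel)"
    by (subst nn_integral_area) (auto simp: c)
  also have "\<dots> \<le> ennreal (1 / pi) * (\<integral>\<^sup>+r. ennreal (2 * pi) * (ennreal (\<omega> r) * indicator {0..<1} r) \<partial>lborel)"
  proof (intro mult_left_mono nn_integral_mono)
    fix r :: real
    have "ennreal (r * \<omega> r) \<le> ennreal (\<omega> r)" if "0 \<le> r" "r < 1"
      using that nonneg[of r] by (intro ennreal_leI mult_left_le_one_le) auto
    then show "ennreal (r * \<omega> r) * ennreal (2 * pi) * indicator {0..<1} r \<le> ennreal (2 * pi) * (ennreal (\<omega> r) * indicator {0..<1} r)"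
      by (auto simp: indicator_def mult.commute[of _ "ennreal (2 * pi)"] intro!: mult_left_mono)
  qed simp
  also have "\<dots> = ennreal (1 / pi) * (ennreal (2 * pi) * ennreal (W 0))"
    by (subst nn_integral_cmult) (auto simp: nn_integral_tail)
  also have "\<dots> < \<infinity>" by (simp add: ennreal_mult_less_top)
  finally show ?thesis .
qed

lemma finite_measure_weighted_area: "finite_measure (weighted_area \<omega>)"
  by standard (use emeasure_weighted_area_finite in auto)

text \<open>\<open>Lp_norm\<close> is built on a Bochner integral, which is 0 in case of divergence.
  Finiteness of the nonnegative integral rules this out and lets the estimates be carried out in
  \<open>ennreal\<close>.\<close>

lemma Lp_norm_powr:
  fixes u :: "complex \<Rightarrow> complex"
  assumes u: "continuous_on disc u" and p: "0 < p"
    and fin: "(\<integral>\<^sup>+z. ennreal (norm (on_disc u z) powr p) \<partial>area) < \<infinity>"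
  shows "u \<in> Lp_space p \<omega>" and "ennreal (Lp_norm p \<omega> u powr p) = (\<integral>\<^sup>+z. ennreal (norm (on_disc u z) powr p) \<partial>area)"
proof -
  have cont: "continuous_on disc (\<lambda>z. norm (u z) powr p)"
    using p by (intro continuous_on_powr' continuous_intros u) auto
  have "(\<integral>\<^sup>+z. ennreal (norm (u z) powr p) \<partial>weighted_area \<omega>) = (\<integral>\<^sup>+z. ennreal (on_disc (\<lambda>z. norm (u z) powr p) z) \<partial>area)"
    by (rule nn_integral_weighted_area_on_disc[OF cont])
  also have "\<dots> = (\<integral>\<^sup>+z. ennreal (norm (on_disc u z) powr p) \<partial>area)"
    by (intro nn_integral_cong) (auto simp: on_disc_def)
  finally have eq: "(\<integral>\<^sup>+z. ennreal (norm (u z) powr p) \<partial>weighted_area \<omega>) = (\<integral>\<^sup>+z. ennreal (norm (on_disc u z) powr p) \<partial>area)" .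
  have int: "integrable (weighted_area \<omega>) (\<lambda>z. norm (u z) powr p)"
    using fin eq measurable_weighted_area_continuous[OF cont] by (intro integrableI_nonneg) auto
  then show "u \<in> Lp_space p \<omega>"
    by (simp add: Lp_space_def measurable_weighted_area_continuous[OF u])
  have "Lp_norm p \<omega> u powr p = (\<integral>z. norm (u z) powr p \<partial>weighted_area \<omega>)"
    using p unfolding Lp_norm_def powr_powr by (simp add: Bochner_Integration.integral_nonneg)
  then show "ennreal (Lp_norm p \<omega> u powr p) = (\<integral>\<^sup>+z. ennreal (norm (on_disc u z) powr p) \<partial>area)"
    using nn_integral_eq_integral[OF int] eq by simp
qed

lemma Lp_space_fin:
  assumes u: "continuous_on disc u" and p: "0 < p" and "u \<in> Lp_space p \<omega>"
  shows "(\<integral>\<^sup>+z. ennreal (norm (on_disc u z) powr p) \<partial>area) < \<infinity>"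
proof -
  have cont: "continuous_on disc (\<lambda>z. norm (u z) powr p)"
    using p by (intro continuous_on_powr' continuous_intros u) auto
  have "(\<integral>\<^sup>+z. ennreal (norm (on_disc u z) powr p) \<partial>area) = (\<integral>\<^sup>+z. ennreal (on_disc (\<lambda>z. norm (u z) powr p) z) \<partial>area)"
    by (intro nn_integral_cong) (auto simp: on_disc_def)
  also have "\<dots> = (\<integral>\<^sup>+z. ennreal (norm (u z) powr p) \<partial>weighted_area \<omega>)"
    by (rule nn_integral_weighted_area_on_disc[OF cont, symmetric])
  also have "\<dots> < \<infinity>"
    using assms(3) by (subst nn_integral_eq_integral) (auto simp: Lp_space_def)
  finally show ?thesis .
qed

lemma Lp_comparison:
  assumes u: "u holomorphic_on disc" and p: "1 < p"
  shows "(\<integral>\<^sup>+z. ennreal (norm (on_disc u z) powr p) \<partial>area) \<le> ennreal \<kappa> * (\<integral>\<^sup>+z. ennreal (norm (on_disc u z) powr p) \<partial>\<nu>)"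
    and "(\<integral>\<^sup>+z. ennreal (norm (on_disc u z) powr p) \<partial>\<nu>) \<le> ennreal \<kappa> * (\<integral>\<^sup>+z. ennreal (norm (on_disc u z) powr p) \<partial>area)"
proof -
  have [measurable]: "on_disc u \<in> borel_measurable borel"
    by (intro borel_measurable_on_disc holomorphic_on_imp_continuous_on u)
  have eq: "circle_nn (\<lambda>z. ennreal (norm (on_disc u z) powr p)) (of_real r) = circle_nn (\<lambda>z. ennreal (norm (u z) powr p)) (of_real r)"
    if "0 \<le> r" "r < 1" for r
    using that by (intro circle_nn_cong_disc) (auto simp: on_disc_def)
  have mono: "circle_nn (\<lambda>z. ennreal (norm (on_disc u z) powr p)) (of_real r) \<le> circle_nn (\<lambda>z. ennreal (norm (on_disc u z) powr p)) (of_real s)"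
    if "0 \<le> r" "r \<le> s" "s < 1" for r s
    using that circle_mean_mono[OF u p that] by (simp add: eq)
  show "(\<integral>\<^sup>+z. ennreal (norm (on_disc u z) powr p) \<partial>area) \<le> ennreal \<kappa> * (\<integral>\<^sup>+z. ennreal (norm (on_disc u z) powr p) \<partial>\<nu>)"
    "(\<integral>\<^sup>+z. ennreal (norm (on_disc u z) powr p) \<partial>\<nu>) \<le> ennreal \<kappa> * (\<integral>\<^sup>+z. ennreal (norm (on_disc u z) powr p) \<partial>area)"
    using mono by (intro area_\<nu>_comparison, measurable)+
qed

lemma H_infinity_subset_Lp:
  assumes g: "g \<in> H_infinity" and p: "0 < p"
  shows "g \<in> Lp_space p \<omega>"
proof -
  interpret finite_measure "weighted_area \<omega>" by (rule finite_measure_weighted_area)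
  have cont: "continuous_on disc g" using g by (auto simp: H_infinity_def intro: holomorphic_on_imp_continuous_on)
  obtain B where B: "\<And>z. z \<in> disc \<Longrightarrow> norm (g z) \<le> B" using H_infinity_bounded[OF g] by blast
  have "integrable (weighted_area \<omega>) (\<lambda>z. norm (g z) powr p)"
  proof (rule integrable_const_bound)
    show "AE z in weighted_area \<omega>. norm (norm (g z) powr p) \<le> B powr p"
      using B p by (intro AE_I2) (auto intro!: powr_mono2)
    show "(\<lambda>z. norm (g z) powr p) \<in> borel_measurable (weighted_area \<omega>)"
      using p by (intro measurable_weighted_area_continuous continuous_on_powr' continuous_intros cont) auto
  qed
  then show ?thesis by (simp add: Lp_space_def measurable_weighted_area_continuous[OF cont])
qed

text \<open>\<open>Lp_comparison\<close> requires an exponent above 1, so \<open>f\<close> is first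
  majorised: its logarithmic growth lies below a multiple of \<open>(1 - norm z) powr (- d)\<close>
  with \<open>0 < d < a\<close>, a radial function with evidently increasing circle means.\<close>

lemma bloch_subset_L1:
  assumes f: "f \<in> bloch_space"
  shows "f \<in> Lp_space 1 \<omega>"
proof -
  define d where "d = a / 2"
  have d: "0 < d" "d < a" using a by (auto simp: d_def)
  have cont: "continuous_on disc f" using f by (auto simp: bloch_space_def intro: holomorphic_on_imp_continuous_on)
  have [measurable]: "on_disc f \<in> borel_measurable borel" by (intro borel_measurable_on_disc cont)
  define K where "K = bloch_norm f * (1 + 1 / d)"
  have B: "0 \<le> bloch_norm f" by (rule bloch_norm_nonneg[OF f])
  then have K: "0 \<le> K" using d by (simp add: K_def)
  define u :: "complex \<Rightarrow> ennreal" where "u z = ennreal ((1 - norm z) powr (- d))" for z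
  have [measurable]: "u \<in> borel_measurable borel" unfolding u_def by measurable
  have cu: "circle_nn u (of_real s) = ennreal ((1 - s) powr (- d)) * ennreal (2 * pi)" if "0 \<le> s" for s
    using that unfolding circle_nn_def u_def by (simp add: norm_mult nn_integral_cmult_indicator)
  have le: "norm (f z) \<le> K * (1 - norm z) powr (- d)" if z: "z \<in> disc" for z
  proof -
    define x where "x = 1 - norm z"
    have x: "0 < x" "x \<le> 1" using z by (auto simp: x_def)
    have "ln (x powr (- d)) \<le> x powr (- d) - 1" using x by (intro ln_le_minus_one) auto
    then have "- d * ln x \<le> x powr (- d)" using x by (simp add: ln_powr)
    then have 1: "- ln x \<le> x powr (- d) / d" using d by (simp add: field_simps)
    have "x powr 0 \<le> x powr (- d)" using x d by (intro powr_mono') auto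
    then have "1 - ln x \<le> (1 + 1 / d) * x powr (- d)" using 1 x by (simp add: distrib_right)
    then have "bloch_norm f * (1 - ln x) \<le> bloch_norm f * ((1 + 1 / d) * x powr (- d))"
      using B by (rule mult_left_mono)
    then show ?thesis using bloch_growth[OF f z] by (simp add: K_def x_def mult.assoc)
  qed
  have "(\<integral>\<^sup>+z. ennreal (norm (on_disc f z) powr 1) \<partial>area) \<le> (\<integral>\<^sup>+z. ennreal K * u z \<partial>area)"
    using le K by (intro nn_integral_mono) (auto simp: on_disc_def u_def ennreal_mult[symmetric] intro!: ennreal_leI)
  also have "\<dots> = ennreal K * (\<integral>\<^sup>+z. u z \<partial>area)" by (rule nn_integral_cmult) measurable
  also have "\<dots> \<le> ennreal K * (ennreal \<kappa> * (\<integral>\<^sup>+z. u z \<partial>\<nu>))"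
  proof (intro mult_left_mono area_\<nu>_comparison)
    fix r s :: real assume "0 \<le> r" "r \<le> s" "s < 1"
    then show "circle_nn u (of_real r) \<le> circle_nn u (of_real s)"
      using d by (simp add: cu) (auto intro!: mult_right_mono ennreal_leI powr_mono2')
  qed auto
  also have "(\<integral>\<^sup>+z. u z \<partial>\<nu>) = (\<integral>\<^sup>+s. ennreal (2 * pi) * (ennreal (W s / (1 - s) * (1 - s) powr (- d)) * indicator {0..<1} s) \<partial>lborel)"
    unfolding nn_integral_\<nu>[OF \<open>u \<in> borel_measurable borel\<close>]
    using tail_nonneg by (intro nn_integral_cong) (auto simp: indicator_def cu ennreal_mult[symmetric] mult_ac)
  also have "\<dots> = ennreal (2 * pi) * (\<integral>\<^sup>+s\<in>{0..<1}. ennreal (W s / (1 - s) * (1 - s) powr (- d)) \<partial>lborel)"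
    by (rule nn_integral_cmult) measurable
  also have "\<dots> \<le> ennreal (2 * pi) * ennreal (A ^ 3 / (a - d) * W 0 * (1 - 0) powr (- d))"
    using d by (intro mult_left_mono nn_integral_tail_upper) auto
  finally have "(\<integral>\<^sup>+z. ennreal (norm (on_disc f z) powr 1) \<partial>area) \<le> ennreal K * (ennreal \<kappa> * (ennreal (2 * pi) * ennreal (A ^ 3 / (a - d) * W 0 * (1 - 0) powr (- d))))"
    by (simp add: mult_left_mono)
  also have "\<dots> < \<infinity>" by (simp add: ennreal_mult_less_top)
  finally show ?thesis by (rule Lp_norm_powr(1)[OF cont, rotated]) simp
qed

lemma L1_integrable:
  assumes "f \<in> Lp_space 1 \<omega>"
  shows "integrable (weighted_area \<omega>) f"
  using assms by (auto simp: Lp_space_def integrable_norm_iff)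

lemma integrable_mult_bounded:
  fixes f h :: "complex \<Rightarrow> complex"
  assumes f: "integrable (weighted_area \<omega>) f" and h: "continuous_on disc h" "\<And>z. z \<in> disc \<Longrightarrow> norm (h z) \<le> B"
  shows "integrable (weighted_area \<omega>) (\<lambda>z. f z * h z)"
proof (rule Bochner_Integration.integrable_bound[of _ "\<lambda>z. of_real B * f z"])
  show "integrable (weighted_area \<omega>) (\<lambda>z. of_real B * f z)" using f by (rule integrable_mult_right)
  have [measurable]: "h \<in> borel_measurable (weighted_area \<omega>)" by (rule measurable_weighted_area_continuous) fact
  show "(\<lambda>z. f z * h z) \<in> borel_measurable (weighted_area \<omega>)" using f by measurable
  show "AE z in weighted_area \<omega>. norm (f z * h z) \<le> norm (of_real B * f z)"
  proof (rule AE_I2)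
    fix z assume "z \<in> space (weighted_area \<omega>)"
    then have "norm (h z) \<le> \<bar>B\<bar>" using h(2)[of z] by simp
    then have "norm (f z) * norm (h z) \<le> norm (f z) * \<bar>B\<bar>" by (rule mult_left_mono) simp
    then show "norm (f z * h z) \<le> norm (of_real B * f z)" unfolding norm_mult norm_of_real by (simp only: mult.commute)
  qed
qed

text \<open>Up to conjugation and the factor \<open>lam n\<close> these are the Taylor coefficients
  of the conjugate of the image of \<open>g\<close>; the image itself is antianalytic.\<close>

definition hankel_coeff :: "(complex \<Rightarrow> complex) \<Rightarrow> (complex \<Rightarrow> complex) \<Rightarrow> nat \<Rightarrow> complex" where
  "hankel_coeff f g n = (\<integral>\<zeta>. cnj (f \<zeta>) * g \<zeta> * \<zeta> ^ n \<partial>weighted_area \<omega>)"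

text \<open>Absolute summability of \<open>\<beta>\<close> bounds the series on the entire disc, so
  \<open>\<phi>\<close> need only be integrable. Fixing a point inside the disc gives the kernel and
  the test functions coefficients of this kind.\<close>

lemma integral_series_weighted_area:
  fixes \<phi> :: "complex \<Rightarrow> complex"
  assumes \<phi>: "integrable (weighted_area \<omega>) \<phi>" and \<beta>: "summable (\<lambda>n. norm (\<beta> n))"
  shows "(\<integral>\<zeta>. \<phi> \<zeta> * (\<Sum>n. \<beta> n * \<zeta> ^ n) \<partial>weighted_area \<omega>) = (\<Sum>n. \<beta> n * (\<integral>\<zeta>. \<phi> \<zeta> * \<zeta> ^ n \<partial>weighted_area \<omega>))"
    and "norm (\<integral>\<zeta>. \<phi> \<zeta> * \<zeta> ^ n \<partial>weighted_area \<omega>) \<le> (\<integral>\<zeta>. norm (\<phi> \<zeta>) \<partial>weighted_area \<omega>)"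
proof -
  have int: "integrable (weighted_area \<omega>) (\<lambda>\<zeta>. \<phi> \<zeta> * \<zeta> ^ n)" for n
    by (rule integrable_mult_bounded[OF \<phi>, where B = 1])
       (auto intro!: continuous_intros simp: norm_power power_le_one less_imp_le)
  have le: "norm (\<phi> \<zeta> * \<zeta> ^ n) \<le> norm (\<phi> \<zeta>)" if "\<zeta> \<in> disc" for \<zeta> n
    using that by (auto simp: norm_mult norm_power intro!: mult_right_le_one_le power_le_one)
  have ile: "(\<integral>\<zeta>. norm (\<phi> \<zeta> * \<zeta> ^ n) \<partial>weighted_area \<omega>) \<le> (\<integral>\<zeta>. norm (\<phi> \<zeta>) \<partial>weighted_area \<omega>)" for n
    using le by (intro integral_mono integrable_norm int \<phi>) auto
  show "norm (\<integral>\<zeta>. \<phi> \<zeta> * \<zeta> ^ n \<partial>weighted_area \<omega>) \<le> (\<integral>\<zeta>. norm (\<phi> \<zeta>) \<partial>weighted_area \<omega>)"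
    by (rule order_trans[OF integral_norm_bound ile])
  have s: "summable (\<lambda>n. norm (\<beta> n * (\<phi> \<zeta> * \<zeta> ^ n)))" if "\<zeta> \<in> disc" for \<zeta>
  proof (rule summable_comparison_test'[OF summable_mult2[OF \<beta>, of "norm (\<phi> \<zeta>)"]])
    show "norm (norm (\<beta> n * (\<phi> \<zeta> * \<zeta> ^ n))) \<le> norm (\<beta> n) * norm (\<phi> \<zeta>)" for n
      using le[OF that, of n] by (subst norm_mult) (simp add: mult_left_mono)
  qed
  have "(\<integral>\<zeta>. \<phi> \<zeta> * (\<Sum>n. \<beta> n * \<zeta> ^ n) \<partial>weighted_area \<omega>) = (\<integral>\<zeta>. (\<Sum>n. \<beta> n * (\<phi> \<zeta> * \<zeta> ^ n)) \<partial>weighted_area \<omega>)"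
  proof (rule Bochner_Integration.integral_cong[OF refl])
    fix \<zeta> assume "\<zeta> \<in> space (weighted_area \<omega>)"
    then have \<zeta>: "norm \<zeta> < 1" by simp
    have "summable (\<lambda>n. \<beta> n * \<zeta> ^ n)"
      by (rule summable_norm_cancel, rule summable_comparison_test'[OF \<beta>])
         (use \<zeta> in \<open>auto simp: norm_mult norm_power intro!: mult_right_le_one_le power_le_one\<close>)
    then have "\<phi> \<zeta> * (\<Sum>n. \<beta> n * \<zeta> ^ n) = (\<Sum>n. \<phi> \<zeta> * (\<beta> n * \<zeta> ^ n))" by (rule suminf_mult[symmetric])
    then show "\<phi> \<zeta> * (\<Sum>n. \<beta> n * \<zeta> ^ n) = (\<Sum>n. \<beta> n * (\<phi> \<zeta> * \<zeta> ^ n))" by (simp add: mult_ac)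
  qed
  also have "\<dots> = (\<Sum>n. \<integral>\<zeta>. \<beta> n * (\<phi> \<zeta> * \<zeta> ^ n) \<partial>weighted_area \<omega>)"
  proof (rule integral_suminf)
    show "summable (\<lambda>n. \<integral>\<zeta>. norm (\<beta> n * (\<phi> \<zeta> * \<zeta> ^ n)) \<partial>weighted_area \<omega>)"
    proof (rule summable_comparison_test'[OF summable_mult2[OF \<beta>, of "\<integral>\<zeta>. norm (\<phi> \<zeta>) \<partial>weighted_area \<omega>"]])
      fix n
      have "(\<integral>\<zeta>. norm (\<beta> n * (\<phi> \<zeta> * \<zeta> ^ n)) \<partial>weighted_area \<omega>) = norm (\<beta> n) * (\<integral>\<zeta>. norm (\<phi> \<zeta> * \<zeta> ^ n) \<partial>weighted_area \<omega>)"
        unfolding norm_mult[of "\<beta> n"] by (rule integral_mult_right_zero)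
      then show "norm (\<integral>\<zeta>. norm (\<beta> n * (\<phi> \<zeta> * \<zeta> ^ n)) \<partial>weighted_area \<omega>) \<le> norm (\<beta> n) * (\<integral>\<zeta>. norm (\<phi> \<zeta>) \<partial>weighted_area \<omega>)"
        using ile[of n] by (simp add: mult_left_mono)
    qed
  qed (use int s in auto)
  also have "\<dots> = (\<Sum>n. \<beta> n * (\<integral>\<zeta>. \<phi> \<zeta> * \<zeta> ^ n \<partial>weighted_area \<omega>))" by simp
  finally show "(\<integral>\<zeta>. \<phi> \<zeta> * (\<Sum>n. \<beta> n * \<zeta> ^ n) \<partial>weighted_area \<omega>) = (\<Sum>n. \<beta> n * (\<integral>\<zeta>. \<phi> \<zeta> * \<zeta> ^ n \<partial>weighted_area \<omega>))" .
qed

lemma integrable_cnj_mult: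
  assumes f: "f \<in> Lp_space 1 \<omega>" and g: "g \<in> H_infinity"
  shows "integrable (weighted_area \<omega>) (\<lambda>\<zeta>. cnj (f \<zeta>) * g \<zeta>)"
proof -
  obtain B where B: "\<And>z. z \<in> disc \<Longrightarrow> norm (g z) \<le> B" using H_infinity_bounded[OF g] by blast
  have "integrable (weighted_area \<omega>) (\<lambda>\<zeta>. cnj (f \<zeta>))" using L1_integrable[OF f] by simp
  then show ?thesis
    using g B by (intro integrable_mult_bounded[where B = B]) (auto simp: H_infinity_def intro: holomorphic_on_imp_continuous_on)
qed

lemma hankel_coeff_bounded:
  assumes f: "f \<in> Lp_space 1 \<omega>" and g: "g \<in> H_infinity"
  obtains B where "0 \<le> B" "\<And>n. norm (hankel_coeff f g n) \<le> B"
proof (rule that)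
  show "norm (hankel_coeff f g n) \<le> (\<integral>\<zeta>. norm (cnj (f \<zeta>) * g \<zeta>) \<partial>weighted_area \<omega>)" for n
    unfolding hankel_coeff_def
    by (rule integral_series_weighted_area(2)[OF integrable_cnj_mult[OF f g], where \<beta> = "\<lambda>_. 0"]) simp
qed (simp add: Bochner_Integration.integral_nonneg)

lemma taylor_little_hankel:
  assumes f: "f \<in> Lp_space 1 \<omega>" and g: "g \<in> H_infinity"
  shows "taylor (\<lambda>z. cnj (little_hankel \<omega> f g z)) (\<lambda>n. of_real (lam n) * cnj (hankel_coeff f g n))"
  unfolding taylor_def
proof
  fix z :: complex assume z: "z \<in> disc"
  obtain B where B: "0 \<le> B" "\<And>n. norm (hankel_coeff f g n) \<le> B" using hankel_coeff_bounded[OF f g] by blast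
  define \<beta> where "\<beta> n = of_real (lam n) * cnj z ^ n" for n
  have sk: "summable (\<lambda>n. norm (of_real (real (Suc n) ^ 0 * lam n) * cnj z ^ n))" by (rule summable_kern) (use z in simp)
  then have \<beta>: "summable (\<lambda>n. norm (\<beta> n))" by (simp add: \<beta>_def)
  have s: "summable (\<lambda>n. \<beta> n * hankel_coeff f g n)"
    by (rule summable_norm_cancel, rule summable_comparison_test'[OF summable_mult2[OF \<beta>, of B]])
       (use B in \<open>auto simp: norm_mult intro!: mult_left_mono\<close>)
  have "little_hankel \<omega> f g z = (\<integral>\<zeta>. cnj (f \<zeta>) * g \<zeta> * (\<Sum>n. \<beta> n * \<zeta> ^ n) \<partial>weighted_area \<omega>)"
    unfolding little_hankel_def bergman_kernel_eq_kern kern_def \<beta>_def by (simp add: power_mult_distrib mult.assoc)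
  also have "\<dots> = (\<Sum>n. \<beta> n * hankel_coeff f g n)"
    unfolding hankel_coeff_def by (rule integral_series_weighted_area(1)[OF integrable_cnj_mult[OF f g] \<beta>])
  finally have "(\<lambda>n. \<beta> n * hankel_coeff f g n) sums little_hankel \<omega> f g z" using s by (simp add: summable_sums)
  then have "(\<lambda>n. cnj (\<beta> n * hankel_coeff f g n)) sums cnj (little_hankel \<omega> f g z)" by (subst sums_cnj)
  then show "(\<lambda>n. of_real (lam n) * cnj (hankel_coeff f g n) * z ^ n) sums cnj (little_hankel \<omega> f g z)"
    by (rule back_subst[of "\<lambda>h. h sums _"]) (auto simp: \<beta>_def fun_eq_iff)
qed

lemma kern_bounded_on_smaller_disc:
  assumes "norm z < 1"
  obtains B where "\<And>\<zeta>. \<zeta> \<in> disc \<Longrightarrow> norm (kern m (cnj z * \<zeta>)) \<le> B"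
proof -
  have "compact (kern m ` cball 0 (norm z))"
    using assms by (intro compact_continuous_image continuous_on_subset[OF holomorphic_on_imp_continuous_on[OF kern_holomorphic]]) auto
  then obtain B where B: "\<And>x. x \<in> kern m ` cball 0 (norm z) \<Longrightarrow> norm x \<le> B"
    using compact_imp_bounded bounded_iff by metis
  show ?thesis
  proof (rule that[of B])
    fix \<zeta> :: complex assume "\<zeta> \<in> disc"
    then have "norm (cnj z * \<zeta>) \<le> norm z" by (simp add: norm_mult mult_left_le)
    then show "norm (kern m (cnj z * \<zeta>)) \<le> B" by (intro B imageI) simp
  qed
qed

lemma kern_comp_holomorphic:
  assumes "norm z < 1"
  shows "(\<lambda>\<zeta>. kern m (cnj z * \<zeta>)) holomorphic_on disc"
proof -
  have "(kern m \<circ> (\<lambda>\<zeta>. cnj z * \<zeta>)) holomorphic_on disc"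
  proof (rule holomorphic_on_compose_gen[OF _ kern_holomorphic])
    have "norm z * norm w < 1" if "norm w < 1" for w :: complex
      using mult_strict_mono'[of "norm z" 1 "norm w" 1] assms that by simp
    then show "(\<lambda>\<zeta>. cnj z * \<zeta>) ` disc \<subseteq> disc" by (auto simp: norm_mult)
  qed (auto intro!: holomorphic_intros)
  then show ?thesis by (simp add: o_def)
qed

text \<open>For fixed \<open>z\<close> the argument \<open>g\<close> and the kernel merge into a
  single analytic function \<open>h\<close>, and the value of the operator is the conjugate of the
  pairing of \<open>f\<close> with \<open>h\<close>, to which \<open>duality_bound\<close>
  applies.\<close>

lemma little_hankel_pointwise:
  assumes f: "f \<in> bloch_space" and g: "g \<in> H_infinity" and z: "norm z < 1"
  shows "ennreal (norm (little_hankel \<omega> f g z))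
    \<le> (\<integral>\<^sup>+\<zeta>. ennreal (norm (on_disc (kern 0) (cnj z * \<zeta>)) * (3 * bloch_norm f / pi * norm (on_disc g \<zeta>))) \<partial>\<nu>)"
proof -
  have hf: "f holomorphic_on disc" and hg: "g holomorphic_on disc" using f g by (auto simp: bloch_space_def H_infinity_def)
  define h where "h \<zeta> = g \<zeta> * kern 0 (cnj z * \<zeta>)" for \<zeta>
  have hh: "h holomorphic_on disc" unfolding h_def by (intro holomorphic_intros hg kern_comp_holomorphic z)
  obtain \<alpha> where \<alpha>: "taylor f \<alpha>" using taylor_exists[OF hf] .
  obtain \<beta> where \<beta>: "taylor h \<beta>" using taylor_exists[OF hh] .
  have F: "taylor (\<lambda>z. 2 * (z * deriv f z) + f z) (\<lambda>n. of_nat (2 * n + 1) * \<alpha> n)"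
  proof -
    have "taylor (\<lambda>z. (z * deriv f z + z * deriv f z) + f z) (\<lambda>n. (of_nat n * \<alpha> n + of_nat n * \<alpha> n) + \<alpha> n)"
      by (intro taylor_add taylor_mult_deriv \<alpha>)
    then show ?thesis by (simp add: algebra_simps mult_2)
  qed
  obtain B1 where B1: "\<And>z. z \<in> disc \<Longrightarrow> norm (g z) \<le> B1" using H_infinity_bounded[OF g] by blast
  obtain B2 where B2: "\<And>\<zeta>. \<zeta> \<in> disc \<Longrightarrow> norm (kern 0 (cnj z * \<zeta>)) \<le> B2" using kern_bounded_on_smaller_disc[OF z] by blast
  have int: "integrable (weighted_area \<omega>) (\<lambda>z. f z * cnj (h z))"
  proof (rule integrable_mult_bounded[OF L1_integrable[OF bloch_subset_L1[OF f]]])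
    show "continuous_on disc (\<lambda>z. cnj (h z))" by (intro continuous_intros holomorphic_on_imp_continuous_on hh)
    show "norm (cnj (h w)) \<le> B1 * B2" if "w \<in> disc" for w
      using B1[OF that] B2[OF that] unfolding h_def complex_mod_cnj norm_mult
      by (intro mult_mono) (auto intro: order_trans[OF norm_ge_zero])
  qed
  have "little_hankel \<omega> f g z = (\<integral>\<zeta>. cnj (f \<zeta> * cnj (h \<zeta>)) \<partial>weighted_area \<omega>)"
    unfolding little_hankel_def bergman_kernel_eq_kern h_def by (simp add: mult.assoc)
  also have "\<dots> = cnj (\<integral>\<zeta>. f \<zeta> * cnj (h \<zeta>) \<partial>weighted_area \<omega>)" by (rule Bochner_Integration.integral_cnj)
  finally have "ennreal (norm (little_hankel \<omega> f g z)) = ennreal (norm (\<integral>\<zeta>. f \<zeta> * cnj (h \<zeta>) \<partial>weighted_area \<omega>))" by simp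
  also have "\<dots> \<le> ennreal (3 * bloch_norm f / pi) * (\<integral>\<^sup>+\<zeta>. ennreal (norm (on_disc h \<zeta>)) \<partial>\<nu>)"
    using bloch_norm_nonneg[OF f] bloch_radial_derivative_bound[OF f]
    by (intro duality_bound[OF \<alpha> \<beta> F int]) auto
  also have "\<dots> = (\<integral>\<^sup>+\<zeta>. ennreal (3 * bloch_norm f / pi) * ennreal (norm (on_disc h \<zeta>)) \<partial>\<nu>)"
    using borel_measurable_on_disc[OF holomorphic_on_imp_continuous_on[OF hh]]
    by (intro nn_integral_cmult[symmetric]) measurable
  also have "\<dots> \<le> (\<integral>\<^sup>+\<zeta>. ennreal (norm (on_disc (kern 0) (cnj z * \<zeta>)) * (3 * bloch_norm f / pi * norm (on_disc g \<zeta>))) \<partial>\<nu>)"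
  proof (rule nn_integral_mono)
    fix \<zeta> :: complex
    have "norm (on_disc h \<zeta>) \<le> norm (on_disc (kern 0) (cnj z * \<zeta>)) * norm (on_disc g \<zeta>)"
      using z mult_strict_mono'[of "norm z" 1 "norm \<zeta>" 1] by (auto simp: on_disc_def h_def norm_mult)
    then have "3 * bloch_norm f / pi * norm (on_disc h \<zeta>) \<le> 3 * bloch_norm f / pi * (norm (on_disc (kern 0) (cnj z * \<zeta>)) * norm (on_disc g \<zeta>))"
      using bloch_norm_nonneg[OF f] by (intro mult_left_mono) auto
    then show "ennreal (3 * bloch_norm f / pi) * ennreal (norm (on_disc h \<zeta>))
      \<le> ennreal (norm (on_disc (kern 0) (cnj z * \<zeta>)) * (3 * bloch_norm f / pi * norm (on_disc g \<zeta>)))"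
      using bloch_norm_nonneg[OF f] by (subst ennreal_mult[symmetric]) (auto intro!: ennreal_leI simp: mult_ac)
  qed
  finally show ?thesis .
qed

lemma bloch_imp_little_hankel_bound:
  assumes p: "1 < p"
  shows "\<exists>C>0. \<forall>f\<in>bloch_space. little_hankel_bound p \<omega> f (C * bloch_norm f)"
proof -
  obtain K where K: "0 < K" and schur: "\<And>S g. (\<And>z. 0 \<le> S z) \<Longrightarrow> (\<And>\<zeta>. 0 \<le> g \<zeta>) \<Longrightarrow> g \<in> borel_measurable borel \<Longrightarrow>
      (\<And>z. 1 \<le> norm z \<Longrightarrow> S z = 0) \<Longrightarrow>
      (\<And>z. norm z < 1 \<Longrightarrow> ennreal (S z) \<le> (\<integral>\<^sup>+\<zeta>. ennreal (norm (on_disc (kern 0) (cnj z * \<zeta>)) * g \<zeta>) \<partial>\<nu>)) \<Longrightarrow>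
      (\<integral>\<^sup>+z. ennreal (S z powr p) \<partial>\<nu>) \<le> ennreal K * (\<integral>\<^sup>+\<zeta>. ennreal (g \<zeta> powr p) \<partial>\<nu>)"
    using kern_Schur[OF p] by blast
  \<comment> \<open>\<open>K\<close> is the Schur constant, the two factors \<open>\<kappa>\<close>
    pay for passing from \<open>area\<close> to \<open>\<nu>\<close> and back, and
    \<open>3 / pi\<close> is the constant of the pointwise bound.\<close>
  define C where "C = (\<kappa> * K * \<kappa>) powr (1 / p) * (3 / pi)"
  have C: "0 < C" using \<kappa>_pos K by (simp add: C_def)
  have "little_hankel_bound p \<omega> f (C * bloch_norm f)" if f: "f \<in> bloch_space" for f
    unfolding little_hankel_bound_def
  proof (intro conjI ballI)
    have B: "0 \<le> bloch_norm f" by (rule bloch_norm_nonneg[OF f])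
    then show "0 \<le> C * bloch_norm f" using C by simp
    fix g assume g: "g \<in> H_infinity"
    define H where "H z = cnj (little_hankel \<omega> f g z)" for z
    have "taylor H (\<lambda>n. of_real (lam n) * cnj (hankel_coeff f g n))"
      using taylor_little_hankel[OF bloch_subset_L1[OF f] g] by (simp add: H_def[abs_def])
    then have hH: "H holomorphic_on disc" by (rule taylor_holomorphic)
    have hg: "g holomorphic_on disc" using g by (simp add: H_infinity_def)
    have cg: "continuous_on disc g" and cH: "continuous_on disc H"
      using hg hH by (auto intro: holomorphic_on_imp_continuous_on)
    have [measurable]: "on_disc g \<in> borel_measurable borel" by (rule borel_measurable_on_disc[OF cg])
    define c where "c = 3 * bloch_norm f / pi"
    have c: "0 \<le> c" using B by (simp add: c_def)
    have gfin: "(\<integral>\<^sup>+z. ennreal (norm (on_disc g z) powr p) \<partial>area) < \<infinity>"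
      using p H_infinity_subset_Lp[OF g, of p] by (intro Lp_space_fin[OF cg]) auto
    have gp: "ennreal (Lp_norm p \<omega> g powr p) = (\<integral>\<^sup>+z. ennreal (norm (on_disc g z) powr p) \<partial>area)"
      using p by (intro Lp_norm_powr(2)[OF cg _ gfin]) auto
    have "(\<integral>\<^sup>+z. ennreal (norm (on_disc H z) powr p) \<partial>area) \<le> ennreal \<kappa> * (\<integral>\<^sup>+z. ennreal (norm (on_disc H z) powr p) \<partial>\<nu>)"
      by (rule Lp_comparison(1)[OF hH p])
    also have "\<dots> \<le> ennreal \<kappa> * (ennreal K * (\<integral>\<^sup>+\<zeta>. ennreal ((c * norm (on_disc g \<zeta>)) powr p) \<partial>\<nu>))"
    proof (intro mult_left_mono schur)
      show "ennreal (norm (on_disc H z)) \<le> (\<integral>\<^sup>+\<zeta>. ennreal (norm (on_disc (kern 0) (cnj z * \<zeta>)) * (c * norm (on_disc g \<zeta>))) \<partial>\<nu>)"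
        if "norm z < 1" for z
        using little_hankel_pointwise[OF f g that] that by (simp add: on_disc_def[of H] H_def c_def)
    qed (use c in \<open>auto simp: on_disc_def[of H]\<close>)
    also have "(\<integral>\<^sup>+\<zeta>. ennreal ((c * norm (on_disc g \<zeta>)) powr p) \<partial>\<nu>) = (\<integral>\<^sup>+\<zeta>. ennreal (c powr p) * ennreal (norm (on_disc g \<zeta>) powr p) \<partial>\<nu>)"
      using c by (intro nn_integral_cong) (simp add: powr_mult ennreal_mult[symmetric])
    also have "\<dots> = ennreal (c powr p) * (\<integral>\<^sup>+\<zeta>. ennreal (norm (on_disc g \<zeta>) powr p) \<partial>\<nu>)"
      by (rule nn_integral_cmult) measurable
    also have "ennreal \<kappa> * (ennreal K * (ennreal (c powr p) * (\<integral>\<^sup>+\<zeta>. ennreal (norm (on_disc g \<zeta>) powr p) \<partial>\<nu>)))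
      \<le> ennreal \<kappa> * (ennreal K * (ennreal (c powr p) * (ennreal \<kappa> * (\<integral>\<^sup>+\<zeta>. ennreal (norm (on_disc g \<zeta>) powr p) \<partial>area))))"
      by (intro mult_left_mono Lp_comparison(2)[OF hg p]) auto
    also have "\<dots> = ennreal (\<kappa> * K * \<kappa> * c powr p * Lp_norm p \<omega> g powr p)"
      unfolding gp[symmetric] using \<kappa>_pos K by (simp add: ennreal_mult mult_ac)
    finally have main: "(\<integral>\<^sup>+z. ennreal (norm (on_disc H z) powr p) \<partial>area) \<le> ennreal (\<kappa> * K * \<kappa> * c powr p * Lp_norm p \<omega> g powr p)" .
    then have Hfin: "(\<integral>\<^sup>+z. ennreal (norm (on_disc H z) powr p) \<partial>area) < \<infinity>"
      by (rule le_less_trans) simp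
    have "H \<in> Lp_space p \<omega>" using p by (intro Lp_norm_powr(1)[OF cH _ Hfin]) auto
    then have "H \<in> bergman_space p \<omega>" using hH by (simp add: bergman_space_def)
    moreover have "little_hankel \<omega> f g = (\<lambda>z. cnj (H z))" by (simp add: H_def)
    ultimately show "little_hankel \<omega> f g \<in> conj_bergman_space p \<omega>" by (auto simp: conj_bergman_space_def)
    have "ennreal (Lp_norm p \<omega> H powr p) \<le> ennreal (\<kappa> * K * \<kappa> * c powr p * Lp_norm p \<omega> g powr p)"
      using main p Lp_norm_powr(2)[OF cH _ Hfin] by simp
    then have "Lp_norm p \<omega> H powr p \<le> \<kappa> * K * \<kappa> * c powr p * Lp_norm p \<omega> g powr p"
      using \<kappa>_pos K by (subst (asm) ennreal_le_iff) auto
    then have "(Lp_norm p \<omega> H powr p) powr (1 / p) \<le> (\<kappa> * K * \<kappa> * c powr p * Lp_norm p \<omega> g powr p) powr (1 / p)"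
      using p by (intro powr_mono2) auto
    then have "Lp_norm p \<omega> H \<le> (\<kappa> * K * \<kappa>) powr (1 / p) * c * Lp_norm p \<omega> g"
      using p \<kappa>_pos K c by (simp add: powr_mult powr_powr Lp_norm_def)
    moreover have "Lp_norm p \<omega> H = Lp_norm p \<omega> (little_hankel \<omega> f g)" by (simp add: Lp_norm_def H_def)
    ultimately show "Lp_norm p \<omega> (little_hankel \<omega> f g) \<le> C * bloch_norm f * Lp_norm p \<omega> g"
      by (simp add: C_def c_def mult_ac)
  qed
  then show ?thesis using C by blast
qed

end

section \<open>Necessity\<close>

lemma taylor_unique_value: "taylor f \<alpha> \<Longrightarrow> taylor g \<alpha> \<Longrightarrow> z \<in> disc \<Longrightarrow> f z = g z"
  unfolding taylor_def using sums_unique2 by blast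

lemma taylor_at_0: "taylor f \<alpha> \<Longrightarrow> f 0 = \<alpha> 0"
  unfolding taylor_def using powser_sums_zero[of \<alpha>] sums_unique2 by (metis centre_in_ball zero_less_one)

lemma taylor_Suc_mult:
  assumes f: "taylor f \<alpha>" and F: "taylor F (\<lambda>n. of_nat (Suc n) * \<alpha> n)" and z: "z \<in> disc"
  shows "F z = f z + z * deriv f z"
proof -
  have "taylor (\<lambda>z. f z + z * deriv f z) (\<lambda>n. \<alpha> n + of_nat n * \<alpha> n)"
    by (intro taylor_add taylor_mult_deriv f)
  then have "taylor (\<lambda>z. f z + z * deriv f z) (\<lambda>n. of_nat (Suc n) * \<alpha> n)"
    by (simp add: algebra_simps)
  from taylor_unique_value[OF F this z] show ?thesis .
qed

text \<open>The multiplier \<open>n + 1\<close> on coefficients is the derivative of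
  \<open>z * f z\<close>, so that product is integrated along the radius. The factor
  \<open>norm z\<close> on the left is the price.\<close>

lemma primitive_growth:
  assumes f: "taylor f \<alpha>" and F: "taylor F (\<lambda>n. of_nat (Suc n) * \<alpha> n)" and z: "z \<in> disc"
    and \<phi>: "continuous_on {0..1} \<phi>" "\<And>t. 0 < t \<Longrightarrow> t < 1 \<Longrightarrow> (\<phi> has_real_derivative \<phi>' t) (at t)"
    and le: "\<And>t. 0 < t \<Longrightarrow> t < 1 \<Longrightarrow> norm z * norm (F (of_real t * z)) \<le> \<phi>' t"
  shows "norm z * norm (f z) \<le> \<phi> 1 - \<phi> 0"
proof -
  have hf: "f holomorphic_on disc" by (rule taylor_holomorphic[OF f])
  have "norm (z * f z - 0 * f 0) \<le> \<phi> 1 - \<phi> 0"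
  proof (rule radial_growth[where f = "\<lambda>z. z * f z", OF _ z \<phi>])
    show "(\<lambda>z. z * f z) holomorphic_on disc" by (intro holomorphic_intros hf)
    fix t :: real assume t: "0 < t" "t < 1"
    have w: "of_real t * z \<in> disc" using t z mult_left_le_one_le[of "norm z" t] by (simp add: norm_mult)
    then have "f field_differentiable at (of_real t * z)"
      using holomorphic_on_imp_differentiable_at[OF hf] by auto
    then have "deriv (\<lambda>z. z * f z) (of_real t * z) = f (of_real t * z) + of_real t * z * deriv f (of_real t * z)"
      by (subst deriv_mult) (auto simp: field_differentiable_ident)
    also have "\<dots> = F (of_real t * z)" by (rule taylor_Suc_mult[OF f F w, symmetric])
    finally show "norm z * norm (deriv (\<lambda>z. z * f z) (of_real t * z)) \<le> \<phi>' t" using le[OF t] by simp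
  qed
  then show ?thesis by (simp add: norm_mult)
qed

text \<open>Bounds \<open>F\<close> on the radius by its bound at the end, so nothing is gained in
  the exponent but the factor \<open>norm z\<close> cancels. This is the tool near the origin; at
  the origin itself \<open>f\<close> and \<open>F\<close> have the same value.\<close>

lemma primitive_growth_crude:
  assumes f: "taylor f \<alpha>" and F: "taylor F (\<lambda>n. of_nat (Suc n) * \<alpha> n)" and z: "z \<in> disc"
    and A: "0 \<le> A" and le: "\<And>z. z \<in> disc \<Longrightarrow> norm (F z) \<le> A * (1 - norm z) powr (- k)" and k: "0 \<le> k"
  shows "norm (f z) \<le> A * (1 - norm z) powr (- k)"
proof (cases "z = 0")
  case True
  have "f 0 = F 0" using taylor_at_0[OF f] taylor_at_0[OF F] by simp
  then show ?thesis using le[OF z] True by simp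
next
  case False
  define r where "r = norm z"
  have r: "0 < r" "r < 1" using z False by (auto simp: r_def)
  have "r * norm (f z) \<le> r * (A * (1 - r) powr (- k)) * 1 - r * (A * (1 - r) powr (- k)) * 0"
  proof (rule primitive_growth[OF f F z, where \<phi> = "\<lambda>t. r * (A * (1 - r) powr (- k)) * t" and \<phi>' = "\<lambda>t. r * (A * (1 - r) powr (- k))", folded r_def])
    fix t :: real assume t: "0 < t" "t < 1"
    have n: "norm (of_real t * z) = t * r" using t by (simp add: norm_mult r_def)
    have tr: "t * r \<le> r" using t r by (intro mult_left_le_one_le) auto
    then have "of_real t * z \<in> disc" using n r order_le_less_trans[OF tr r(2)] by simp
    then have "norm (F (of_real t * z)) \<le> A * (1 - t * r) powr (- k)" using le[of "of_real t * z"] unfolding n by simp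
    also have "\<dots> \<le> A * (1 - r) powr (- k)" using A tr r k by (intro mult_left_mono powr_mono2') auto
    finally show "r * norm (F (of_real t * z)) \<le> r * (A * (1 - r) powr (- k))" using r by (intro mult_left_mono) auto
    show "((\<lambda>t. r * (A * (1 - r) powr (- k)) * t) has_real_derivative r * (A * (1 - r) powr (- k))) (at t)"
      by (auto intro!: derivative_eq_intros)
  qed (auto intro!: continuous_intros)
  then show ?thesis using r unfolding r_def[symmetric] by simp
qed

text \<open>Integration gains one power of \<open>1 - norm z\<close>. For \<open>norm z\<close> at
  least \<open>1 / 2\<close> dividing by \<open>norm z\<close> costs the factor 2; closer to the
  origin the crude bound exceeds the claimed one by at most that factor. The condition
  \<open>1 \<le> k\<close> keeps the constant independent of \<open>k\<close>.\<close>

lemma primitive_growth_step: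
  assumes f: "taylor f \<alpha>" and F: "taylor F (\<lambda>n. of_nat (Suc n) * \<alpha> n)" and z: "z \<in> disc"
    and A: "0 \<le> A" and le: "\<And>z. z \<in> disc \<Longrightarrow> norm (F z) \<le> A * (1 - norm z) powr (- (k + 1))" and k: "1 \<le> k"
  shows "norm (f z) \<le> 2 * A * (1 - norm z) powr (- k)"
proof -
  define r where "r = norm z"
  have r: "0 \<le> r" "r < 1" using z by (auto simp: r_def)
  show ?thesis
  proof (cases "r < 1 / 2")
    case True
    have "norm (f z) \<le> A * (1 - r) powr (- (k + 1))"
      unfolding r_def using k by (intro primitive_growth_crude[OF f F z A le]) auto
    also have "(1 - r) powr (- (k + 1)) = (1 - r) powr (- k) * (1 - r) powr (- 1)"
      using powr_add[of "1 - r" "- k" "- 1"] by simp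
    also have "(1 - r) powr (- 1) \<le> 2" using True r by (simp add: powr_minus_divide field_simps)
    finally have "norm (f z) \<le> A * ((1 - r) powr (- k) * 2)" using A by (simp add: mult_left_mono)
    then show ?thesis by (simp add: r_def mult_ac)
  next
    case False
    have tr: "t * r < 1" if "0 \<le> t" "t \<le> 1" for t using that r mult_left_le_one_le[of r t] by simp
    have "r * norm (f z) \<le> A * (1 - 1 * r) powr (- k) / k - A * (1 - 0 * r) powr (- k) / k"
    proof (rule primitive_growth[OF f F z, where \<phi> = "\<lambda>t. A * (1 - t * r) powr (- k) / k" and \<phi>' = "\<lambda>t. r * (A * (1 - t * r) powr (- (k + 1)))", folded r_def])
      show "continuous_on {0..1} (\<lambda>t. A * (1 - t * r) powr (- k) / k)"
        using tr k by (intro continuous_intros) force+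
      fix t :: real assume t: "0 < t" "t < 1"
      have n: "norm (of_real t * z) = t * r" using t by (simp add: norm_mult r_def)
      then have "of_real t * z \<in> disc" using tr[of t] t by simp
      then have "norm (F (of_real t * z)) \<le> A * (1 - t * r) powr (- (k + 1))" using le[of "of_real t * z"] unfolding n by simp
      then show "r * norm (F (of_real t * z)) \<le> r * (A * (1 - t * r) powr (- (k + 1)))" using r by (intro mult_left_mono) auto
      have "((\<lambda>t. A * (1 - t * r) powr (- k) / k) has_real_derivative A * (- k * (1 - t * r) powr (- k - 1) * (- r)) / k) (at t)"
        using tr[of t] t by (auto intro!: derivative_eq_intros)
      moreover have "A * (- k * (1 - t * r) powr (- k - 1) * (- r)) / k = r * (A * (1 - t * r) powr (- (k + 1)))"
        using k by simp
      ultimately show "((\<lambda>t. A * (1 - t * r) powr (- k) / k) has_real_derivative r * (A * (1 - t * r) powr (- (k + 1)))) (at t)"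
        by (simp only:)
    qed
    also have "\<dots> \<le> A * (1 - r) powr (- k) / k" using A k by simp
    also have "\<dots> \<le> A * (1 - r) powr (- k) / 1" using A k by (intro divide_left_mono) auto
    finally have "r * norm (f z) \<le> A * (1 - r) powr (- k)" by simp
    moreover have "1 / 2 * norm (f z) \<le> r * norm (f z)" using False by (intro mult_right_mono) auto
    ultimately have "norm (f z) \<le> 2 * (A * (1 - r) powr (- k))" by simp
    then show ?thesis by (simp add: r_def mult.assoc)
  qed
qed

lemma taylor_Suc_power:
  assumes f: "taylor f \<alpha>"
  shows "taylor (\<lambda>z. \<Sum>n. of_nat (Suc n) ^ k * \<alpha> n * z ^ n) (\<lambda>n. of_nat (Suc n) ^ k * \<alpha> n)"
proof (induction k)
  case 0
  show ?case using f by (intro taylorI) (auto simp: taylor_def intro: sums_summable)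
next
  case (Suc k)
  let ?G = "\<lambda>z. \<Sum>n. of_nat (Suc n) ^ k * \<alpha> n * z ^ n"
  have "taylor (\<lambda>z. ?G z + z * deriv ?G z) (\<lambda>n. of_nat (Suc n) ^ k * \<alpha> n + of_nat n * (of_nat (Suc n) ^ k * \<alpha> n))"
    by (intro taylor_add taylor_mult_deriv Suc)
  moreover have "(\<lambda>n. of_nat (Suc n) ^ k * \<alpha> n + of_nat n * (of_nat (Suc n) ^ k * \<alpha> n)) = (\<lambda>n. of_nat (Suc n) ^ Suc k * \<alpha> n)"
    by (simp add: fun_eq_iff algebra_simps)
  ultimately have G: "taylor (\<lambda>z. ?G z + z * deriv ?G z) (\<lambda>n. of_nat (Suc n) ^ Suc k * \<alpha> n)" by (simp only:)
  have "summable (\<lambda>n. of_nat (Suc n) ^ Suc k * \<alpha> n * z ^ n)" if "norm z < 1" for z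
    using G[unfolded taylor_def, rule_format, of z] that by (intro sums_summable) simp
  then show ?case by (intro taylorI)
qed

text \<open>Each descent in the order costs a factor 2. It stops at order 1; \<open>f\<close> itself
  is bounded crudely by the same power, and away from the origin \<open>deriv f\<close> is read off
  from \<open>z * deriv f z = G 1 z - f z\<close>. In the constant 17, a Cauchy estimate near the
  origin accounts for 16 and the value at 0 for 1.\<close>

lemma bloch_of_high_derivative:
  assumes hf: "f holomorphic_on disc" and f: "taylor f \<alpha>" and F: "taylor F (\<lambda>n. of_nat (Suc n) ^ m * \<alpha> n)" and m: "1 \<le> m"
    and A: "0 \<le> A" and le: "\<And>z. z \<in> disc \<Longrightarrow> norm (F z) \<le> A * (1 - norm z) powr (- real m)"
  shows "f \<in> bloch_space" and "bloch_norm f \<le> 17 * (2 ^ m * A)"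
proof -
  define G where "G k z = (\<Sum>n. of_nat (Suc n) ^ k * \<alpha> n * z ^ n)" for k z
  have G: "taylor (G k) (\<lambda>n. of_nat (Suc n) ^ k * \<alpha> n)" for k unfolding G_def[abs_def] by (rule taylor_Suc_power[OF f])
  have GS: "taylor (G (Suc k)) (\<lambda>n. of_nat (Suc n) * (of_nat (Suc n) ^ k * \<alpha> n))" for k
    using G[of "Suc k"] by (simp add: mult.assoc)
  have down: "\<forall>z\<in>disc. norm (G (m - j) z) \<le> 2 ^ j * A * (1 - norm z) powr (- real (m - j))" if "j < m" for j
    using that
  proof (induction j)
    case 0
    show ?case
    proof
      fix z assume z: "z \<in> disc"
      have "G m z = F z" using taylor_unique_value[OF G F z] .
      then show "norm (G (m - 0) z) \<le> 2 ^ 0 * A * (1 - norm z) powr (- real (m - 0))" using le[OF z] by simp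
    qed
  next
    case (Suc j)
    define k where "k = m - Suc j"
    have k: "1 \<le> k" "m - j = Suc k" using Suc.prems by (auto simp: k_def)
    show ?case
    proof
      fix z assume z: "z \<in> disc"
      have "norm (G k z) \<le> 2 * (2 ^ j * A) * (1 - norm z) powr (- real k)"
      proof (rule primitive_growth_step[OF G GS z])
        show "norm (G (Suc k) z) \<le> 2 ^ j * A * (1 - norm z) powr (- (real k + 1))" if "z \<in> disc" for z
          using Suc.IH Suc.prems that k by (simp add: add.commute)
      qed (use A k in auto)
      then show "norm (G (m - Suc j) z) \<le> 2 ^ Suc j * A * (1 - norm z) powr (- real (m - Suc j))"
        by (simp add: k_def mult_ac)
    qed
  qed
  define A' where "A' = 2 ^ m * A"
  have A': "0 \<le> A'" using A by (simp add: A'_def)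
  have G1: "norm (G 1 z) \<le> A' * (1 - norm z) powr (- 1)" if z: "z \<in> disc" for z
  proof -
    have "norm (G 1 z) \<le> 2 ^ (m - 1) * A * (1 - norm z) powr (- 1)"
      using down[of "m - 1"] m z by simp
    also have "\<dots> \<le> A' * (1 - norm z) powr (- 1)"
      unfolding A'_def using A by (intro mult_right_mono power_increasing) auto
    finally show ?thesis .
  qed
  have F1: "taylor (G 1) (\<lambda>n. of_nat (Suc n) * \<alpha> n)" using G[of 1] by simp
  have fz: "norm (f z) \<le> A' * (1 - norm z) powr (- 1)" if "z \<in> disc" for z
    by (rule primitive_growth_crude[OF f F1 that A' G1]) auto
  have bd: "norm (deriv f z) * (1 - (norm z)\<^sup>2) \<le> 16 * A'" if z: "z \<in> disc" for z
  proof (cases "norm z < 1 / 2")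
    case True
    \<comment> \<open>A circle of radius \<open>1 / 4\<close> stays in
      \<open>norm x \<le> 3 / 4\<close>, where the crude bound for \<open>f\<close> is
      \<open>4 * A'\<close>; dividing by the radius gives \<open>16 * A'\<close>.\<close>
    have sub: "cball z (1 / 4) \<subseteq> disc"
    proof
      fix x assume "x \<in> cball z (1 / 4)"
      then have "norm (z - x) \<le> 1 / 4" by (simp add: dist_norm)
      then show "x \<in> disc" using True norm_triangle_ineq4[of z "z - x"] by simp
    qed
    have "norm ((deriv ^^ 1) f z) \<le> fact 1 * (4 * A') / (1 / 4) ^ 1"
    proof (rule Cauchy_inequality)
      show "f holomorphic_on ball z (1 / 4)" "continuous_on (cball z (1 / 4)) f"
        by (rule holomorphic_on_subset[OF hf order_trans[OF ball_subset_cball sub]],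
            rule continuous_on_subset[OF holomorphic_on_imp_continuous_on[OF hf] sub])
      fix x assume "norm (z - x) = 1 / 4"
      then have x: "norm x \<le> 3 / 4" using True norm_triangle_ineq4[of z "z - x"] by simp
      then have "norm (f x) \<le> A' * (1 - norm x) powr (- 1)" by (intro fz) auto
      also have "\<dots> \<le> A' * 4"
        using A' x by (intro mult_left_mono) (auto simp: powr_minus_divide field_simps)
      finally show "norm (f x) \<le> 4 * A'" by simp
    qed auto
    then have "norm (deriv f z) \<le> 16 * A'" by simp
    then have "norm (deriv f z) * (1 - (norm z)\<^sup>2) \<le> 16 * A' * 1"
      using z A' power_le_one[of "norm z" 2] by (intro mult_mono) auto
    then show ?thesis by simp
  next
    case False
    define r where "r = norm z"
    have r: "1 / 2 \<le> r" "r < 1" using z False by (auto simp: r_def)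
    have "z * deriv f z = G 1 z - f z" using taylor_Suc_mult[OF f F1 z] by simp
    then have "norm (z * deriv f z) \<le> norm (G 1 z) + norm (f z)" by (simp add: norm_triangle_ineq4)
    also have "\<dots> \<le> 2 * (A' * (1 - r) powr (- 1))" using G1[OF z] fz[OF z] by (simp add: r_def)
    finally have "r * norm (deriv f z) \<le> 2 * (A' / (1 - r))" using r by (simp add: norm_mult r_def powr_minus_divide)
    moreover have "1 / 2 * norm (deriv f z) \<le> r * norm (deriv f z)" using r by (intro mult_right_mono) auto
    ultimately have d: "norm (deriv f z) \<le> 4 * (A' / (1 - r))" by simp
    have "1 - r\<^sup>2 = (1 + r) * (1 - r)" by (simp add: power2_eq_square algebra_simps)
    also have "\<dots> \<le> 2 * (1 - r)" using r by (intro mult_right_mono) auto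
    finally have "norm (deriv f z) * (1 - r\<^sup>2) \<le> (4 * (A' / (1 - r))) * (2 * (1 - r))"
      using d r power_le_one[of r 2] A' by (intro mult_mono) auto
    also have "\<dots> = 8 * A'" using r by (simp add: field_simps)
    finally show ?thesis using A' by (simp add: r_def)
  qed
  then have "bdd_above ((\<lambda>z. norm (deriv f z) * (1 - (norm z)\<^sup>2)) ` disc)" by (intro bdd_aboveI2)
  then show "f \<in> bloch_space" using hf by (simp add: bloch_space_def)
  have "(SUP z\<in>disc. norm (deriv f z) * (1 - (norm z)\<^sup>2)) \<le> 16 * A'" using bd by (intro cSUP_least) auto
  moreover have "norm (f 0) \<le> A'" using fz[of 0] by simp
  ultimately show "bloch_norm f \<le> 17 * (2 ^ m * A)" by (simp add: bloch_norm_def A'_def)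
qed

section \<open>Test functions, duality and the lower bound for the Hankel operator\<close>

context regular_weight
begin

text \<open>
  Hoelder's inequality for \<open>\<integral> u * cnj H\<close> is applied in the form of Jensen's inequality with weight \<open>\<bar>u\<bar>\<^sup>q\<close>.
\<close>

lemma high_derivative_bound:
  assumes p: "1 < p" and m: "real b + 1 < real m * p"
  shows "\<exists>C>0. \<forall>f \<alpha> C0 F. f \<in> Lp_space 1 \<omega> \<longrightarrow> little_hankel_bound p \<omega> f C0 \<longrightarrow> taylor f \<alpha> \<longrightarrow>
    taylor F (\<lambda>n. of_nat (Suc n) ^ m * \<alpha> n) \<longrightarrow> (\<forall>w\<in>disc. norm (F w) \<le> C * C0 * (1 - norm w) powr (- real m))"
proof -
  define q where "q = p / (p - 1)"
  have q: "1 < q" using p by (simp add: q_def field_simps)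
  have qp: "q * (p - 1) = p" "q + (1 - q) * p = 0" "(1 - q) * (p - 1) = - 1"
  proof -
    show 1: "q * (p - 1) = p" using p by (simp add: q_def)
    show "q + (1 - q) * p = 0" "(1 - q) * (p - 1) = - 1" using 1 by (simp_all add: algebra_simps)
  qed
  obtain Cg where Cg: "0 < Cg" and gn: "\<And>w. norm w < 1 \<Longrightarrow>
    (\<integral>\<^sup>+\<zeta>. ennreal (norm (1 - cnj w * \<zeta>) powr (- (real m * p))) \<partial>\<nu>) \<le> ennreal (Cg * W (norm w) * (1 - norm w) powr (1 - real m * p))"
    using test_function_norm[OF m] by blast
  obtain Cu where Cu: "0 < Cu" and un: "\<And>w. norm w < 1 \<Longrightarrow>
    (\<integral>\<^sup>+\<zeta>. ennreal (norm (on_disc (\<lambda>\<eta>. kern m \<eta> * (1 - \<eta>) ^ m) (cnj w * \<zeta>)) powr q) \<partial>\<nu>)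
      \<le> ennreal (Cu * (W (norm w) * (1 - norm w)) powr (1 - q))"
    using test_kernel_norm[OF q] by blast
  \<comment> \<open>The p-th root of what remains at the end:
    \<open>(\<kappa> * Cu) powr (p - 1)\<close> from the mass of the Jensen weight and
    \<open>\<kappa> * Cg\<close> from the norm of the test function.\<close>
  define C where "C = ((\<kappa> * Cu) powr (p - 1) * (\<kappa> * Cg)) powr (1 / p)"
  have C: "0 < C" using \<kappa>_pos Cu Cg by (simp add: C_def)
  have "norm (F w) \<le> C * C0 * (1 - norm w) powr (- real m)"
    if fL: "f \<in> Lp_space 1 \<omega>" and bound: "little_hankel_bound p \<omega> f C0" and f: "taylor f \<alpha>"
      and F: "taylor F (\<lambda>n. of_nat (Suc n) ^ m * \<alpha> n)" and w: "w \<in> disc" for f \<alpha> C0 F w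
  proof -
    have C0: "0 \<le> C0" using bound by (simp add: little_hankel_bound_def)
    define r where "r = norm w"
    have r: "0 \<le> r" "r < 1" using w by (auto simp: r_def)
    have Wr: "0 < W r" using r by (intro tail_pos)
    define U where "U \<eta> = kern m \<eta> * (1 - \<eta>) ^ m" for \<eta>
    have hU: "U holomorphic_on disc" unfolding U_def by (intro holomorphic_intros kern_holomorphic)
    obtain \<upsilon> where \<upsilon>: "taylor U \<upsilon>" using taylor_exists[OF hU] .
    have wz: "cnj w * \<zeta> \<in> disc" if "\<zeta> \<in> disc" for \<zeta>
      using that w mult_strict_mono'[of "norm w" 1 "norm \<zeta>" 1] by (simp add: norm_mult)
    have wz': "norm (cnj w * \<zeta>) \<le> r" if "\<zeta> \<in> disc" for \<zeta>
      using that by (simp add: norm_mult r_def mult_left_le)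
    define u where "u \<zeta> = U (cnj w * \<zeta>)" for \<zeta>
    define g where "g \<zeta> = inverse ((1 - cnj w * \<zeta>) ^ m)" for \<zeta>
    define h where "h \<zeta> = kern m (cnj w * \<zeta>)" for \<zeta>
    have nz: "1 - cnj w * \<zeta> \<noteq> 0" if "\<zeta> \<in> disc" for \<zeta> using wz[OF that] by auto
    have gu: "g \<zeta> * u \<zeta> = h \<zeta>" if "\<zeta> \<in> disc" for \<zeta>
      using nz[OF that] by (simp add: g_def u_def U_def h_def)
    have hh: "h holomorphic_on disc" unfolding h_def using w by (intro kern_comp_holomorphic) auto
    have hg: "g holomorphic_on disc" unfolding g_def using nz by (intro holomorphic_intros) auto
    have tu: "taylor u (\<lambda>n. \<upsilon> n * cnj w ^ n)"
      unfolding taylor_def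
    proof
      fix z assume "z \<in> disc"
      from \<upsilon>[unfolded taylor_def, rule_format, OF wz[OF this]]
      show "(\<lambda>n. \<upsilon> n * cnj w ^ n * z ^ n) sums u z" by (simp only: u_def power_mult_distrib mult.assoc)
    qed
    have th: "taylor h (\<lambda>n. of_real (real (Suc n) ^ m * lam n) * cnj w ^ n)"
      unfolding taylor_def
    proof
      fix z assume "z \<in> disc"
      from taylor_kern[of m, unfolded taylor_def, rule_format, OF wz[OF this]]
      show "(\<lambda>n. of_real (real (Suc n) ^ m * lam n) * cnj w ^ n * z ^ n) sums h z"
        by (simp only: h_def power_mult_distrib mult.assoc)
    qed
    have hu: "u holomorphic_on disc" by (rule taylor_holomorphic[OF tu])
    have sw: "summable (\<lambda>n. norm (\<upsilon> n * cnj w ^ n))"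
      using taylor_abs_summable[OF \<upsilon> r] by (simp add: norm_mult norm_power r_def)
    obtain Bh where Bh: "\<And>\<zeta>. \<zeta> \<in> disc \<Longrightarrow> norm (h \<zeta>) \<le> Bh"
      using kern_bounded_on_smaller_disc[of w m] w unfolding h_def by auto
    obtain Bu where Bu: "\<And>\<zeta>. \<zeta> \<in> disc \<Longrightarrow> norm (u \<zeta>) \<le> Bu"
    proof -
      have "norm (u \<zeta>) \<le> Bh * 2 ^ m" if "\<zeta> \<in> disc" for \<zeta>
      proof -
        have "norm (1 - cnj w * \<zeta>) \<le> 2" using norm_triangle_ineq4[of 1 "cnj w * \<zeta>"] wz[OF that] by simp
        then have "norm (1 - cnj w * \<zeta>) ^ m \<le> 2 ^ m" by (intro power_mono) auto
        then show ?thesis unfolding u_def U_def norm_mult[of "kern m _"] norm_power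
          using Bh[OF that] unfolding h_def by (intro mult_mono) (auto intro: order_trans[OF norm_ge_zero])
      qed
      then show ?thesis using that by blast
    qed
    have gH: "g \<in> H_infinity"
    proof -
      have "norm (g \<zeta>) \<le> inverse ((1 - r) ^ m)" if "\<zeta> \<in> disc" for \<zeta>
      proof -
        have "1 - r \<le> norm (1 - cnj w * \<zeta>)" using norm_one_minus_ge[of "cnj w * \<zeta>"] wz'[OF that] by linarith
        then have "(1 - r) ^ m \<le> norm (1 - cnj w * \<zeta>) ^ m" using r by (intro power_mono) auto
        then show ?thesis unfolding g_def norm_inverse norm_power using r by (intro le_imp_inverse_le) auto
      qed
      then have "bounded (g ` disc)" unfolding bounded_iff by blast
      then show ?thesis using hg by (simp add: H_infinity_def)
    qed
    define H where "H z = cnj (little_hankel \<omega> f g z)" for z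
    have tH: "taylor H (\<lambda>n. of_real (lam n) * cnj (hankel_coeff f g n))"
      using taylor_little_hankel[OF fL gH] by (simp add: H_def[abs_def])
    have hH: "H holomorphic_on disc" by (rule taylor_holomorphic[OF tH])
    note cont = holomorphic_on_imp_continuous_on
    have [measurable]: "on_disc H \<in> borel_measurable borel" "on_disc u \<in> borel_measurable borel"
      by (intro borel_measurable_on_disc cont hH hu)+
    have HLp: "H \<in> Lp_space p \<omega>"
    proof -
      have "little_hankel \<omega> f g \<in> conj_bergman_space p \<omega>" using bound gH by (simp add: little_hankel_bound_def)
      then obtain G where G: "G \<in> bergman_space p \<omega>" "little_hankel \<omega> f g = (\<lambda>z. cnj (G z))" by (auto simp: conj_bergman_space_def)
      then have "H = G" by (simp add: H_def fun_eq_iff)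
      then show ?thesis using G by (simp add: bergman_space_def)
    qed
    have Hnorm: "Lp_norm p \<omega> H \<le> C0 * Lp_norm p \<omega> g"
    proof -
      have "Lp_norm p \<omega> (little_hankel \<omega> f g) \<le> C0 * Lp_norm p \<omega> g" using bound gH by (simp add: little_hankel_bound_def)
      then show ?thesis by (simp add: Lp_norm_def H_def)
    qed
    interpret wa: finite_measure "weighted_area \<omega>" by (rule finite_measure_weighted_area)
    have intf: "integrable (weighted_area \<omega>) f" by (rule L1_integrable[OF fL])
    \<comment> \<open>The measure is finite and \<open>x \<le> 1 + x powr p\<close>, so membership
      in the space of exponent \<open>p\<close> gives integrability.\<close>
    have intH: "integrable (weighted_area \<omega>) H"
    proof (rule Bochner_Integration.integrable_bound)
      show "integrable (weighted_area \<omega>) (\<lambda>z. 1 + norm (H z) powr p)" using HLp by (simp add: Lp_space_def)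
      show "H \<in> borel_measurable (weighted_area \<omega>)" by (intro measurable_weighted_area_continuous cont hH)
      have "x \<le> 1 + x powr p" if "0 \<le> x" for x :: real
      proof (cases "x \<le> 1")
        case False
        then have "x powr 1 \<le> x powr p" using p by (intro powr_mono) auto
        then show ?thesis using False by simp
      qed (simp add: add_increasing2)
      then show "AE z in weighted_area \<omega>. norm (H z) \<le> norm (1 + norm (H z) powr p)" by (intro AE_I2) simp
    qed
    \<comment> \<open>Both pairings are evaluated through Taylor coefficients, where
      \<open>lam n * (2 * mom n) = 1\<close> removes the weight. The bridge between them is the
      integral of \<open>cnj f * g * u\<close>: reading \<open>g * u\<close> as the kernel function
      \<open>h\<close> gives \<open>F w\<close>, and expanding \<open>u\<close> alone gives the
      Hankel coefficients.\<close>
    have Fw: "F w = cnj (\<integral>z. u z * cnj (H z) \<partial>weighted_area \<omega>)"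
    proof -
      have "(\<integral>z. f z * cnj (h z) \<partial>weighted_area \<omega>)
        = (\<Sum>n. \<alpha> n * cnj (of_real (real (Suc n) ^ m * lam n) * cnj w ^ n) * of_real (2 * mom n))"
      proof (rule pairing_taylor[OF f th])
        show "integrable (weighted_area \<omega>) (\<lambda>z. f z * cnj (h z))"
          using Bh by (intro integrable_mult_bounded[OF intf continuous_on_cnj[OF cont[OF hh]]]) simp
        have "norm (\<alpha> n * cnj (of_real (real (Suc n) ^ m * lam n) * cnj w ^ n)) * mom n = norm (of_nat (Suc n) ^ m * \<alpha> n) * r ^ n * (1 / 2)" for n
        proof -
          have "\<bar>real (Suc n) ^ m * lam n\<bar> * mom n = real (Suc n) ^ m * (1 / 2)"
            using mom_pos[of n] lam_pos[of n] by (simp add: lam_def abs_mult del: of_nat_Suc)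
          then show ?thesis
            unfolding norm_mult complex_mod_cnj norm_of_real norm_power norm_of_nat r_def
            by (metis (no_types, opaque_lifting) mult.assoc mult.commute)
        qed
        then show "summable (\<lambda>n. norm (\<alpha> n * cnj (of_real (real (Suc n) ^ m * lam n) * cnj w ^ n)) * mom n)"
          using summable_mult2[OF taylor_abs_summable[OF F r], of "1 / 2"] by (simp only:)
      qed
      also have "\<dots> = (\<Sum>n. of_nat (Suc n) ^ m * \<alpha> n * w ^ n)"
      proof (rule suminf_cong)
        fix n
        have "of_real (lam n) * (of_real (2 * mom n) :: complex) = 1"
          using mom_pos[of n] by (simp add: lam_def flip: of_real_mult)
        then have "\<alpha> n * (of_real (real (Suc n) ^ m) * w ^ n) * (of_real (lam n) * of_real (2 * mom n)) = \<alpha> n * (of_real (real (Suc n) ^ m) * w ^ n)"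
          by (simp only: mult_1_right)
        then show "\<alpha> n * cnj (of_real (real (Suc n) ^ m * lam n) * cnj w ^ n) * of_real (2 * mom n) = of_nat (Suc n) ^ m * \<alpha> n * w ^ n"
          by (simp add: mult_ac)
      qed
      also have "\<dots> = F w" using taylor_eq[OF F, of w] w by simp
      finally have 1: "F w = (\<integral>z. f z * cnj (h z) \<partial>weighted_area \<omega>)" ..
      have "(\<integral>z. f z * cnj (h z) \<partial>weighted_area \<omega>) = (\<integral>z. cnj (cnj (f z) * g z * u z) \<partial>weighted_area \<omega>)"
        by (rule Bochner_Integration.integral_cong) (auto simp: gu[symmetric] mult.assoc)
      also have "\<dots> = cnj (\<integral>z. cnj (f z) * g z * u z \<partial>weighted_area \<omega>)" by (rule Bochner_Integration.integral_cnj)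
      also have "(\<integral>z. cnj (f z) * g z * u z \<partial>weighted_area \<omega>) = (\<integral>z. cnj (f z) * g z * (\<Sum>n. (\<upsilon> n * cnj w ^ n) * z ^ n) \<partial>weighted_area \<omega>)"
      proof (rule Bochner_Integration.integral_cong[OF refl])
        fix z assume "z \<in> space (weighted_area \<omega>)"
        then have "u z = (\<Sum>n. (\<upsilon> n * cnj w ^ n) * z ^ n)" by (intro taylor_eq[OF tu]) simp
        then show "cnj (f z) * g z * u z = cnj (f z) * g z * (\<Sum>n. (\<upsilon> n * cnj w ^ n) * z ^ n)" by (simp only:)
      qed
      also have "\<dots> = (\<Sum>n. \<upsilon> n * cnj w ^ n * hankel_coeff f g n)"
        unfolding hankel_coeff_def by (rule integral_series_weighted_area(1)[OF integrable_cnj_mult[OF fL gH] sw])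
      also have "\<dots> = (\<Sum>n. \<upsilon> n * cnj w ^ n * cnj (of_real (lam n) * cnj (hankel_coeff f g n)) * of_real (2 * mom n))"
      proof (rule suminf_cong)
        fix n
        have "of_real (lam n) * (of_real (2 * mom n) :: complex) = 1"
          using mom_pos[of n] by (simp add: lam_def flip: of_real_mult)
        moreover have "\<upsilon> n * cnj w ^ n * cnj (of_real (lam n) * cnj (hankel_coeff f g n)) * of_real (2 * mom n)
          = \<upsilon> n * cnj w ^ n * hankel_coeff f g n * (of_real (lam n) * of_real (2 * mom n))"
          by (simp only: complex_cnj_mult complex_cnj_complex_of_real complex_cnj_cnj mult_ac)
        ultimately show "\<upsilon> n * cnj w ^ n * hankel_coeff f g n = \<upsilon> n * cnj w ^ n * cnj (of_real (lam n) * cnj (hankel_coeff f g n)) * of_real (2 * mom n)"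
          by (simp only: mult_1_right)
      qed
      also have "\<dots> = (\<integral>z. u z * cnj (H z) \<partial>weighted_area \<omega>)"
      proof (rule pairing_taylor[OF tu tH, symmetric])
        have "integrable (weighted_area \<omega>) (\<lambda>z. cnj (H z) * u z)"
          by (rule integrable_mult_bounded[OF _ cont[OF hu] Bu]) (simp_all add: intH)
        then show "integrable (weighted_area \<omega>) (\<lambda>z. u z * cnj (H z))" by (simp only: mult.commute)
        obtain B where B: "0 \<le> B" "\<And>n. norm (hankel_coeff f g n) \<le> B" using hankel_coeff_bounded[OF fL gH] by blast
        show "summable (\<lambda>n. norm (\<upsilon> n * cnj w ^ n * cnj (of_real (lam n) * cnj (hankel_coeff f g n))) * mom n)"
        proof (rule summable_comparison_test'[OF summable_mult2[OF sw, of B]])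
          fix n
          have lm: "lam n * mom n = 1 / 2" using mom_pos[of n] by (simp add: lam_def)
          have "norm (\<upsilon> n * cnj w ^ n * cnj (of_real (lam n) * cnj (hankel_coeff f g n))) * mom n
            = norm (\<upsilon> n * cnj w ^ n) * (norm (hankel_coeff f g n) * (lam n * mom n))"
            unfolding norm_mult[of "\<upsilon> n * cnj w ^ n"] complex_mod_cnj norm_mult[of "of_real (lam n)"] norm_of_real
            using lam_pos[of n] by simp
          also have "\<dots> \<le> norm (\<upsilon> n * cnj w ^ n) * (B * 1)"
            unfolding lm using B(1) B(2)[of n] by (intro mult_left_mono mult_mono) auto
          finally show "norm (norm (\<upsilon> n * cnj w ^ n * cnj (of_real (lam n) * cnj (hankel_coeff f g n))) * mom n) \<le> norm (\<upsilon> n * cnj w ^ n) * B"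
            using mom_pos[of n] by simp
        qed
      qed
      finally show ?thesis unfolding 1 .
    qed
    define S where "S = norm (F w)"
    define D where "D = \<kappa> * Cu * (W r * (1 - r)) powr (1 - q)"
    have D: "0 \<le> D" using \<kappa>_pos Cu by (simp add: D_def)
    have mass: "(\<integral>\<^sup>+z. ennreal (norm (on_disc u z) powr q) \<partial>area) \<le> ennreal D"
    proof -
      have "(\<integral>\<^sup>+z. ennreal (norm (on_disc u z) powr q) \<partial>area) \<le> ennreal \<kappa> * (\<integral>\<^sup>+z. ennreal (norm (on_disc u z) powr q) \<partial>\<nu>)"
        by (rule Lp_comparison(1)[OF hu q])
      also have "\<dots> \<le> ennreal \<kappa> * (\<integral>\<^sup>+\<zeta>. ennreal (norm (on_disc (\<lambda>\<eta>. kern m \<eta> * (1 - \<eta>) ^ m) (cnj w * \<zeta>)) powr q) \<partial>\<nu>)"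
      proof (intro mult_left_mono nn_integral_mono ennreal_leI powr_mono2)
        show "norm (on_disc u \<zeta>) \<le> norm (on_disc (\<lambda>\<eta>. kern m \<eta> * (1 - \<eta>) ^ m) (cnj w * \<zeta>))" for \<zeta>
          using wz[of \<zeta>] by (auto simp: on_disc_def u_def U_def)
      qed (use q in auto)
      also have "\<dots> \<le> ennreal \<kappa> * ennreal (Cu * (W r * (1 - r)) powr (1 - q))"
        unfolding r_def using w by (intro mult_left_mono un) auto
      also have "\<dots> = ennreal D" using \<kappa>_pos Cu by (simp add: D_def ennreal_mult[symmetric] mult.assoc)
      finally show ?thesis .
    qed
    \<comment> \<open>The product of \<open>u\<close> and \<open>H\<close> is written as the weight
      \<open>norm u powr q\<close> times the value \<open>norm H * norm u powr (1 - q)\<close>. The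
      p-th power of the value times the weight is again \<open>norm H powr p\<close>, since
      \<open>q + (1 - q) * p = 0\<close>.\<close>
    have SI: "ennreal S \<le> (\<integral>\<^sup>+z. ennreal (norm (on_disc u z) powr q * (norm (on_disc H z) * norm (on_disc u z) powr (1 - q))) \<partial>area)"
    proof -
      have ci: "integrable (weighted_area \<omega>) (\<lambda>z. u z * cnj (H z))"
      proof -
        have "integrable (weighted_area \<omega>) (\<lambda>z. cnj (H z) * u z)"
          by (rule integrable_mult_bounded[OF _ cont[OF hu] Bu]) (simp_all add: intH)
        then show ?thesis by (simp only: mult.commute)
      qed
      have "ennreal S \<le> (\<integral>\<^sup>+z. ennreal (norm (u z * cnj (H z))) \<partial>weighted_area \<omega>)"
        unfolding S_def Fw complex_mod_cnj by (rule integral_norm_bound_ennreal[OF ci])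
      also have "\<dots> = (\<integral>\<^sup>+z. ennreal (on_disc (\<lambda>z. norm (u z * cnj (H z))) z) \<partial>area)"
        by (intro nn_integral_weighted_area_on_disc continuous_intros cont hu hH)
      also have "\<dots> = (\<integral>\<^sup>+z. ennreal (norm (on_disc u z) powr q * (norm (on_disc H z) * norm (on_disc u z) powr (1 - q))) \<partial>area)"
      proof (rule nn_integral_cong, rule arg_cong[where f = ennreal])
        fix z
        have 1: "x powr q * (y * x powr (1 - q)) = x * y" if "0 \<le> x" for x y :: real
        proof (cases "x = 0")
          case False
          then have "x powr q * x powr (1 - q) = x" using that by (simp flip: powr_add)
          then show ?thesis by (simp add: mult_ac)
        qed simp
        have "on_disc (\<lambda>z. norm (u z * cnj (H z))) z = norm (on_disc u z) * norm (on_disc H z)"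
          by (simp add: on_disc_def norm_mult)
        then show "on_disc (\<lambda>z. norm (u z * cnj (H z))) z = norm (on_disc u z) powr q * (norm (on_disc H z) * norm (on_disc u z) powr (1 - q))"
          by (simp only: 1[OF norm_ge_zero])
      qed
      finally show ?thesis .
    qed
    have "ennreal (S powr p) \<le> ennreal (D powr (p - 1)) *
      (\<integral>\<^sup>+z. ennreal (norm (on_disc u z) powr q * (norm (on_disc H z) * norm (on_disc u z) powr (1 - q)) powr p) \<partial>area)"
      by (rule powr_Jensen_nn_integral[OF p _ _ _ _ _ D mass SI]) (simp_all add: S_def)
    also have "\<dots> \<le> ennreal (D powr (p - 1)) * (\<integral>\<^sup>+z. ennreal (norm (on_disc H z) powr p) \<partial>area)"
    proof (intro mult_left_mono nn_integral_mono ennreal_leI)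
      fix z
      \<comment> \<open>Only an inequality: at zeros of \<open>u\<close> the left side is 0 because
        \<open>0 powr _\<close> is 0.\<close>
      have 1: "x powr q * (y * x powr (1 - q)) powr p \<le> y powr p" if "0 \<le> x" "0 \<le> y" for x y :: real
      proof (cases "x = 0")
        case False
        have "x powr q * (y * x powr (1 - q)) powr p = y powr p * (x powr q * x powr ((1 - q) * p))"
          using that by (simp add: powr_mult powr_powr)
        also have "x powr q * x powr ((1 - q) * p) = 1" using False qp(2) by (simp flip: powr_add)
        finally show ?thesis by simp
      qed simp
      show "norm (on_disc u z) powr q * (norm (on_disc H z) * norm (on_disc u z) powr (1 - q)) powr p \<le> norm (on_disc H z) powr p"
        by (rule 1) (rule norm_ge_zero)+
    qed simp
    also have "(\<integral>\<^sup>+z. ennreal (norm (on_disc H z) powr p) \<partial>area) = ennreal (Lp_norm p \<omega> H powr p)"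
      using p by (intro Lp_norm_powr(2)[symmetric] Lp_space_fin cont hH HLp) auto
    also have "\<dots> \<le> ennreal ((C0 * Lp_norm p \<omega> g) powr p)"
      using Hnorm p by (intro ennreal_leI powr_mono2) (auto simp: Lp_norm_def)
    also have "\<dots> = ennreal (C0 powr p) * ennreal (Lp_norm p \<omega> g powr p)"
      using C0 by (simp add: powr_mult Lp_norm_def ennreal_mult[symmetric])
    also have "ennreal (Lp_norm p \<omega> g powr p) = (\<integral>\<^sup>+z. ennreal (norm (on_disc g z) powr p) \<partial>area)"
      using p by (intro Lp_norm_powr(2) Lp_space_fin cont hg H_infinity_subset_Lp gH) auto
    also have "\<dots> \<le> ennreal \<kappa> * (\<integral>\<^sup>+z. ennreal (norm (on_disc g z) powr p) \<partial>\<nu>)"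
      by (rule Lp_comparison(1)[OF hg p])
    also have "(\<integral>\<^sup>+z. ennreal (norm (on_disc g z) powr p) \<partial>\<nu>) \<le> (\<integral>\<^sup>+\<zeta>. ennreal (norm (1 - cnj w * \<zeta>) powr (- (real m * p))) \<partial>\<nu>)"
    proof (intro nn_integral_mono ennreal_leI)
      fix \<zeta>
      show "norm (on_disc g \<zeta>) powr p \<le> norm (1 - cnj w * \<zeta>) powr (- (real m * p))"
      proof (cases "\<zeta> \<in> disc")
        case True
        then have "0 < norm (1 - cnj w * \<zeta>)" using nz by simp
        then have "norm (g \<zeta>) = norm (1 - cnj w * \<zeta>) powr (- real m)"
          by (simp add: g_def norm_inverse norm_power powr_minus powr_realpow)
        then show ?thesis using True by (simp add: on_disc_def powr_powr)
      qed (simp add: on_disc_def)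
    qed
    also have "\<dots> \<le> ennreal (Cg * W r * (1 - r) powr (1 - real m * p))" unfolding r_def using w by (intro gn) auto
    finally have "ennreal (S powr p) \<le> ennreal (D powr (p - 1)) * (ennreal (C0 powr p) * (ennreal \<kappa> * ennreal (Cg * W r * (1 - r) powr (1 - real m * p))))"
      by (simp add: mult_left_mono)
    also have "\<dots> = ennreal (D powr (p - 1) * (C0 powr p * (\<kappa> * (Cg * W r * (1 - r) powr (1 - real m * p)))))"
      using D \<kappa>_pos Cg Wr r by (simp add: ennreal_mult)
    finally have "S powr p \<le> D powr (p - 1) * (C0 powr p * (\<kappa> * (Cg * W r * (1 - r) powr (1 - real m * p))))"
      using \<kappa>_pos Cg Wr r by (subst (asm) ennreal_le_iff) auto
    also have "\<dots> = ((\<kappa> * Cu) powr (p - 1) * (\<kappa> * Cg)) * C0 powr p * (1 - r) powr (- (real m * p))"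
    proof -
      have "D powr (p - 1) = (\<kappa> * Cu) powr (p - 1) * (W r * (1 - r)) powr (- 1)"
        using \<kappa>_pos Cu by (simp add: D_def powr_mult powr_powr qp(3) abs_mult)
      moreover have "(W r * (1 - r)) powr (- 1) * (W r * (1 - r) powr (1 - real m * p)) = (1 - r) powr (- (real m * p))"
        using Wr r by (simp add: powr_minus_divide powr_diff)
      moreover have "x * y * (c * (k * (g * v * t))) = (x * (k * g)) * c * (y * (v * t))" for x y c k g v t :: real
        by (simp only: mult_ac)
      ultimately show ?thesis by (simp only:)
    qed
    finally have "(S powr p) powr (1 / p) \<le> (((\<kappa> * Cu) powr (p - 1) * (\<kappa> * Cg)) * C0 powr p * (1 - r) powr (- (real m * p))) powr (1 / p)"
      using p by (intro powr_mono2) auto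
    also have "(S powr p) powr (1 / p) = S" using p by (simp add: powr_powr S_def)
    also have "(((\<kappa> * Cu) powr (p - 1) * (\<kappa> * Cg)) * C0 powr p * (1 - r) powr (- (real m * p))) powr (1 / p)
      = C * C0 * (1 - r) powr (- real m)"
      using p \<kappa>_pos Cu Cg C0 by (simp add: C_def powr_mult powr_powr)
    finally show ?thesis by (simp add: S_def r_def)
  qed
  then show ?thesis using C by (intro exI[of _ C]) blast
qed

lemma little_hankel_bound_imp_bloch:
  assumes p: "1 < p"
  shows "\<exists>C>0. \<forall>f C0. f holomorphic_on disc \<longrightarrow> f \<in> Lp_space 1 \<omega> \<longrightarrow> little_hankel_bound p \<omega> f C0 \<longrightarrow>
    f \<in> bloch_space \<and> bloch_norm f \<le> C * C0"
proof -
  obtain m0 :: nat where "(real b + 1) / p < real m0" using reals_Archimedean2 by blast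
  \<comment> \<open>The successor secures \<open>1 \<le> m\<close> and preserves the strict lower
    bound.\<close>
  define m where "m = Suc m0"
  have m: "real b + 1 < real m * p" "1 \<le> m"
    using \<open>(real b + 1) / p < real m0\<close> p by (auto simp: m_def field_simps)
  obtain C where C: "0 < C" and main: "\<And>f \<alpha> C0 F w. f \<in> Lp_space 1 \<omega> \<Longrightarrow> little_hankel_bound p \<omega> f C0 \<Longrightarrow> taylor f \<alpha> \<Longrightarrow>
    taylor F (\<lambda>n. of_nat (Suc n) ^ m * \<alpha> n) \<Longrightarrow> w \<in> disc \<Longrightarrow> norm (F w) \<le> C * C0 * (1 - norm w) powr (- real m)"
    using high_derivative_bound[OF p m(1)] by blast
  have "f \<in> bloch_space \<and> bloch_norm f \<le> 17 * (2 ^ m * C) * C0"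
    if hf: "f holomorphic_on disc" and fL: "f \<in> Lp_space 1 \<omega>" and bound: "little_hankel_bound p \<omega> f C0" for f C0
  proof -
    obtain \<alpha> where \<alpha>: "taylor f \<alpha>" using taylor_exists[OF hf] .
    note F = taylor_Suc_power[OF \<alpha>, of m]
    have C0: "0 \<le> C * C0" using bound C by (simp add: little_hankel_bound_def)
    note res = bloch_of_high_derivative[OF hf \<alpha> F m(2) C0 main[OF fL bound \<alpha> F]]
    show ?thesis using res by (simp add: mult_ac)
  qed
  then show ?thesis using C by (intro exI[of _ "17 * (2 ^ m * C)"]) auto
qed

lemma little_hankel_bloch:
  assumes p: "1 < p"
  shows "(\<forall>f. f holomorphic_on disc \<longrightarrow> (little_hankel_bounded p \<omega> f \<longleftrightarrow> f \<in> bloch_space)) \<and>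
         (\<exists>C1>0. \<exists>C2>0. \<forall>f. f holomorphic_on disc \<longrightarrow> f \<in> bloch_space \<longrightarrow>
            bloch_norm f \<le> C1 * little_hankel_norm p \<omega> f \<and>
            little_hankel_norm p \<omega> f \<le> C2 * bloch_norm f)"
proof -
  obtain C1 where C1: "0 < C1" and nec: "\<And>f C0. f holomorphic_on disc \<Longrightarrow> f \<in> Lp_space 1 \<omega> \<Longrightarrow> little_hankel_bound p \<omega> f C0 \<Longrightarrow>
    f \<in> bloch_space \<and> bloch_norm f \<le> C1 * C0"
    using little_hankel_bound_imp_bloch[OF p] by blast
  obtain C2 where C2: "0 < C2" and suff: "\<And>f. f \<in> bloch_space \<Longrightarrow> little_hankel_bound p \<omega> f (C2 * bloch_norm f)"
    using bloch_imp_little_hankel_bound[OF p] by blast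
  have "little_hankel_bounded p \<omega> f \<longleftrightarrow> f \<in> bloch_space" if "f holomorphic_on disc" for f
    using that nec suff bloch_subset_L1 unfolding little_hankel_bounded_def by blast
  moreover have "bloch_norm f \<le> C1 * little_hankel_norm p \<omega> f \<and> little_hankel_norm p \<omega> f \<le> C2 * bloch_norm f"
    if hf: "f holomorphic_on disc" and f: "f \<in> bloch_space" for f
  proof
    \<comment> \<open>Both estimates of the norm need an admissible constant: \<open>Inf\<close> of
      an empty set of reals would carry no information.\<close>
    have ne: "C2 * bloch_norm f \<in> {C. little_hankel_bound p \<omega> f C}" using suff[OF f] by simp
    have "bloch_norm f / C1 \<le> C0" if "C0 \<in> {C. little_hankel_bound p \<omega> f C}" for C0
      using nec[OF hf bloch_subset_L1[OF f], of C0] that C1 by (simp add: field_simps)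
    then have "bloch_norm f / C1 \<le> little_hankel_norm p \<omega> f"
      unfolding little_hankel_norm_def using ne by (intro cInf_greatest) auto
    then show "bloch_norm f \<le> C1 * little_hankel_norm p \<omega> f" using C1 by (simp add: field_simps)
    show "little_hankel_norm p \<omega> f \<le> C2 * bloch_norm f"
      unfolding little_hankel_norm_def
      by (rule cInf_lower[OF ne]) (auto intro!: bdd_belowI[of _ 0] simp: little_hankel_bound_def)
  qed
  ultimately show ?thesis using C1 C2 by blast
qed

end

theorem theorem3:
  fixes p :: real and \<omega> :: "real \<Rightarrow> real"
  assumes "1 < p" and "\<omega> \<in> D_class"
  shows "(\<forall>f. f holomorphic_on disc \<longrightarrow>
            (little_hankel_bounded p \<omega> f \<longleftrightarrow> f \<in> bloch_space)) \<and>
         (\<exists>C1>0. \<exists>C2>0. \<forall>f. f holomorphic_on disc \<longrightarrow> f \<in> bloch_space \<longrightarrow>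
            bloch_norm f \<le> C1 * little_hankel_norm p \<omega> f \<and>
            little_hankel_norm p \<omega> f \<le> C2 * bloch_norm f)"
proof -
  have "radial_weight \<omega>" using assms(2) by (simp add: D_class_def D_hat_def)
  then obtain \<omega>' where \<omega>': "borel_weight \<omega>'" "weighted_area \<omega>' = weighted_area \<omega>"
    "\<And>r. 0 \<le> r \<Longrightarrow> weight_tail \<omega>' r = weight_tail \<omega> r" "weight_moment \<omega>' = weight_moment \<omega>"
    using borel_weight_representative by metis
  have "\<exists>C>1. \<forall>r\<in>{0..<1}. weight_tail \<omega>' r \<le> C * weight_tail \<omega>' ((1 + r) / 2)"
    using assms(2) by (simp add: D_class_def D_hat_def \<omega>'(3))
  moreover have "\<exists>C>1. \<exists>K>1. \<forall>x\<ge>1. weight_moment \<omega>' x \<ge> C * weight_moment \<omega>' (K * x)"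
    using assms(2) by (simp add: D_class_def M_class_def \<omega>'(4))
  ultimately obtain a A b where "regular_weight \<omega>' a A b"
    using borel_weight.regular_weightI[OF \<omega>'(1)] by metis
  note main = regular_weight.little_hankel_bloch[OF this assms(1)]
  \<comment> \<open>All notions of the statement see the weight only through
    \<open>weighted_area\<close> and \<open>weight_moment\<close>, and both are the same for the
    Borel representative.\<close>
  have Lp: "Lp_space q \<omega>' = Lp_space q \<omega>" "Lp_norm q \<omega>' = Lp_norm q \<omega>" for q
    by (auto simp: Lp_space_def Lp_norm_def \<omega>'(2) fun_eq_iff)
  have "little_hankel \<omega>' = little_hankel \<omega>"
    by (simp add: little_hankel_def bergman_kernel_def \<omega>'(2,4) fun_eq_iff)
  then have bd: "little_hankel_bound p \<omega>' = little_hankel_bound p \<omega>"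
    unfolding little_hankel_bound_def[abs_def] conj_bergman_space_def bergman_space_def Lp by (simp only:)
  show ?thesis
    using main unfolding little_hankel_bounded_def little_hankel_norm_def Lp bd .
qed

end
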